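(* Let $\mathbb K$ be an algebraically closed field of characteristic $3$. Let $\mathfrak e_6=\mathfrak g(A)$ with purely even Cartan matrix $$A=\begin{pmatrix}2&0&-1&0&0&0\\0&2&0&-1&0&0\\-1&0&2&-1&0&0\\0&-1&-1&2&-1&0\\0&0&0&-1&2&-1\\0&0&0&0&-1&2\end{pmatrix},$$ and let $\mathfrak z$ be the (one-dimensional) center of $\mathfrak e_6^{(1)}$. Let $\mathfrak g(2,6)=\mathfrak g(\widetilde A)$ be the Elduque and Cunha Lie superalgebra with Cartan matrix $$\widetilde A=\begin{pmatrix}2&-1&0&0&0\\-1&2&-1&0&0\\0&-1&0&-1&0\\0&0&-1&2&-1\\0&0&0&-1&2\end{pmatrix}$$ in which the third index is odd and the others are even, and let $\mathfrak c$ be the (one-dimensional) center of $\mathfrak g(2,6)^{(1)}$. Then the semisimplification of $\mathfrak e_6^{(1)}/\mathfrak z$, as an object in $\mathrm{Rep}\,\alpha_3$ under the adjoint action of $e_2$, is (isomorphic as a Lie superalgebra to) $\mathfrak g(2,6)^{(1)}/\mathfrak c$.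
   Context: **Contragredient Lie superalgebras.** Lie superalgebras in characteristic $3$ are required to satisfy $[x,[x,x]]=0$ for odd $x$. Let $A=(a_{ij})$ be an $n\times n$ integer matrix (a Cartan matrix) with a parity $\mathrm{par}(i)\in\mathbb Z/2$ for each index; let $\overline A=(\overline a_{ij})$ be its reduction mod $3$, of rank $s$. Let $\widetilde{\mathfrak h}$ be a $\mathbb K$-vector space of dimension $2n-s$ with linearly independent $h_1,\dots,h_n\in\widetilde{\mathfrak h}$ and linearly independent $\alpha_1,\dots,\alpha_n\in\widetilde{\mathfrak h}^*$ such that $\alpha_j(h_i)=\overline a_{ij}$. $\widetilde{\mathfrak g}(A)$ is the Lie superalgebra generated by $\widetilde{\mathfrak h}$ (even) and $e_i,f_i$ ($1\le i\le n$) of parity $\mathrm{par}(i)$, with relations $[e_i,f_j]=\delta_{ij}h_i$, $[h,e_j]=\alpha_j(h)e_j$, $[h,f_j]=-\alpha_j(h)f_j$, $[\widetilde{\mathfrak h},\widetilde{\mathfrak h}]=0$. It is graded by the free abelian group $Q=\bigoplus_k\mathbb Z\alpha_k$ with $\deg e_i=\alpha_i$, $\deg f_i=-\alpha_i$, $\deg h=0$. $\mathfrak g(A)=\widetilde{\mathfrak g}(A)/\mathfrak r$, where $\mathfrak r$ is the largest $Q$-graded ideal meeting $\widetilde{\mathfrak h}$ trivially; images of $e_i,f_i,h_i$ (also in quotients) keep their names. $X^{(1)}=[X,X]$ is the derived algebra; $\mathfrak g(A)^{(1)}$ is generated by the $e_i,f_i,h_i$. If all parities are $0$, $\mathfrak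 g(A)$ is a Lie algebra. **Semisimplification.** $\mathrm{Rep}\,\alpha_3$ (representations of the Frobenius kernel of $\mathbb G_a$) is the symmetric tensor category of finite-dimensional $\mathbb K[t]/(t^3)$-modules, with $t$ acting on $V\otimes W$ by $t\otimes1+1\otimes t$ and the flip as braiding. Its indecomposables are $J_1,J_2,J_3$, where $t$ acts on $J_n=\mathbb K^n$ as one nilpotent Jordan block. A Lie algebra $\mathfrak g$ with a derivation $d$, $d^3=0$, is a Lie algebra in $\mathrm{Rep}\,\alpha_3$ with $t$ acting by $d$; "under the adjoint action of $x$" means $d=\mathrm{ad}\,x$. The semisimplification functor $V\mapsto\overline V$ is the quotient of $\mathrm{Rep}\,\alpha_3$ by negligible morphisms ($u:V\to W$ with $\mathrm{tr}(u\circ v)=0$ for all $v:W\to V$), with target the Verlinde category $\mathrm{Ver}_3$, whose simple objects are $L_1=\overline{J_1}$, $L_2=\overline{J_2}$ ($\overline{J_3}=0$); $\mathrm{Ver}_3$ is identified with super vector spaces, $L_1$ being an even line and $L_2$ an odd line, so $\overline{\mathfrak g}$ is a Lie superalgebra. Explicitly, decompose $\mathfrak g$ into Jordan blocks $x_i$ ($i\le n_1$), $x_i\mapsto x_i'$ ($n_1<i\le n_1+n_2$), and blocks $x_i\mapsto x_i'\mapsto x_i''$ (arrows are the action of $d$). Then $\overline{\mathfrak g}$ has basis $y_i$ ($i\le n_1+n_2$), even for $i\le n_1$ and odd for $i>n_1$; the coefficient of $y_k$ in $[y_i,y_j]$ is the coefficient of $x_k$ in $[x_i,x_j]$ if the parities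 of $y_i,y_j,y_k$ are compatible and $y_i,y_j$ are not both odd; it is the coefficient of $x_k$ in $-[x_i,x_j']+[x_i',x_j]$ if $i,j>n_1$, $k\le n_1$; and $0$ otherwise. *)

theory Defs
  imports
    "HOL-Analysis.Cartesian_Space"
    "HOL-Algebra.Algebraic_Closure_Type"
    "HOL-Algebra.QuotRing"
    "HOL-Library.Poly_Mapping"
    "HOL-Library.Z2"
begin

unbundle no fps_syntax  (* keeps \<open>$\<close> for vector entries *)

section \<open>Lie superalgebras\<close>

text \<open>
  A nonassociative superalgebra over a field \<open>'k\<close> is a \<^type>\<open>module\<close> record together with its two
  homogeneous parts, indexed by parity. The multiplication slot \<^const>\<open>monoid.mult\<close> holds the bracket;
  the slot \<^const>\<open>one\<close> is not used.
\<close>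

record ('k, 'a) superalgebra = "('k, 'a) module" +
  part :: "bit \<Rightarrow> 'a set"

abbreviation scalars :: "'k::field ring" where
  "scalars \<equiv> ring_of_type_algebra"

definition koszul_sign :: "bit \<Rightarrow> bit \<Rightarrow> 'k::field" where
  "koszul_sign p q = (if p = 1 \<and> q = 1 then - 1 else 1)"

text \<open>
  The axiom \<open>cube\<close> is a consequence of the others unless the characteristic is 3, where it has to be
  required. Since only characteristic 3 is considered, \<open>[x, x] = 0\<close> for even \<open>x\<close> is a
  consequence of \<open>anticommutative\<close>.
\<close>

locale lie_superalgebra = Module.module "scalars :: 'k::field ring" L
  for L :: "('k::field, 'a, 'm) superalgebra_scheme" (structure) +
  assumes part_submodule: "submodule (part L p) (scalars :: 'k ring) L"
    and part_decomposition:
      "x \<in> carrier L \<Longrightarrow> \<exists>!y. y \<in> part L 0 \<times> part L 1 \<and> x = fst y \<oplus> snd y"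
    and bracket_closed: "\<lbrakk>x \<in> carrier L; y \<in> carrier L\<rbrakk> \<Longrightarrow> x \<otimes> y \<in> carrier L"
    and bracket_add_left: "\<lbrakk>x \<in> carrier L; y \<in> carrier L; z \<in> carrier L\<rbrakk>
      \<Longrightarrow> (x \<oplus> y) \<otimes> z = (x \<otimes> z) \<oplus> (y \<otimes> z)"
    and bracket_add_right: "\<lbrakk>x \<in> carrier L; y \<in> carrier L; z \<in> carrier L\<rbrakk>
      \<Longrightarrow> x \<otimes> (y \<oplus> z) = (x \<otimes> y) \<oplus> (x \<otimes> z)"
    and bracket_smult_left: "\<lbrakk>x \<in> carrier L; y \<in> carrier L\<rbrakk>
      \<Longrightarrow> (c \<odot>\<^bsub>L\<^esub> x) \<otimes> y = c \<odot>\<^bsub>L\<^esub> (x \<otimes> y)"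
    and bracket_smult_right: "\<lbrakk>x \<in> carrier L; y \<in> carrier L\<rbrakk>
      \<Longrightarrow> x \<otimes> (c \<odot>\<^bsub>L\<^esub> y) = c \<odot>\<^bsub>L\<^esub> (x \<otimes> y)"
    and bracket_part: "\<lbrakk>x \<in> part L p; y \<in> part L q\<rbrakk> \<Longrightarrow> x \<otimes> y \<in> part L (p + q)"
    and anticommutative: "\<lbrakk>x \<in> part L p; y \<in> part L q\<rbrakk>
      \<Longrightarrow> x \<otimes> y = \<ominus> (koszul_sign p q \<odot>\<^bsub>L\<^esub> (y \<otimes> x))"
    and jacobi: "\<lbrakk>x \<in> part L p; y \<in> part L q; z \<in> part L r\<rbrakk>
      \<Longrightarrow> x \<otimes> (y \<otimes> z) = ((x \<otimes> y) \<otimes> z) \<oplus> (koszul_sign p q \<odot>\<^bsub>L\<^esub> (y \<otimes> (x \<otimes> z)))"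
    and cube: "x \<in> part L 1 \<Longrightarrow> x \<otimes> (x \<otimes> x) = \<zero>"

definition lin_span :: "('k::field, 'a, 'm) superalgebra_scheme \<Rightarrow> 'a set \<Rightarrow> 'a set" where
  "lin_span L S = \<Inter> {N. submodule N scalars L \<and> S \<subseteq> N}"

definition superalgebra_ideal :: "'a set \<Rightarrow> ('k::field, 'a, 'm) superalgebra_scheme \<Rightarrow> bool" where
  "superalgebra_ideal J L \<longleftrightarrow> submodule J scalars L \<and>
     (\<forall>x\<in>carrier L. \<forall>y\<in>J. x \<otimes>\<^bsub>L\<^esub> y \<in> J \<and> y \<otimes>\<^bsub>L\<^esub> x \<in> J)"

text \<open>The ring structure is that of \<^term>\<open>L Quot J\<close>: the elements are the cosets \<open>J +> x\<close>.\<close>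

definition superalgebra_quotient ::
  "('k::field, 'a, 'm) superalgebra_scheme \<Rightarrow> 'a set \<Rightarrow> ('k, 'a set) superalgebra" where
  "superalgebra_quotient L J = \<lparr>carrier = a_rcosets\<^bsub>L\<^esub> J, monoid.mult = rcoset_mult L J, one = J +>\<^bsub>L\<^esub> \<one>\<^bsub>L\<^esub>,
     zero = J, add = set_add L,
     module.smult = (\<lambda>c C. \<Union>x\<in>C. J +>\<^bsub>L\<^esub> (c \<odot>\<^bsub>L\<^esub> x)),
     part = (\<lambda>p. (\<lambda>x. J +>\<^bsub>L\<^esub> x) ` part L p)\<rparr>"

definition derived_algebra ::
  "('k::field, 'a, 'm) superalgebra_scheme \<Rightarrow> ('k, 'a, 'm) superalgebra_scheme" where
  "derived_algebra L =
     (let D = lin_span L {x \<otimes>\<^bsub>L\<^esub> y | x y. x \<in> carrier L \<and> y \<in> carrier L}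
      in L\<lparr>carrier := D, part := (\<lambda>p. part L p \<inter> D)\<rparr>)"

definition center :: "('k::field, 'a, 'm) superalgebra_scheme \<Rightarrow> 'a set" where
  "center L = {z \<in> carrier L. \<forall>x\<in>carrier L. z \<otimes>\<^bsub>L\<^esub> x = \<zero>\<^bsub>L\<^esub>}"

definition one_dimensional :: "('k::field, 'a, 'm) superalgebra_scheme \<Rightarrow> 'a set \<Rightarrow> bool" where
  "one_dimensional L V \<longleftrightarrow>
     (\<exists>z\<in>carrier L. z \<noteq> \<zero>\<^bsub>L\<^esub> \<and> V = {c \<odot>\<^bsub>L\<^esub> z | c. True})"

definition superalgebra_isomorphic ::
  "('k::field, 'a, 'm) superalgebra_scheme \<Rightarrow> ('k, 'b, 'n) superalgebra_scheme \<Rightarrow> bool" where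
  "superalgebra_isomorphic L M \<longleftrightarrow> (\<exists>\<phi>. bij_betw \<phi> (carrier L) (carrier M) \<and>
     (\<forall>x\<in>carrier L. \<forall>y\<in>carrier L. \<phi> (x \<oplus>\<^bsub>L\<^esub> y) = \<phi> x \<oplus>\<^bsub>M\<^esub> \<phi> y) \<and>
     (\<forall>c. \<forall>x\<in>carrier L. \<phi> (c \<odot>\<^bsub>L\<^esub> x) = c \<odot>\<^bsub>M\<^esub> \<phi> x) \<and>
     (\<forall>x\<in>carrier L. \<forall>y\<in>carrier L. \<phi> (x \<otimes>\<^bsub>L\<^esub> y) = \<phi> x \<otimes>\<^bsub>M\<^esub> \<phi> y) \<and>
     (\<forall>p. \<phi> ` part L p = part M p))"


section \<open>Lie superalgebras given by generators and relations\<close>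

datatype 'g magma = Gen 'g | Br "'g magma" "'g magma"

text \<open>The free nonassociative superalgebra on generators with prescribed parities: the vector space
  with basis the free magma.\<close>

primrec magma_parity :: "('g \<Rightarrow> bit) \<Rightarrow> 'g magma \<Rightarrow> bit" where
  "magma_parity gp (Gen g) = gp g"
| "magma_parity gp (Br s t) = magma_parity gp s + magma_parity gp t"

definition free_superalgebra ::
  "('g \<Rightarrow> bit) \<Rightarrow> ('k::field, 'g magma \<Rightarrow>\<^sub>0 'k) superalgebra" where
  "free_superalgebra gp = \<lparr>carrier = UNIV,
     monoid.mult = (\<lambda>u v. \<Sum>s\<in>Poly_Mapping.keys u. \<Sum>t\<in>Poly_Mapping.keys v.
       Poly_Mapping.single (Br s t) (Poly_Mapping.lookup u s * Poly_Mapping.lookup v t)),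
     one = undefined, zero = 0, add = (+),
     module.smult = (\<lambda>c. Poly_Mapping.map ((*) c)),
     part = (\<lambda>p. {u. \<forall>s\<in>Poly_Mapping.keys u. magma_parity gp s = p})\<rparr>"

abbreviation gen :: "'g \<Rightarrow> 'g magma \<Rightarrow>\<^sub>0 'k::field" where
  "gen g \<equiv> Poly_Mapping.single (Gen g) 1"

text \<open>The smallest ideal that contains the relators \<open>R\<close> and has a Lie superalgebra as quotient.\<close>

definition presentation_ideal ::
  "('g \<Rightarrow> bit) \<Rightarrow> ('g magma \<Rightarrow>\<^sub>0 'k::field) set \<Rightarrow> ('g magma \<Rightarrow>\<^sub>0 'k) set" where
  "presentation_ideal gp R = \<Inter> {J. superalgebra_ideal J (free_superalgebra gp) \<and> R \<subseteq> J \<and>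
     lie_superalgebra (superalgebra_quotient (free_superalgebra gp) J)}"


section \<open>Contragredient Lie superalgebras\<close>

text \<open>
  The space \<open>\<hh>\<close> is the type \<open>'h\<close> with scalar multiplication \<open>sc\<close>. Its prescribed
  dimension is positive, so the equation for \<open>dim\<close> entails that \<open>\<hh>\<close> is finite-dimensional. In
  characteristic 3, \<^const>\<open>of_int\<close> is reduction mod 3 followed by the inclusion of the prime field.
\<close>

definition cartan_reduction :: "int^'i^'i \<Rightarrow> 'k::field^'i^'i" where
  "cartan_reduction A = (\<chi> i j. of_int (A $ i $ j))"

definition cartan_realization :: "int^'i::finite^'i \<Rightarrow> ('k::field \<Rightarrow> 'h::ab_group_add \<Rightarrow> 'h) \<Rightarrow>
    ('i \<Rightarrow> 'h) \<Rightarrow> ('i \<Rightarrow> 'h \<Rightarrow> 'k) \<Rightarrow> bool" where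
  "cartan_realization A sc h \<alpha> \<longleftrightarrow> vector_space sc \<and>
     vector_space.dim sc (UNIV :: 'h set) =
       2 * CARD('i) - rank (cartan_reduction A :: 'k^'i^'i) \<and>
     (\<forall>c. (\<Sum>i\<in>UNIV. sc (c i) (h i)) = 0 \<longrightarrow> (\<forall>i. c i = 0)) \<and>
     (\<forall>j. Vector_Spaces.linear sc (*) (\<alpha> j)) \<and>
     (\<forall>c. (\<forall>x. (\<Sum>j\<in>UNIV. c j * \<alpha> j x) = 0) \<longrightarrow> (\<forall>j. c j = 0)) \<and>
     (\<forall>i j. \<alpha> j (h i) = (cartan_reduction A :: 'k^'i^'i) $ i $ j)"

datatype ('h, 'i) generator = GenH 'h | GenE 'i | GenF 'i

primrec generator_parity :: "('i \<Rightarrow> bit) \<Rightarrow> ('h, 'i) generator \<Rightarrow> bit" where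
  "generator_parity par (GenH x) = 0"
| "generator_parity par (GenE i) = par i"
| "generator_parity par (GenF i) = par i"

text \<open>Every \<open>x \<in> \<hh>\<close> is a generator; the first two sets make \<open>x \<mapsto> GenH x\<close> linear.\<close>

definition contragredient_relators :: "('i \<Rightarrow> bit) \<Rightarrow>
    ('k::field \<Rightarrow> 'h::ab_group_add \<Rightarrow> 'h) \<Rightarrow> ('i \<Rightarrow> 'h) \<Rightarrow> ('i \<Rightarrow> 'h \<Rightarrow> 'k) \<Rightarrow>
    (('h, 'i) generator magma \<Rightarrow>\<^sub>0 'k) set" where
  "contragredient_relators par sc h \<alpha> =
     (let F = free_superalgebra (generator_parity par) :: ('k, ('h, 'i) generator magma \<Rightarrow>\<^sub>0 'k) superalgebra
      in {gen (GenH (x + y)) - (gen (GenH x) + gen (GenH y)) | x y. True} \<union>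
         {gen (GenH (sc c x)) - c \<odot>\<^bsub>F\<^esub> gen (GenH x) | c x. True} \<union>
         {gen (GenE i) \<otimes>\<^bsub>F\<^esub> gen (GenF j) - (if i = j then gen (GenH (h i)) else 0) | i j. True} \<union>
         {gen (GenH x) \<otimes>\<^bsub>F\<^esub> gen (GenE j) - \<alpha> j x \<odot>\<^bsub>F\<^esub> gen (GenE j) | x j. True} \<union>
         {gen (GenH x) \<otimes>\<^bsub>F\<^esub> gen (GenF j) + \<alpha> j x \<odot>\<^bsub>F\<^esub> gen (GenF j) | x j. True} \<union>
         {gen (GenH x) \<otimes>\<^bsub>F\<^esub> gen (GenH y) | x y. True})"

definition contragredient_ideal where
  "contragredient_ideal par sc h \<alpha> =
     presentation_ideal (generator_parity par) (contragredient_relators par sc h \<alpha>)"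

definition contragredient_tilde :: "('i \<Rightarrow> bit) \<Rightarrow>
    ('k::field \<Rightarrow> 'h::ab_group_add \<Rightarrow> 'h) \<Rightarrow> ('i \<Rightarrow> 'h) \<Rightarrow> ('i \<Rightarrow> 'h \<Rightarrow> 'k) \<Rightarrow>
    ('k, (('h, 'i) generator magma \<Rightarrow>\<^sub>0 'k) set) superalgebra" where
  "contragredient_tilde par sc h \<alpha> =
     superalgebra_quotient (free_superalgebra (generator_parity par)) (contragredient_ideal par sc h \<alpha>)"

definition tilde_class where
  "tilde_class par sc h \<alpha> u =
     contragredient_ideal par sc h \<alpha> +>\<^bsub>free_superalgebra (generator_parity par)\<^esub> u"

text \<open>The root lattice \<open>Q\<close> is \<^typ>\<open>int^'i\<close>, with \<^term>\<open>axis i 1\<close> in the role of the simple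
  root of index \<open>i\<close>.\<close>

primrec generator_degree :: "('h, 'i::finite) generator \<Rightarrow> int^'i" where
  "generator_degree (GenH x) = 0"
| "generator_degree (GenE i) = axis i 1"
| "generator_degree (GenF i) = - axis i 1"

primrec magma_degree :: "('h, 'i::finite) generator magma \<Rightarrow> int^'i" where
  "magma_degree (Gen g) = generator_degree g"
| "magma_degree (Br s t) = magma_degree s + magma_degree t"

definition tilde_component where
  "tilde_component par sc h \<alpha> q =
     tilde_class par sc h \<alpha> ` {u. \<forall>s\<in>Poly_Mapping.keys u. magma_degree s = q}"

definition Q_graded_ideal where
  "Q_graded_ideal par sc h \<alpha> J \<longleftrightarrow>
     superalgebra_ideal J (contragredient_tilde par sc h \<alpha>) \<and>
     J = lin_span (contragredient_tilde par sc h \<alpha>) (\<Union>q. J \<inter> tilde_component par sc h \<alpha> q)"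

definition contragredient_radical where
  "contragredient_radical par sc h \<alpha> = (GREATEST J. Q_graded_ideal par sc h \<alpha> J \<and>
     J \<inter> range (\<lambda>x. tilde_class par sc h \<alpha> (gen (GenH x))) = {\<zero>\<^bsub>contragredient_tilde par sc h \<alpha>\<^esub>})"

text \<open>The Cartan matrix enters only through \<open>h\<close> and \<open>\<alpha>\<close>, see \<^const>\<open>cartan_realization\<close>.\<close>

definition contragredient :: "('i::finite \<Rightarrow> bit) \<Rightarrow>
    ('k::field \<Rightarrow> 'h::ab_group_add \<Rightarrow> 'h) \<Rightarrow> ('i \<Rightarrow> 'h) \<Rightarrow> ('i \<Rightarrow> 'h \<Rightarrow> 'k) \<Rightarrow>
    ('k, (('h, 'i) generator magma \<Rightarrow>\<^sub>0 'k) set set) superalgebra" where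
  "contragredient par sc h \<alpha> =
     superalgebra_quotient (contragredient_tilde par sc h \<alpha>) (contragredient_radical par sc h \<alpha>)"

definition chevalley_e where
  "chevalley_e par sc h \<alpha> i = contragredient_radical par sc h \<alpha>
     +>\<^bsub>contragredient_tilde par sc h \<alpha>\<^esub> tilde_class par sc h \<alpha> (gen (GenE i))"


section \<open>Semisimplification\<close>

text \<open>Lie algebras in \<open>Rep \<alpha>\<^sub>3\<close>: finite-dimensional Lie algebras with a derivation \<open>d\<close>, \<open>d\<^sup>3 = 0\<close>.\<close>

definition rep_alpha3_lie_algebra ::
  "('k::field, 'a, 'm) superalgebra_scheme \<Rightarrow> ('a \<Rightarrow> 'a) \<Rightarrow> bool" where
  "rep_alpha3_lie_algebra L d \<longleftrightarrow> lie_superalgebra L \<and> part L 1 = {\<zero>\<^bsub>L\<^esub>} \<and>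
     (\<exists>B. finite B \<and> B \<subseteq> carrier L \<and> lin_span L B = carrier L) \<and>
     d \<in> carrier L \<rightarrow> carrier L \<and>
     (\<forall>x\<in>carrier L. \<forall>y\<in>carrier L. d (x \<oplus>\<^bsub>L\<^esub> y) = d x \<oplus>\<^bsub>L\<^esub> d y) \<and>
     (\<forall>c. \<forall>x\<in>carrier L. d (c \<odot>\<^bsub>L\<^esub> x) = c \<odot>\<^bsub>L\<^esub> d x) \<and>
     (\<forall>x\<in>carrier L. \<forall>y\<in>carrier L. d (x \<otimes>\<^bsub>L\<^esub> y) = (d x \<otimes>\<^bsub>L\<^esub> y) \<oplus>\<^bsub>L\<^esub> (x \<otimes>\<^bsub>L\<^esub> d y)) \<and>
     (\<forall>x\<in>carrier L. (d ^^ 3) x = \<zero>\<^bsub>L\<^esub>)"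

text \<open>
  A decomposition into \<open>n1\<close>, \<open>n2\<close>, \<open>n3\<close> Jordan blocks of sizes 1, 2, 3, where the blocks are
  numbered from 1 in order of size and \<open>x i\<close> generates block \<open>i\<close>. The basis vector
  \<open>(d ^^ l) (x i)\<close> is indexed by \<open>(i, l)\<close>.
\<close>

definition block_size :: "nat \<Rightarrow> nat \<Rightarrow> nat \<Rightarrow> nat" where
  "block_size n1 n2 i = (if i \<le> n1 then 1 else if i \<le> n1 + n2 then 2 else 3)"

definition jordan_index :: "nat \<Rightarrow> nat \<Rightarrow> nat \<Rightarrow> (nat \<times> nat) set" where
  "jordan_index n1 n2 n3 = (SIGMA i:{1..n1 + n2 + n3}. {..<block_size n1 n2 i})"

definition is_coordinates :: "('k::field, 'a, 'm) superalgebra_scheme \<Rightarrow> ('a \<Rightarrow> 'a) \<Rightarrow>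
    nat \<Rightarrow> nat \<Rightarrow> nat \<Rightarrow> (nat \<Rightarrow> 'a) \<Rightarrow> 'a \<Rightarrow> (nat \<times> nat \<Rightarrow> 'k) \<Rightarrow> bool" where
  "is_coordinates L d n1 n2 n3 x v c \<longleftrightarrow> (\<forall>p. p \<notin> jordan_index n1 n2 n3 \<longrightarrow> c p = 0) \<and>
     v = (\<Oplus>\<^bsub>L\<^esub>p\<in>jordan_index n1 n2 n3. c p \<odot>\<^bsub>L\<^esub> (d ^^ snd p) (x (fst p)))"

definition jordan_decomposition :: "('k::field, 'a, 'm) superalgebra_scheme \<Rightarrow> ('a \<Rightarrow> 'a) \<Rightarrow>
    nat \<Rightarrow> nat \<Rightarrow> nat \<Rightarrow> (nat \<Rightarrow> 'a) \<Rightarrow> bool" where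
  "jordan_decomposition L d n1 n2 n3 x \<longleftrightarrow>
     (\<forall>i\<in>{1..n1 + n2 + n3}. x i \<in> carrier L \<and> (d ^^ block_size n1 n2 i) (x i) = \<zero>\<^bsub>L\<^esub>) \<and>
     (\<forall>v\<in>carrier L. \<exists>!c. is_coordinates L d n1 n2 n3 x v c)"

definition coefficient :: "('k::field, 'a, 'm) superalgebra_scheme \<Rightarrow> ('a \<Rightarrow> 'a) \<Rightarrow>
    nat \<Rightarrow> nat \<Rightarrow> nat \<Rightarrow> (nat \<Rightarrow> 'a) \<Rightarrow> nat \<Rightarrow> 'a \<Rightarrow> 'k" where
  "coefficient L d n1 n2 n3 x k v = (THE c. is_coordinates L d n1 n2 n3 x v c) (k, 0)"

definition block_parity :: "nat \<Rightarrow> nat \<Rightarrow> bit" where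
  "block_parity n1 i = (if i \<le> n1 then 0 else 1)"

definition semisimple_constant :: "('k::field, 'a, 'm) superalgebra_scheme \<Rightarrow> ('a \<Rightarrow> 'a) \<Rightarrow>
    nat \<Rightarrow> nat \<Rightarrow> nat \<Rightarrow> (nat \<Rightarrow> 'a) \<Rightarrow> nat \<Rightarrow> nat \<Rightarrow> nat \<Rightarrow> 'k" where
  "semisimple_constant L d n1 n2 n3 x i j k =
     (if block_parity n1 k \<noteq> block_parity n1 i + block_parity n1 j then 0
      else if block_parity n1 i = 1 \<and> block_parity n1 j = 1 then
        coefficient L d n1 n2 n3 x k
          ((\<ominus>\<^bsub>L\<^esub> (x i \<otimes>\<^bsub>L\<^esub> d (x j))) \<oplus>\<^bsub>L\<^esub> (d (x i) \<otimes>\<^bsub>L\<^esub> x j))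
      else coefficient L d n1 n2 n3 x k (x i \<otimes>\<^bsub>L\<^esub> x j))"

text \<open>
  The semisimplification computed from a Jordan decomposition. Its elements are the coefficient
  families, supported on \<open>{1..n1 + n2}\<close>, with respect to the basis given by the blocks of sizes 1
  (even) and 2 (odd); the blocks of size 3 are negligible. The sign in \<^const>\<open>semisimple_constant\<close>
  comes from the embedding \<open>x \<mapsto> - v \<otimes> v' + v' \<otimes> v\<close> of the unit object into the tensor square
  of the block \<open>v \<mapsto> v'\<close> of size 2.
\<close>

definition semisimplification :: "('k::field, 'a, 'm) superalgebra_scheme \<Rightarrow> ('a \<Rightarrow> 'a) \<Rightarrow>
    nat \<Rightarrow> nat \<Rightarrow> nat \<Rightarrow> (nat \<Rightarrow> 'a) \<Rightarrow> ('k, nat \<Rightarrow> 'k) superalgebra" where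
  "semisimplification L d n1 n2 n3 x = \<lparr>carrier = {y. \<forall>i. i \<notin> {1..n1 + n2} \<longrightarrow> y i = 0},
     monoid.mult = (\<lambda>y z k. if k \<in> {1..n1 + n2}
       then \<Sum>i\<in>{1..n1 + n2}. \<Sum>j\<in>{1..n1 + n2}. y i * z j * semisimple_constant L d n1 n2 n3 x i j k
       else 0),
     one = undefined, zero = (\<lambda>i. 0), add = (\<lambda>y z i. y i + z i), module.smult = (\<lambda>c y i. c * y i),
     part = (\<lambda>p. {y. \<forall>i. y i \<noteq> 0 \<longrightarrow> i \<in> {1..n1 + n2} \<and> block_parity n1 i = p})\<rparr>"


section \<open>The algebras \<open>\<ee>\<^sub>6\<close> and \<open>\<gg>(2,6)\<close>\<close>

text \<open>The constructor \<^const>\<open>vector\<close> starts at index 1, and in the types \<open>6\<close> and \<open>5\<close> the last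
  index \<open>n\<close> is the number \<open>0\<close>, so the indices \<open>1, \<dots>, n\<close> are the usual ones.\<close>

definition e6_cartan :: "int^6^6" where
  "e6_cartan = vector [
     vector [ 2,  0, -1,  0,  0,  0],
     vector [ 0,  2,  0, -1,  0,  0],
     vector [-1,  0,  2, -1,  0,  0],
     vector [ 0, -1, -1,  2, -1,  0],
     vector [ 0,  0,  0, -1,  2, -1],
     vector [ 0,  0,  0,  0, -1,  2]]"

definition e6_parity :: "6 \<Rightarrow> bit" where
  "e6_parity i = 0"

definition g26_cartan :: "int^5^5" where
  "g26_cartan = vector [
     vector [ 2, -1,  0,  0,  0],
     vector [-1,  2, -1,  0,  0],
     vector [ 0, -1,  0, -1,  0],
     vector [ 0,  0, -1,  2, -1],
     vector [ 0,  0,  0, -1,  2]]"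

definition g26_parity :: "5 \<Rightarrow> bit" where
  "g26_parity i = (if i = 3 then 1 else 0)"

end

(*
  Over a field of characteristic 3, each of the two algebras modulo its center has an explicit model: a
  Cartan part, spanned by the rows of the Cartan matrix, and one-dimensional root spaces whose bracket is
  given by a sign cocycle on the root lattice of type E6. The contragredient algebra maps onto such a
  model with Cartan part h, and the map is injective because a graded ideal of the model that meets h
  trivially is zero. For g(2,6) the even and the odd roots are the roots of E6 that have inner product 0
  and -1 with the simple root alpha_2.

  Under D = ad e_2 the root spaces of weight -1 and 1 form Jordan blocks of size 2, the root spaces of
  weight 0 and the kernel of alpha_2 in the Cartan part form blocks of size 1, and f_2, h_2,
  e_2 span the single block of size 3. The semisimplification does not depend on the Jordan decomposition:
  its even part is ker D / (ker D \<inter> im D) and its odd part is ker D^2 / (ker D + im D). In the model of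
  e6 these quotients, with the bracket -[u, D v] + [D u, v] of two odd elements, are the model of g(2,6).
*)

theory Submission
  imports Defs "HOL-Library.Function_Algebras"
begin

text \<open>Inside a quotient given by generators and relations only upper bounds are visible; the
  explicit models supply the lower bounds. An upper bound is needed in degree 0 alone: once this
  component of the algebra before reduction is known to consist of Cartan elements, a graded ideal
  that meets the Cartan part trivially cannot contain an element with nonzero image in the model,
  because a bracket with an opposite root vector would produce a coroot. The structure constants of
  g(2,6) are read off from the odd bracket of the semisimplification, where 1 + 1 = - 1 produces an
  extra sign; hence the projections to the model of g(2,6) respect brackets without any rescaling of
  root vectors. The Cartan matrix of g(2,6) agrees with the inner product of E6, corrected for
  parity, only mod 3. After a common sign is divided out, the Jacobi identity for three roots
  depends on three parities and two inner products, so that one table of 200 cases proves it for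
  both algebras.\<close>

no_notation fps_nth (infixl \<open>$\<close> 75)

section \<open>Transport of structure along surjective homomorphisms\<close>

section \<open>Superalgebras and quotients\<close>

text \<open>The axioms shared by free superalgebras, their quotients and the root models:
  bilinearity, with submodules as parts, but no Lie identity and no direct sum of the parts.
  Kernels, ideals and quotients are treated at this level, before it is known which quotients are
  Lie.\<close>

locale bilinear_superalgebra = Module.module "scalars :: 'k::field ring" A
  for A :: "('k::field, 'a, 'm) superalgebra_scheme" (structure) +
  assumes part_submodule: "submodule (part A p) (scalars :: 'k ring) A"
    and mult_closed: "\<lbrakk>x \<in> carrier A; y \<in> carrier A\<rbrakk> \<Longrightarrow> x \<otimes> y \<in> carrier A"
    and mult_add_left: "\<lbrakk>x \<in> carrier A; y \<in> carrier A; z \<in> carrier A\<rbrakk>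
      \<Longrightarrow> (x \<oplus> y) \<otimes> z = (x \<otimes> z) \<oplus> (y \<otimes> z)"
    and mult_add_right: "\<lbrakk>x \<in> carrier A; y \<in> carrier A; z \<in> carrier A\<rbrakk>
      \<Longrightarrow> x \<otimes> (y \<oplus> z) = (x \<otimes> y) \<oplus> (x \<otimes> z)"
    and mult_smult_left: "\<lbrakk>x \<in> carrier A; y \<in> carrier A\<rbrakk>
      \<Longrightarrow> (c \<odot>\<^bsub>A\<^esub> x) \<otimes> y = c \<odot>\<^bsub>A\<^esub> (x \<otimes> y)"
    and mult_smult_right: "\<lbrakk>x \<in> carrier A; y \<in> carrier A\<rbrakk>
      \<Longrightarrow> x \<otimes> (c \<odot>\<^bsub>A\<^esub> y) = c \<odot>\<^bsub>A\<^esub> (x \<otimes> y)"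

lemma scalars_simps [simp]:
  "carrier (scalars :: 'k::field ring) = UNIV" "x \<oplus>\<^bsub>(scalars :: 'k ring)\<^esub> y = x + y"
  "x \<otimes>\<^bsub>(scalars :: 'k ring)\<^esub> y = x * y" "\<one>\<^bsub>(scalars :: 'k ring)\<^esub> = 1" "\<zero>\<^bsub>(scalars :: 'k ring)\<^esub> = 0"
  by (simp_all add: ring_of_type_algebra_def)

lemma cring_scalars: "cring (scalars :: 'k::field ring)"
  by (rule cring_from_type_algebra)

lemma lie_imp_bilinear: "lie_superalgebra L \<Longrightarrow> bilinear_superalgebra L"
  unfolding lie_superalgebra_def lie_superalgebra_axioms_def
    bilinear_superalgebra_def bilinear_superalgebra_axioms_def
  by (elim conjE, intro conjI) assumption+

text \<open>Equality for the images of the parts makes an injective map of this kind the same as an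
  isomorphism of superalgebras. The zero slots do not occur because between modules scalar
  multiplication by 0 forces them to correspond.\<close>

definition superalgebra_epi ::
  "('k::field, 'a, 'm) superalgebra_scheme \<Rightarrow> ('k, 'b, 'n) superalgebra_scheme \<Rightarrow> ('a \<Rightarrow> 'b) \<Rightarrow> bool" where
  "superalgebra_epi A B \<phi> \<longleftrightarrow> \<phi> ` carrier A = carrier B \<and>
     (\<forall>x\<in>carrier A. \<forall>y\<in>carrier A. \<phi> (x \<oplus>\<^bsub>A\<^esub> y) = \<phi> x \<oplus>\<^bsub>B\<^esub> \<phi> y) \<and>
     (\<forall>c. \<forall>x\<in>carrier A. \<phi> (c \<odot>\<^bsub>A\<^esub> x) = c \<odot>\<^bsub>B\<^esub> \<phi> x) \<and>
     (\<forall>x\<in>carrier A. \<forall>y\<in>carrier A. \<phi> (x \<otimes>\<^bsub>A\<^esub> y) = \<phi> x \<otimes>\<^bsub>B\<^esub> \<phi> y) \<and>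
     (\<forall>p. \<phi> ` part A p = part B p)"

lemma superalgebra_epiD:
  assumes "superalgebra_epi A B \<phi>"
  shows "\<phi> ` carrier A = carrier B"
    and "x \<in> carrier A \<Longrightarrow> \<phi> x \<in> carrier B"
    and "\<lbrakk>x \<in> carrier A; y \<in> carrier A\<rbrakk> \<Longrightarrow> \<phi> (x \<oplus>\<^bsub>A\<^esub> y) = \<phi> x \<oplus>\<^bsub>B\<^esub> \<phi> y"
    and "x \<in> carrier A \<Longrightarrow> \<phi> (c \<odot>\<^bsub>A\<^esub> x) = c \<odot>\<^bsub>B\<^esub> \<phi> x"
    and "\<lbrakk>x \<in> carrier A; y \<in> carrier A\<rbrakk> \<Longrightarrow> \<phi> (x \<otimes>\<^bsub>A\<^esub> y) = \<phi> x \<otimes>\<^bsub>B\<^esub> \<phi> y"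
    and "\<phi> ` part A p = part B p"
  using assms unfolding superalgebra_epi_def by blast+

lemma superalgebra_epi_comp:
  assumes "superalgebra_epi A B \<phi>" "superalgebra_epi B C \<psi>"
  shows "superalgebra_epi A C (\<psi> \<circ> \<phi>)"
proof -
  note a = superalgebra_epiD[OF assms(1)] and b = superalgebra_epiD[OF assms(2)]
  have im: "(\<psi> \<circ> \<phi>) ` S = \<psi> ` (\<phi> ` S)" for S by (rule image_comp [symmetric])
  show ?thesis unfolding superalgebra_epi_def im
    using a b by simp
qed

context bilinear_superalgebra
begin

lemma part_subset: "part A p \<subseteq> carrier A"
  using part_submodule[of p] submoduleE(1) by blast

lemma smult_in: "x \<in> carrier A \<Longrightarrow> c \<odot>\<^bsub>A\<^esub> x \<in> carrier A"
  using smult_closed[of c x] by simp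

lemma minus_eq_smult: "x \<in> carrier A \<Longrightarrow> \<ominus> x = (-1) \<odot>\<^bsub>A\<^esub> x"
  using smult_l_minus[of 1 x] smult_one[of x]
  by (metis M.minus_equality R.zero_closed UNIV_I add.left_inverse scalars_simps smult_in smult_l_distr smult_l_null)

lemma mult_zero_left: "x \<in> carrier A \<Longrightarrow> \<zero> \<otimes> x = \<zero>"
  using mult_smult_left[of \<zero> x 0] by (metis M.zero_closed mult_closed scalars_simps(5) smult_l_null)

lemma mult_zero_right: "x \<in> carrier A \<Longrightarrow> x \<otimes> \<zero> = \<zero>"
  using mult_smult_right[of x \<zero> 0] by (metis M.zero_closed mult_closed scalars_simps(5) smult_l_null)

lemma submoduleI':
  assumes "N \<subseteq> carrier A" "\<zero> \<in> N" "\<And>x y. \<lbrakk>x \<in> N; y \<in> N\<rbrakk> \<Longrightarrow> x \<oplus> y \<in> N"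
    "\<And>c x. x \<in> N \<Longrightarrow> c \<odot>\<^bsub>A\<^esub> x \<in> N"
  shows "submodule N (scalars :: 'k ring) A"
  using assms by (intro submoduleI) (auto simp: minus_eq_smult subsetD)

lemma submoduleD:
  assumes "submodule N (scalars :: 'k ring) A"
  shows "N \<subseteq> carrier A" "\<zero> \<in> N" "\<And>x y. \<lbrakk>x \<in> N; y \<in> N\<rbrakk> \<Longrightarrow> x \<oplus> y \<in> N"
    "\<And>c x. x \<in> N \<Longrightarrow> c \<odot>\<^bsub>A\<^esub> x \<in> N" "\<And>x. x \<in> N \<Longrightarrow> \<ominus> x \<in> N"
    "\<And>x y. \<lbrakk>x \<in> N; y \<in> N\<rbrakk> \<Longrightarrow> x \<ominus> y \<in> N"
  using submoduleE[OF assms] submodule.smult_closed[OF assms] subgroup.one_closed[OF submodule.axioms(1)[OF assms]]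
  by (auto simp: a_minus_def)

end

text \<open>Every axiom is an equation or a closure property and passes from \<open>A\<close> to its
  image. Nothing is presupposed about the record \<open>B\<close>, whose zero slot is independent of
  its other operations; hence the equation for it. Quotients and derived algebras obtain their
  axioms in this way.\<close>

lemma (in bilinear_superalgebra) epi_image:
  assumes "superalgebra_epi A B \<phi>" "\<zero>\<^bsub>B\<^esub> = \<phi> \<zero>\<^bsub>A\<^esub>"
  shows "bilinear_superalgebra B"
proof -
  note e = superalgebra_epiD[OF assms(1)]
  have img: "\<And>y. y \<in> carrier B \<Longrightarrow> \<exists>x\<in>carrier A. y = \<phi> x" using e(1) by blast
  have ag: "abelian_group B"
  proof (rule abelian_groupI)
    show "\<And>x y. x \<in> carrier B \<Longrightarrow> y \<in> carrier B \<Longrightarrow> x \<oplus>\<^bsub>B\<^esub> y \<in> carrier B"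
      by (metis e(2,3) img M.add.m_closed)
    show "\<zero>\<^bsub>B\<^esub> \<in> carrier B" using assms(2) e(2) by simp
    show "x \<oplus>\<^bsub>B\<^esub> y \<oplus>\<^bsub>B\<^esub> z = x \<oplus>\<^bsub>B\<^esub> (y \<oplus>\<^bsub>B\<^esub> z)"
      if "x \<in> carrier B" "y \<in> carrier B" "z \<in> carrier B" for x y z
      using img[OF that(1)] img[OF that(2)] img[OF that(3)] by (auto simp: e(3)[symmetric] M.a_assoc)
    show "\<And>x y. x \<in> carrier B \<Longrightarrow> y \<in> carrier B \<Longrightarrow> x \<oplus>\<^bsub>B\<^esub> y = y \<oplus>\<^bsub>B\<^esub> x"
      by (metis e(3) img M.add.m_comm)
    show "\<And>x. x \<in> carrier B \<Longrightarrow> \<zero>\<^bsub>B\<^esub> \<oplus>\<^bsub>B\<^esub> x = x"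
      by (metis assms(2) e(3) img M.zero_closed M.l_zero)
    show "\<And>x. x \<in> carrier B \<Longrightarrow> \<exists>y\<in>carrier B. y \<oplus>\<^bsub>B\<^esub> x = \<zero>\<^bsub>B\<^esub>"
      by (metis assms(2) e(2,3) img M.a_inv_closed M.l_neg)
  qed
  have sc: "\<And>c x. x \<in> carrier A \<Longrightarrow> c \<odot>\<^bsub>B\<^esub> \<phi> x = \<phi> (c \<odot>\<^bsub>A\<^esub> x)" using e(4) by simp
  have m: "Module.module (scalars :: 'k ring) B"
  proof (rule moduleI[OF cring_scalars ag])
    show "a \<odot>\<^bsub>B\<^esub> x \<in> carrier B" if "x \<in> carrier B" for a x
      using img[OF that] e(2) sc smult_in by metis
    show "(a \<oplus>\<^bsub>scalars\<^esub> b) \<odot>\<^bsub>B\<^esub> x = a \<odot>\<^bsub>B\<^esub> x \<oplus>\<^bsub>B\<^esub> b \<odot>\<^bsub>B\<^esub> x" if "x \<in> carrier B" for a b x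
      using img[OF that] smult_l_distr[of a b] by (auto simp: sc e(3)[symmetric] smult_in)
    show "a \<odot>\<^bsub>B\<^esub> (x \<oplus>\<^bsub>B\<^esub> y) = a \<odot>\<^bsub>B\<^esub> x \<oplus>\<^bsub>B\<^esub> a \<odot>\<^bsub>B\<^esub> y" if "x \<in> carrier B" "y \<in> carrier B" for a x y
      using img[OF that(1)] img[OF that(2)] smult_r_distr[of a]
      by (auto simp: sc e(3)[symmetric] smult_in)
    show "(a \<otimes>\<^bsub>scalars\<^esub> b) \<odot>\<^bsub>B\<^esub> x = a \<odot>\<^bsub>B\<^esub> (b \<odot>\<^bsub>B\<^esub> x)" if "x \<in> carrier B" for a b x
      using img[OF that] smult_assoc1[of a b] by (auto simp: sc smult_in)
    show "\<one>\<^bsub>scalars\<^esub> \<odot>\<^bsub>B\<^esub> x = x" if "x \<in> carrier B" for x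
      using img[OF that] smult_one by (auto simp: sc)
  qed
  interpret B: Module.module "scalars :: 'k ring" B by (rule m)
  have mi: "\<ominus>\<^bsub>B\<^esub> \<phi> x = \<phi> (\<ominus> x)" if "x \<in> carrier A" for x
    using that by (metis B.M.minus_equality assms(2) e(2,3) M.a_inv_closed M.l_neg)
  show ?thesis
  proof (intro bilinear_superalgebra.intro m bilinear_superalgebra_axioms.intro)
    fix p
    note pa = submoduleD[OF part_submodule[of p]]
    show "submodule (part B p) scalars B"
      unfolding e(6)[of p, symmetric]
    proof (rule B.submoduleI)
      show "\<phi> ` part A p \<subseteq> carrier B" using pa(1) e(2) by blast
      show "\<zero>\<^bsub>B\<^esub> \<in> \<phi> ` part A p" using pa(2) assms(2) by simp
      show "\<ominus>\<^bsub>B\<^esub> a \<in> \<phi> ` part A p" if a: "a \<in> \<phi> ` part A p" for a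
      proof -
        obtain x where x: "x \<in> part A p" "a = \<phi> x" using a by blast
        then have "x \<in> carrier A" using pa(1) by auto
        then have "\<ominus>\<^bsub>B\<^esub> a = \<phi> (\<ominus> x)" using mi x by simp
        then show ?thesis using pa(5)[OF x(1)] by simp
      qed
      show "a \<oplus>\<^bsub>B\<^esub> b \<in> \<phi> ` part A p" if ab: "a \<in> \<phi> ` part A p" "b \<in> \<phi> ` part A p" for a b
      proof -
        obtain x y where xy: "x \<in> part A p" "y \<in> part A p" "a = \<phi> x" "b = \<phi> y" using ab by blast
        then have "x \<in> carrier A" "y \<in> carrier A" using pa(1) by auto
        then have "a \<oplus>\<^bsub>B\<^esub> b = \<phi> (x \<oplus> y)" using e(3) xy by simp
        then show ?thesis using pa(3)[OF xy(1,2)] by simp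
      qed
      show "a \<odot>\<^bsub>B\<^esub> x \<in> \<phi> ` part A p" if x: "x \<in> \<phi> ` part A p" for a x
      proof -
        obtain y where y: "y \<in> part A p" "x = \<phi> y" using x by blast
        then have "y \<in> carrier A" using pa(1) by auto
        then have "a \<odot>\<^bsub>B\<^esub> x = \<phi> (a \<odot>\<^bsub>A\<^esub> y)" using sc y by simp
        then show ?thesis using pa(4)[OF y(1)] by simp
      qed
    qed
  next
    show "x \<otimes>\<^bsub>B\<^esub> y \<in> carrier B" if "x \<in> carrier B" "y \<in> carrier B" for x y
      using img[OF that(1)] img[OF that(2)] e(2,5) mult_closed by metis
    show "(x \<oplus>\<^bsub>B\<^esub> y) \<otimes>\<^bsub>B\<^esub> z = x \<otimes>\<^bsub>B\<^esub> z \<oplus>\<^bsub>B\<^esub> y \<otimes>\<^bsub>B\<^esub> z"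
      if "x \<in> carrier B" "y \<in> carrier B" "z \<in> carrier B" for x y z
      using img[OF that(1)] img[OF that(2)] img[OF that(3)]
      by (auto simp: e(3)[symmetric] e(5)[symmetric] mult_closed mult_add_left)
    show "x \<otimes>\<^bsub>B\<^esub> (y \<oplus>\<^bsub>B\<^esub> z) = x \<otimes>\<^bsub>B\<^esub> y \<oplus>\<^bsub>B\<^esub> x \<otimes>\<^bsub>B\<^esub> z"
      if "x \<in> carrier B" "y \<in> carrier B" "z \<in> carrier B" for x y z
      using img[OF that(1)] img[OF that(2)] img[OF that(3)]
      by (auto simp: e(3)[symmetric] e(5)[symmetric] mult_closed mult_add_right)
    show "(c \<odot>\<^bsub>B\<^esub> x) \<otimes>\<^bsub>B\<^esub> y = c \<odot>\<^bsub>B\<^esub> (x \<otimes>\<^bsub>B\<^esub> y)"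
      if "x \<in> carrier B" "y \<in> carrier B" for x y c
      using img[OF that(1)] img[OF that(2)]
      by (auto simp: sc e(5)[symmetric] mult_closed mult_smult_left smult_in)
    show "x \<otimes>\<^bsub>B\<^esub> (c \<odot>\<^bsub>B\<^esub> y) = c \<odot>\<^bsub>B\<^esub> (x \<otimes>\<^bsub>B\<^esub> y)"
      if "x \<in> carrier B" "y \<in> carrier B" for x y c
      using img[OF that(1)] img[OF that(2)]
      by (auto simp: sc e(5)[symmetric] mult_closed mult_smult_right smult_in)
  qed
qed

lemma epi_zero_minus:
  assumes "bilinear_superalgebra A" "bilinear_superalgebra B" "superalgebra_epi A B \<phi>"
  shows "\<phi> \<zero>\<^bsub>A\<^esub> = \<zero>\<^bsub>B\<^esub>" "x \<in> carrier A \<Longrightarrow> \<phi> (\<ominus>\<^bsub>A\<^esub> x) = \<ominus>\<^bsub>B\<^esub> \<phi> x"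
proof -
  interpret A: bilinear_superalgebra A by fact
  interpret B: bilinear_superalgebra B by fact
  note e = superalgebra_epiD[OF assms(3)]
  show "\<phi> \<zero>\<^bsub>A\<^esub> = \<zero>\<^bsub>B\<^esub>"
    using e(4)[of "\<zero>\<^bsub>A\<^esub>" 0] e(2)[of "\<zero>\<^bsub>A\<^esub>"] A.smult_l_null[of "\<zero>\<^bsub>A\<^esub>"] B.smult_l_null[of "\<phi> \<zero>\<^bsub>A\<^esub>"] by simp
  show "x \<in> carrier A \<Longrightarrow> \<phi> (\<ominus>\<^bsub>A\<^esub> x) = \<ominus>\<^bsub>B\<^esub> \<phi> x"
    using e by (simp add: A.minus_eq_smult B.minus_eq_smult)
qed

definition epi_kernel ::
  "('k::field, 'a, 'm) superalgebra_scheme \<Rightarrow> ('k, 'b, 'n) superalgebra_scheme \<Rightarrow> ('a \<Rightarrow> 'b) \<Rightarrow> 'a set" where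
  "epi_kernel A B \<phi> = {x \<in> carrier A. \<phi> x = \<zero>\<^bsub>B\<^esub>}"

lemma epi_kernel_ideal:
  assumes "bilinear_superalgebra A" "bilinear_superalgebra B" "superalgebra_epi A B \<phi>"
  shows "superalgebra_ideal (epi_kernel A B \<phi>) A"
proof -
  interpret A: bilinear_superalgebra A by fact
  interpret B: bilinear_superalgebra B by fact
  note e = superalgebra_epiD[OF assms(3)]
  have "submodule (epi_kernel A B \<phi>) scalars A"
  proof (rule A.submoduleI')
    show "\<zero>\<^bsub>A\<^esub> \<in> epi_kernel A B \<phi>" using epi_zero_minus(1)[OF assms] by (simp add: epi_kernel_def)
    show "c \<odot>\<^bsub>A\<^esub> x \<in> epi_kernel A B \<phi>" if "x \<in> epi_kernel A B \<phi>" for c x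
      using that e(4) B.smult_r_null[of c] by (simp add: epi_kernel_def A.smult_in)
  qed (use e(3) in \<open>auto simp: epi_kernel_def\<close>)
  then show ?thesis using e(2,5)
    by (auto simp: superalgebra_ideal_def epi_kernel_def A.mult_closed B.mult_zero_left B.mult_zero_right)
qed

locale superalgebra_with_ideal = bilinear_superalgebra A
  for A :: "('k::field, 'a, 'm) superalgebra_scheme" (structure) and J +
  assumes ideal: "superalgebra_ideal J A"
begin

lemma J_submodule: "submodule J (scalars :: 'k ring) A"
  using ideal by (simp add: superalgebra_ideal_def)

lemmas J_facts = submoduleD[OF J_submodule]

lemma J_mult: "\<lbrakk>x \<in> carrier A; y \<in> J\<rbrakk> \<Longrightarrow> x \<otimes> y \<in> J" "\<lbrakk>x \<in> carrier A; y \<in> J\<rbrakk> \<Longrightarrow> y \<otimes> x \<in> J"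
  using ideal by (auto simp: superalgebra_ideal_def)

sublocale J: abelian_subgroup J A
  by (intro abelian_subgroupI3 additive_subgroup.intro submodule.axioms(1)[OF J_submodule])
     unfold_locales

lemma coset_eq_iff:
  assumes "x \<in> carrier A" "y \<in> carrier A"
  shows "J +> x = J +> y \<longleftrightarrow> x \<ominus> y \<in> J"
  using assms J.a_rcos_self J.a_repr_independence'[of x y] J.a_rcos_module by (metis a_minus_def)

lemma coset_eq_J_iff: "x \<in> carrier A \<Longrightarrow> J +> x = J \<longleftrightarrow> x \<in> J"
  by (metis J.a_rcos_const J.a_rcos_self)

lemma mem_coset_iff: "x \<in> carrier A \<Longrightarrow> u \<in> J +> x \<longleftrightarrow> u \<in> carrier A \<and> u \<ominus> x \<in> J"
  by (metis J.a_elemrcos_carrier J.a_rcos_module a_minus_def)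

lemma coset_add: "\<lbrakk>x \<in> carrier A; y \<in> carrier A\<rbrakk> \<Longrightarrow> set_add A (J +> x) (J +> y) = J +> (x \<oplus> y)"
  by (rule J.a_rcos_sum)

text \<open>Scalar multiplication in \<open>superalgebra_quotient\<close> is a union over all
  representatives; the union collapses because the cosets in it coincide.\<close>

lemma coset_smult:
  assumes "x \<in> carrier A" shows "(\<Union>u\<in>J +> x. J +> (c \<odot>\<^bsub>A\<^esub> u)) = J +> (c \<odot>\<^bsub>A\<^esub> x)"
proof -
  have "J +> (c \<odot>\<^bsub>A\<^esub> u) = J +> (c \<odot>\<^bsub>A\<^esub> x)" if "u \<in> J +> x" for u
  proof -
    have u: "u \<in> carrier A" "u \<ominus> x \<in> J" using that assms mem_coset_iff by auto
    then have "c \<odot>\<^bsub>A\<^esub> (u \<ominus> x) \<in> J" by (simp add: J_facts(4))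
    then have "c \<odot>\<^bsub>A\<^esub> u \<ominus> c \<odot>\<^bsub>A\<^esub> x \<in> J"
      using u assms smult_r_distr[of c u "\<ominus> x"] smult_r_minus[of c x] by (simp add: a_minus_def)
    then show ?thesis using u assms coset_eq_iff smult_in by simp
  qed
  moreover have "x \<in> J +> x" using assms by (simp add: J.a_rcos_self)
  ultimately show ?thesis by fast
qed

lemma coset_mult:
  assumes "x \<in> carrier A" "y \<in> carrier A"
  shows "rcoset_mult A J (J +> x) (J +> y) = J +> (x \<otimes> y)"
proof -
  have "J +> (u \<otimes> v) = J +> (x \<otimes> y)" if "u \<in> J +> x" "v \<in> J +> y" for u v
  proof -
    have u: "u \<in> carrier A" "u \<ominus> x \<in> J" and v: "v \<in> carrier A" "v \<ominus> y \<in> J"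
      using that assms mem_coset_iff by auto
    \<comment> \<open>Independence of representatives rests on the splitting u v - x y = (u - x) v +
      x (v - y), where both summands lie in the ideal.\<close>
    have d: "u = (u \<ominus> x) \<oplus> x" "v = (v \<ominus> y) \<oplus> y" using u v assms by (simp_all add: a_minus_def M.a_assoc M.l_neg)
    have c: "u \<ominus> x \<in> carrier A" "v \<ominus> y \<in> carrier A" using u v assms by auto
    have 1: "u \<otimes> v = ((u \<ominus> x) \<otimes> v) \<oplus> (x \<otimes> v)" using mult_add_left[OF c(1) assms(1) v(1)] unfolding d(1)[symmetric] .
    have 2: "x \<otimes> v = (x \<otimes> (v \<ominus> y)) \<oplus> (x \<otimes> y)" using mult_add_right[OF assms(1) c(2) assms(2)] unfolding d(2)[symmetric] .
    have cc: "(u \<ominus> x) \<otimes> v \<in> carrier A" "x \<otimes> (v \<ominus> y) \<in> carrier A" "x \<otimes> y \<in> carrier A"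
      using c u v assms mult_closed by auto
    have "(u \<otimes> v) \<ominus> (x \<otimes> y) = ((u \<ominus> x) \<otimes> v) \<oplus> (x \<otimes> (v \<ominus> y))"
      unfolding 1 2 using cc by (simp add: a_minus_def M.a_assoc M.r_neg)
    also have "\<dots> \<in> J" by (rule J_facts(3)[OF J_mult(2)[OF v(1) u(2)] J_mult(1)[OF assms(1) v(2)]])
    finally show ?thesis using coset_eq_iff mult_closed u v assms by simp
  qed
  moreover have "x \<in> J +> x" "y \<in> J +> y" using assms by (simp_all add: J.a_rcos_self)
  ultimately show ?thesis unfolding rcoset_mult_def by fast
qed

lemma quotient_simps:
  "carrier (superalgebra_quotient A J) = (\<lambda>x. J +> x) ` carrier A"
  "\<lbrakk>x \<in> carrier A; y \<in> carrier A\<rbrakk> \<Longrightarrow> (J +> x) \<oplus>\<^bsub>superalgebra_quotient A J\<^esub> (J +> y) = J +> (x \<oplus> y)"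
  "\<lbrakk>x \<in> carrier A; y \<in> carrier A\<rbrakk> \<Longrightarrow> (J +> x) \<otimes>\<^bsub>superalgebra_quotient A J\<^esub> (J +> y) = J +> (x \<otimes> y)"
  "x \<in> carrier A \<Longrightarrow> c \<odot>\<^bsub>superalgebra_quotient A J\<^esub> (J +> x) = J +> (c \<odot>\<^bsub>A\<^esub> x)"
  "\<zero>\<^bsub>superalgebra_quotient A J\<^esub> = J"
  "part (superalgebra_quotient A J) p = (\<lambda>x. J +> x) ` part A p"
  by (simp_all add: superalgebra_quotient_def coset_add coset_smult coset_mult)
     (auto simp: A_RCOSETS_def' a_r_coset_def' RCOSETS_def A_RCOSETS_def a_r_coset_def r_coset_def)

lemma quotient_epi: "superalgebra_epi A (superalgebra_quotient A J) (\<lambda>x. J +> x)"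
  unfolding superalgebra_epi_def by (simp add: quotient_simps)

lemma quotient_bilinear: "bilinear_superalgebra (superalgebra_quotient A J)"
  by (rule epi_image[OF quotient_epi]) (use coset_eq_J_iff[of \<zero>] J_facts(2) in \<open>simp add: quotient_simps\<close>)

text \<open>The homomorphism theorem in two strengths: a map that kills \<open>J\<close> factors
  through the quotient, and the factor is injective once \<open>J\<close> is the whole kernel. The
  factor evaluates \<open>\<phi>\<close> at a representative chosen in each coset.\<close>

lemma quotient_factor:
  assumes "bilinear_superalgebra B" "superalgebra_epi A B \<phi>" "J \<subseteq> epi_kernel A B \<phi>"
  obtains \<psi> where "superalgebra_epi (superalgebra_quotient A J) B \<psi>"
    "\<And>x. x \<in> carrier A \<Longrightarrow> \<psi> (J +> x) = \<phi> x"
    "J = epi_kernel A B \<phi> \<Longrightarrow> inj_on \<psi> (carrier (superalgebra_quotient A J))"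
proof
  interpret B: bilinear_superalgebra B by fact
  note e = superalgebra_epiD[OF assms(2)]
  define \<psi> where "\<psi> C = \<phi> (SOME x. x \<in> C)" for C
  have diff: "\<phi> (x \<ominus> y) = \<phi> x \<ominus>\<^bsub>B\<^esub> \<phi> y" if "x \<in> carrier A" "y \<in> carrier A" for x y
    using that e(3) epi_zero_minus(2)[OF bilinear_superalgebra_axioms assms(1,2)] by (simp add: a_minus_def)
  have \<psi>: "\<psi> (J +> x) = \<phi> x" if x: "x \<in> carrier A" for x
  proof -
    define u where "u = (SOME u. u \<in> J +> x)"
    have "u \<in> J +> x" unfolding u_def by (rule someI[of _ x]) (simp add: x J.a_rcos_self)
    then have u: "u \<in> carrier A" "u \<ominus> x \<in> J" using x mem_coset_iff by auto
    then have "\<phi> u \<ominus>\<^bsub>B\<^esub> \<phi> x = \<zero>\<^bsub>B\<^esub>" using diff[OF u(1) x] assms(3) by (auto simp: epi_kernel_def)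
    then have "\<phi> u = \<phi> x" 
      using e(2)[OF u(1)] e(2)[OF x] by (metis B.M.a_assoc B.M.a_inv_closed B.M.l_neg B.M.l_zero B.M.r_zero a_minus_def)
    then show ?thesis by (simp add: \<psi>_def u_def)
  qed
  then show "\<psi> (J +> x) = \<phi> x" if "x \<in> carrier A" for x using that by simp
  have im: "(\<lambda>x. \<psi> (J +> x)) ` part A p = part B p" for p
    using e(6)[of p] \<psi> part_subset[of p] by (metis (no_types, lifting) image_cong subsetD)
  show "superalgebra_epi (superalgebra_quotient A J) B \<psi>"
    unfolding superalgebra_epi_def
    using e(1-5) \<psi> im by (auto simp: quotient_simps image_image smult_in mult_closed)
  show "inj_on \<psi> (carrier (superalgebra_quotient A J))" if "J = epi_kernel A B \<phi>"
  proof (rule inj_onI)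
    fix C D assume C: "C \<in> carrier (superalgebra_quotient A J)" "D \<in> carrier (superalgebra_quotient A J)" "\<psi> C = \<psi> D"
    then obtain x y where xy: "x \<in> carrier A" "y \<in> carrier A" "C = J +> x" "D = J +> y"
      unfolding quotient_simps by blast
    then have eq: "\<psi> (J +> x) = \<psi> (J +> y)" using C by simp
    have "\<phi> (x \<ominus> y) = \<phi> x \<ominus>\<^bsub>B\<^esub> \<phi> y" by (rule diff[OF xy(1,2)])
    also have "\<dots> = \<zero>\<^bsub>B\<^esub>"
      using eq e(2)[OF xy(1)] by (simp add: \<psi>[OF xy(1)] \<psi>[OF xy(2)] B.M.r_neg a_minus_def)
    finally have "x \<ominus> y \<in> epi_kernel A B \<phi>" using xy(1,2) by (simp add: epi_kernel_def)
    then have "x \<ominus> y \<in> J" unfolding that[symmetric] .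
    then show "C = D" unfolding xy(3,4) by (simp only: coset_eq_iff[OF xy(1,2)])
  qed
qed

end

lemma epi_inverse:
  assumes "superalgebra_epi A B \<phi>" "inj_on \<phi> (carrier A)" "bilinear_superalgebra A"
  shows "superalgebra_epi B A (the_inv_into (carrier A) \<phi>)"
proof -
  interpret A: bilinear_superalgebra A by fact
  note e = superalgebra_epiD[OF assms(1)]
  define \<psi> where "\<psi> = the_inv_into (carrier A) \<phi>"
  have inv: "\<And>x. x \<in> carrier A \<Longrightarrow> \<psi> (\<phi> x) = x"
    unfolding \<psi>_def using assms(2) by (simp add: the_inv_into_f_f)
  have pt: "\<psi> ` part B p = part A p" for p
    unfolding e(6)[of p, symmetric] image_image using inv A.part_subset[of p] by force
  have "\<psi> ` carrier B = carrier A" unfolding e(1)[symmetric] image_image using inv by simp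
  moreover have "\<forall>x\<in>carrier B. \<forall>y\<in>carrier B. \<psi> (x \<oplus>\<^bsub>B\<^esub> y) = \<psi> x \<oplus>\<^bsub>A\<^esub> \<psi> y"
    unfolding e(1)[symmetric] by (auto simp: inv e(3)[symmetric])
  moreover have "\<forall>c. \<forall>x\<in>carrier B. \<psi> (c \<odot>\<^bsub>B\<^esub> x) = c \<odot>\<^bsub>A\<^esub> \<psi> x"
    unfolding e(1)[symmetric] by (auto simp: inv e(4)[symmetric] A.smult_in)
  moreover have "\<forall>x\<in>carrier B. \<forall>y\<in>carrier B. \<psi> (x \<otimes>\<^bsub>B\<^esub> y) = \<psi> x \<otimes>\<^bsub>A\<^esub> \<psi> y"
    unfolding e(1)[symmetric] by (auto simp: inv e(5)[symmetric] A.mult_closed)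
  ultimately show ?thesis using pt unfolding superalgebra_epi_def \<psi>_def by blast
qed

text \<open>Along an injective map the Lie identities can be checked after applying it, and the
  decomposition into parts is pulled back summand by summand. The main use: a free superalgebra
  modulo the kernel of an evaluation in a Lie superalgebra is itself Lie.\<close>

lemma lie_superalgebra_pullback:
  assumes "lie_superalgebra B" "bilinear_superalgebra A" "superalgebra_epi A B \<phi>" "inj_on \<phi> (carrier A)"
  shows "lie_superalgebra A"
proof -
  interpret A: bilinear_superalgebra A by fact
  interpret B: lie_superalgebra B by fact
  note bb = lie_imp_bilinear[OF assms(1)]
  interpret B': bilinear_superalgebra B by (rule bb)
  note e = superalgebra_epiD[OF assms(3)]
  note z = epi_zero_minus[OF assms(2) bb assms(3)]
  have eq: "x = y" if "x \<in> carrier A" "y \<in> carrier A" "\<phi> x = \<phi> y" for x y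
    using that assms(4) by (meson inj_onD)
  have pc: "x \<in> carrier A" if "x \<in> part A p" for x p using that A.part_subset by blast
  have pp: "\<phi> x \<in> part B p" if "x \<in> part A p" for x p using that e(6) by blast
  have pp': "x \<in> part A p" if "\<phi> x \<in> part B p" "x \<in> carrier A" for x p
    using that e(6)[of p] eq pc by (metis imageE)
  note ph = z e(2-5) A.smult_in A.mult_closed pc
  show ?thesis
  proof (intro lie_superalgebra.intro A.module_axioms lie_superalgebra_axioms.intro)
    fix x assume x: "x \<in> carrier A"
    have ex1: "\<exists>!y. y \<in> part B 0 \<times> part B 1 \<and> \<phi> x = fst y \<oplus>\<^bsub>B\<^esub> snd y"
      using B.part_decomposition[of "\<phi> x"] e(2) x by blast
    then obtain w where w: "w \<in> part B 0 \<times> part B 1 \<and> \<phi> x = fst w \<oplus>\<^bsub>B\<^esub> snd w" by blast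
    define b0 b1 where "b0 = fst w" and "b1 = snd w"
    have b: "b0 \<in> part B 0" "b1 \<in> part B 1" "\<phi> x = b0 \<oplus>\<^bsub>B\<^esub> b1"
      using w by (auto simp: b0_def b1_def)
    obtain a0 where a0: "a0 \<in> part A 0" "b0 = \<phi> a0" using b(1) e(6)[of 0] by blast
    obtain a1 where a1: "a1 \<in> part A 1" "b1 = \<phi> a1" using b(2) e(6)[of 1] by blast
    note a = a0(1) a1(1) a0(2) a1(2)
    have "x = a0 \<oplus>\<^bsub>A\<^esub> a1" by (rule eq) (use a b(3) x e(3)[of a0 a1] pc[OF a(1)] pc[OF a(2)] in simp_all)
    moreover have "y = (a0,a1)" if y: "y \<in> part A 0 \<times> part A 1" "x = fst y \<oplus>\<^bsub>A\<^esub> snd y" for y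
    proof -
      have "(\<phi> (fst y), \<phi> (snd y)) \<in> part B 0 \<times> part B 1" "\<phi> x = \<phi> (fst y) \<oplus>\<^bsub>B\<^esub> \<phi> (snd y)"
        using y pp pc e(3) by auto
      then have "(\<phi> (fst y), \<phi> (snd y)) = w" using ex1 w by (metis fst_conv snd_conv)
      then have "\<phi> (fst y) = \<phi> a0" "\<phi> (snd y) = \<phi> a1"
        using b0_def b1_def a0(2) a1(2) by (metis fst_conv, metis snd_conv)
      moreover have "fst y \<in> carrier A" "snd y \<in> carrier A" using y(1) pc by (auto simp: mem_Times_iff)
      ultimately have "fst y = a0" "snd y = a1" using eq pc[OF a(1)] pc[OF a(2)] by auto
      then show ?thesis by (simp add: prod_eq_iff)
    qed
    ultimately show "\<exists>!y. y \<in> part A 0 \<times> part A 1 \<and> x = fst y \<oplus>\<^bsub>A\<^esub> snd y"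
      using a by (intro ex1I[of _ "(a0,a1)"]) auto
  next
    fix x y p q assume "x \<in> part A p" "y \<in> part A q"
    then show "x \<otimes>\<^bsub>A\<^esub> y \<in> part A (p + q)"
      using pp' B.bracket_part pp ph(6) ph(8) ph(9) by metis
  next
    fix x y p q assume xy: "x \<in> part A p" "y \<in> part A q"
    show "x \<otimes>\<^bsub>A\<^esub> y = \<ominus>\<^bsub>A\<^esub> (koszul_sign p q \<odot>\<^bsub>A\<^esub> (y \<otimes>\<^bsub>A\<^esub> x))"
      by (rule eq) (use pc[OF xy(1)] pc[OF xy(2)] B.anticommutative[OF pp[OF xy(1)] pp[OF xy(2)]]
        in \<open>simp_all add: z e(2-5) A.smult_in A.mult_closed\<close>)
  next
    fix x y z p q r assume xy: "x \<in> part A p" "y \<in> part A q" "z \<in> part A r"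
    show "x \<otimes>\<^bsub>A\<^esub> (y \<otimes>\<^bsub>A\<^esub> z) = x \<otimes>\<^bsub>A\<^esub> y \<otimes>\<^bsub>A\<^esub> z \<oplus>\<^bsub>A\<^esub> koszul_sign p q \<odot>\<^bsub>A\<^esub> (y \<otimes>\<^bsub>A\<^esub> (x \<otimes>\<^bsub>A\<^esub> z))"
      by (rule eq) (use pc[OF xy(1)] pc[OF xy(2)] pc[OF xy(3)]
          B.jacobi[OF pp[OF xy(1)] pp[OF xy(2)] pp[OF xy(3)]]
        in \<open>simp_all add: z e(2-5) A.smult_in A.mult_closed\<close>)
  next
    fix x assume x: "x \<in> part A 1"
    show "x \<otimes>\<^bsub>A\<^esub> (x \<otimes>\<^bsub>A\<^esub> x) = \<zero>\<^bsub>A\<^esub>"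
      by (rule eq) (use pc[OF x] B.cube[OF pp[OF x]] in \<open>simp_all add: z e(2-5) A.smult_in A.mult_closed\<close>)
  qed (rule A.part_submodule A.mult_closed A.mult_add_left A.mult_add_right A.mult_smult_left A.mult_smult_right; assumption)+
qed

lemma superalgebra_isomorphicI:
  assumes "superalgebra_epi A B \<phi>" "inj_on \<phi> (carrier A)"
  shows "superalgebra_isomorphic A B"
  using assms unfolding superalgebra_epi_def superalgebra_isomorphic_def bij_betw_def by blast

lemma lin_span_submodule:
  assumes "bilinear_superalgebra A" "S \<subseteq> carrier A"
  shows "submodule (lin_span A S) scalars A" "S \<subseteq> lin_span A S"
    "\<And>N. submodule N scalars A \<Longrightarrow> S \<subseteq> N \<Longrightarrow> lin_span A S \<subseteq> N"
proof -
  interpret A: bilinear_superalgebra A by fact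
  have car: "submodule (carrier A) scalars A" by (rule A.carrier_is_submodule)
  show "submodule (lin_span A S) scalars A"
  proof (rule A.submoduleI')
    show "lin_span A S \<subseteq> carrier A" unfolding lin_span_def using car assms by blast
  qed (auto simp: lin_span_def A.submoduleD)
qed (auto simp: lin_span_def)

section \<open>Superalgebras on vector space types\<close>

text \<open>Records whose addition and zero are those of the type, so that calculations use
  \<open>ab_group_add\<close> and \<open>vector_space\<close> in place of record operations. The
  carrier may be a proper subspace.\<close>

definition typed_superalgebra ::
  "'m::ab_group_add set \<Rightarrow> ('m \<Rightarrow> 'm \<Rightarrow> 'm) \<Rightarrow> ('k::field \<Rightarrow> 'm \<Rightarrow> 'm) \<Rightarrow> (bit \<Rightarrow> 'm set) \<Rightarrow> ('k, 'm) superalgebra" where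
  "typed_superalgebra C m s P = \<lparr>carrier = C, monoid.mult = m, one = undefined,
     zero = 0, add = (+), module.smult = s, part = P\<rparr>"

lemma typed_superalgebra_simps [simp]:
  "carrier (typed_superalgebra C m s P) = C" "monoid.mult (typed_superalgebra C m s P) = m"
  "zero (typed_superalgebra C m s P) = 0" "add (typed_superalgebra C m s P) = (+)"
  "module.smult (typed_superalgebra C m s P) = s" "part (typed_superalgebra C m s P) = P"
  by (simp_all add: typed_superalgebra_def)

lemma typed_superalgebra_bilinear:
  fixes s :: "'k::field \<Rightarrow> 'm::ab_group_add \<Rightarrow> 'm"
  assumes "vector_space s" "module.subspace s C" "\<And>p. module.subspace s (P p)" "\<And>p. P p \<subseteq> C"
    "\<And>x y. x \<in> C \<Longrightarrow> y \<in> C \<Longrightarrow> m x y \<in> C"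
    "\<And>x y z. m (x + y) z = m x z + m y z" "\<And>x y z. m x (y + z) = m x y + m x z"
    "\<And>c x y. m (s c x) y = s c (m x y)" "\<And>c x y. m x (s c y) = s c (m x y)"
  shows "bilinear_superalgebra (typed_superalgebra C m s P)"
proof -
  interpret vector_space s by fact
  note C = subspace_add[OF assms(2)] subspace_0[OF assms(2)] subspace_neg[OF assms(2)] subspace_scale[OF assms(2)]
  let ?A = "typed_superalgebra C m s P"
  have ag: "abelian_group ?A"
    by (rule abelian_groupI) (auto simp: C algebra_simps intro: bexI[of _ "- x" for x])
  have md: "Module.module (scalars :: 'k ring) ?A"
    by (rule moduleI[OF cring_scalars ag]) (auto simp: C algebra_simps)
  interpret M: Module.module "scalars :: 'k ring" ?A by (rule md)
  have inv: "\<ominus>\<^bsub>?A\<^esub> x = - x" if "x \<in> C" for x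
    using M.M.minus_equality[of "- x" x] that C by simp
  have sub: "submodule (P p) (scalars :: 'k ring) ?A" for p
    using assms(4)[of p] subspace_add[OF assms(3)] subspace_0[OF assms(3)] subspace_neg[OF assms(3)] subspace_scale[OF assms(3)]
    by (intro M.submoduleI) (auto simp: inv subsetD)
  show ?thesis
    by (intro bilinear_superalgebra.intro md bilinear_superalgebra_axioms.intro) (simp_all add: assms sub)
qed

lemma typed_superalgebra_minus:
  assumes "bilinear_superalgebra (typed_superalgebra C m s P)" "x \<in> C" "- x \<in> C"
  shows "\<ominus>\<^bsub>typed_superalgebra C m s P\<^esub> x = - x"
proof -
  interpret A: bilinear_superalgebra "typed_superalgebra C m s P" by fact
  show ?thesis using A.M.minus_equality[of "- x" x] assms(2,3) by simp
qed

section \<open>Lie superalgebras assembled from a Cartan space and root lines\<close>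

section \<open>Superalgebras with one-dimensional root spaces\<close>

text \<open>\<open>c x y\<close> is the structure constant in [e_x, e_y] = c x y e_(x+y), and for
  opposite roots the factor in front of the coroot. The rules \<open>c_swap\<close> and
  \<open>c_swap_zero\<close> differ by a sign because the coroot of - x is minus the coroot of x. By
  \<open>odd_double\<close> the bracket of an odd root vector with itself is zero.\<close>

locale root_datum =
  fixes R :: "(int^'n::finite) set" and par :: "int^'n \<Rightarrow> bit"
    and c :: "int^'n \<Rightarrow> int^'n \<Rightarrow> 'k::field" and A :: "int^'n^'n"
  assumes finite_roots: "finite R" and zero_not_root: "0 \<notin> R"
    and minus_root: "x \<in> R \<Longrightarrow> - x \<in> R"
    and par_add: "par (x + y) = par x + par y"
    and c_nonzero: "x \<in> R \<Longrightarrow> c x (- x) \<noteq> 0"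
    and c_swap: "\<lbrakk>x \<in> R; y \<in> R; x + y \<in> R\<rbrakk> \<Longrightarrow> c x y = - koszul_sign (par x) (par y) * c y x"
    and c_swap_zero: "x \<in> R \<Longrightarrow> c x (- x) = koszul_sign (par x) (par x) * c (- x) x"
    and odd_double: "\<lbrakk>x \<in> R; par x = 1\<rbrakk> \<Longrightarrow> x + x \<notin> R"
begin

definition pairing :: "int^'n \<Rightarrow> int^'n \<Rightarrow> int" where
  "pairing x y = (\<Sum>i\<in>UNIV. \<Sum>j\<in>UNIV. x $ i * y $ j * A $ i $ j)"

text \<open>The coefficient of [e_x, [e_y, e_z]] at e_(x+y+z). If y + z = 0, the inner bracket is
  \<open>c y z\<close> times the coroot of y, and its bracket with e_x contributes minus the value
  of the root x on that coroot.\<close>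

definition double_coeff :: "int^'n \<Rightarrow> int^'n \<Rightarrow> int^'n \<Rightarrow> 'k" where
  "double_coeff x y z = (if y + z \<in> R then c y z * c x (y + z)
     else if y + z = 0 then - c y z * of_int (pairing y x) else 0)"

end

text \<open>The two Jacobi axioms are the Jacobi identity for three root vectors whose degrees sum to a
  root or to zero.\<close>

locale jacobi_root_datum = root_datum R par c A
  for R :: "(int^'n::finite) set" and par :: "int^'n \<Rightarrow> bit"
    and c :: "int^'n \<Rightarrow> int^'n \<Rightarrow> 'k::field" and A :: "int^'n^'n" +
  assumes jacobi_root: "\<lbrakk>x \<in> R; y \<in> R; z \<in> R; x + y + z \<in> R\<rbrakk> \<Longrightarrow>
      double_coeff x y z = - koszul_sign (par x + par y) (par z) * double_coeff z x y
        + koszul_sign (par x) (par y) * double_coeff y x z"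
    and jacobi_zero: "\<lbrakk>x \<in> R; y \<in> R; z \<in> R; x + y + z = 0\<rbrakk> \<Longrightarrow>
      c y z * c x (y + z) = koszul_sign (par z) (par z) * (c x y * c z (x + y)) \<and>
      koszul_sign (par z) (par z) * (c x y * c z (x + y)) = - koszul_sign (par x) (par y) * (c x z * c y (x + z))"

text \<open>\<open>H\<close> is the Cartan subalgebra; it need not contain all of the ambient space nor separate the roots.\<close>

locale root_model = jacobi_root_datum R par c A + vector_space sc
  for R :: "(int^'n::finite) set" and par and c :: "int^'n \<Rightarrow> int^'n \<Rightarrow> 'k::field" and A
    and sc :: "'k \<Rightarrow> 'h::ab_group_add \<Rightarrow> 'h" +
  fixes h :: "'n \<Rightarrow> 'h" and \<alpha> :: "'n \<Rightarrow> 'h \<Rightarrow> 'k" and H :: "'h set"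
  assumes \<alpha>_linear: "Vector_Spaces.linear sc (*) (\<alpha> j)"
    and \<alpha>_h: "\<alpha> j (h i) = of_int (A $ i $ j)"
    and H_subspace: "subspace H" and h_in_H: "h i \<in> H"
begin

definition coroot :: "int^'n \<Rightarrow> 'h" where
  "coroot x = (\<Sum>i\<in>UNIV. sc (of_int (x $ i)) (h i))"

definition root :: "int^'n \<Rightarrow> 'h \<Rightarrow> 'k" where
  "root x t = (\<Sum>j\<in>UNIV. of_int (x $ j) * \<alpha> j t)"

lemma \<alpha>_simps [simp]: "\<alpha> j (x + y) = \<alpha> j x + \<alpha> j y" "\<alpha> j (sc k x) = k * \<alpha> j x" "\<alpha> j 0 = 0"
  "\<alpha> j (sum f S) = (\<Sum>i\<in>S. \<alpha> j (f i))" "\<alpha> j (- x) = - \<alpha> j x" "\<alpha> j (x - y) = \<alpha> j x - \<alpha> j y"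
proof -
  interpret l: Vector_Spaces.linear sc "(*)" "\<alpha> j" by (rule \<alpha>_linear)
  show "\<alpha> j (x + y) = \<alpha> j x + \<alpha> j y" "\<alpha> j (sc k x) = k * \<alpha> j x" "\<alpha> j 0 = 0"
    "\<alpha> j (sum f S) = (\<Sum>i\<in>S. \<alpha> j (f i))" "\<alpha> j (- x) = - \<alpha> j x" "\<alpha> j (x - y) = \<alpha> j x - \<alpha> j y"
    by (rule l.add l.scale l.zero l.sum l.neg l.diff)+
qed

lemma root_simps [simp]: "root x (s + t) = root x s + root x t" "root x (sc k t) = k * root x t"
  "root x 0 = 0" "root (x + y) t = root x t + root y t" "root 0 t = 0" "root (- x) t = - root x t"
  by (simp_all add: root_def sum.distrib sum_distrib_left algebra_simps sum_negf)

lemma coroot_simps [simp]: "coroot (x + y) = coroot x + coroot y" "coroot 0 = 0" "coroot (- x) = - coroot x"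
  by (simp_all add: coroot_def sum.distrib scale_left_distrib sum_negf)

lemma root_coroot: "root y (coroot x) = of_int (pairing x y)"
proof -
  have "root y (coroot x) = (\<Sum>j\<in>UNIV. \<Sum>i\<in>UNIV. of_int (x $ i * y $ j * A $ i $ j))"
    by (simp add: root_def coroot_def \<alpha>_h sum_distrib_left algebra_simps)
  also have "\<dots> = (\<Sum>i\<in>UNIV. \<Sum>j\<in>UNIV. of_int (x $ i * y $ j * A $ i $ j))" by (rule sum.swap)
  finally show ?thesis by (simp add: pairing_def)
qed

lemma coroot_in_H: "coroot x \<in> H"
  unfolding coroot_def by (intro subspace_sum H_subspace subspace_scale h_in_H)

definition smul :: "'k \<Rightarrow> 'h \<times> (int^'n \<Rightarrow> 'k) \<Rightarrow> 'h \<times> (int^'n \<Rightarrow> 'k)" where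
  "smul k u = (sc k (fst u), \<lambda>\<gamma>. k * snd u \<gamma>)"

text \<open>An element is a Cartan vector together with its coefficients at root vectors. The Cartan
  component collects the brackets of opposite root vectors; the component at \<delta> consists of
  the two actions of the Cartan parts and of a convolution over the decompositions of \<delta> into
  two roots.\<close>

definition br :: "'h \<times> (int^'n \<Rightarrow> 'k) \<Rightarrow> 'h \<times> (int^'n \<Rightarrow> 'k) \<Rightarrow> 'h \<times> (int^'n \<Rightarrow> 'k)" where
  "br u v = (\<Sum>\<gamma>\<in>R. sc (snd u \<gamma> * snd v (- \<gamma>) * c \<gamma> (- \<gamma>)) (coroot \<gamma>),
     \<lambda>\<delta>. if \<delta> \<in> R then root \<delta> (fst u) * snd v \<delta> - root \<delta> (fst v) * snd u \<delta> +
       (\<Sum>\<gamma>\<in>R. if \<delta> - \<gamma> \<in> R then c \<gamma> (\<delta> - \<gamma>) * snd u \<gamma> * snd v (\<delta> - \<gamma>) else 0) else 0)"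

definition Car :: "('h \<times> (int^'n \<Rightarrow> 'k)) set" where
  "Car = {u. fst u \<in> H \<and> (\<forall>\<gamma>. \<gamma> \<notin> R \<longrightarrow> snd u \<gamma> = 0)}"

definition Par :: "bit \<Rightarrow> ('h \<times> (int^'n \<Rightarrow> 'k)) set" where
  "Par p = {u\<in>Car. (p = 1 \<longrightarrow> fst u = 0) \<and> (\<forall>\<gamma>. snd u \<gamma> \<noteq> 0 \<longrightarrow> par \<gamma> = p)}"

definition alg where "alg = typed_superalgebra Car br smul Par"

definition cart :: "'h \<Rightarrow> 'h \<times> (int^'n \<Rightarrow> 'k)" where "cart t = (t, 0)"

definition rv :: "int^'n \<Rightarrow> 'k \<Rightarrow> 'h \<times> (int^'n \<Rightarrow> 'k)" where
  "rv \<gamma> k = (0, \<lambda>\<delta>. if \<delta> = \<gamma> then k else 0)"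

lemma pair_eqI: "fst u = fst v \<Longrightarrow> (\<And>\<gamma>. snd u \<gamma> = snd v \<gamma>) \<Longrightarrow> u = v"
  by (auto simp: prod_eq_iff)

lemma smul_vector_space: "vector_space smul"
  by unfold_locales (auto simp: smul_def algebra_simps plus_fun_def)

sublocale V: vector_space smul by (rule smul_vector_space)

lemma br_add_left: "br (u + v) w = br u w + br v w"
  by (rule pair_eqI)
     (auto simp: br_def scale_left_distrib algebra_simps sum.distrib[symmetric] intro!: sum.cong)

lemma br_add_right: "br u (v + w) = br u v + br u w"
  by (rule pair_eqI)
     (auto simp: br_def scale_left_distrib algebra_simps sum.distrib[symmetric] intro!: sum.cong)

lemma br_smul_left: "br (smul k u) v = smul k (br u v)"
  by (rule pair_eqI)
     (auto simp: br_def smul_def scale_sum_right algebra_simps sum_distrib_left intro!: sum.cong)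

lemma br_smul_right: "br u (smul k v) = smul k (br u v)"
  by (rule pair_eqI)
     (auto simp: br_def smul_def scale_sum_right algebra_simps sum_distrib_left intro!: sum.cong)

lemma br_zero [simp]: "br 0 u = 0" "br u 0 = 0"
  using br_add_left[of 0 0 u] br_add_right[of u 0 0] by auto

lemma br_minus: "br (- u) v = - br u v" "br u (- v) = - br u v"
  using br_add_left[of u "- u" v] br_add_right[of u v "- v"] by (auto simp: eq_neg_iff_add_eq_0 add.commute)

lemma rv_simps: "rv \<gamma> (k + l) = rv \<gamma> k + rv \<gamma> l" "rv \<gamma> 0 = 0" "smul k (rv \<gamma> l) = rv \<gamma> (k * l)"
  "rv \<gamma> (- k) = - rv \<gamma> k"
  by (auto simp: rv_def smul_def fun_eq_iff zero_prod_def)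

lemma cart_simps: "cart (s + t) = cart s + cart t" "cart 0 = 0" "smul k (cart t) = cart (sc k t)"
  "cart (- t) = - cart t"
  by (auto simp: cart_def smul_def fun_eq_iff zero_prod_def)

lemma fst_rv [simp]: "fst (rv \<gamma> k) = 0" and fst_cart [simp]: "fst (cart t) = t"
  and snd_rv: "snd (rv \<gamma> k) \<delta> = (if \<delta> = \<gamma> then k else 0)" and snd_cart [simp]: "snd (cart t) \<delta> = 0"
  by (auto simp: rv_def cart_def)

lemma br_cart_cart: "br (cart s) (cart t) = 0"
  by (rule pair_eqI) (auto simp: br_def cong: if_cong)

lemma br_cart_rv: "\<gamma> \<in> R \<Longrightarrow> br (cart t) (rv \<gamma> k) = rv \<gamma> (root \<gamma> t * k)"
  by (rule pair_eqI) (auto simp: br_def snd_rv cong: if_cong)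

lemma br_rv_cart: "\<gamma> \<in> R \<Longrightarrow> br (rv \<gamma> k) (cart t) = rv \<gamma> (- root \<gamma> t * k)"
  by (rule pair_eqI) (auto simp: br_def snd_rv cong: if_cong)

lemma br_rv_rv:
  assumes "\<gamma> \<in> R" "\<delta> \<in> R"
  shows "br (rv \<gamma> k) (rv \<delta> l) = (if \<gamma> + \<delta> \<in> R then rv (\<gamma> + \<delta>) (c \<gamma> \<delta> * k * l)
     else if \<gamma> + \<delta> = 0 then cart (sc (c \<gamma> \<delta> * k * l) (coroot \<gamma>)) else 0)"
proof -
  have 1: "(\<Sum>\<epsilon>\<in>R. sc ((if \<epsilon> = \<gamma> then k else 0) * (if - \<epsilon> = \<delta> then l else 0) * c \<epsilon> (- \<epsilon>)) (coroot \<epsilon>))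
      = (if \<gamma> + \<delta> = 0 then sc (c \<gamma> \<delta> * k * l) (coroot \<gamma>) else 0)"
  proof -
    have "(\<Sum>\<epsilon>\<in>R. sc ((if \<epsilon> = \<gamma> then k else 0) * (if - \<epsilon> = \<delta> then l else 0) * c \<epsilon> (- \<epsilon>)) (coroot \<epsilon>))
      = (\<Sum>\<epsilon>\<in>R. if \<epsilon> = \<gamma> then sc (k * (if - \<epsilon> = \<delta> then l else 0) * c \<epsilon> (- \<epsilon>)) (coroot \<epsilon>) else 0)"
      by (intro sum.cong) auto
    also have "\<dots> = sc (k * (if - \<gamma> = \<delta> then l else 0) * c \<gamma> (- \<gamma>)) (coroot \<gamma>)"
      using assms finite_roots by simp
    finally have e: "(\<Sum>\<epsilon>\<in>R. sc ((if \<epsilon> = \<gamma> then k else 0) * (if - \<epsilon> = \<delta> then l else 0) * c \<epsilon> (- \<epsilon>)) (coroot \<epsilon>))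
      = sc (k * (if - \<gamma> = \<delta> then l else 0) * c \<gamma> (- \<gamma>)) (coroot \<gamma>)" .
    show ?thesis
    proof (cases "\<gamma> + \<delta> = 0")
      case True
      then have "\<delta> = - \<gamma>" by (simp add: eq_neg_iff_add_eq_0 add.commute)
      then show ?thesis unfolding e by (simp add: mult_ac)
    next
      case False
      then have "- \<gamma> \<noteq> \<delta>" by auto
      then show ?thesis unfolding e using False by simp
    qed
  qed
  have 2: "(\<Sum>\<epsilon>\<in>R. if \<eta> - \<epsilon> \<in> R then c \<epsilon> (\<eta> - \<epsilon>) * (if \<epsilon> = \<gamma> then k else 0) * (if \<eta> - \<epsilon> = \<delta> then l else 0) else 0)
     = (if \<eta> = \<gamma> + \<delta> then c \<gamma> \<delta> * k * l else 0)" for \<eta>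
  proof -
    have "(\<Sum>\<epsilon>\<in>R. if \<eta> - \<epsilon> \<in> R then c \<epsilon> (\<eta> - \<epsilon>) * (if \<epsilon> = \<gamma> then k else 0) * (if \<eta> - \<epsilon> = \<delta> then l else 0) else 0)
      = (\<Sum>\<epsilon>\<in>R. if \<epsilon> = \<gamma> then if \<eta> - \<epsilon> \<in> R then c \<epsilon> (\<eta> - \<epsilon>) * k * (if \<eta> - \<epsilon> = \<delta> then l else 0) else 0 else 0)"
      by (rule sum.cong[OF refl], case_tac "x = \<gamma>") (simp_all cong: if_cong)
    also have "\<dots> = (if \<eta> - \<gamma> \<in> R then c \<gamma> (\<eta> - \<gamma>) * k * (if \<eta> - \<gamma> = \<delta> then l else 0) else 0)"
      using assms finite_roots by simp
    finally have e: "(\<Sum>\<epsilon>\<in>R. if \<eta> - \<epsilon> \<in> R then c \<epsilon> (\<eta> - \<epsilon>) * (if \<epsilon> = \<gamma> then k else 0) * (if \<eta> - \<epsilon> = \<delta> then l else 0) else 0)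
      = (if \<eta> - \<gamma> \<in> R then c \<gamma> (\<eta> - \<gamma>) * k * (if \<eta> - \<gamma> = \<delta> then l else 0) else 0)" .
    show ?thesis
    proof (cases "\<eta> = \<gamma> + \<delta>")
      case True
      then show ?thesis unfolding e using assms by simp
    next
      case False
      then have "\<eta> - \<gamma> \<noteq> \<delta>" by (metis add_diff_cancel_left' diff_add_cancel add.commute)
      then show ?thesis unfolding e using False by simp
    qed
  qed
  show ?thesis
    by (rule pair_eqI) (use zero_not_root in \<open>auto simp: br_def snd_rv 1 2 cong: if_cong\<close>)
qed

lemma rv_in_Car: "\<gamma> \<in> R \<Longrightarrow> rv \<gamma> k \<in> Car" and cart_in_Car: "t \<in> H \<Longrightarrow> cart t \<in> Car"
  and rv_in_Par: "\<gamma> \<in> R \<Longrightarrow> par \<gamma> = p \<Longrightarrow> rv \<gamma> k \<in> Par p" and cart_in_Par: "t \<in> H \<Longrightarrow> cart t \<in> Par 0"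
  using subspace_0[OF H_subspace] by (auto simp: Car_def Par_def snd_rv)

lemma Car_subspace: "V.subspace Car"
  using subspace_0[OF H_subspace] subspace_add[OF H_subspace] subspace_scale[OF H_subspace]
  by (auto simp: V.subspace_def Car_def smul_def)

lemma Par_subspace: "V.subspace (Par p)"
proof (rule V.subspaceI)
  show "0 \<in> Par p" using V.subspace_0[OF Car_subspace] by (simp add: Par_def)
next
  fix u v assume uv: "u \<in> Par p" "v \<in> Par p"
  then have "u + v \<in> Car" using V.subspace_add[OF Car_subspace] by (simp add: Par_def)
  moreover have "par \<gamma> = p" if "snd (u + v) \<gamma> \<noteq> 0" for \<gamma>
  proof -
    have "snd u \<gamma> \<noteq> 0 \<or> snd v \<gamma> \<noteq> 0" using that by auto
    then show ?thesis using uv by (auto simp: Par_def)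
  qed
  ultimately show "u + v \<in> Par p" using uv by (simp add: Par_def)
next
  fix k u assume u: "u \<in> Par p"
  then have "smul k u \<in> Car" using V.subspace_scale[OF Car_subspace] by (simp add: Par_def)
  then show "smul k u \<in> Par p" using u by (auto simp: Par_def smul_def)
qed

lemma sum_fun_apply: "(\<Sum>i\<in>S. f i) x = (\<Sum>i\<in>S. f i x)" for f :: "_ \<Rightarrow> _ \<Rightarrow> 'k"
  by (induction S rule: infinite_finite_induct) auto

lemma decompose:
  assumes "u \<in> Car"
  shows "u = cart (fst u) + (\<Sum>\<gamma>\<in>R. rv \<gamma> (snd u \<gamma>))"
proof (rule pair_eqI)
  show "fst u = fst (cart (fst u) + (\<Sum>\<gamma>\<in>R. rv \<gamma> (snd u \<gamma>)))" by (simp add: fst_sum)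
  fix \<delta>
  have "snd (\<Sum>\<gamma>\<in>R. rv \<gamma> (snd u \<gamma>)) \<delta> = (\<Sum>\<gamma>\<in>R. if \<delta> = \<gamma> then snd u \<gamma> else 0)"
    by (simp add: snd_sum sum_fun_apply snd_rv)
  also have "\<dots> = snd u \<delta>" using assms finite_roots by (auto simp: Car_def)
  finally show "snd u \<delta> = snd (cart (fst u) + (\<Sum>\<gamma>\<in>R. rv \<gamma> (snd u \<gamma>))) \<delta>" by simp
qed

text \<open>Reduces identities for elements of one parity to Cartan elements and multiples of single
  root vectors. The Cartan case arises for even parity only.\<close>

lemma Par_induct [consumes 1, case_names zero cart rv add]:
  assumes "u \<in> Par p" "Q 0" "\<And>t. t \<in> H \<Longrightarrow> p = 0 \<Longrightarrow> Q (cart t)"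
    "\<And>\<gamma> k. \<gamma> \<in> R \<Longrightarrow> par \<gamma> = p \<Longrightarrow> Q (rv \<gamma> k)" "\<And>u v. Q u \<Longrightarrow> Q v \<Longrightarrow> Q (u + v)"
  shows "Q u"
proof -
  have u: "u \<in> Car" using assms(1) by (simp add: Par_def)
  have qc: "Q (cart (fst u))"
  proof (cases "p = 0")
    case True then show ?thesis using assms(3) u by (simp add: Car_def)
  next
    case False then show ?thesis using assms(1,2) by (simp add: Par_def cart_simps)
  qed
  have qr: "Q (rv \<gamma> (snd u \<gamma>))" if "\<gamma> \<in> R" for \<gamma>
  proof (cases "snd u \<gamma> = 0")
    case False then show ?thesis using assms(1,4) that by (auto simp: Par_def)
  qed (simp add: assms rv_simps)
  have "Q (\<Sum>\<gamma>\<in>S. rv \<gamma> (snd u \<gamma>))" if "S \<subseteq> R" for S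
    using finite_subset[OF that finite_roots] that
    by (induction S rule: finite_induct) (auto simp: assms(2) intro!: assms(5) qr)
  then show ?thesis using decompose[OF u] assms(5) qc by (metis order_refl)
qed

lemma Car_induct [consumes 1, case_names cart rv add]:
  assumes "u \<in> Car" "\<And>t. t \<in> H \<Longrightarrow> Q (cart t)"
    "\<And>\<gamma> k. \<gamma> \<in> R \<Longrightarrow> Q (rv \<gamma> k)" "\<And>u v. Q u \<Longrightarrow> Q v \<Longrightarrow> Q (u + v)"
  shows "Q u"
proof -
  have "Q (\<Sum>\<gamma>\<in>S. rv \<gamma> (snd u \<gamma>))" if "S \<subseteq> R" for S
    using finite_subset[OF that finite_roots] that
    by (induction S rule: finite_induct) (use assms(2)[OF subspace_0[OF H_subspace]] assms(3,4) in \<open>auto simp: cart_simps\<close>)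
  moreover have "Q (cart (fst u))" using assms(1,2) by (simp add: Car_def)
  ultimately show ?thesis using decompose[OF assms(1)] assms(4) by (metis order_refl)
qed

lemma br_in_Car: "br u v \<in> Car"
  by (auto simp: Car_def br_def intro!: subspace_sum H_subspace subspace_scale coroot_in_H)

lemma par_zero: "par 0 = 0" using par_add[of 0 0] by simp

lemma Par_add: "u \<in> Par p \<Longrightarrow> v \<in> Par p \<Longrightarrow> u + v \<in> Par p" and Par_zero: "0 \<in> Par p"
  using V.subspace_add[OF Par_subspace] V.subspace_0[OF Par_subspace] by auto

lemma br_in_Par: "u \<in> Par p \<Longrightarrow> v \<in> Par q \<Longrightarrow> br u v \<in> Par (p + q)"
proof (induction u rule: Par_induct)
  case (cart t)
  from cart(3) show ?case
    by (induction v rule: Par_induct)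
       (use cart in \<open>auto simp: br_cart_cart br_cart_rv Par_zero br_add_right Par_add rv_in_Par\<close>)
next
  case (rv \<gamma> k)
  have zz: "\<gamma> + \<delta> = 0 \<Longrightarrow> par \<gamma> + par \<delta> = 0" for \<delta> using par_add[of \<gamma> \<delta>] par_zero by simp
  have 0: "\<gamma> + \<delta> = 0 \<Longrightarrow> cart (sc m (coroot \<gamma>)) \<in> Par (par \<gamma> + par \<delta>)" for \<delta> m
    unfolding zz by (intro cart_in_Par subspace_scale H_subspace coroot_in_H)
  from rv(3) show ?case
  proof (induction v rule: Par_induct)
    case (rv \<delta> l)
    then show ?case using rv.hyps \<open>\<gamma> \<in> R\<close> \<open>par \<gamma> = p\<close> 0[of \<delta>] zero_not_root
      by (auto simp: br_rv_rv Par_zero par_add intro!: rv_in_Par)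
  qed (use rv in \<open>auto simp: br_rv_cart Par_zero br_add_right Par_add rv_in_Par\<close>)
qed (auto simp: br_add_left Par_zero Par_add)

lemma koszul_simps [simp]: "koszul_sign 0 p = 1" "koszul_sign p 0 = 1" "koszul_sign 1 1 = -1"
  by (simp_all add: koszul_sign_def)

lemma koszul_square [simp]: "koszul_sign p q * koszul_sign p q = 1" "koszul_sign p q * (koszul_sign p q * x) = x"
  by (auto simp: koszul_sign_def)

lemma br_anticommute:
  "u \<in> Par p \<Longrightarrow> v \<in> Par q \<Longrightarrow> br u v = - smul (koszul_sign p q) (br v u)"
proof (induction u rule: Par_induct)
  case (cart t)
  from cart(3) show ?case
    by (induction v rule: Par_induct)
       (use cart in \<open>auto simp: br_cart_cart br_cart_rv br_rv_cart br_add_right br_add_left rv_simps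
          V.scale_right_distrib\<close>)
next
  case (rv \<gamma> k)
  from rv(3) show ?case
  proof (induction v rule: Par_induct)
    case (rv \<delta> l)
    note g = \<open>\<gamma> \<in> R\<close> \<open>par \<gamma> = p\<close> and d = rv.hyps
    consider "\<gamma> + \<delta> \<in> R" | "\<gamma> + \<delta> = 0" | "\<gamma> + \<delta> \<notin> R" "\<gamma> + \<delta> \<noteq> 0" by blast
    then show ?case
    proof cases
      case 1
      then show ?thesis using g d c_swap[of \<gamma> \<delta>] by (simp add: br_rv_rv add.commute[of \<delta>] rv_simps(3) rv_simps(4)[symmetric] mult_ac)
    next
      case 2
      then have e: "\<delta> = - \<gamma>" by (simp add: eq_neg_iff_add_eq_0 add.commute)
      have pp: "par \<delta> = par \<gamma>" using par_add[of \<gamma> \<delta>] 2 par_zero by (metis add_bit_eq_xor bit_eq_iff add.commute add.left_neutral bit_not_one_iff)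
      show ?thesis using g d c_swap_zero[of \<gamma>] pp zero_not_root
        by (simp add: br_rv_rv cart_simps e mult_ac)
    next
      case 3
      then show ?thesis using g d by (simp add: br_rv_rv add.commute[of \<delta>])
    qed
  qed (use rv in \<open>auto simp: br_cart_rv br_rv_cart br_add_right br_add_left rv_simps V.scale_right_distrib\<close>)
qed (auto simp: br_add_left br_add_right V.scale_right_distrib)

lemma br_rv_rv_rv_root:
  assumes "x \<in> R" "y \<in> R" "z \<in> R" "x + y + z \<in> R"
  shows "br (rv x k) (br (rv y l) (rv z m)) = rv (x + y + z) (double_coeff x y z * (k * l * m))"
proof -
  have "y + z = 0 \<Longrightarrow> x + y + z = x" by (simp add: add.assoc)
  then show ?thesis using assms
    by (auto simp: br_rv_rv br_rv_cart double_coeff_def root_coroot rv_simps add.assoc algebra_simps)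
qed

lemma br_rv_rv_rv_zero:
  assumes "x \<in> R" "y \<in> R" "z \<in> R" "x + y + z = 0"
  shows "br (rv x k) (br (rv y l) (rv z m)) = cart (sc (c y z * c x (y + z) * (k * l * m)) (coroot x))"
proof -
  have "y + z = - x" using assms(4) by (simp add: eq_neg_iff_add_eq_0 algebra_simps)
  then show ?thesis using assms minus_root[of x] zero_not_root by (simp add: br_rv_rv algebra_simps)
qed

lemma br_rv_rv_rv_other:
  assumes "x \<in> R" "y \<in> R" "z \<in> R" "x + y + z \<noteq> 0" "x + y + z \<notin> R"
  shows "br (rv x k) (br (rv y l) (rv z m)) = 0"
proof -
  have "y + z = 0 \<Longrightarrow> x + y + z = x" by (simp add: add.assoc)
  then show ?thesis using assms by (auto simp: br_rv_rv add.assoc)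
qed

text \<open>Anticommutativity turns [[x, y], z] into a bracket nested to the right, so that one
  formula governs all three terms. The degree x + y + z is a root, zero or neither; these cases are
  \<open>jacobi_root\<close>, \<open>jacobi_zero\<close> and trivial, respectively.\<close>

lemma br_jacobi_rv:
  assumes "x \<in> R" "y \<in> R" "z \<in> R"
  shows "br (rv x k) (br (rv y l) (rv z m)) = br (br (rv x k) (rv y l)) (rv z m)
     + smul (koszul_sign (par x) (par y)) (br (rv y l) (br (rv x k) (rv z m)))"
proof -
  have "br (rv x k) (rv y l) \<in> Par (par x + par y)"
    using br_in_Par rv_in_Par assms by blast
  then have sw: "br (br (rv x k) (rv y l)) (rv z m) =
      - smul (koszul_sign (par x + par y) (par z)) (br (rv z m) (br (rv x k) (rv y l)))"
    using br_anticommute rv_in_Par assms by blast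
  consider "x + y + z \<in> R" | "x + y + z = 0" | "x + y + z \<noteq> 0" "x + y + z \<notin> R" by blast
  then show ?thesis
  proof cases
    case 1
    have p: "z + x + y = x + y + z" "y + x + z = x + y + z" by (simp_all add: algebra_simps)
    show ?thesis unfolding sw using assms 1
      by (simp add: br_rv_rv_rv_root p rv_simps(3) rv_simps(1,4)[symmetric] jacobi_root[OF assms 1] algebra_simps)
  next
    case 2
    have p: "z + x + y = 0" "y + x + z = 0" using 2 by (simp_all add: algebra_simps)
    have "par x + par y + par z = 0" using 2 par_add par_zero by metis
    then have pz: "par x + par y = par z" by (metis add.assoc add.right_neutral add_bit_eq_xor bit_eq_iff xor_self_eq)
    have z: "z = - x - y" using 2 by (simp add: algebra_simps eq_neg_iff_add_eq_0)
    \<comment> \<open>The three coefficients agree with this value up to sign, and the identity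
      becomes the linear relation coroot x + coroot y + coroot z = 0.\<close>
    define a where "a = koszul_sign (par z) (par z) * (c x y * c z (x + y))"
    have j: "c y z * c x (y + z) = a" "koszul_sign (par z) (par z) * (c x y * c z (x + y)) = a"
      "koszul_sign (par x) (par y) * (c x z * c y (x + z)) = - a"
      using jacobi_zero[OF assms 2] by (auto simp: a_def)
    have cz: "coroot z = - coroot x - coroot y" unfolding z by (metis coroot_simps(1,3) diff_conv_add_uminus)
    have j2: "koszul_sign (par z) (par z) * (c x y * c z (x + y) * (m * k * l)) = a * (k * l * m)"
      "koszul_sign (par x) (par y) * (c x z * c y (x + z) * (l * k * m)) = - (a * (k * l * m))"
      unfolding j(2,3)[symmetric] using j(2,3) by (simp_all add: mult_ac) 
    show ?thesis unfolding sw
      unfolding br_rv_rv_rv_zero[OF assms 2] br_rv_rv_rv_zero[OF assms(3,1,2) p(1)] br_rv_rv_rv_zero[OF assms(2,1,3) p(2)]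
        cart_simps(3) scale_scale pz j2 j(1) cz
      by (simp add: cart_simps(4)[symmetric] cart_simps(1)[symmetric] algebra_simps)
  next
    case 3
    then have "z + x + y \<noteq> 0" "z + x + y \<notin> R" "y + x + z \<noteq> 0" "y + x + z \<notin> R" by (simp_all add: algebra_simps)
    then show ?thesis unfolding sw using assms 3 by (simp add: br_rv_rv_rv_other)
  qed
qed

text \<open>The parities are parameters and not derived from the vectors: this makes the statement
  additive in each of the three vectors, as the nested inductions over homogeneous elements
  require.\<close>

definition jac :: "bit \<Rightarrow> bit \<Rightarrow> _ \<Rightarrow> _ \<Rightarrow> _ \<Rightarrow> bool" where
  "jac p q u v w \<longleftrightarrow> br u (br v w) = br (br u v) w + smul (koszul_sign p q) (br v (br u w))"

lemma jac_add:
  "jac p q u v w \<Longrightarrow> jac p q u' v w \<Longrightarrow> jac p q (u + u') v w"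
  "jac p q u v w \<Longrightarrow> jac p q u v' w \<Longrightarrow> jac p q u (v + v') w"
  "jac p q u v w \<Longrightarrow> jac p q u v w' \<Longrightarrow> jac p q u v (w + w')"
  by (simp_all add: jac_def br_add_left br_add_right V.scale_right_distrib)

lemma jac_zero: "jac p q 0 v w" "jac p q u 0 w" "jac p q u v 0"
  by (simp_all add: jac_def)

lemma br_jacobi:
  assumes "u \<in> Par p" "v \<in> Par q" "w \<in> Par r" shows "jac p q u v w"
  using assms
proof (induction u rule: Par_induct)
  case (cart s)
  note s = cart.hyps
  from cart.prems show ?case
  proof (induction v rule: Par_induct)
    case (cart t)
    from cart.prems show ?case
      by (induction w rule: Par_induct)
         (simp_all add: jac_zero jac_add, simp_all add: jac_def br_cart_cart br_cart_rv s cart.hyps mult_ac)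
  next
    case (rv \<gamma> k)
    note g = rv.hyps
    from rv.prems show ?case
    proof (induction w rule: Par_induct)
      case (cart t)
      then show ?case by (simp add: jac_def br_cart_cart br_cart_rv br_rv_cart s g rv_simps br_minus mult_ac)
    next
      case (rv \<delta> l)
      have "root \<delta> s = - root \<gamma> s" if "\<gamma> + \<delta> = 0"
        using that by (metis root_simps(4,5) eq_neg_iff_add_eq_0 add.commute)
      then show ?case
        using s g rv.hyps by (auto simp: jac_def br_cart_cart br_cart_rv br_rv_rv algebra_simps rv_simps cart_simps br_minus)
    qed (simp_all add: jac_zero jac_add)
  qed (simp_all add: jac_zero jac_add)
next
  case (rv \<gamma> k)
  note g = rv.hyps
  from rv.prems show ?case
  proof (induction v rule: Par_induct)
    case (cart s)
    note s = cart.hyps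
    from cart.prems show ?case
    proof (induction w rule: Par_induct)
      case (cart t)
      then show ?case by (simp add: jac_def br_cart_cart br_cart_rv br_rv_cart s g rv_simps br_minus mult_ac)
    next
      case (rv \<delta> l)
      have "root \<delta> s = - root \<gamma> s" if "\<gamma> + \<delta> = 0"
        using that by (metis root_simps(4,5) eq_neg_iff_add_eq_0 add.commute)
      then show ?case
        using s g rv.hyps by (auto simp: jac_def br_cart_cart br_cart_rv br_rv_cart br_rv_rv algebra_simps rv_simps cart_simps br_minus)
    qed (simp_all add: jac_zero jac_add)
  next
    case (rv \<delta> l)
    note d = rv.hyps
    from rv.prems show ?case
    proof (induction w rule: Par_induct)
      case (cart t)
      \<comment> \<open>Whether \<gamma> + \<delta> is a root, zero or neither, \<open>B\<close> has
        weight \<gamma> + \<delta> under the Cartan part. All terms become multiples of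
        \<open>B\<close>, and additivity of \<open>root\<close> settles the case.\<close>
      define B where "B = br (rv \<gamma> k) (rv \<delta> l)"
      have sw: "B = - smul (koszul_sign p q) (br (rv \<delta> l) (rv \<gamma> k))"
        unfolding B_def using br_anticommute rv_in_Par g d by blast
      have "br (rv \<gamma> k) (br (rv \<delta> l) (cart t)) = br (rv \<gamma> k) (smul (- root \<delta> t) (rv \<delta> l))"
        using d by (simp add: br_rv_cart rv_simps(3))
      then have l: "br (rv \<gamma> k) (br (rv \<delta> l) (cart t)) = smul (- root \<delta> t) B"
        by (simp only: br_smul_right B_def)
      have "br (rv \<delta> l) (br (rv \<gamma> k) (cart t)) = br (rv \<delta> l) (smul (- root \<gamma> t) (rv \<gamma> k))"
        using g by (simp add: br_rv_cart rv_simps(3))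
      then have "br (rv \<delta> l) (br (rv \<gamma> k) (cart t)) = smul (- root \<gamma> t) (br (rv \<delta> l) (rv \<gamma> k))"
        by (simp only: br_smul_right)
      then have r: "smul (koszul_sign p q) (br (rv \<delta> l) (br (rv \<gamma> k) (cart t))) = smul (root \<gamma> t) B"
        unfolding sw by (simp add: mult.commute)
      have m: "br B (cart t) = smul (- root (\<gamma> + \<delta>) t) B"
      proof -
        consider "\<gamma> + \<delta> \<in> R" | "\<gamma> + \<delta> = 0" | "\<gamma> + \<delta> \<notin> R" "\<gamma> + \<delta> \<noteq> 0" by blast
        then show ?thesis
        proof cases
          case 1
          then have "B = rv (\<gamma> + \<delta>) (c \<gamma> \<delta> * k * l)" using g d by (simp add: B_def br_rv_rv)
          then show ?thesis using 1 by (simp only: br_rv_cart rv_simps(3))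
        next
          case 2
          then have "B = cart (sc (c \<gamma> \<delta> * k * l) (coroot \<gamma>))"
            using g d zero_not_root by (simp add: B_def br_rv_rv)
          then show ?thesis unfolding 2 by (simp add: br_cart_cart)
        next
          case 3
          then show ?thesis using g d by (simp add: B_def br_rv_rv)
        qed
      qed
      have "smul (- root \<delta> t) B = smul (- root (\<gamma> + \<delta>) t + root \<gamma> t) B" by simp
      then show ?case unfolding jac_def B_def[symmetric] l r m by (simp only: V.scale_left_distrib)
    next
      case (rv \<epsilon> m)
      then show ?case using br_jacobi_rv[of \<gamma> \<delta> \<epsilon>] g d by (auto simp: jac_def)
    qed (simp_all add: jac_zero jac_add)
  qed (simp_all add: jac_zero jac_add)
qed (simp_all add: jac_zero jac_add)

text \<open>In characteristic 3 the map \<open>x \<mapsto> [x, [x, x]]\<close> is additive on the odd part, because the mixed terms are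
  multiples of 3 by the Jacobi identity.\<close>

lemma br_cube:
  assumes "CHAR('k) = 3" "u \<in> Par 1"
  shows "br u (br u u) = 0"
proof -
  have three: "(1::'k) + 1 + 1 = 0" using of_nat_CHAR[where 'a = 'k] assms(1) by simp
  have t: "w + w + w = 0" for w :: "'h \<times> (int^'n \<Rightarrow> 'k)"
  proof -
    have "w + w + w = smul (1 + 1 + 1) w" by (simp only: V.scale_left_distrib V.scale_one)
    then show ?thesis unfolding three by simp
  qed
  have "u \<in> Par 1 \<and> br u (br u u) = 0" using assms(2)
  proof (induction u rule: Par_induct)
    case (rv \<gamma> k)
    have "\<gamma> + \<gamma> \<noteq> 0"
    proof
      assume "\<gamma> + \<gamma> = 0"
      then have "\<gamma> $ i + \<gamma> $ i = 0" for i by (metis vector_add_component zero_index)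
      then have "\<gamma> = 0" by (simp add: vec_eq_iff)
      then show False using rv zero_not_root by simp
    qed
    then show ?case using rv odd_double by (simp add: br_rv_rv rv_in_Par)
  next
    case (add u v)
    then have p: "u \<in> Par 1" "v \<in> Par 1" by auto
    have sw: "br u v = br v u" using br_anticommute[OF p] by (simp add: V.scale_minus_left)
    have "jac 1 1 u v u" "jac 1 1 v u v" "jac 1 1 u u v" "jac 1 1 v v u"
      using br_jacobi p by blast+
    then have j: "br u (br v u) = br (br u v) u - br v (br u u)" "br u (br u v) = br (br u u) v - br u (br u v)"
       "br v (br v u) = br (br v v) u - br v (br v u)"
      by (simp_all add: jac_def V.scale_minus_left)
    have e: "br u u \<in> Par 0" "br v v \<in> Par 0" using br_in_Par[OF p(1) p(1)] br_in_Par[OF p(2) p(2)] by simp_all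
    have s2: "br (br u u) v = - br v (br u u)" "br (br v v) u = - br u (br v v)"
      using br_anticommute[OF e(1) p(2)] br_anticommute[OF e(2) p(1)] by simp_all
    have eq: "x + x + y = 0" if "x = - y - x" for x y :: "'h \<times> (int^'n \<Rightarrow> 'k)"
      using arg_cong[OF that, of "\<lambda>z. z + (y + x)"] by (simp add: algebra_simps)
    \<comment> \<open>For odd elements the Jacobi identity for u, u, v reads 2 [u, [u, v]] + [v,
      [u, u]] = 0. The left side is the mixed term of [x, [x, x]] at x = u + v that is quadratic in
      u.\<close>
    have 1: "br u (br u v) + br u (br u v) + br v (br u u) = 0"
      by (rule eq) (use j(2) in \<open>simp only: s2\<close>)
    have 2: "br v (br v u) + br v (br v u) + br u (br v v) = 0"
      by (rule eq) (use j(3) in \<open>simp only: s2\<close>)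
    have "br (u + v) (br (u + v) (u + v)) = br u (br u u) + br v (br v v)
       + (br u (br u v) + br u (br u v) + br v (br u u)) + (br v (br v u) + br v (br v u) + br u (br v v))"
      by (simp add: br_add_left br_add_right sw algebra_simps)
    also have "\<dots> = 0" using add 1 2 by simp
    finally show ?case using p Par_add by blast
  qed (simp_all add: Par_zero)
  then show ?thesis ..
qed

lemma alg_simps [simp]: "carrier alg = Car" "monoid.mult alg = br" "zero alg = 0" "add alg = (+)"
  "module.smult alg = smul" "part alg = Par"
  by (simp_all add: alg_def)

lemma alg_bilinear: "bilinear_superalgebra alg"
  unfolding alg_def
  by (rule typed_superalgebra_bilinear[OF smul_vector_space Car_subspace Par_subspace])
     (auto simp: Par_def br_in_Car br_add_left br_add_right br_smul_left br_smul_right)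

lemma alg_minus: "u \<in> Car \<Longrightarrow> \<ominus>\<^bsub>alg\<^esub> u = - u"
  unfolding alg_def using typed_superalgebra_minus alg_bilinear alg_def V.subspace_neg[OF Car_subspace] by metis

lemma alg_lie:
  assumes "CHAR('k) = 3" shows "lie_superalgebra alg"
proof -
  interpret B: bilinear_superalgebra alg by (rule alg_bilinear)
  show ?thesis
  proof (intro lie_superalgebra.intro B.module_axioms lie_superalgebra_axioms.intro)
    fix x assume "x \<in> carrier alg"
    then have x: "x \<in> Car" by simp
    define y0 where "y0 = (fst x, \<lambda>\<gamma>. if par \<gamma> = 0 then snd x \<gamma> else 0)"
    define y1 where "y1 = (0::'h, \<lambda>\<gamma>. if par \<gamma> = 0 then 0 else snd x \<gamma>)"
    have y: "y0 \<in> Par 0" "y1 \<in> Par 1" using x subspace_0[OF H_subspace]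
      by (auto simp: y0_def y1_def Par_def Car_def split: if_splits)
    have sum: "x = y0 + y1" by (rule pair_eqI) (auto simp: y0_def y1_def)
    have "z = (y0, y1)" if z: "fst z \<in> Par 0" "snd z \<in> Par 1" "x = fst z + snd z" for z
    proof -
      have a: "fst (snd z) = 0" "\<And>\<gamma>. par \<gamma> \<noteq> 0 \<Longrightarrow> snd (fst z) \<gamma> = 0" "\<And>\<gamma>. par \<gamma> = 0 \<Longrightarrow> snd (snd z) \<gamma> = 0"
        using z(1,2) by (auto simp: Par_def)
      have "fst z = y0" by (rule pair_eqI) (use a in \<open>auto simp: y0_def z(3)\<close>)
      moreover have "snd z = y1" by (rule pair_eqI) (use a in \<open>auto simp: y1_def z(3)\<close>)
      ultimately show ?thesis by (simp add: prod_eq_iff)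
    qed
    then show "\<exists>!y. y \<in> part alg 0 \<times> part alg 1 \<and> x = fst y \<oplus>\<^bsub>alg\<^esub> snd y"
      using y sum by (intro ex1I[of _ "(y0, y1)"]) (auto simp: mem_Times_iff)
  next
    fix x y p q assume "x \<in> part alg p" "y \<in> part alg q"
    then have xy: "x \<in> Par p" "y \<in> Par q" by auto
    show "x \<otimes>\<^bsub>alg\<^esub> y \<in> part alg (p + q)" using br_in_Par[OF xy] by simp
    have "smul (koszul_sign p q) (br y x) \<in> Car" using br_in_Car V.subspace_scale[OF Car_subspace] by blast
    then show "x \<otimes>\<^bsub>alg\<^esub> y = \<ominus>\<^bsub>alg\<^esub> (koszul_sign p q \<odot>\<^bsub>alg\<^esub> (y \<otimes>\<^bsub>alg\<^esub> x))"
      using br_anticommute[OF xy] by (simp add: alg_minus)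
  next
    fix x y z p q r assume "x \<in> part alg p" "y \<in> part alg q" "z \<in> part alg r"
    then show "x \<otimes>\<^bsub>alg\<^esub> (y \<otimes>\<^bsub>alg\<^esub> z) = x \<otimes>\<^bsub>alg\<^esub> y \<otimes>\<^bsub>alg\<^esub> z \<oplus>\<^bsub>alg\<^esub> koszul_sign p q \<odot>\<^bsub>alg\<^esub> (y \<otimes>\<^bsub>alg\<^esub> (x \<otimes>\<^bsub>alg\<^esub> z))"
      using br_jacobi[of x p y q z r] by (simp add: jac_def)
  next
    fix x assume "x \<in> part alg 1"
    then show "x \<otimes>\<^bsub>alg\<^esub> (x \<otimes>\<^bsub>alg\<^esub> x) = \<zero>\<^bsub>alg\<^esub>" using br_cube[OF assms] by simp
  qed (rule B.part_submodule B.mult_closed B.mult_add_left B.mult_add_right B.mult_smult_left B.mult_smult_right; assumption)+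
qed

end

section \<open>The free superalgebra\<close>

definition fmul :: "('g magma \<Rightarrow>\<^sub>0 'k::field) \<Rightarrow> ('g magma \<Rightarrow>\<^sub>0 'k) \<Rightarrow> ('g magma \<Rightarrow>\<^sub>0 'k)" where
  "fmul u v = (\<Sum>s\<in>Poly_Mapping.keys u. \<Sum>t\<in>Poly_Mapping.keys v.
       Poly_Mapping.single (Br s t) (Poly_Mapping.lookup u s * Poly_Mapping.lookup v t))"

definition fscale :: "'k::field \<Rightarrow> ('s \<Rightarrow>\<^sub>0 'k) \<Rightarrow> ('s \<Rightarrow>\<^sub>0 'k)" where
  "fscale k = Poly_Mapping.map ((*) k)"

definition fpart :: "('g \<Rightarrow> bit) \<Rightarrow> bit \<Rightarrow> ('g magma \<Rightarrow>\<^sub>0 'k::field) set" where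
  "fpart gp p = {u. \<forall>s\<in>Poly_Mapping.keys u. magma_parity gp s = p}"

lemma free_superalgebra_typed: "free_superalgebra gp = typed_superalgebra UNIV fmul fscale (fpart gp)"
  by (simp add: free_superalgebra_def typed_superalgebra_def fmul_def[abs_def] fscale_def[abs_def] fpart_def[abs_def])

lemma lookup_fscale [simp]: "Poly_Mapping.lookup (fscale k u) s = k * Poly_Mapping.lookup u s"
  by (simp add: fscale_def map.rep_eq when_def)

lemma fscale_single [simp]: "fscale k (Poly_Mapping.single s a) = Poly_Mapping.single s (k * a)"
  by (rule poly_mapping_eqI) (simp add: lookup_single when_def)

lemma fscale_vector_space: "vector_space fscale"
  by unfold_locales (auto intro!: poly_mapping_eqI simp: lookup_add algebra_simps)

interpretation FV: vector_space fscale by (rule fscale_vector_space)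

lemma sum_keys_fscale:
  assumes "\<And>s. g s 0 = 0"
  shows "(\<Sum>s\<in>Poly_Mapping.keys (fscale k u). g s (Poly_Mapping.lookup (fscale k u) s))
    = (\<Sum>s\<in>Poly_Mapping.keys u. g s (k * Poly_Mapping.lookup u s))"
  by (intro sum.mono_neutral_cong_left) (auto simp: in_keys_iff assms)

lemma fmul_add_left: "fmul (u + v) w = fmul u w + fmul v w"
  unfolding fmul_def
  by (rule setsum_keys_plus_distrib) (simp_all add: distrib_right single_add sum.distrib)

lemma fmul_add_right: "fmul w (u + v) = fmul w u + fmul w v"
  unfolding fmul_def sum.distrib[symmetric]
  by (rule sum.cong[OF refl], rule setsum_keys_plus_distrib) (simp_all add: distrib_left single_add)

lemma fmul_scale_left: "fmul (fscale k u) w = fscale k (fmul u w)"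
  unfolding fmul_def
  by (subst sum_keys_fscale) (simp_all add: FV.scale_sum_right mult.assoc)

lemma fmul_scale_right: "fmul w (fscale k u) = fscale k (fmul w u)"
  unfolding fmul_def FV.scale_sum_right
  by (rule sum.cong[OF refl], subst sum_keys_fscale) (simp_all add: mult_ac)

lemma fmul_single: "fmul (Poly_Mapping.single s a) (Poly_Mapping.single t b) = Poly_Mapping.single (Br s t) (a * b)"
  by (simp add: fmul_def)

lemma fmul_zero [simp]: "fmul 0 u = 0" "fmul u 0 = 0" by (simp_all add: fmul_def)

lemma fmul_minus: "fmul (- u) v = - fmul u v" "fmul u (- v) = - fmul u v"
  using fmul_add_left[of u "- u" v] fmul_add_right[of u v "- v"] by (auto simp: eq_neg_iff_add_eq_0 add.commute)

lemma fmul_diff: "fmul (u - w) v = fmul u v - fmul w v" "fmul u (v - w) = fmul u v - fmul u w"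
  using fmul_add_left[of u "- w" v] fmul_add_right[of u v "- w"] by (simp_all add: fmul_minus)

lemma poly_mapping_decompose:
  fixes u :: "'s \<Rightarrow>\<^sub>0 'k::field"
  shows "u = (\<Sum>s\<in>Poly_Mapping.keys u. Poly_Mapping.single s (Poly_Mapping.lookup u s))"
proof (rule poly_mapping_eqI)
  fix t
  have "(\<Sum>s\<in>Poly_Mapping.keys u. Poly_Mapping.lookup u s when s = t)
    = (\<Sum>s\<in>Poly_Mapping.keys u. if s = t then Poly_Mapping.lookup u s else 0)"
    by (simp add: when_def)
  also have "\<dots> = Poly_Mapping.lookup u t" by (simp add: in_keys_iff)
  finally show "Poly_Mapping.lookup u t
      = Poly_Mapping.lookup (\<Sum>s\<in>Poly_Mapping.keys u. Poly_Mapping.single s (Poly_Mapping.lookup u s)) t"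
    by (simp add: lookup_sum lookup_single)
qed

lemma homogeneous_induct [consumes 1, case_names zero single add]:
  fixes u :: "'s \<Rightarrow>\<^sub>0 'k::field"
  assumes "\<forall>s\<in>Poly_Mapping.keys u. C s" "Q 0" "\<And>s k. C s \<Longrightarrow> Q (Poly_Mapping.single s k)"
    "\<And>u v. Q u \<Longrightarrow> Q v \<Longrightarrow> Q (u + v)"
  shows "Q u"
proof -
  have "Q (\<Sum>s\<in>S. Poly_Mapping.single s (Poly_Mapping.lookup u s))" if "S \<subseteq> Poly_Mapping.keys u" for S
    using finite_subset[OF that] that
    by (induction S rule: infinite_finite_induct) (use assms in auto)
  from this[OF subset_refl] show ?thesis using poly_mapping_decompose[of u] by metis
qed

lemma fpart_subspace: "FV.subspace (fpart (gp :: 'g \<Rightarrow> bit) p :: ('g magma \<Rightarrow>\<^sub>0 'k::field) set)"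
proof (rule FV.subspaceI)
  fix u v :: "'g magma \<Rightarrow>\<^sub>0 'k" assume "u \<in> fpart gp p" "v \<in> fpart gp p"
  then show "u + v \<in> fpart gp p" using keys_add[of u v] by (auto simp: fpart_def)
qed (auto simp: fpart_def in_keys_iff)

lemma fpart_single: "magma_parity gp s = p \<Longrightarrow> Poly_Mapping.single s k \<in> fpart gp p"
  by (simp add: fpart_def)

lemma fpart_mul: "u \<in> fpart gp p \<Longrightarrow> v \<in> fpart gp q \<Longrightarrow> fmul u v \<in> fpart gp (p + q)"
  unfolding fmul_def
  by (intro FV.subspace_sum[OF fpart_subspace] fpart_single) (auto simp: fpart_def)

lemma free_superalgebra_bilinear: "bilinear_superalgebra (free_superalgebra gp)"
  unfolding free_superalgebra_typed
  by (rule typed_superalgebra_bilinear[OF fscale_vector_space FV.subspace_UNIV fpart_subspace])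
     (simp_all add: fmul_add_left fmul_add_right fmul_scale_left fmul_scale_right)

lemma superalgebra_ideal_typed:
  assumes "vector_space s" "bilinear_superalgebra (typed_superalgebra UNIV m s P)"
  shows "superalgebra_ideal J (typed_superalgebra UNIV m s P) \<longleftrightarrow>
    module.subspace s J \<and> (\<forall>x. \<forall>y\<in>J. m x y \<in> J \<and> m y x \<in> J)"
proof -
  interpret vector_space s by fact
  interpret B: bilinear_superalgebra "typed_superalgebra UNIV m s P" by fact
  have "submodule J scalars (typed_superalgebra UNIV m s P) \<longleftrightarrow> subspace J"
  proof
    assume "submodule J scalars (typed_superalgebra UNIV m s P)"
    from B.submoduleD(2-4)[OF this] show "subspace J" by (simp add: subspace_def)
  next
    assume "subspace J"
    then show "submodule J scalars (typed_superalgebra UNIV m s P)"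
      by (intro B.submoduleI') (simp_all add: subspace_def)
  qed
  then show ?thesis by (simp add: superalgebra_ideal_def)
qed

section \<open>Identification of a contragredient superalgebra with its root model\<close>

section \<open>Contragredient superalgebras of root data\<close>

text \<open>The Cartan part is the whole realization space. \<open>simple_diff\<close> gives
  [e_i, f_j] = 0 for distinct indices; \<open>generation\<close> and \<open>c_nonzero_sum\<close>
  make Cartan elements and simple root vectors generate the model; \<open>coroot_nonzero\<close>
  lets every root vector in an ideal produce a nonzero Cartan element.\<close>

locale contragredient_model = root_model R par c A sc h \<alpha> UNIV
  for R :: "(int^'n::finite) set" and par and c :: "int^'n \<Rightarrow> int^'n \<Rightarrow> 'k::field" and A
    and sc :: "'k \<Rightarrow> 'h::ab_group_add \<Rightarrow> 'h" and h :: "'n \<Rightarrow> 'h" and \<alpha> +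
  assumes char3: "CHAR('k) = 3"
    and coroot_nonzero: "x \<in> R \<Longrightarrow> coroot x \<noteq> 0"
    and simple_root: "axis i 1 \<in> R"
    and simple_diff: "i \<noteq> j \<Longrightarrow> axis i 1 - axis j 1 \<notin> R"
    and c_nonzero_sum: "\<lbrakk>x \<in> R; y \<in> R; x + y \<in> R\<rbrakk> \<Longrightarrow> c x y \<noteq> 0"
    and generation: "x \<in> R \<Longrightarrow> \<exists>i. x = axis i 1 \<or> x = - axis i 1 \<or>
      x - axis i 1 \<in> R \<and> (\<Sum>j\<in>UNIV. \<bar>(x - axis i 1) $ j\<bar>) < (\<Sum>j\<in>UNIV. \<bar>x $ j\<bar>) \<or>
      x + axis i 1 \<in> R \<and> (\<Sum>j\<in>UNIV. \<bar>(x + axis i 1) $ j\<bar>) < (\<Sum>j\<in>UNIV. \<bar>x $ j\<bar>)"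
begin

abbreviation gpar :: "'n \<Rightarrow> bit" where "gpar \<equiv> (\<lambda>i. par (axis i 1))"

abbreviation GP :: "('h, 'n) generator \<Rightarrow> bit" where "GP \<equiv> generator_parity gpar"

abbreviation Fr :: "('k, ('h, 'n) generator magma \<Rightarrow>\<^sub>0 'k) superalgebra" where
  "Fr \<equiv> free_superalgebra GP"

lemma par_minus: "par (- x) = par x"
  using par_add[of x "- x"] par_zero by (metis add.right_inverse add_bit_eq_xor bit_eq_iff add.commute add.left_commute add.right_neutral xor_self_eq)

lemma magma_parity_degree: "magma_parity GP s = par (magma_degree s)"
proof (induction s)
  case (Gen g) then show ?case by (cases g) (simp_all add: par_zero par_minus)
qed (simp add: par_add)

subsection \<open>Evaluation in the model\<close>

text \<open>The scalar at \<open>GenF\<close> normalizes the root vector of - alpha_i so that its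
  bracket with that of alpha_i is exactly h_i.\<close>

primrec ev :: "('h, 'n) generator \<Rightarrow> 'h \<times> (int^'n \<Rightarrow> 'k)" where
  "ev (GenH t) = cart t"
| "ev (GenE i) = rv (axis i 1) 1"
| "ev (GenF i) = rv (- axis i 1) (1 / c (axis i 1) (- axis i 1))"

primrec mu :: "('h, 'n) generator magma \<Rightarrow> 'h \<times> (int^'n \<Rightarrow> 'k)" where
  "mu (Gen g) = ev g"
| "mu (Br s t) = br (mu s) (mu t)"

definition eval_free :: "(('h, 'n) generator magma \<Rightarrow>\<^sub>0 'k) \<Rightarrow> 'h \<times> (int^'n \<Rightarrow> 'k)" where
  "eval_free u = (\<Sum>s\<in>Poly_Mapping.keys u. smul (Poly_Mapping.lookup u s) (mu s))"

lemma eval_add: "eval_free (u + v) = eval_free u + eval_free v"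
  unfolding eval_free_def by (rule setsum_keys_plus_distrib) (simp_all add: V.scale_left_distrib)

lemma eval_scale: "eval_free (fscale k u) = smul k (eval_free u)"
  unfolding eval_free_def by (subst sum_keys_fscale) (simp_all add: V.scale_sum_right)

lemma eval_single [simp]: "eval_free (Poly_Mapping.single s k) = smul k (mu s)"
  by (simp add: eval_free_def)

lemma eval_zero [simp]: "eval_free 0 = 0" by (simp add: eval_free_def)

lemma eval_minus: "eval_free (- u) = - eval_free u" "eval_free (u - v) = eval_free u - eval_free v"
  using eval_add[of u "- u"] eval_add[of "u - v" v] by (auto simp: eq_neg_iff_add_eq_0 add.commute algebra_simps)

lemma eval_sum: "eval_free (sum f S) = (\<Sum>i\<in>S. eval_free (f i))"
  by (induction S rule: infinite_finite_induct) (auto simp: eval_add)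

lemma eval_mul: "eval_free (fmul u v) = br (eval_free u) (eval_free v)"
proof -
  have "\<forall>s\<in>Poly_Mapping.keys u. True" "\<forall>s\<in>Poly_Mapping.keys v. True" by auto
  then show ?thesis
  proof (induction u rule: homogeneous_induct)
    case (single s k)
    from single(2) show ?case
      by (induction v rule: homogeneous_induct)
         (simp_all add: fmul_add_right eval_add br_add_right fmul_single br_smul_left br_smul_right)
  qed (simp_all add: fmul_add_left eval_add br_add_left)
qed

definition Deg :: "int^'n \<Rightarrow> ('h \<times> (int^'n \<Rightarrow> 'k)) set" where
  "Deg q = {u\<in>Car. (fst u \<noteq> 0 \<longrightarrow> q = 0) \<and> (\<forall>\<gamma>. snd u \<gamma> \<noteq> 0 \<longrightarrow> \<gamma> = q)}"

lemma Deg_cases: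
  assumes "u \<in> Deg q"
  obtains t where "q = 0" "u = cart t" | k where "q \<in> R" "u = rv q k" | "u = 0"
proof -
  have d: "u \<in> Car" "fst u \<noteq> 0 \<longrightarrow> q = 0" "\<And>\<gamma>. snd u \<gamma> \<noteq> 0 \<Longrightarrow> \<gamma> = q"
    "\<And>\<gamma>. \<gamma> \<notin> R \<Longrightarrow> snd u \<gamma> = 0"
    using assms by (auto simp: Deg_def Car_def)
  consider "q = 0" | "q \<in> R" "q \<noteq> 0" | "q \<notin> R" "q \<noteq> 0" by blast
  then show ?thesis
  proof cases
    case 1
    have "snd u \<gamma> = 0" for \<gamma> using d(3,4)[of \<gamma>] 1 zero_not_root by blast
    then have "u = cart (fst u)" by (intro pair_eqI) simp_all
    with 1 that(1) show ?thesis by blast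
  next
    case 2
    have "u = rv q (snd u q)" by (rule pair_eqI) (use d 2 in \<open>auto simp: snd_rv\<close>)
    with 2 that(2) show ?thesis by blast
  next
    case 3
    have "u = 0" by (rule pair_eqI) (use d 3 in auto)
    with that show ?thesis by blast
  qed
qed

lemma rv_Deg: "q \<in> R \<Longrightarrow> rv q k \<in> Deg q" and cart_Deg: "cart t \<in> Deg 0" and zero_Deg: "0 \<in> Deg q"
  using zero_not_root by (auto simp: Deg_def Car_def snd_rv split: if_splits)

lemma br_Deg: "u \<in> Deg p \<Longrightarrow> v \<in> Deg q \<Longrightarrow> br u v \<in> Deg (p + q)"
  by (erule Deg_cases; erule Deg_cases)
     (simp_all add: br_cart_cart br_cart_rv br_rv_cart br_rv_rv rv_Deg cart_Deg zero_Deg)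

lemma mu_Deg: "mu s \<in> Deg (magma_degree s)"
proof (induction s)
  case (Gen g)
  then show ?case using simple_root minus_root[OF simple_root] by (cases g) (auto intro: rv_Deg cart_Deg)
qed (simp add: br_Deg)

lemma mu_Car: "mu s \<in> Car" using mu_Deg[of s] by (simp add: Deg_def)

lemma eval_Car: "eval_free u \<in> Car"
  unfolding eval_free_def by (intro V.subspace_sum V.subspace_scale Car_subspace mu_Car)

lemma mu_Par: "mu s \<in> Par (magma_parity GP s)"
proof (induction s)
  case (Gen g)
  then show ?case using simple_root minus_root[OF simple_root]
    by (cases g) (auto intro: rv_in_Par cart_in_Par simp: par_minus)
next
  case (Br s t)
  then show ?case unfolding mu.simps magma_parity.simps by (rule br_in_Par)
qed

lemma eval_fpart: "u \<in> fpart GP p \<Longrightarrow> eval_free u \<in> Par p"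
  unfolding eval_free_def
  by (intro V.subspace_sum V.subspace_scale Par_subspace) (use mu_Par in \<open>auto simp: fpart_def\<close>)

text \<open>Strong induction on the sum of the absolute values of the coordinates:
  \<open>generation\<close> leads to a root closer to 0, and the bracket with e_i or f_i only brings
  in a nonzero structure constant. A single monomial is obtained, not a combination, so that it can
  serve as a homogeneous multiplier in the study of the radical.\<close>

lemma root_vector_generated: "x \<in> R \<Longrightarrow> \<exists>s k. magma_degree s = x \<and> k \<noteq> 0 \<and> mu s = rv x k"
proof (induction "nat (\<Sum>j\<in>UNIV. \<bar>x $ j\<bar>)" arbitrary: x rule: less_induct)
  case less
  have step: "\<exists>s k. magma_degree s = x \<and> k \<noteq> 0 \<and> mu s = rv x k"
    if y: "y \<in> R" "(\<Sum>j\<in>UNIV. \<bar>y $ j\<bar>) < (\<Sum>j\<in>UNIV. \<bar>x $ j\<bar>)" and g: "x = generator_degree g + y"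
      "ev g = rv (generator_degree g) m" "generator_degree g \<in> R" "m \<noteq> 0" for y :: "int^'n" and g m
  proof -
    have "nat (\<Sum>j\<in>UNIV. \<bar>y $ j\<bar>) < nat (\<Sum>j\<in>UNIV. \<bar>x $ j\<bar>)"
      using y(2) by (subst nat_less_eq_zless) (auto intro: sum_nonneg)
    then obtain s k where s: "magma_degree s = y" "k \<noteq> 0" "mu s = rv y k" using less.hyps y(1) by blast
    have x: "generator_degree g + y \<in> R" using g(1) less.prems by simp
    have "magma_degree (Br (Gen g) s) = x" by (simp add: s g)
    moreover have "mu (Br (Gen g) s) = rv x (c (generator_degree g) y * m * k)"
      using br_rv_rv[OF g(3) y(1)] x by (simp add: g(2) s(3) g(1))
    moreover have "c (generator_degree g) y * m * k \<noteq> 0"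
      using c_nonzero_sum[OF g(3) y(1) x] g(4) s(2) by simp
    ultimately show ?thesis by blast
  qed
  obtain i where i: "x = axis i 1 \<or> x = - axis i 1 \<or>
      x - axis i 1 \<in> R \<and> (\<Sum>j\<in>UNIV. \<bar>(x - axis i 1) $ j\<bar>) < (\<Sum>j\<in>UNIV. \<bar>x $ j\<bar>) \<or>
      x + axis i 1 \<in> R \<and> (\<Sum>j\<in>UNIV. \<bar>(x + axis i 1) $ j\<bar>) < (\<Sum>j\<in>UNIV. \<bar>x $ j\<bar>)"
    using generation[OF less.prems] by blast
  have cn: "c (axis i 1) (- axis i 1) \<noteq> 0" by (rule c_nonzero[OF simple_root])
  from i show ?case
  proof (elim disjE conjE)
    assume x: "x = axis i 1"
    then have "magma_degree (Gen (GenE i)) = x" "mu (Gen (GenE i)) = rv x 1" by simp_all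
    then show ?case by (metis zero_neq_one)
  next
    assume x: "x = - axis i 1"
    then have "magma_degree (Gen (GenF i)) = x" "mu (Gen (GenF i)) = rv x (1 / c (axis i 1) (- axis i 1))" by simp_all
    moreover have "1 / c (axis i 1) (- axis i 1) \<noteq> 0" using cn by simp
    ultimately show ?case by blast
  next
    assume "x - axis i 1 \<in> R" "(\<Sum>j\<in>UNIV. \<bar>(x - axis i 1) $ j\<bar>) < (\<Sum>j\<in>UNIV. \<bar>x $ j\<bar>)"
    from step[OF this, of "GenE i" 1] show ?case using simple_root by simp
  next
    assume "x + axis i 1 \<in> R" "(\<Sum>j\<in>UNIV. \<bar>(x + axis i 1) $ j\<bar>) < (\<Sum>j\<in>UNIV. \<bar>x $ j\<bar>)"
    from step[OF this, of "GenF i" "1 / c (axis i 1) (- axis i 1)"] show ?case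
      using minus_root[OF simple_root[of i]] cn by simp
  qed
qed

lemma eval_fpart_onto: "eval_free ` fpart GP p = Par p"
proof
  show "eval_free ` fpart GP p \<subseteq> Par p" using eval_fpart by blast
  show "Par p \<subseteq> eval_free ` fpart GP p"
  proof
    fix u assume "u \<in> Par p"
    then show "u \<in> eval_free ` fpart GP p"
    proof (induction u rule: Par_induct)
      case zero
      then show ?case using eval_zero FV.subspace_0[OF fpart_subspace] by (metis image_eqI)
    next
      case (cart t)
      have "eval_free (gen (GenH t)) = cart t" by simp
      then show ?case using cart fpart_single[of GP "Gen (GenH t)" 0 1] by (metis generator_parity.simps(1) imageI magma_parity.simps(1))
    next
      case (rv \<gamma> k)
      then obtain s m where s: "magma_degree s = \<gamma>" "m \<noteq> 0" "mu s = rv \<gamma> m" using root_vector_generated by blast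
      then have "eval_free (Poly_Mapping.single s (k / m)) = rv \<gamma> k" by (simp add: rv_simps)
      moreover have "Poly_Mapping.single s (k / m) \<in> fpart GP p"
        using s rv by (intro fpart_single) (simp add: magma_parity_degree)
      ultimately show ?case by (metis imageI)
    next
      case (add u v)
      then obtain x y where "x \<in> fpart GP p" "y \<in> fpart GP p" "u = eval_free x" "v = eval_free y" by blast
      then have "u + v = eval_free (x + y)" "x + y \<in> fpart GP p"
        using FV.subspace_add[OF fpart_subspace] by (auto simp: eval_add)
      then show ?case by blast
    qed
  qed
qed

lemma Car_Par_sum: "u \<in> Car \<Longrightarrow> \<exists>u0\<in>Par 0. \<exists>u1\<in>Par 1. u = u0 + u1"
proof -
  assume "u \<in> Car"
  interpret L: lie_superalgebra alg by (rule alg_lie[OF char3])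
  have "\<exists>!y. y \<in> part alg 0 \<times> part alg 1 \<and> u = fst y \<oplus>\<^bsub>alg\<^esub> snd y"
    by (rule L.part_decomposition) (simp add: \<open>u \<in> Car\<close>)
  then show ?thesis by (auto simp: mem_Times_iff)
qed

lemma eval_onto: "range eval_free = Car"
proof
  show "Car \<subseteq> range eval_free"
  proof
    fix u assume "u \<in> Car"
    then obtain u0 u1 where "u0 \<in> Par 0" "u1 \<in> Par 1" "u = u0 + u1" using Car_Par_sum by blast
    then show "u \<in> range eval_free" unfolding eval_fpart_onto[symmetric] by (auto simp: eval_add[symmetric])
  qed
qed (use eval_Car in blast)

lemma eval_epi: "superalgebra_epi Fr alg eval_free"
  unfolding superalgebra_epi_def free_superalgebra_typed
  by (simp add: eval_onto eval_add eval_scale eval_mul eval_fpart_onto)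

end

context contragredient_model
begin

subsection \<open>The relations\<close>

sublocale FrB: bilinear_superalgebra Fr by (rule free_superalgebra_bilinear)

lemma Fr_simps: "carrier Fr = UNIV" "monoid.mult Fr = fmul" "zero Fr = 0" "add Fr = (+)"
  "module.smult Fr = fscale" "part Fr = fpart GP"
  by (simp_all add: free_superalgebra_typed)

lemma Fr_minus: "\<ominus>\<^bsub>Fr\<^esub> u = - u" "u \<ominus>\<^bsub>Fr\<^esub> v = u - v"
proof -
  show *: "\<ominus>\<^bsub>Fr\<^esub> u = - u" for u
    using typed_superalgebra_minus[OF free_superalgebra_bilinear[of GP, unfolded free_superalgebra_typed]]
    by (simp add: free_superalgebra_typed)
  show "u \<ominus>\<^bsub>Fr\<^esub> v = u - v" by (simp add: a_minus_def * Fr_simps)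
qed

lemma Fr_ideal_iff: "superalgebra_ideal J Fr \<longleftrightarrow> FV.subspace J \<and> (\<forall>x. \<forall>y\<in>J. fmul x y \<in> J \<and> fmul y x \<in> J)"
  unfolding free_superalgebra_typed
  by (rule superalgebra_ideal_typed[OF fscale_vector_space free_superalgebra_bilinear[unfolded free_superalgebra_typed]])

definition Rel where "Rel = contragredient_relators gpar sc h \<alpha>"

definition I where "I = contragredient_ideal gpar sc h \<alpha>"

definition Js where "Js = {J. superalgebra_ideal J Fr \<and> Rel \<subseteq> J \<and> lie_superalgebra (superalgebra_quotient Fr J)}"

lemma I_Js: "I = \<Inter>Js"
  by (simp add: I_def Js_def contragredient_ideal_def presentation_ideal_def Rel_def)

abbreviation Hg :: "'h \<Rightarrow> ('h, 'n) generator magma \<Rightarrow>\<^sub>0 'k" where "Hg t \<equiv> gen (GenH t)"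
abbreviation Eg :: "'n \<Rightarrow> ('h, 'n) generator magma \<Rightarrow>\<^sub>0 'k" where "Eg i \<equiv> gen (GenE i)"
abbreviation Fg :: "'n \<Rightarrow> ('h, 'n) generator magma \<Rightarrow>\<^sub>0 'k" where "Fg i \<equiv> gen (GenF i)"

lemma Rel_eq: "Rel = {Hg (x + y) - (Hg x + Hg y) | x y. True} \<union> {Hg (sc k x) - fscale k (Hg x) | k x. True}
    \<union> {fmul (Eg i) (Fg j) - (if i = j then Hg (h i) else 0) | i j. True}
    \<union> {fmul (Hg x) (Eg j) - fscale (\<alpha> j x) (Eg j) | x j. True}
    \<union> {fmul (Hg x) (Fg j) + fscale (\<alpha> j x) (Fg j) | x j. True}
    \<union> {fmul (Hg x) (Hg y) | x y. True}"
  unfolding Rel_def contragredient_relators_def Let_def Fr_simps ..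

definition Ker where "Ker = epi_kernel Fr alg eval_free"

lemma Ker_iff: "u \<in> Ker \<longleftrightarrow> eval_free u = 0"
  by (simp add: Ker_def epi_kernel_def Fr_simps)

text \<open>The kernel of the evaluation takes part in the intersection that defines the
  presentation: its quotient embeds in the model and is therefore Lie, and the relators evaluate to
  zero. Hence the relations collapse nothing that the model distinguishes.\<close>

lemma Ker_Js: "Ker \<in> Js"
proof -
  have id: "superalgebra_ideal Ker Fr"
    unfolding Ker_def by (rule epi_kernel_ideal[OF free_superalgebra_bilinear alg_bilinear eval_epi])
  interpret Q: superalgebra_with_ideal Fr Ker
    by (intro superalgebra_with_ideal.intro superalgebra_with_ideal_axioms.intro id free_superalgebra_bilinear)
  obtain \<psi> where \<psi>: "superalgebra_epi (superalgebra_quotient Fr Ker) alg \<psi>"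
    "Ker = epi_kernel Fr alg eval_free \<Longrightarrow> inj_on \<psi> (carrier (superalgebra_quotient Fr Ker))"
    using Q.quotient_factor[OF alg_bilinear eval_epi] Ker_def by blast
  have "lie_superalgebra (superalgebra_quotient Fr Ker)"
    by (rule lie_superalgebra_pullback[OF alg_lie[OF char3] Q.quotient_bilinear \<psi>(1) \<psi>(2)[OF Ker_def]])
  moreover have "Rel \<subseteq> Ker"
  proof -
    have sr: "root (axis j 1) x = \<alpha> j x" for j x
    proof -
      have "root (axis j 1) x = (\<Sum>i\<in>UNIV. if i = j then \<alpha> i x else 0)"
        unfolding root_def by (rule sum.cong) (auto simp: axis_def)
      then show ?thesis by simp
    qed
    have sh: "coroot (axis j 1) = h j" for j
    proof -
      have "coroot (axis j 1) = (\<Sum>i\<in>UNIV. if i = j then h i else 0)"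
        unfolding coroot_def by (rule sum.cong) (auto simp: axis_def)
      then show ?thesis by simp
    qed
    have sm: "- axis j 1 \<in> R" for j by (rule minus_root[OF simple_root])
    have cn: "c (axis j 1) (- axis j 1) \<noteq> 0" for j by (rule c_nonzero[OF simple_root])
    have ef: "br (rv (axis i 1) 1) (rv (- axis j 1) (1 / c (axis j 1) (- axis j 1)))
        = (if i = j then cart (h i) else 0)" for i j
    proof (cases "i = j")
      case True
      then show ?thesis using br_rv_rv[OF simple_root[of j] sm[of j]] zero_not_root cn[of j] by (simp add: sh)
    next
      case False
      have "axis i (1::int) + - axis j 1 \<noteq> 0"
      proof
        assume "axis i (1::int) + - axis j 1 = 0"
        then have "axis i (1::int) = axis j 1" by simp
        then have "axis i (1::int) $ i = axis j 1 $ i" by simp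
        then show False using False by (simp add: axis_def split: if_splits)
      qed
      then show ?thesis using False br_rv_rv[OF simple_root[of i] sm[of j]] simple_diff[OF False] by simp
    qed
    have ei: "eval_free (if i = j then Hg (h i) else 0) = (if i = j then cart (h i) else 0)" for i j by simp
    have eg: "eval_free (Hg t) = cart t" "eval_free (Eg i) = rv (axis i 1) 1"
      "eval_free (Fg i) = rv (- axis i 1) (1 / c (axis i 1) (- axis i 1))" for t i
      by simp_all
    show ?thesis
    proof
      fix r assume "r \<in> Rel"
      then show "r \<in> Ker" unfolding Rel_eq
        by (elim UnE CollectE exE conjE; hypsubst)
           (simp_all only: Ker_iff eval_minus(2) eval_add eval_mul eval_scale ei eg cart_simps ef
             br_cart_rv[OF simple_root] br_cart_rv[OF sm] root_simps sr br_cart_cart rv_simps, simp_all add: rv_simps)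
    qed
  qed
  ultimately show ?thesis using id by (simp add: Js_def)
qed

lemma I_Ker: "I \<subseteq> Ker" using Ker_Js I_Js by blast

lemma Rel_I: "Rel \<subseteq> I" unfolding I_Js Js_def by blast

lemma I_ideal: "superalgebra_ideal I Fr"
proof -
  have J: "FV.subspace J" "y \<in> J \<Longrightarrow> fmul x y \<in> J" "y \<in> J \<Longrightarrow> fmul y x \<in> J" if "J \<in> Js" for J x y
  proof -
    have "superalgebra_ideal J Fr" using that by (simp add: Js_def)
    then show "FV.subspace J" "y \<in> J \<Longrightarrow> fmul x y \<in> J" "y \<in> J \<Longrightarrow> fmul y x \<in> J"
      unfolding Fr_ideal_iff by auto
  qed
  show ?thesis unfolding Fr_ideal_iff I_Js
    by (intro conjI allI ballI InterI FV.subspace_Inter J(1)) (auto intro: J(2,3))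
qed

sublocale I: superalgebra_with_ideal Fr I
  by (intro superalgebra_with_ideal.intro superalgebra_with_ideal_axioms.intro I_ideal free_superalgebra_bilinear)

lemma I_subspace: "FV.subspace I" and I_mul: "y \<in> I \<Longrightarrow> fmul x y \<in> I" "y \<in> I \<Longrightarrow> fmul y x \<in> I"
  using I_ideal unfolding Fr_ideal_iff by blast+

lemmas I_closed = FV.subspace_0[OF I_subspace] FV.subspace_add[OF I_subspace] FV.subspace_diff[OF I_subspace]
  FV.subspace_scale[OF I_subspace] FV.subspace_neg[OF I_subspace]

text \<open>Both identities hold in the quotient by each member of \<open>Js\<close>. Written as
  memberships in the ideal, they pass to the intersection \<open>I\<close>.\<close>

lemma Js_jacobi:
  assumes "J \<in> Js" "x \<in> fpart GP p" "y \<in> fpart GP q" "z \<in> fpart GP r"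
  shows "fmul x (fmul y z) - (fmul (fmul x y) z + fscale (koszul_sign p q) (fmul y (fmul x z))) \<in> J"
    and "fmul x y + fscale (koszul_sign p q) (fmul y x) \<in> J"
proof -
  have id: "superalgebra_ideal J Fr" using assms(1) by (simp add: Js_def)
  interpret Q: superalgebra_with_ideal Fr J
    by (intro superalgebra_with_ideal.intro superalgebra_with_ideal_axioms.intro id free_superalgebra_bilinear)
  interpret L: lie_superalgebra "superalgebra_quotient Fr J" using assms(1) by (simp add: Js_def)
  have qs: "(J +>\<^bsub>Fr\<^esub> u) \<oplus>\<^bsub>superalgebra_quotient Fr J\<^esub> (J +>\<^bsub>Fr\<^esub> v) = J +>\<^bsub>Fr\<^esub> (u + v)"
    "(J +>\<^bsub>Fr\<^esub> u) \<otimes>\<^bsub>superalgebra_quotient Fr J\<^esub> (J +>\<^bsub>Fr\<^esub> v) = J +>\<^bsub>Fr\<^esub> (fmul u v)"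
    "k \<odot>\<^bsub>superalgebra_quotient Fr J\<^esub> (J +>\<^bsub>Fr\<^esub> u) = J +>\<^bsub>Fr\<^esub> (fscale k u)" for u v k
    using Q.quotient_simps(2-4) by (simp_all add: Fr_simps)
  have qm: "\<ominus>\<^bsub>superalgebra_quotient Fr J\<^esub> (J +>\<^bsub>Fr\<^esub> u) = J +>\<^bsub>Fr\<^esub> (- u)" for u
    using epi_zero_minus(2)[OF free_superalgebra_bilinear Q.quotient_bilinear Q.quotient_epi, of u]
    by (simp add: Fr_simps Fr_minus)
  have pt: "J +>\<^bsub>Fr\<^esub> u \<in> part (superalgebra_quotient Fr J) s" if "u \<in> fpart GP s" for u s
    using that Q.quotient_simps(6) by (simp add: Fr_simps)
  have ceq: "u - v \<in> J" if "J +>\<^bsub>Fr\<^esub> u = J +>\<^bsub>Fr\<^esub> v" for u v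
    using that Q.coset_eq_iff[of u v] by (simp add: Fr_simps Fr_minus)
  show "fmul x (fmul y z) - (fmul (fmul x y) z + fscale (koszul_sign p q) (fmul y (fmul x z))) \<in> J"
    using L.jacobi[OF pt[OF assms(2)] pt[OF assms(3)] pt[OF assms(4)]] by (intro ceq) (simp only: qs)
  show "fmul x y + fscale (koszul_sign p q) (fmul y x) \<in> J"
    using L.anticommutative[OF pt[OF assms(2)] pt[OF assms(3)]] ceq[of "fmul x y" "- fscale (koszul_sign p q) (fmul y x)"]
    by (simp only: qs qm diff_minus_eq_add)
qed

text \<open>Computations in the algebra before reduction are carried out on representatives in the
  free superalgebra, modulo this congruence, which avoids handling cosets.\<close>

definition eqI where "eqI u v \<longleftrightarrow> u - v \<in> I"

lemma eqI_refl [simp]: "eqI u u" and eqI_sym: "eqI u v \<Longrightarrow> eqI v u"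
  and eqI_trans [trans]: "eqI u v \<Longrightarrow> eqI v w \<Longrightarrow> eqI u w"
  and eqI_add: "eqI u v \<Longrightarrow> eqI u' v' \<Longrightarrow> eqI (u + u') (v + v')"
  and eqI_scale: "eqI u v \<Longrightarrow> eqI (fscale k u) (fscale k v)"
  and eqI_mul: "eqI u v \<Longrightarrow> eqI u' v' \<Longrightarrow> eqI (fmul u u') (fmul v v')"
proof -
  show "eqI u u" by (simp add: eqI_def I_closed)
  show "eqI v u" if "eqI u v" using that I_closed(5)[of "u - v"] by (simp add: eqI_def)
  show "eqI u w" if "eqI u v" "eqI v w" using that I_closed(2)[of "u - v" "v - w"] by (simp add: eqI_def)
  show "eqI (u + u') (v + v')" if "eqI u v" "eqI u' v'"
    using that I_closed(2)[of "u - v" "u' - v'"] by (simp add: eqI_def algebra_simps)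
  show "eqI (fscale k u) (fscale k v)" if "eqI u v"
    using that I_closed(4)[of "u - v" k] by (simp add: eqI_def FV.scale_right_diff_distrib)
  show "eqI (fmul u u') (fmul v v')" if "eqI u v" "eqI u' v'"
    using that I_closed(2)[OF I_mul(2)[of "u - v" u'] I_mul(1)[of "u' - v'" v]] by (simp add: eqI_def fmul_diff)
qed

lemma eqI_jacobi:
  assumes "x \<in> fpart GP p" "y \<in> fpart GP q" "z \<in> fpart GP r"
  shows "eqI (fmul x (fmul y z)) (fmul (fmul x y) z + fscale (koszul_sign p q) (fmul y (fmul x z)))"
  unfolding eqI_def I_Js using Js_jacobi(1)[OF _ assms] by blast

lemma eqI_anticommute:
  assumes "x \<in> fpart GP p" "y \<in> fpart GP q"
  shows "eqI (fmul x y) (- fscale (koszul_sign p q) (fmul y x))"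
  unfolding eqI_def I_Js diff_minus_eq_add using Js_jacobi(2)[OF _ assms assms(2)] by blast

lemma eqI_Hg: "eqI (Hg (s + t)) (Hg s + Hg t)" "eqI (Hg (sc k t)) (fscale k (Hg t))"
  and eqI_EF: "eqI (fmul (Eg i) (Fg j)) (if i = j then Hg (h i) else 0)"
  and eqI_HE: "eqI (fmul (Hg t) (Eg j)) (fscale (\<alpha> j t) (Eg j))"
  and eqI_HF: "eqI (fmul (Hg t) (Fg j)) (fscale (- \<alpha> j t) (Fg j))"
  and eqI_HH: "eqI (fmul (Hg s) (Hg t)) 0"
proof -
  note sub = subsetD[OF Rel_I, unfolded Rel_eq]
  show "eqI (Hg (s + t)) (Hg s + Hg t)" unfolding eqI_def
    by (rule sub, rule UnI1, rule UnI1, rule UnI1, rule UnI1, rule UnI1, rule CollectI) blast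
  show "eqI (Hg (sc k t)) (fscale k (Hg t))" unfolding eqI_def
    by (rule sub, rule UnI1, rule UnI1, rule UnI1, rule UnI1, rule UnI2, rule CollectI) blast
  show "eqI (fmul (Eg i) (Fg j)) (if i = j then Hg (h i) else 0)" unfolding eqI_def
    by (rule sub, rule UnI1, rule UnI1, rule UnI1, rule UnI2, rule CollectI) blast
  show "eqI (fmul (Hg t) (Eg j)) (fscale (\<alpha> j t) (Eg j))" unfolding eqI_def
    by (rule sub, rule UnI1, rule UnI1, rule UnI2, rule CollectI) blast
  have "fmul (Hg t) (Fg j) + fscale (\<alpha> j t) (Fg j) \<in> I"
    by (rule sub, rule UnI1, rule UnI2, rule CollectI) blast
  then show "eqI (fmul (Hg t) (Fg j)) (fscale (- \<alpha> j t) (Fg j))" unfolding eqI_def FV.scale_minus_left by simp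
  show "eqI (fmul (Hg s) (Hg t)) 0" unfolding eqI_def diff_zero
    by (rule sub, rule UnI2, rule CollectI) blast
qed

lemma eqI_Hg_zero: "eqI (Hg 0) 0"
  using eqI_Hg(2)[of 0 0] by (simp only: scale_zero_left FV.scale_zero_left)

subsection \<open>Triangular decomposition\<close>

text \<open>\<open>Chain True\<close> and \<open>Chain False\<close> are the spans of the iterated brackets of the \<open>e\<close>'s and of the
  \<open>f\<close>'s. Together with the Cartan part they are stable under all generators, which shows that
  the component of degree 0 consists of Cartan elements only.\<close>

abbreviation sg :: "bool \<Rightarrow> 'n \<Rightarrow> ('h, 'n) generator" where "sg b i \<equiv> (if b then GenE i else GenF i)"
abbreviation ax :: "bool \<Rightarrow> 'n \<Rightarrow> int^'n" where "ax b i \<equiv> (if b then axis i 1 else - axis i 1)"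

inductive Chain :: "bool \<Rightarrow> int^'n \<Rightarrow> (('h, 'n) generator magma \<Rightarrow>\<^sub>0 'k) \<Rightarrow> bool" for b where
  Chain_zero: "Chain b q 0"
| Chain_gen: "Chain b (ax b i) (gen (sg b i))"
| Chain_mul: "Chain b q u \<Longrightarrow> Chain b (ax b i + q) (fmul (gen (sg b i)) u)"
| Chain_add: "Chain b q u \<Longrightarrow> Chain b q v \<Longrightarrow> Chain b q (u + v)"
| Chain_scale: "Chain b q u \<Longrightarrow> Chain b q (fscale k u)"

lemma gen_fpart: "gen g \<in> fpart GP (par (generator_degree g))"
  by (rule fpart_single) (use magma_parity_degree[of "Gen g"] in simp)

lemma sg_fpart: "gen (sg b i) \<in> fpart GP (par (ax b i))"
  using gen_fpart[of "GenE i"] gen_fpart[of "GenF i"] by (cases b) simp_all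

lemma Chain_fpart: "Chain b q u \<Longrightarrow> u \<in> fpart GP (par q)"
proof (induction rule: Chain.induct)
  case (Chain_mul q u i)
  then show ?case using fpart_mul[OF sg_fpart] by (simp only: par_add)
next
  case (Chain_gen i)
  show ?case by (rule sg_fpart)
qed (use FV.subspace_0[OF fpart_subspace] FV.subspace_add[OF fpart_subspace] FV.subspace_scale[OF fpart_subspace] in auto)

lemma sum_axis: "(\<Sum>j\<in>UNIV. axis i (1::int) $ j) = 1"
  by (simp add: axis_def)

text \<open>The height of a degree, the sum of its coordinates, grows with every e and falls with
  every f. Consequently only the zero chain is left in degree 0.\<close>

lemma Chain_height:
  "Chain b q u \<Longrightarrow> u = 0 \<or> (if b then 0 < (\<Sum>j\<in>UNIV. q $ j) else (\<Sum>j\<in>UNIV. q $ j) < 0)"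
proof (induction rule: Chain.induct)
  case (Chain_gen i)
  then show ?case using sum_axis[of i] by (simp add: sum_negf)
next
  case (Chain_mul q u i)
  then show ?case using sum_axis[of i] by (auto simp: sum_negf sum.distrib sum_subtractf)
qed auto

lemma eqI_H_Chain: "Chain b q u \<Longrightarrow> eqI (fmul (Hg t) u) (fscale (root q t) u)"
proof (induction rule: Chain.induct)
  case (Chain_gen i)
  have "root (axis i 1) t = \<alpha> i t"
    by (simp add: root_def axis_def if_distrib[of of_int] if_distrib[of "\<lambda>x. x * _"] cong: if_cong)
  then show ?case using eqI_HE eqI_HF by simp
next
  case (Chain_mul q u i)
  have r: "root (ax b i) t = (if b then \<alpha> i t else - \<alpha> i t)"
    by (simp add: root_def axis_def if_distrib[of of_int] if_distrib[of "\<lambda>x. x * _"] sum_negf cong: if_cong)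
  have hg: "eqI (fmul (Hg t) (gen (sg b i))) (fscale (root (ax b i) t) (gen (sg b i)))"
    unfolding r using eqI_HE eqI_HF by simp
  have "eqI (fmul (Hg t) (fmul (gen (sg b i)) u))
    (fmul (fmul (Hg t) (gen (sg b i))) u + fscale (koszul_sign 0 (par (ax b i))) (fmul (gen (sg b i)) (fmul (Hg t) u)))"
    using gen_fpart[of "GenH t"] by (intro eqI_jacobi[OF _ sg_fpart Chain_fpart[OF Chain_mul.hyps]]) (simp add: par_zero)
  also have "eqI \<dots> (fmul (fscale (root (ax b i) t) (gen (sg b i))) u + fscale 1 (fmul (gen (sg b i)) (fscale (root q t) u)))"
    unfolding koszul_simps by (intro eqI_add eqI_scale eqI_mul eqI_refl hg Chain_mul.IH)
  also have "\<dots> = fscale (root (ax b i + q) t) (fmul (gen (sg b i)) u)"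
    unfolding fmul_scale_left fmul_scale_right root_simps(4) FV.scale_left_distrib FV.scale_one ..
  finally show ?case .
next
  case (Chain_add q u v)
  then show ?case unfolding fmul_add_right FV.scale_right_distrib by (intro eqI_add)
next
  case (Chain_scale q u k)
  then show ?case unfolding fmul_scale_right FV.scale_left_commute[of _ k] by (intro eqI_scale)
qed simp

text \<open>Membership modulo \<open>I\<close>, in degree \<open>q\<close>, in the positive half
  (\<open>b\<close> true) or the negative half of the algebra enlarged by the Cartan part, which
  contributes only for q = 0.\<close>

definition T1 where
  "T1 b q u \<longleftrightarrow> (\<exists>a t. Chain b q a \<and> eqI u (a + (if q = 0 then Hg t else 0)))"

lemma T1_cong: "T1 b q v \<Longrightarrow> eqI u v \<Longrightarrow> T1 b q u"
  unfolding T1_def using eqI_trans by blast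

lemma T1_Chain: "Chain b q u \<Longrightarrow> T1 b q u"
  unfolding T1_def using eqI_add[OF eqI_refl eqI_sym[OF eqI_Hg_zero], of u]
  by (intro exI[of _ u] exI[of _ 0]) simp

lemma T1_zero: "T1 b q 0" by (rule T1_Chain) (rule Chain_zero)

lemma T1_H: "T1 b 0 (Hg t)"
  unfolding T1_def by (intro exI[of _ 0] exI[of _ t]) (simp add: Chain_zero)

lemma T1_add: "T1 b q u \<Longrightarrow> T1 b q v \<Longrightarrow> T1 b q (u + v)"
proof -
  assume "T1 b q u" "T1 b q v"
  then obtain a s a' t where a: "Chain b q a" "eqI u (a + (if q = 0 then Hg s else 0))"
    "Chain b q a'" "eqI v (a' + (if q = 0 then Hg t else 0))" unfolding T1_def by blast
  have "eqI (u + v) ((a + (if q = 0 then Hg s else 0)) + (a' + (if q = 0 then Hg t else 0)))"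
    by (intro eqI_add a)
  also have "\<dots> = (a + a') + ((if q = 0 then Hg s else 0) + (if q = 0 then Hg t else 0))" by (simp add: algebra_simps)
  also have "eqI \<dots> ((a + a') + (if q = 0 then Hg (s + t) else 0))"
    by (intro eqI_add eqI_refl) (simp add: eqI_sym[OF eqI_Hg(1)])
  finally show ?thesis unfolding T1_def using Chain_add[OF a(1,3)] by blast
qed

lemma T1_scale: "T1 b q u \<Longrightarrow> T1 b q (fscale k u)"
proof -
  assume "T1 b q u"
  then obtain a s where a: "Chain b q a" "eqI u (a + (if q = 0 then Hg s else 0))" unfolding T1_def by blast
  have "eqI (fscale k u) (fscale k (a + (if q = 0 then Hg s else 0)))" by (rule eqI_scale[OF a(2)])
  also have "\<dots> = fscale k a + (if q = 0 then fscale k (Hg s) else 0)" by (simp add: FV.scale_right_distrib)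
  also have "eqI \<dots> (fscale k a + (if q = 0 then Hg (sc k s) else 0))"
    by (intro eqI_add eqI_refl) (cases "q = 0", simp_all only: simp_thms if_True if_False eqI_sym[OF eqI_Hg(2)] eqI_refl)
  finally show ?thesis unfolding T1_def using Chain_scale[OF a(1)] by blast
qed

lemma eqI_gen_H: "eqI (fmul (gen (sg b i)) (Hg t)) (fscale (- root (ax b i) t) (gen (sg b i)))"
proof -
  have "Hg t \<in> fpart GP 0" using gen_fpart[of "GenH t"] by (simp add: par_zero)
  then have "eqI (fmul (gen (sg b i)) (Hg t)) (- fscale (koszul_sign (par (ax b i)) 0) (fmul (Hg t) (gen (sg b i))))"
    by (rule eqI_anticommute[OF sg_fpart])
  then have "eqI (fmul (gen (sg b i)) (Hg t)) (fscale (-1) (fmul (Hg t) (gen (sg b i))))"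
    unfolding koszul_simps FV.scale_minus_left .
  also have "eqI \<dots> (fscale (-1) (fscale (root (ax b i) t) (gen (sg b i))))"
    by (rule eqI_scale[OF eqI_H_Chain[OF Chain_gen]])
  also have "\<dots> = fscale (- root (ax b i) t) (gen (sg b i))" unfolding FV.scale_scale by (simp only: mult_minus1)
  finally show ?thesis .
qed

lemma T1_same: "T1 b q u \<Longrightarrow> T1 b (ax b i + q) (fmul (gen (sg b i)) u)"
proof -
  assume "T1 b q u"
  then obtain a s where a: "Chain b q a" "eqI u (a + (if q = 0 then Hg s else 0))" unfolding T1_def by blast
  have "eqI (fmul (gen (sg b i)) u) (fmul (gen (sg b i)) (a + (if q = 0 then Hg s else 0)))"
    by (rule eqI_mul[OF eqI_refl a(2)])
  moreover have "T1 b (ax b i + q) (fmul (gen (sg b i)) (a + (if q = 0 then Hg s else 0)))"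
    unfolding fmul_add_right
  proof (rule T1_add[OF T1_Chain[OF Chain_mul[OF a(1)]]])
    show "T1 b (ax b i + q) (fmul (gen (sg b i)) (if q = 0 then Hg s else 0))"
    proof (cases "q = 0")
      case True
      have "T1 b (ax b i) (fmul (gen (sg b i)) (Hg s))"
        by (rule T1_cong[OF T1_Chain[OF Chain_scale[OF Chain_gen]] eqI_gen_H])
      then show ?thesis using True by (simp only: simp_thms if_True add.right_neutral)
    next
      case False then show ?thesis by (simp add: T1_zero)
    qed
  qed
  ultimately show ?thesis by (rule T1_cong[rotated])
qed

lemma eqI_opposite_gen: "\<exists>t. eqI (fmul (gen (sg (\<not> b) j)) (gen (sg b i))) (if i = j then Hg t else 0)"
proof (cases b)
  case False
  then show ?thesis using eqI_EF[of j i] by (intro exI[of _ "h j"]) (auto split: if_splits)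
next
  case True
  let ?k = "koszul_sign (par (ax False j)) (par (ax True i))"
  have "eqI (fmul (gen (sg False j)) (gen (sg True i))) (- fscale ?k (fmul (gen (sg True i)) (gen (sg False j))))"
    by (rule eqI_anticommute[OF sg_fpart sg_fpart])
  also have "- fscale ?k (fmul (gen (sg True i)) (gen (sg False j))) = fscale (- ?k) (fmul (Eg i) (Fg j))"
    by (simp add: FV.scale_minus_left)
  also have "eqI (fscale (- ?k) (fmul (Eg i) (Fg j))) (fscale (- ?k) (if i = j then Hg (h i) else 0))"
    by (rule eqI_scale[OF eqI_EF])
  also have "eqI \<dots> (if i = j then Hg (sc (- ?k) (h i)) else 0)"
    by (cases "i = j") (simp_all only: simp_thms if_True if_False eqI_sym[OF eqI_Hg(2)] FV.scale_zero_right eqI_refl)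
  finally show ?thesis using True by (intro exI[of _ "sc (- ?k) (h i)"]) simp
qed

text \<open>The Jacobi identity moves an opposite generator past the leading generator of a chain.
  The bracket of these two is zero for different indices and otherwise a Cartan element, which acts
  on the rest by a scalar; the remaining term is covered by the induction hypothesis and
  \<open>T1_same\<close>.\<close>

lemma T1_opposite: "Chain b q u \<Longrightarrow> T1 b (ax (\<not> b) j + q) (fmul (gen (sg (\<not> b) j)) u)"
proof (induction rule: Chain.induct)
  case (Chain_gen i)
  obtain t where t: "eqI (fmul (gen (sg (\<not> b) j)) (gen (sg b i))) (if i = j then Hg t else 0)"
    using eqI_opposite_gen by blast
  have "T1 b (ax (\<not> b) j + ax b i) (if i = j then Hg t else 0)"
    by (cases "i = j") (simp_all add: T1_H T1_zero)
  then show ?case using t by (rule T1_cong)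
next
  case (Chain_mul q u i)
  obtain t where t: "eqI (fmul (gen (sg (\<not> b) j)) (gen (sg b i))) (if i = j then Hg t else 0)"
    using eqI_opposite_gen by blast
  let ?k = "koszul_sign (par (ax (\<not> b) j)) (par (ax b i))"
  have "eqI (fmul (gen (sg (\<not> b) j)) (fmul (gen (sg b i)) u))
    (fmul (fmul (gen (sg (\<not> b) j)) (gen (sg b i))) u + fscale ?k (fmul (gen (sg b i)) (fmul (gen (sg (\<not> b) j)) u)))"
    by (rule eqI_jacobi[OF sg_fpart sg_fpart Chain_fpart[OF Chain_mul.hyps]])
  also have "eqI \<dots> (fmul (if i = j then Hg t else 0) u + fscale ?k (fmul (gen (sg b i)) (fmul (gen (sg (\<not> b) j)) u)))"
    by (intro eqI_add eqI_mul t eqI_refl)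
  finally have e: "eqI (fmul (gen (sg (\<not> b) j)) (fmul (gen (sg b i)) u))
    (fmul (if i = j then Hg t else 0) u + fscale ?k (fmul (gen (sg b i)) (fmul (gen (sg (\<not> b) j)) u)))" .
  have 1: "T1 b (ax (\<not> b) j + (ax b i + q)) (fmul (if i = j then Hg t else 0) u)"
  proof (cases "i = j")
    case True
    have "T1 b q (fmul (Hg t) u)"
      by (rule T1_cong[OF T1_Chain[OF Chain_scale[OF Chain_mul.hyps]] eqI_H_Chain[OF Chain_mul.hyps]])
    moreover have "ax (\<not> b) j + (ax b i + q) = q" using True by simp
    ultimately show ?thesis using True by (simp only: simp_thms if_True)
  qed (simp add: T1_zero)
  have "ax b i + (ax (\<not> b) j + q) = ax (\<not> b) j + (ax b i + q)" by (simp only: add.left_commute)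
  then have 2: "T1 b (ax (\<not> b) j + (ax b i + q)) (fscale ?k (fmul (gen (sg b i)) (fmul (gen (sg (\<not> b) j)) u)))"
    using T1_scale[OF T1_same[OF Chain_mul.IH, of i], of ?k] by (simp only:)
  show ?case by (rule T1_cong[OF T1_add[OF 1 2] e])
qed (simp_all add: T1_zero fmul_add_right fmul_scale_right T1_add T1_scale)

definition TD where "TD q u \<longleftrightarrow> (\<exists>a a'. T1 True q a \<and> T1 False q a' \<and> eqI u (a + a'))"

lemma TD_T1: "T1 b q u \<Longrightarrow> TD q u"
proof (cases b)
  case True
  assume "T1 b q u"
  then show ?thesis unfolding TD_def using True
    by (intro exI[of _ u] exI[of _ 0]) (simp add: T1_zero)
next
  case False
  assume "T1 b q u"
  then show ?thesis unfolding TD_def using False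
    by (intro exI[of _ 0] exI[of _ u]) (simp add: T1_zero)
qed

lemma TD_cong: "TD q v \<Longrightarrow> eqI u v \<Longrightarrow> TD q u"
  unfolding TD_def using eqI_trans by blast

lemma TD_add: "TD q u \<Longrightarrow> TD q v \<Longrightarrow> TD q (u + v)"
proof -
  assume "TD q u" "TD q v"
  then obtain a a' b b' where a: "T1 True q a" "T1 False q a'" "eqI u (a + a')" "T1 True q b" "T1 False q b'" "eqI v (b + b')"
    unfolding TD_def by blast
  have "eqI (u + v) ((a + a') + (b + b'))" by (intro eqI_add a)
  also have "(a + a') + (b + b') = (a + b) + (a' + b')" by (simp add: algebra_simps)
  finally show ?thesis unfolding TD_def using T1_add a by blast
qed

lemma TD_scale: "TD q u \<Longrightarrow> TD q (fscale k u)"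
proof -
  assume "TD q u"
  then obtain a a' where a: "T1 True q a" "T1 False q a'" "eqI u (a + a')" unfolding TD_def by blast
  have "eqI (fscale k u) (fscale k (a + a'))" by (rule eqI_scale[OF a(3)])
  then show ?thesis unfolding TD_def FV.scale_right_distrib using T1_scale a by blast
qed

lemma TD_gen_T1: "T1 b q u \<Longrightarrow> TD (generator_degree g + q) (fmul (gen g) u)"
proof -
  assume "T1 b q u"
  then obtain a s where a: "Chain b q a" "eqI u (a + (if q = 0 then Hg s else 0))" unfolding T1_def by blast
  have "eqI (fmul (gen g) u) (fmul (gen g) a + fmul (gen g) (if q = 0 then Hg s else 0))"
    using eqI_mul[OF eqI_refl a(2)] by (simp only: fmul_add_right)
  moreover have "TD (generator_degree g + q) (fmul (gen g) a)"
  proof -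
    consider t where "g = GenH t" | i where "g = sg b i" | i where "g = sg (\<not> b) i"
      by (cases g; cases b) auto
    then show ?thesis
    proof cases
      case 1
      have "TD q (fmul (Hg t) a)" by (rule TD_cong[OF TD_T1[OF T1_Chain[OF Chain_scale[OF a(1)]]] eqI_H_Chain[OF a(1)]])
      then show ?thesis using 1 by simp
    next
      case 2
      have "generator_degree g = ax b i" using 2 by simp
      then show ?thesis using TD_T1[OF T1_Chain[OF Chain_mul[OF a(1), of i]]] 2 by (simp only:)
    next
      case 3
      have "generator_degree g = ax (\<not> b) i" using 3 by simp
      then show ?thesis using TD_T1[OF T1_opposite[OF a(1), of i]] 3 by (simp only:)
    qed
  qed
  moreover have "TD (generator_degree g + q) (fmul (gen g) (if q = 0 then Hg s else 0))"
  proof (cases "q = 0")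
    case True
    consider t where "g = GenH t" | b' i where "g = sg b' i"
      by (cases g) (metis (full_types))+
    then have "TD (generator_degree g) (fmul (gen g) (Hg s))"
    proof cases
      case 1
      then show ?thesis using TD_cong[OF TD_T1[OF T1_zero] eqI_HH] by simp
    next
      case 2
      then have d: "generator_degree g = ax b' i" by simp
      show ?thesis unfolding d unfolding 2
        by (rule TD_cong[OF TD_T1[OF T1_Chain[OF Chain_scale[OF Chain_gen]]] eqI_gen_H])
    qed
    then show ?thesis using True by simp
  next
    case False
    have "TD (generator_degree g + q) 0" by (rule TD_T1[OF T1_zero])
    then show ?thesis using False by simp
  qed
  ultimately show ?thesis using TD_add TD_cong by blast
qed

lemma TD_gen: "TD q u \<Longrightarrow> TD (generator_degree g + q) (fmul (gen g) u)"
proof -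
  assume "TD q u"
  then obtain a a' where a: "T1 True q a" "T1 False q a'" "eqI u (a + a')" unfolding TD_def by blast
  have "eqI (fmul (gen g) u) (fmul (gen g) a + fmul (gen g) a')"
    using eqI_mul[OF eqI_refl a(3)] by (simp only: fmul_add_right)
  then show ?thesis using TD_cong TD_add[OF TD_gen_T1[OF a(1)] TD_gen_T1[OF a(2)]] by blast
qed

lemma T1_homogeneous: "T1 b q u \<Longrightarrow> \<exists>v\<in>fpart GP (par q). eqI u v"
proof -
  assume "T1 b q u"
  then obtain a s where a: "Chain b q a" "eqI u (a + (if q = 0 then Hg s else 0))" unfolding T1_def by blast
  have "(if q = 0 then Hg s else 0) \<in> fpart GP (par q)"
    using gen_fpart[of "GenH s"] FV.subspace_0[OF fpart_subspace] by (cases "q = 0") simp_all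
  then have "a + (if q = 0 then Hg s else 0) \<in> fpart GP (par q)"
    by (rule FV.subspace_add[OF fpart_subspace Chain_fpart[OF a(1)]])
  then show ?thesis using a(2) by blast
qed

text \<open>The Jacobi identity modulo \<open>I\<close> is available for elements of definite parity
  only; a homogeneous representative makes it applicable.\<close>

lemma TD_homogeneous: "TD q u \<Longrightarrow> \<exists>v\<in>fpart GP (par q). eqI u v"
proof -
  assume "TD q u"
  then obtain a a' where a: "T1 True q a" "T1 False q a'" "eqI u (a + a')" unfolding TD_def by blast
  then obtain v v' where "v \<in> fpart GP (par q)" "v' \<in> fpart GP (par q)" "eqI a v" "eqI a' v'"
    using T1_homogeneous by blast
  then show ?thesis using eqI_trans[OF a(3) eqI_add] FV.subspace_add[OF fpart_subspace] by blast
qed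

text \<open>For a compound monomial the Jacobi identity expresses [[s, t], v] through [s, [t, v]]
  and [t, [s, v]], so that stability under generators (\<open>TD_gen\<close>) extends to all
  monomials.\<close>

lemma TD_magma: "TD q v \<Longrightarrow> TD (magma_degree s + q) (fmul (Poly_Mapping.single s 1) v)"
proof (induction s arbitrary: q v)
  case (Gen g) then show ?case using TD_gen by simp
next
  case (Br s t)
  let ?s = "Poly_Mapping.single s (1::'k)" and ?t = "Poly_Mapping.single t (1::'k)"
  let ?k = "koszul_sign (par (magma_degree s)) (par (magma_degree t)) :: 'k"
  obtain w where w: "w \<in> fpart GP (par q)" "eqI v w" using TD_homogeneous[OF Br.prems] by blast
  have st: "?s \<in> fpart GP (par (magma_degree s))" "?t \<in> fpart GP (par (magma_degree t))"
    by (rule fpart_single, rule magma_parity_degree)+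
  have W: "TD q w" using Br.prems w(2) eqI_sym TD_cong by blast
  have j: "fmul ?s (fmul ?t w) - (fmul (fmul ?s ?t) w + fscale ?k (fmul ?t (fmul ?s w))) \<in> I"
    using eqI_jacobi[OF st w(1)] by (simp add: eqI_def)
  have "eqI (fmul (fmul ?s ?t) w) (fmul ?s (fmul ?t w) + fscale (- ?k) (fmul ?t (fmul ?s w)))"
    unfolding eqI_def using I_closed(5)[OF j] by (simp add: algebra_simps)
  moreover have "TD (magma_degree (Br s t) + q) (fmul ?s (fmul ?t w) + fscale (- ?k) (fmul ?t (fmul ?s w)))"
  proof (rule TD_add[OF _ TD_scale])
    show "TD (magma_degree (Br s t) + q) (fmul ?s (fmul ?t w))"
      using Br.IH(1)[OF Br.IH(2)[OF W]] by (simp add: algebra_simps)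
    show "TD (magma_degree (Br s t) + q) (fmul ?t (fmul ?s w))"
      using Br.IH(2)[OF Br.IH(1)[OF W]] by (simp add: algebra_simps)
  qed
  ultimately have "TD (magma_degree (Br s t) + q) (fmul (fmul ?s ?t) w)" by (rule TD_cong[rotated])
  moreover have "eqI (fmul (fmul ?s ?t) v) (fmul (fmul ?s ?t) w)" by (rule eqI_mul[OF eqI_refl w(2)])
  ultimately show ?case using TD_cong by (simp add: fmul_single)
qed

lemma TD_single: "TD (magma_degree s) (Poly_Mapping.single s k)"
proof -
  have "TD (magma_degree s) (Poly_Mapping.single s 1)"
  proof (induction s)
    case (Gen g)
    consider t where "g = GenH t" | b i where "g = sg b i"
      by (cases g) (metis (full_types))+
    then show ?case
    proof cases
      case 1 then show ?thesis using TD_T1[OF T1_H] by simp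
    next
      case 2
      then have d: "magma_degree (Gen g) = ax b i" by simp
      show ?thesis unfolding d unfolding 2 by (rule TD_T1[OF T1_Chain[OF Chain_gen]])
    qed
  next
    case (Br s t)
    then show ?case using TD_magma[of "magma_degree t" "Poly_Mapping.single t 1" s] by (simp add: fmul_single)
  qed
  from TD_scale[OF this, of k] show ?thesis by simp
qed

text \<open>The upper bound on which the computation of the radical rests: in degree 0 both halves
  of the triangular sum are reduced to their Cartan summands by \<open>Chain_height\<close>.\<close>

lemma degree_zero_Cartan:
  assumes "\<forall>s\<in>Poly_Mapping.keys u. magma_degree s = 0"
  shows "\<exists>t. eqI u (Hg t)"
proof -
  have "TD 0 u" using assms
  proof (induction u rule: homogeneous_induct)
    case zero show ?case by (rule TD_T1[OF T1_zero])
  next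
    case (single s k) then show ?case using TD_single[of s k] by simp
  qed (rule TD_add)
  then obtain a a' where a: "T1 True 0 a" "T1 False 0 a'" "eqI u (a + a')" unfolding TD_def by blast
  have 0: "\<exists>t. eqI w (Hg t)" if w: "T1 b 0 w" for b w
  proof -
    obtain x s where x: "Chain b 0 x" "eqI w (x + Hg s)" using w unfolding T1_def by auto
    have "x = 0" using Chain_height[OF x(1)] by (auto split: if_splits)
    then show ?thesis using x(2) by auto
  qed
  obtain t t' where t: "eqI a (Hg t)" "eqI a' (Hg t')" using 0 a(1,2) by blast
  have "eqI u (Hg (t + t'))"
    by (rule eqI_trans[OF a(3) eqI_trans[OF eqI_add[OF t] eqI_sym[OF eqI_Hg(1)]]])
  then show ?thesis by blast
qed

end

context contragredient_model
begin

subsection \<open>The radical\<close>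

definition tilde where "tilde = contragredient_tilde gpar sc h \<alpha>"

lemma tilde_quotient: "tilde = superalgebra_quotient Fr I"
  by (simp add: tilde_def contragredient_tilde_def I_def)

abbreviation cls :: "(('h, 'n) generator magma \<Rightarrow>\<^sub>0 'k) \<Rightarrow> (('h, 'n) generator magma \<Rightarrow>\<^sub>0 'k) set" where
  "cls u \<equiv> I +>\<^bsub>Fr\<^esub> u"

lemma tilde_class_eq: "tilde_class gpar sc h \<alpha> = cls"
  by (rule ext) (simp add: tilde_class_def I_def)

sublocale Ti: bilinear_superalgebra tilde
  unfolding tilde_quotient by (rule I.quotient_bilinear)

lemma tilde_simps:
  "carrier tilde = range cls" "cls u \<oplus>\<^bsub>tilde\<^esub> cls v = cls (u + v)" "cls u \<otimes>\<^bsub>tilde\<^esub> cls v = cls (fmul u v)"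
  "\<zero>\<^bsub>tilde\<^esub> = cls 0" "cls u = cls v \<longleftrightarrow> eqI u v"
proof -
  show "carrier tilde = range cls" "cls u \<oplus>\<^bsub>tilde\<^esub> cls v = cls (u + v)" "cls u \<otimes>\<^bsub>tilde\<^esub> cls v = cls (fmul u v)"
    using I.quotient_simps(1-3) unfolding tilde_quotient by (simp_all add: Fr_simps)
  show "cls u = cls v \<longleftrightarrow> eqI u v"
    using I.coset_eq_iff[of u v] by (simp add: Fr_simps Fr_minus eqI_def)
  show "\<zero>\<^bsub>tilde\<^esub> = cls 0"
    using I.quotient_simps(5) I.coset_eq_J_iff[of 0] I_closed(1) unfolding tilde_quotient by (simp add: Fr_simps)
qed

lemma cls_carrier: "cls u \<in> carrier tilde"
  unfolding tilde_simps(1) by (rule rangeI)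

definition teval where
  "teval = (SOME \<psi>. superalgebra_epi tilde alg \<psi> \<and> (\<forall>u. \<psi> (cls u) = eval_free u))"

lemma teval_epi: "superalgebra_epi tilde alg teval" and teval_cls: "teval (cls u) = eval_free u"
proof -
  obtain \<psi> where "superalgebra_epi tilde alg \<psi>" "\<And>u. u \<in> carrier Fr \<Longrightarrow> \<psi> (cls u) = eval_free u"
    using I.quotient_factor[OF alg_bilinear eval_epi] I_Ker unfolding tilde_quotient Ker_def by blast
  then have "\<exists>\<psi>. superalgebra_epi tilde alg \<psi> \<and> (\<forall>u. \<psi> (cls u) = eval_free u)" by (auto simp: Fr_simps)
  from someI_ex[OF this] show "superalgebra_epi tilde alg teval" "teval (cls u) = eval_free u"
    unfolding teval_def by blast+
qed

definition TK where "TK = epi_kernel tilde alg teval"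

lemma TK_cls: "cls u \<in> TK \<longleftrightarrow> eval_free u = 0"
  by (simp add: TK_def epi_kernel_def teval_cls cls_carrier)

lemma TK_carrier: "x \<in> TK \<Longrightarrow> \<exists>u. x = cls u"
  by (auto simp: TK_def epi_kernel_def tilde_simps)

lemma TK_ideal: "superalgebra_ideal TK tilde"
  unfolding TK_def by (rule epi_kernel_ideal[OF Ti.bilinear_superalgebra_axioms alg_bilinear teval_epi])

definition hom_deg :: "int^'n \<Rightarrow> (('h, 'n) generator magma \<Rightarrow>\<^sub>0 'k) set" where
  "hom_deg q = {u. \<forall>s\<in>Poly_Mapping.keys u. magma_degree s = q}"

definition proj_deg :: "int^'n \<Rightarrow> (('h, 'n) generator magma \<Rightarrow>\<^sub>0 'k) \<Rightarrow> (('h, 'n) generator magma \<Rightarrow>\<^sub>0 'k)" where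
  "proj_deg q u = (\<Sum>s\<in>{s\<in>Poly_Mapping.keys u. magma_degree s = q}. Poly_Mapping.single s (Poly_Mapping.lookup u s))"

lemma hom_deg_subspace: "FV.subspace (hom_deg q)"
proof (rule FV.subspaceI)
  fix u v :: "('h, 'n) generator magma \<Rightarrow>\<^sub>0 'k" assume "u \<in> hom_deg q" "v \<in> hom_deg q"
  then show "u + v \<in> hom_deg q" using keys_add[of u v] by (auto simp: hom_deg_def)
qed (auto simp: hom_deg_def in_keys_iff)

lemma proj_deg_hom: "proj_deg q u \<in> hom_deg q"
  unfolding proj_deg_def by (rule FV.subspace_sum[OF hom_deg_subspace]) (auto simp: hom_deg_def)

lemma proj_deg_sum: "u = (\<Sum>q\<in>magma_degree ` Poly_Mapping.keys u. proj_deg q u)"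
  unfolding proj_deg_def
  by (subst sum.image_gen[where g = magma_degree, symmetric]) (simp_all add: poly_mapping_decompose[symmetric])

definition comp :: "int^'n \<Rightarrow> 'h \<times> (int^'n \<Rightarrow> 'k) \<Rightarrow> 'h \<times> (int^'n \<Rightarrow> 'k)" where
  "comp q u = (if q = 0 then fst u else 0, \<lambda>\<gamma>. if \<gamma> = q then snd u \<gamma> else 0)"

lemma comp_simps: "comp q (u + v) = comp q u + comp q v" "comp q 0 = 0" "comp q (smul k u) = smul k (comp q u)"
  "comp q (sum f S) = (\<Sum>i\<in>S. comp q (f i))"
proof -
  show add: "comp q (u + v) = comp q u + comp q v" for u v
    by (rule pair_eqI) (auto simp: comp_def)
  show z: "comp q 0 = 0" by (rule pair_eqI) (auto simp: comp_def)
  show "comp q (smul k u) = smul k (comp q u)" by (rule pair_eqI) (auto simp: comp_def smul_def)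
  show "comp q (sum f S) = (\<Sum>i\<in>S. comp q (f i))"
    by (induction S rule: infinite_finite_induct) (simp_all add: add z)
qed

lemma comp_Deg: "u \<in> Deg p \<Longrightarrow> comp q u = (if p = q then u else 0)"
  by (rule pair_eqI) (auto simp: comp_def Deg_def)

lemma eval_proj_deg: "eval_free (proj_deg q u) = comp q (eval_free u)"
proof -
  have "comp q (eval_free u) = (\<Sum>s\<in>Poly_Mapping.keys u. if magma_degree s = q then smul (Poly_Mapping.lookup u s) (mu s) else 0)"
    unfolding eval_free_def comp_simps(4) by (rule sum.cong) (auto simp: comp_simps comp_Deg[OF mu_Deg])
  also have "\<dots> = (\<Sum>s\<in>{s\<in>Poly_Mapping.keys u. magma_degree s = q}. smul (Poly_Mapping.lookup u s) (mu s))"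
    by (rule sum.inter_filter[symmetric]) simp
  finally show ?thesis by (simp add: proj_deg_def eval_sum)
qed

lemma eval_hom_deg: "u \<in> hom_deg q \<Longrightarrow> eval_free u \<in> Deg q"
proof -
  assume "u \<in> hom_deg q"
  then have "\<forall>s\<in>Poly_Mapping.keys u. magma_degree s = q" by (simp add: hom_deg_def)
  moreover have "V.subspace (Deg q)"
  proof (rule V.subspaceI)
    fix u v assume uv: "u \<in> Deg q" "v \<in> Deg q"
    have "u + v \<in> Car" using uv V.subspace_add[OF Car_subspace] by (simp add: Deg_def)
    moreover have "fst (u + v) \<noteq> 0 \<Longrightarrow> q = 0" using uv by (auto simp: Deg_def)
    moreover have "\<gamma> = q" if "snd (u + v) \<gamma> \<noteq> 0" for \<gamma>
    proof -
      have "snd u \<gamma> \<noteq> 0 \<or> snd v \<gamma> \<noteq> 0" using that by auto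
      then show ?thesis using uv by (auto simp: Deg_def)
    qed
    ultimately show "u + v \<in> Deg q" by (simp add: Deg_def)
  next
    fix k u assume "u \<in> Deg q"
    then show "smul k u \<in> Deg q" using V.subspace_scale[OF Car_subspace] by (auto simp: Deg_def smul_def)
  qed (rule zero_Deg)
  ultimately show ?thesis unfolding eval_free_def
    using mu_Deg by (intro V.subspace_sum V.subspace_scale) auto
qed

lemma tilde_component_eq: "tilde_component gpar sc h \<alpha> q = cls ` hom_deg q"
  by (simp add: tilde_component_def tilde_class_eq hom_deg_def)

lemma tilde_sum_in:
  assumes "submodule N scalars tilde" "\<And>i. i \<in> S \<Longrightarrow> cls (f i) \<in> N"
  shows "cls (sum f S) \<in> N"
  using assms(2)
proof (induction S rule: infinite_finite_induct)
  case (insert x F)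
  then have "cls (f x) \<oplus>\<^bsub>tilde\<^esub> cls (sum f F) \<in> N" using Ti.submoduleD(3)[OF assms(1)] by blast
  then show ?case using insert by (simp add: tilde_simps)
qed (use Ti.submoduleD(2)[OF assms(1)] in \<open>simp_all add: tilde_simps\<close>)

text \<open>Evaluation respects degrees (\<open>eval_proj_deg\<close>), so with each element its
  kernel contains all homogeneous components of that element.\<close>

lemma Q_graded_TK: "Q_graded_ideal gpar sc h \<alpha> TK"
proof -
  let ?S = "\<Union>q. TK \<inter> cls ` hom_deg q"
  have S: "?S \<subseteq> carrier tilde" by (auto simp: tilde_simps)
  note sp = lin_span_submodule[OF Ti.bilinear_superalgebra_axioms S]
  have sub: "submodule TK scalars tilde" using TK_ideal by (simp add: superalgebra_ideal_def)
  have "TK = lin_span tilde ?S"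
  proof
    show "lin_span tilde ?S \<subseteq> TK" by (rule sp(3)[OF sub]) blast
    show "TK \<subseteq> lin_span tilde ?S"
    proof
      fix x assume x: "x \<in> TK"
      then obtain u where u: "x = cls u" using TK_carrier by blast
      then have e: "eval_free u = 0" using x TK_cls by simp
      have "cls (proj_deg q u) \<in> ?S" for q
        using proj_deg_hom[of q u] by (auto simp: TK_cls eval_proj_deg e comp_simps)
      then have "cls (proj_deg q u) \<in> lin_span tilde ?S" for q using sp(2) by blast
      then have "cls (\<Sum>q\<in>magma_degree ` Poly_Mapping.keys u. proj_deg q u) \<in> lin_span tilde ?S"
        by (rule tilde_sum_in[OF sp(1)])
      then show "x \<in> lin_span tilde ?S" using u proj_deg_sum[of u] by simp
    qed
  qed
  then show ?thesis unfolding Q_graded_ideal_def tilde_component_eq tilde_def[symmetric] using TK_ideal by blast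
qed

lemma Cartan_meets_TK: "TK \<inter> range (\<lambda>t. cls (Hg t)) = {\<zero>\<^bsub>tilde\<^esub>}"
proof
  show "{\<zero>\<^bsub>tilde\<^esub>} \<subseteq> TK \<inter> range (\<lambda>t. cls (Hg t))"
  proof -
    have "cls 0 = cls (Hg 0)" using eqI_sym[OF eqI_Hg_zero] by (simp add: tilde_simps)
    moreover have "cls 0 \<in> TK" by (simp add: TK_cls)
    ultimately show ?thesis by (auto simp: tilde_simps(4))
  qed
  show "TK \<inter> range (\<lambda>t. cls (Hg t)) \<subseteq> {\<zero>\<^bsub>tilde\<^esub>}"
  proof
    fix x assume "x \<in> TK \<inter> range (\<lambda>t. cls (Hg t))"
    then obtain t where t: "x = cls (Hg t)" "eval_free (Hg t) = 0" using TK_cls by auto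
    then have "cart t = 0" by simp
    then have "t = 0" by (metis fst_cart fst_zero)
    then show "x \<in> {\<zero>\<^bsub>tilde\<^esub>}" using t eqI_Hg_zero by (simp add: tilde_simps)
  qed
qed

text \<open>In degree 0 an element of \<open>J\<close> is a Cartan class and therefore zero. A
  homogeneous element with nonzero value in the model thus has a root q as its degree; its bracket
  with a monomial of degree - q would be an element of \<open>J\<close> of degree 0 that evaluates
  to a nonzero multiple of a coroot.\<close>

lemma Q_graded_subset_TK:
  assumes "Q_graded_ideal gpar sc h \<alpha> J" "J \<inter> range (\<lambda>t. cls (Hg t)) = {\<zero>\<^bsub>tilde\<^esub>}"
  shows "J \<subseteq> TK"
proof -
  have J: "superalgebra_ideal J tilde" "J = lin_span tilde (\<Union>q. J \<inter> cls ` hom_deg q)"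
    using assms(1) unfolding Q_graded_ideal_def tilde_component_eq tilde_def[symmetric] by blast+
  have Jm: "x \<otimes>\<^bsub>tilde\<^esub> y \<in> J" if "x \<in> carrier tilde" "y \<in> J" for x y
    using J(1) that by (simp add: superalgebra_ideal_def)
  have zero: "eval_free u = 0" if u: "u \<in> hom_deg 0" "cls u \<in> J" for u
  proof -
    obtain t where "eqI u (Hg t)" using degree_zero_Cartan u(1) by (auto simp: hom_deg_def)
    then have c: "cls u = cls (Hg t)" by (simp add: tilde_simps)
    then have "cls u \<in> J \<inter> range (\<lambda>t. cls (Hg t))" using u(2) by auto
    then have "cls u = cls 0" using assms(2) by (simp add: tilde_simps)
    then have "teval (cls u) = teval (cls 0)" by simp
    then show ?thesis by (simp add: teval_cls)
  qed
  have "cls u \<in> TK" if u: "u \<in> hom_deg q" "cls u \<in> J" for u q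
  proof (rule ccontr)
    assume "cls u \<notin> TK"
    then have e: "eval_free u \<noteq> 0" by (simp add: TK_cls)
    then have q: "q \<noteq> 0" using zero u by blast
    obtain k where k: "q \<in> R" "eval_free u = rv q k"
      using Deg_cases[OF eval_hom_deg[OF u(1)]] e q by metis
    then have k0: "k \<noteq> 0" using e rv_simps(2) by metis
    obtain s m where s: "magma_degree s = - q" "m \<noteq> 0" "mu s = rv (- q) m"
      using root_vector_generated[OF minus_root[OF k(1)]] by blast
    define w where "w = fmul (Poly_Mapping.single s 1) u"
    have "cls w = cls (Poly_Mapping.single s 1) \<otimes>\<^bsub>tilde\<^esub> cls u" by (simp add: w_def tilde_simps)
    also have "\<dots> \<in> J" by (rule Jm[OF cls_carrier u(2)])
    finally have w: "cls w \<in> J" .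
    have "magma_degree r = 0" if "r \<in> Poly_Mapping.keys w" for r
    proof -
      have "w \<in> hom_deg 0" unfolding w_def fmul_def
        by (intro FV.subspace_sum[OF hom_deg_subspace]) (use u(1) s(1) in \<open>auto simp: hom_deg_def\<close>)
      then show ?thesis using that by (simp add: hom_deg_def)
    qed
    then have "w \<in> hom_deg 0" by (simp add: hom_deg_def)
    then have "eval_free w = 0" using zero w by blast
    moreover have "eval_free w = cart (sc (c (- q) q * m * k) (coroot (- q)))"
      using br_rv_rv[OF minus_root[OF k(1)] k(1)] zero_not_root by (simp add: w_def eval_mul s k)
    ultimately have "sc (c (- q) q * m * k) (coroot (- q)) = 0" by (metis fst_cart fst_zero)
    moreover have "c (- q) q \<noteq> 0" using c_nonzero[OF minus_root[OF k(1)]] by simp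
    ultimately show False using k0 s(2) coroot_nonzero[OF minus_root[OF k(1)]] by simp
  qed
  then have 1: "(\<Union>q. J \<inter> cls ` hom_deg q) \<subseteq> TK" by blast
  have 2: "(\<Union>q. J \<inter> cls ` hom_deg q) \<subseteq> carrier tilde" by (auto simp: tilde_simps)
  have 3: "submodule TK scalars tilde" using TK_ideal by (simp add: superalgebra_ideal_def)
  show ?thesis
    by (subst J(2)) (rule lin_span_submodule(3)[OF Ti.bilinear_superalgebra_axioms 2 3 1])
qed

lemma radical_eq: "contragredient_radical gpar sc h \<alpha> = TK"
  unfolding contragredient_radical_def tilde_class_eq tilde_def[symmetric]
  by (rule Greatest_equality) (simp_all add: Q_graded_TK Cartan_meets_TK Q_graded_subset_TK)

theorem contragredient_iso_model:
  obtains \<Theta> where "superalgebra_epi (contragredient gpar sc h \<alpha>) alg \<Theta>"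
    "inj_on \<Theta> (carrier (contragredient gpar sc h \<alpha>))"
    "bilinear_superalgebra (contragredient gpar sc h \<alpha>)"
    "\<And>i. chevalley_e gpar sc h \<alpha> i \<in> carrier (contragredient gpar sc h \<alpha>)"
    "\<And>i. \<Theta> (chevalley_e gpar sc h \<alpha> i) = rv (axis i 1) 1"
proof -
  interpret K: superalgebra_with_ideal tilde TK
    by (intro superalgebra_with_ideal.intro superalgebra_with_ideal_axioms.intro TK_ideal Ti.bilinear_superalgebra_axioms)
  have eq: "contragredient gpar sc h \<alpha> = superalgebra_quotient tilde TK"
    by (simp add: contragredient_def tilde_def radical_eq)
  have ch: "chevalley_e gpar sc h \<alpha> i = TK +>\<^bsub>tilde\<^esub> cls (Eg i)" for i
    by (simp add: chevalley_e_def radical_eq tilde_def tilde_class_eq)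
  obtain \<psi> where \<psi>: "superalgebra_epi (superalgebra_quotient tilde TK) alg \<psi>"
    "\<And>x. x \<in> carrier tilde \<Longrightarrow> \<psi> (TK +>\<^bsub>tilde\<^esub> x) = teval x"
    "TK = epi_kernel tilde alg teval \<Longrightarrow> inj_on \<psi> (carrier (superalgebra_quotient tilde TK))"
    using K.quotient_factor[OF alg_bilinear teval_epi] TK_def by blast
  have E: "cls (Eg i) \<in> carrier tilde" for i by (rule cls_carrier)
  show thesis
  proof (rule that[of \<psi>])
    show "superalgebra_epi (contragredient gpar sc h \<alpha>) alg \<psi>" unfolding eq by (rule \<psi>(1))
    show "inj_on \<psi> (carrier (contragredient gpar sc h \<alpha>))" unfolding eq by (rule \<psi>(3)[OF TK_def])
    show "bilinear_superalgebra (contragredient gpar sc h \<alpha>)" unfolding eq by (rule K.quotient_bilinear)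
    show "chevalley_e gpar sc h \<alpha> i \<in> carrier (contragredient gpar sc h \<alpha>)" for i
      unfolding eq ch K.quotient_simps(1) using E by blast
    show "\<psi> (chevalley_e gpar sc h \<alpha> i) = rv (axis i 1) 1" for i
      unfolding ch \<psi>(2)[OF E] teval_cls by simp
  qed
qed

end

section \<open>The derived algebra modulo its center\<close>

definition cartan_row :: "int^'n^'n \<Rightarrow> 'n \<Rightarrow> 'k::field^'n" where
  "cartan_row A i = (\<chi> j. of_int (A $ i $ j))"

lemma (in jacobi_root_datum) row_root_model:
  "root_model R par c A (*s) (cartan_row A) (\<lambda>j (t :: 'k^'n). t $ j) (vec.span (range (cartan_row A)))"
proof (intro root_model.intro jacobi_root_datum_axioms vec.vector_space_axioms root_model_axioms.intro)
  show "Vector_Spaces.linear (*s) (*) (\<lambda>t :: 'k^'n. t $ j)" for j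
    by unfold_locales (simp_all add: algebra_simps)
qed (auto simp: cartan_row_def vec.span_base)

text \<open>The quotient of the derived algebra by its center is again a root model: its Cartan subalgebra is the
  span of the rows of the Cartan matrix, where \<open>t\<close> is represented by the values \<open>\<alpha> j t\<close>.\<close>

locale derived_model = contragredient_model R par c A sc h \<alpha>
  for R :: "(int^'n::finite) set" and par and c :: "int^'n \<Rightarrow> int^'n \<Rightarrow> 'k::field" and A
    and sc :: "'k \<Rightarrow> 'h::ab_group_add \<Rightarrow> 'h" and h :: "'n \<Rightarrow> 'h" and \<alpha> +
  assumes independent_h: "(\<Sum>i\<in>UNIV. sc (k i) (h i)) = 0 \<Longrightarrow> k i = 0"
    and root_nonzero: "x \<in> R \<Longrightarrow> \<exists>t. root x t \<noteq> 0"
    and kernel_line: "\<exists>v. (\<exists>i. v i \<noteq> 0) \<and> (\<forall>w. (\<forall>j. (\<Sum>i\<in>UNIV. w i * of_int (A $ i $ j)) = 0)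
       \<longleftrightarrow> (\<exists>k::'k. w = (\<lambda>i. k * v i)))"
begin

abbreviation row_vec :: "'n \<Rightarrow> 'k^'n" where "row_vec \<equiv> cartan_row A"

sublocale D: root_model R par c A sc h \<alpha> "span (range h)"
  by unfold_locales (auto simp: \<alpha>_linear \<alpha>_h subspace_span intro: span_base)

sublocale Q: root_model R par c A "(*s)" row_vec "\<lambda>j (t :: 'k^'n). t $ j" "vec.span (range row_vec)"
  by (rule row_root_model)

definition reduce :: "'h \<times> (int^'n \<Rightarrow> 'k) \<Rightarrow> ('k^'n) \<times> (int^'n \<Rightarrow> 'k)" where
  "reduce u = ((\<chi> j. \<alpha> j (fst u)), snd u)"

lemma span_h: "t \<in> span (range h) \<longleftrightarrow> (\<exists>k. t = (\<Sum>i\<in>UNIV. sc (k i) (h i)))"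
proof
  assume "t \<in> span (range h)"
  then show "\<exists>k. t = (\<Sum>i\<in>UNIV. sc (k i) (h i))"
  proof (induction t rule: span_induct_alt)
    case base
    show ?case by (intro exI[of _ "\<lambda>_. 0"]) simp
  next
    case (step k x y)
    then obtain m i where m: "y = (\<Sum>i\<in>UNIV. sc (m i) (h i))" "x = h i" by blast
    have "sc k x = (\<Sum>j\<in>UNIV. if j = i then sc k (h j) else 0)" by (simp add: m)
    also have "\<dots> = (\<Sum>j\<in>UNIV. sc (if j = i then k else 0) (h j))" by (rule sum.cong) auto
    finally have "sc k x + y = (\<Sum>j\<in>UNIV. sc ((if j = i then k else 0) + m j) (h j))"
      by (simp only: m(1) scale_left_distrib sum.distrib)
    then show ?case by (intro exI[of _ "\<lambda>j. (if j = i then k else 0) + m j"])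
  qed
next
  assume "\<exists>k. t = (\<Sum>i\<in>UNIV. sc (k i) (h i))"
  then show "t \<in> span (range h)" by (auto intro: span_sum span_scale span_base)
qed

lemma reduce_sum: "(\<chi> j. \<alpha> j (\<Sum>i\<in>UNIV. sc (k i) (h i))) = (\<Sum>i\<in>UNIV. k i *s row_vec i)"
  by (simp add: vec_eq_iff cartan_row_def \<alpha>_h)

lemma span_row: "t \<in> vec.span (range row_vec) \<longleftrightarrow> (\<exists>k. t = (\<Sum>i\<in>UNIV. k i *s row_vec i))"
proof
  assume "t \<in> vec.span (range row_vec)"
  then show "\<exists>k. t = (\<Sum>i\<in>UNIV. k i *s row_vec i)"
  proof (induction t rule: vec.span_induct_alt)
    case base
    show ?case by (intro exI[of _ "\<lambda>_. 0"]) simp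
  next
    case (step k x y)
    then obtain m i where m: "y = (\<Sum>i\<in>UNIV. m i *s row_vec i)" "x = row_vec i" by blast
    have "k *s x = (\<Sum>j\<in>UNIV. if j = i then k *s row_vec j else 0)" by (simp add: m)
    also have "\<dots> = (\<Sum>j\<in>UNIV. (if j = i then k else 0) *s row_vec j)" by (rule sum.cong) auto
    finally have "k *s x + y = (\<Sum>j\<in>UNIV. ((if j = i then k else 0) + m j) *s row_vec j)"
      by (simp only: m(1) vec.scale_left_distrib sum.distrib)
    then show ?case by (intro exI[of _ "\<lambda>j. (if j = i then k else 0) + m j"])
  qed
next
  assume "\<exists>k. t = (\<Sum>i\<in>UNIV. k i *s row_vec i)"
  then show "t \<in> vec.span (range row_vec)" by (auto intro: vec.span_sum vec.span_scale vec.span_base)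
qed

lemma reduce_coroot: "(\<chi> j. \<alpha> j (coroot x)) = Q.coroot x"
  unfolding coroot_def Q.coroot_def by (rule reduce_sum)

lemma reduce_root: "Q.root x (\<chi> j. \<alpha> j t) = root x t"
  by (simp add: root_def Q.root_def)

lemma reduce_add: "reduce (u + v) = reduce u + reduce v"
  by (rule Q.pair_eqI) (simp_all add: reduce_def vec_eq_iff)

lemma reduce_smul: "reduce (smul k u) = Q.smul k (reduce u)"
  by (rule Q.pair_eqI) (simp_all add: reduce_def vec_eq_iff smul_def Q.smul_def)

lemma reduce_br: "reduce (br u v) = Q.br (reduce u) (reduce v)"
proof (rule Q.pair_eqI)
  have "(\<chi> j. \<alpha> j (\<Sum>\<gamma>\<in>R. sc (f \<gamma>) (coroot \<gamma>))) = (\<Sum>\<gamma>\<in>R. f \<gamma> *s Q.coroot \<gamma>)" for f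
    unfolding reduce_coroot[symmetric] by (simp add: vec_eq_iff)
  then show "fst (reduce (br u v)) = fst (Q.br (reduce u) (reduce v))"
    by (simp add: reduce_def br_def Q.br_def)
  show "snd (reduce (br u v)) \<gamma> = snd (Q.br (reduce u) (reduce v)) \<gamma>" for \<gamma>
    by (simp add: reduce_def br_def Q.br_def reduce_root cong: if_cong)
qed

lemma reduce_span: "(\<lambda>t. \<chi> j. \<alpha> j t) ` span (range h) = vec.span (range row_vec)"
proof
  show "(\<lambda>t. \<chi> j. \<alpha> j t) ` span (range h) \<subseteq> vec.span (range row_vec)"
  proof
    fix s assume "s \<in> (\<lambda>t. \<chi> j. \<alpha> j t) ` span (range h)"
    then obtain t where t: "t \<in> span (range h)" "s = (\<chi> j. \<alpha> j t)" by blast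
    then obtain k where "t = (\<Sum>i\<in>UNIV. sc (k i) (h i))" unfolding span_h by blast
    then have "s = (\<Sum>i\<in>UNIV. k i *s row_vec i)" by (simp only: t(2) reduce_sum)
    then show "s \<in> vec.span (range row_vec)" unfolding span_row by blast
  qed
  show "vec.span (range row_vec) \<subseteq> (\<lambda>t. \<chi> j. \<alpha> j t) ` span (range h)"
  proof
    fix t assume "t \<in> vec.span (range row_vec)"
    then obtain k where "t = (\<Sum>i\<in>UNIV. k i *s row_vec i)" unfolding span_row by blast
    then have "t = (\<chi> j. \<alpha> j (\<Sum>i\<in>UNIV. sc (k i) (h i)))" by (simp only: reduce_sum)
    then show "t \<in> (\<lambda>t. \<chi> j. \<alpha> j t) ` span (range h)" using span_h by blast
  qed
qed

lemma reduce_in_Car: "u \<in> D.Car \<Longrightarrow> reduce u \<in> Q.Car"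
  using reduce_span by (auto simp: D.Car_def Q.Car_def reduce_def)

text \<open>A zero Cartan part is lifted to zero: odd elements have no Cartan part, and an odd
  element must lift to an odd element.\<close>

lemma reduce_lift:
  assumes "w \<in> Q.Car" obtains u where "u \<in> D.Car" "w = reduce u" "fst w = 0 \<longrightarrow> fst u = 0" "snd u = snd w"
proof (cases "fst w = 0")
  case True
  show thesis
    by (rule that[of "(0, snd w)"]) (use assms True in \<open>auto simp: D.Car_def Q.Car_def reduce_def span_zero prod_eq_iff vec_eq_iff\<close>)
next
  case False
  have "fst w \<in> (\<lambda>t. \<chi> j. \<alpha> j t) ` span (range h)" using assms by (simp add: reduce_span Q.Car_def)
  then obtain t where t: "t \<in> span (range h)" "fst w = (\<chi> j. \<alpha> j t)" by blast
  show thesis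
    by (rule that[of "(t, snd w)"]) (use assms t False in \<open>auto simp: D.Car_def Q.Car_def reduce_def prod_eq_iff\<close>)
qed

lemma reduce_epi: "superalgebra_epi D.alg Q.alg reduce"
proof -
  have "reduce ` D.Car = Q.Car" using reduce_in_Car reduce_lift by blast
  moreover have "reduce ` D.Par p = Q.Par p" for p
  proof
    show "reduce ` D.Par p \<subseteq> Q.Par p"
      using reduce_in_Car by (auto simp: D.Par_def Q.Par_def) (auto simp: reduce_def vec_eq_iff)
    show "Q.Par p \<subseteq> reduce ` D.Par p"
    proof
      fix w assume w: "w \<in> Q.Par p"
      then have "w \<in> Q.Car" by (simp add: Q.Par_def)
      then obtain u where u: "u \<in> D.Car" "w = reduce u" "fst w = 0 \<longrightarrow> fst u = 0" "snd u = snd w"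
        by (rule reduce_lift)
      then have "u \<in> D.Par p" using w by (auto simp: D.Par_def Q.Par_def)
      then show "w \<in> reduce ` D.Par p" using u by blast
    qed
  qed
  ultimately show ?thesis
    unfolding superalgebra_epi_def by (simp add: reduce_add reduce_smul reduce_br)
qed

lemma rv_in_DCar: "\<gamma> \<in> R \<Longrightarrow> rv \<gamma> k \<in> D.Car"
  by (rule D.rv_in_Car)

text \<open>The bracket with the root vector of - \<gamma> multiplies a nonzero coroot by the
  coefficient at \<gamma>, so a central element lies in the Cartan part; brackets with simple root
  vectors then show its values under all \<alpha> j. All these test vectors lie in
  \<open>D.Car\<close>.\<close>

lemma center_iff:
  assumes "z \<in> D.Car"
  shows "(\<forall>x\<in>D.Car. br z x = 0) \<longleftrightarrow> reduce z = 0"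
proof
  assume z: "\<forall>x\<in>D.Car. br z x = 0"
  have snd0: "snd z \<gamma> = 0" for \<gamma>
  proof (cases "\<gamma> \<in> R")
    case True
    then have m: "- \<gamma> \<in> R" by (rule minus_root)
    have "(\<Sum>\<delta>\<in>R. sc (snd z \<delta> * snd (rv (- \<gamma>) 1) (- \<delta>) * c \<delta> (- \<delta>)) (coroot \<delta>))
       = (\<Sum>\<delta>\<in>R. if \<delta> = \<gamma> then sc (snd z \<delta> * c \<delta> (- \<delta>)) (coroot \<delta>) else 0)"
      by (rule sum.cong) (auto simp: snd_rv)
    then have "fst (br z (rv (- \<gamma>) 1)) = sc (snd z \<gamma> * c \<gamma> (- \<gamma>)) (coroot \<gamma>)"
      using True finite_roots by (simp add: br_def)
    moreover have "br z (rv (- \<gamma>) 1) = 0" using z rv_in_DCar[OF m] by blast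
    ultimately have "sc (snd z \<gamma> * c \<gamma> (- \<gamma>)) (coroot \<gamma>) = 0" by simp
    then show ?thesis using coroot_nonzero[OF True] c_nonzero[OF True] by simp
  next
    case False then show ?thesis using assms by (simp add: D.Car_def)
  qed
  have "\<alpha> j (fst z) = 0" for j
  proof -
    have r: "root (axis j 1) t = \<alpha> j t" for t
      by (simp add: root_def axis_def if_distrib[of of_int] if_distrib[of "\<lambda>x. x * _"] cong: if_cong)
    have "z = cart (fst z)" by (rule pair_eqI) (simp_all add: snd0)
    then have "br z (rv (axis j 1) 1) = rv (axis j 1) (\<alpha> j (fst z))"
      using br_cart_rv[OF simple_root] r by (metis mult.right_neutral)
    moreover have "br z (rv (axis j 1) 1) = 0" using z rv_in_DCar[OF simple_root] by blast
    ultimately have "snd (rv (axis j 1) (\<alpha> j (fst z))) (axis j 1) = 0" by simp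
    then show ?thesis by (simp add: snd_rv)
  qed
  then show "reduce z = 0" by (intro Q.pair_eqI) (simp_all add: reduce_def snd0 vec_eq_iff)
next
  assume z: "reduce z = 0"
  have "snd (reduce z) = snd 0" "fst (reduce z) = fst 0" using z by simp_all
  then have a: "snd z = 0" "\<And>j. \<alpha> j (fst z) = 0" by (simp_all add: reduce_def vec_eq_iff)
  have "root x (fst z) = 0" for x by (simp add: root_def a)
  then show "\<forall>x\<in>D.Car. br z x = 0"
    by (intro ballI pair_eqI) (simp_all add: br_def a cong: if_cong)
qed

text \<open>Each h_i is the bracket of e_i and f_i. A root vector is recovered from its bracket with
  an element of the full Cartan part on which the root does not vanish, as supplied by
  \<open>root_nonzero\<close>.\<close>

lemma derived_spanned:
  assumes "V.subspace N" "\<And>u v. br u v \<in> N \<or> u \<notin> Car \<or> v \<notin> Car"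
  shows "D.Car \<subseteq> N"
proof
  fix u assume "u \<in> D.Car"
  have b: "br x y \<in> N" if "x \<in> Car" "y \<in> Car" for x y using assms(2) that by blast
  have ch: "cart (h i) \<in> N" for i
  proof -
    have m: "- axis i 1 \<in> R" by (rule minus_root[OF simple_root])
    have cn: "c (axis i 1) (- axis i 1) \<noteq> 0" by (rule c_nonzero[OF simple_root])
    have sh: "coroot (axis i 1) = h i"
    proof -
      have "coroot (axis i 1) = (\<Sum>j\<in>UNIV. if j = i then h j else 0)"
        unfolding coroot_def by (rule sum.cong) (auto simp: axis_def)
      then show ?thesis by simp
    qed
    have "br (rv (axis i 1) 1) (rv (- axis i 1) (1 / c (axis i 1) (- axis i 1))) = cart (h i)"
      using br_rv_rv[OF simple_root[of i] m] zero_not_root cn by (simp add: sh)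
    then show ?thesis using b[OF rv_in_Car[OF simple_root] rv_in_Car[OF m]] by metis
  qed
  from \<open>u \<in> D.Car\<close> show "u \<in> N"
  proof (induction u rule: D.Car_induct)
    case (cart t)
    then obtain k where t: "t = (\<Sum>i\<in>UNIV. sc (k i) (h i))" using span_h by blast
    have "cart (sum f S) = (\<Sum>i\<in>S. cart (f i))" for f :: "'n \<Rightarrow> 'h" and S
      by (induction S rule: infinite_finite_induct) (simp_all add: cart_simps)
    then have "cart t = (\<Sum>i\<in>UNIV. smul (k i) (cart (h i)))" unfolding t by (simp add: cart_simps)
    then show ?case using ch by (simp add: V.subspace_sum V.subspace_scale assms(1))
  next
    case (rv \<gamma> k)
    obtain t where t: "root \<gamma> t \<noteq> 0" using root_nonzero[OF rv] by blast
    have "br (cart t) (rv \<gamma> (k / root \<gamma> t)) = rv \<gamma> k" using br_cart_rv[OF rv] t by simp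
    then show ?case using b[OF cart_in_Car rv_in_Car[OF rv]] by (metis UNIV_I)
  next
    case (add u v)
    then show ?case using V.subspace_add[OF assms(1)] by blast
  qed
qed

theorem derived_mod_center:
  defines "E \<equiv> derived_algebra (contragredient gpar sc h \<alpha>)"
  obtains \<theta> where "superalgebra_epi (superalgebra_quotient E (center E)) Q.alg \<theta>"
    "inj_on \<theta> (carrier (superalgebra_quotient E (center E)))"
    "bilinear_superalgebra (superalgebra_quotient E (center E))"
    "one_dimensional E (center E)"
    "\<And>i. chevalley_e gpar sc h \<alpha> i \<in> carrier E"
    "\<And>i. center E +>\<^bsub>E\<^esub> chevalley_e gpar sc h \<alpha> i \<in> carrier (superalgebra_quotient E (center E))"
    "\<And>i. \<theta> (center E +>\<^bsub>E\<^esub> chevalley_e gpar sc h \<alpha> i) = Q.rv (axis i 1) 1"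
proof -
  let ?C = "contragredient gpar sc h \<alpha>"
  obtain \<Theta> where \<Theta>: "superalgebra_epi ?C alg \<Theta>" "inj_on \<Theta> (carrier ?C)" "bilinear_superalgebra ?C"
    "\<And>i. chevalley_e gpar sc h \<alpha> i \<in> carrier ?C" "\<And>i. \<Theta> (chevalley_e gpar sc h \<alpha> i) = rv (axis i 1) 1"
    using contragredient_iso_model by blast
  interpret C: bilinear_superalgebra ?C by (rule \<Theta>(3))
  note e = superalgebra_epiD[OF \<Theta>(1), unfolded alg_simps]
  note z = epi_zero_minus[OF \<Theta>(3) alg_bilinear \<Theta>(1), unfolded alg_simps]
  \<comment> \<open>The preimage of the model whose Cartan part is spanned by the h_i; it turns out
    to be the carrier of the derived algebra.\<close>
  define D0 where "D0 = {u\<in>carrier ?C. \<Theta> u \<in> D.Car}"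
  let ?S = "{x \<otimes>\<^bsub>?C\<^esub> y | x y. x \<in> carrier ?C \<and> y \<in> carrier ?C}"
  have S: "?S \<subseteq> carrier ?C" using C.mult_closed by blast
  have D0sub: "submodule D0 scalars ?C"
    by (rule C.submoduleI')
       (auto simp: D0_def z e(3,4) C.smult_in V.subspace_0[OF D.Car_subspace] V.subspace_add[OF D.Car_subspace]
         V.subspace_scale[OF D.Car_subspace])
  have "lin_span ?C ?S = D0"
  proof
    show "lin_span ?C ?S \<subseteq> D0"
    proof (rule lin_span_submodule(3)[OF \<Theta>(3) S D0sub])
      show "?S \<subseteq> D0"
      proof (rule subsetI, elim CollectE exE conjE)
        fix w x y assume w: "w = x \<otimes>\<^bsub>?C\<^esub> y" and xy: "x \<in> carrier ?C" "y \<in> carrier ?C"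
        have "\<Theta> w \<in> D.Car" unfolding w e(5)[OF xy] by (rule D.br_in_Car)
        then show "w \<in> D0" using C.mult_closed[OF xy] w by (simp add: D0_def)
      qed
    qed
    show "D0 \<subseteq> lin_span ?C ?S"
    proof
      fix u assume u: "u \<in> D0"
      note sp = lin_span_submodule(1,2)[OF \<Theta>(3) S]
      note sm = C.submoduleD[OF sp(1)]
      have sub: "V.subspace (\<Theta> ` lin_span ?C ?S)"
      proof (rule V.subspaceI)
        show "0 \<in> \<Theta> ` lin_span ?C ?S" using imageI[OF sm(2), of \<Theta>] unfolding z(1) .
      next
        fix x y assume "x \<in> \<Theta> ` lin_span ?C ?S" "y \<in> \<Theta> ` lin_span ?C ?S"
        then obtain a b where ab: "a \<in> lin_span ?C ?S" "b \<in> lin_span ?C ?S" "x = \<Theta> a" "y = \<Theta> b" by blast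
        then have "a \<in> carrier ?C" "b \<in> carrier ?C" using sm(1) by blast+
        then have "x + y = \<Theta> (a \<oplus>\<^bsub>?C\<^esub> b)" using ab e(3) by simp
        then show "x + y \<in> \<Theta> ` lin_span ?C ?S" using sm(3)[OF ab(1,2)] by simp
      next
        fix k x assume "x \<in> \<Theta> ` lin_span ?C ?S"
        then obtain a where a: "a \<in> lin_span ?C ?S" "x = \<Theta> a" by blast
        then have "a \<in> carrier ?C" using sm(1) by blast
        then have "smul k x = \<Theta> (k \<odot>\<^bsub>?C\<^esub> a)" using a e(4) by simp
        then show "smul k x \<in> \<Theta> ` lin_span ?C ?S" using sm(4)[OF a(1)] by simp
      qed
      have mem: "br x y \<in> \<Theta> ` lin_span ?C ?S \<or> x \<notin> Car \<or> y \<notin> Car" for x y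
      proof (cases "x \<in> Car \<and> y \<in> Car")
        case True
        obtain a where a: "a \<in> carrier ?C" "x = \<Theta> a" using True unfolding e(1)[symmetric] by blast
        obtain b where b: "b \<in> carrier ?C" "y = \<Theta> b" using True unfolding e(1)[symmetric] by blast
        have "br x y = \<Theta> (a \<otimes>\<^bsub>?C\<^esub> b)" unfolding a(2) b(2) by (rule e(5)[OF a(1) b(1), symmetric])
        moreover have "a \<otimes>\<^bsub>?C\<^esub> b \<in> lin_span ?C ?S"
          by (rule subsetD[OF sp(2)]) (use a(1) b(1) in blast)
        ultimately show ?thesis by simp
      next
        case False
        then show ?thesis by simp
      qed
      have sp1: "D.Car \<subseteq> \<Theta> ` lin_span ?C ?S" by (rule derived_spanned[OF sub mem])
      have "\<Theta> u \<in> D.Car" using u by (simp add: D0_def)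
      then have "\<Theta> u \<in> \<Theta> ` lin_span ?C ?S" by (rule subsetD[OF sp1])
      then obtain a where a: "\<Theta> u = \<Theta> a" "a \<in> lin_span ?C ?S" by (rule imageE)
      have "u = a"
        by (rule inj_onD[OF \<Theta>(2) a(1)]) (use u subsetD[OF sm(1) a(2)] in \<open>simp_all add: D0_def\<close>)
      then show "u \<in> lin_span ?C ?S" using a(2) by simp
    qed
  qed
  then have Eeq: "E = ?C\<lparr>carrier := D0, part := (\<lambda>p. part ?C p \<inter> D0)\<rparr>"
    unfolding E_def derived_algebra_def Let_def by simp
  have Es: "carrier E = D0" "monoid.mult E = monoid.mult ?C" "add E = add ?C" "zero E = zero ?C"
    "module.smult E = module.smult ?C" "part E p = part ?C p \<inter> D0" for p
    unfolding Eeq by simp_all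
  \<comment> \<open>The inverse map is needed because \<open>epi_image\<close> transfers the axioms
    along a surjection onto \<open>E\<close>, and on the other side they are known for the
    model.\<close>
  define \<Xi> where "\<Xi> = the_inv_into D0 \<Theta>"
  have D0C: "D0 \<subseteq> carrier ?C" by (auto simp: D0_def)
  have injD: "inj_on \<Theta> D0" by (rule inj_on_subset[OF \<Theta>(2) D0C])
  have im: "\<Theta> ` D0 = D.Car"
  proof
    show "D.Car \<subseteq> \<Theta> ` D0"
    proof
      fix w assume w: "w \<in> D.Car"
      then have "w \<in> Car" by (auto simp: D.Car_def Car_def)
      then obtain u where "u \<in> carrier ?C" "w = \<Theta> u" unfolding e(1)[symmetric] by blast
      then show "w \<in> \<Theta> ` D0" using w by (auto simp: D0_def)
    qed
  qed (auto simp: D0_def)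
  have DP: "D.Par p = Par p \<inter> D.Car" for p by (auto simp: D.Par_def Par_def D.Car_def Car_def)
  have imp: "\<Theta> ` (part ?C p \<inter> D0) = D.Par p" for p
  proof -
    have "\<Theta> ` (part ?C p \<inter> D0) = \<Theta> ` part ?C p \<inter> \<Theta> ` D0"
      by (rule inj_on_image_Int[OF \<Theta>(2) C.part_subset D0C])
    then show ?thesis by (simp add: e(6) im DP)
  qed
  have epiE: "superalgebra_epi E D.alg \<Theta>"
    unfolding superalgebra_epi_def Es D.alg_simps im imp using D0C e(3-5) by (simp add: subset_iff)
  have zD: "zero E = \<Xi> 0" "\<Xi> ` D.Car = D0" and \<Xi>\<Theta>: "\<And>u. u \<in> D0 \<Longrightarrow> \<Xi> (\<Theta> u) = u"
  proof -
    show x: "\<And>u. u \<in> D0 \<Longrightarrow> \<Xi> (\<Theta> u) = u" unfolding \<Xi>_def using injD by (simp add: the_inv_into_f_f)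
    have "zero ?C \<in> D0" using C.submoduleD(2)[OF D0sub] .
    then show "zero E = \<Xi> 0" using x[of "zero ?C"] by (simp add: z(1) Es(4))
    show "\<Xi> ` D.Car = D0" unfolding im[symmetric] image_image using x by simp
  qed
  have epiI: "superalgebra_epi D.alg E \<Xi>"
  proof -
    have ap: "\<Xi> (\<Theta> a + \<Theta> b) = a \<oplus>\<^bsub>?C\<^esub> b" if "a \<in> D0" "b \<in> D0" for a b
    proof -
      have "a \<in> carrier ?C" "b \<in> carrier ?C" using that D0C by auto
      then show ?thesis using \<Xi>\<Theta>[OF C.submoduleD(3)[OF D0sub that]] e(3) by simp
    qed
    have as: "\<Xi> (smul k (\<Theta> a)) = k \<odot>\<^bsub>?C\<^esub> a" if "a \<in> D0" for k a
    proof -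
      have "a \<in> carrier ?C" using that D0C by auto
      then show ?thesis using \<Xi>\<Theta>[OF C.submoduleD(4)[OF D0sub that]] e(4) by simp
    qed
    have am: "\<Xi> (br (\<Theta> a) (\<Theta> b)) = a \<otimes>\<^bsub>?C\<^esub> b" if "a \<in> D0" "b \<in> D0" for a b
    proof -
      have ab: "a \<in> carrier ?C" "b \<in> carrier ?C" using that D0C by auto
      then have "a \<otimes>\<^bsub>?C\<^esub> b \<in> D0" using C.mult_closed D.br_in_Car e(5) by (simp add: D0_def)
      then show ?thesis using \<Xi>\<Theta>[of "a \<otimes>\<^bsub>?C\<^esub> b"] e(5)[OF ab] by simp
    qed
    have pt: "\<Xi> ` D.Par p = part ?C p \<inter> D0" for p
      unfolding imp[symmetric] image_image using \<Xi>\<Theta> by auto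
    show ?thesis
      unfolding superalgebra_epi_def Es D.alg_simps zD(2) pt
      unfolding im[symmetric] by (simp add: ap as am \<Xi>\<Theta>)
  qed
  have Ebil: "bilinear_superalgebra E"
    by (rule bilinear_superalgebra.epi_image[OF D.alg_bilinear epiI]) (simp add: zD)
  define \<kappa> where "\<kappa> = reduce \<circ> \<Theta>"
  have epik: "superalgebra_epi E Q.alg \<kappa>"
    unfolding \<kappa>_def by (rule superalgebra_epi_comp[OF epiE reduce_epi])
  have cker: "center E = epi_kernel E Q.alg \<kappa>"
  proof -
    have "(\<forall>x\<in>D0. u \<otimes>\<^bsub>?C\<^esub> x = zero ?C) \<longleftrightarrow> \<kappa> u = 0" if u: "u \<in> D0" for u
    proof -
      have uc: "u \<in> carrier ?C" using u D0C by auto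
      have "(\<forall>x\<in>D0. u \<otimes>\<^bsub>?C\<^esub> x = zero ?C) \<longleftrightarrow> (\<forall>x\<in>D0. br (\<Theta> u) (\<Theta> x) = 0)"
      proof (intro ball_cong refl)
        fix x assume "x \<in> D0"
        then have xc: "x \<in> carrier ?C" using D0C by auto
        have "u \<otimes>\<^bsub>?C\<^esub> x = zero ?C \<longleftrightarrow> \<Theta> (u \<otimes>\<^bsub>?C\<^esub> x) = \<Theta> (zero ?C)"
          by (rule inj_on_eq_iff[OF \<Theta>(2) C.mult_closed[OF uc xc] C.M.zero_closed, symmetric])
        then show "u \<otimes>\<^bsub>?C\<^esub> x = zero ?C \<longleftrightarrow> br (\<Theta> u) (\<Theta> x) = 0" using e(5)[OF uc xc] z(1) by simp
      qed
      also have "\<dots> \<longleftrightarrow> (\<forall>w\<in>D.Car. br (\<Theta> u) w = 0)" unfolding im[symmetric] by blast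
      also have "\<dots> \<longleftrightarrow> reduce (\<Theta> u) = 0" by (rule center_iff) (use u in \<open>simp add: D0_def\<close>)
      finally show ?thesis by (simp add: \<kappa>_def)
    qed
    then show ?thesis unfolding center_def epi_kernel_def Es Q.alg_simps by blast
  qed
  have idE: "superalgebra_ideal (center E) E"
    unfolding cker by (rule epi_kernel_ideal[OF Ebil Q.alg_bilinear epik])
  interpret K: superalgebra_with_ideal E "center E"
    by (intro superalgebra_with_ideal.intro superalgebra_with_ideal_axioms.intro idE Ebil)
  obtain \<theta> where \<theta>: "superalgebra_epi (superalgebra_quotient E (center E)) Q.alg \<theta>"
    "\<And>x. x \<in> carrier E \<Longrightarrow> \<theta> (center E +>\<^bsub>E\<^esub> x) = \<kappa> x"
    "center E = epi_kernel E Q.alg \<kappa> \<Longrightarrow> inj_on \<theta> (carrier (superalgebra_quotient E (center E)))"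
    using K.quotient_factor[OF Q.alg_bilinear epik] cker by blast
  have ce: "chevalley_e gpar sc h \<alpha> i \<in> carrier E" for i
    using \<Theta>(4,5) rv_in_DCar[OF simple_root] by (simp add: Es D0_def)
  have ke: "\<kappa> (chevalley_e gpar sc h \<alpha> i) = Q.rv (axis i 1) 1" for i
    by (rule Q.pair_eqI) (simp_all add: \<kappa>_def \<Theta>(5) reduce_def vec_eq_iff snd_rv Q.snd_rv)
  have one: "one_dimensional E (center E)"
  proof -
    \<comment> \<open>\<open>v\<close> spans the left kernel of the Cartan matrix over the field.
      The combination of the h_i with these coefficients is annihilated by every \<alpha> j and
      spans the center.\<close>
    obtain v where v: "\<exists>i. v i \<noteq> 0" "\<And>w. (\<forall>j. (\<Sum>i\<in>UNIV. w i * of_int (A $ i $ j)) = 0)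
       \<longleftrightarrow> (\<exists>k::'k. w = (\<lambda>i. k * v i))"
      using kernel_line by blast
    define t where "t = (\<Sum>i\<in>UNIV. sc (v i) (h i))"
    have tH: "t \<in> span (range h)" unfolding t_def span_h by blast
    have t0: "t \<noteq> 0" using v(1) independent_h unfolding t_def by blast
    have "cart t \<in> \<Theta> ` D0" unfolding im by (rule D.cart_in_Car[OF tH])
    then obtain \<zeta> where \<zeta>: "\<zeta> \<in> D0" "\<Theta> \<zeta> = cart t" by force
    have ker: "reduce u = 0 \<longleftrightarrow> (\<exists>k. u = smul k (cart t))" if u: "u \<in> D.Car" for u
    proof
      assume r: "reduce u = 0"
      have "snd (reduce u) = snd 0" "fst (reduce u) = fst 0" using r by simp_all
      then have a: "snd u = 0" "\<And>j. \<alpha> j (fst u) = 0" by (simp_all add: reduce_def vec_eq_iff)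
      obtain w where w: "fst u = (\<Sum>i\<in>UNIV. sc (w i) (h i))" using u span_h by (auto simp: D.Car_def)
      then have "\<forall>j. (\<Sum>i\<in>UNIV. w i * of_int (A $ i $ j)) = 0" using a(2) by (simp add: \<alpha>_h)
      then obtain k where "w = (\<lambda>i. k * v i)" using v(2) by blast
      then have "fst u = sc k t" by (simp add: w t_def scale_sum_right)
      then have "u = smul k (cart t)" by (intro pair_eqI) (simp_all add: a smul_def)
      then show "\<exists>k. u = smul k (cart t)" by blast
    next
      assume "\<exists>k. u = smul k (cart t)"
      then obtain k where k: "u = smul k (cart t)" by blast
      have "\<forall>j. (\<Sum>i\<in>UNIV. v i * of_int (A $ i $ j)) = 0" using v(2)[of v] by (auto intro: exI[of _ 1])
      then have "\<alpha> j t = 0" for j by (simp add: t_def \<alpha>_h)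
      then show "reduce u = 0" unfolding k
        by (intro Q.pair_eqI) (simp_all add: reduce_def smul_def vec_eq_iff)
    qed
    have "center E = {k \<odot>\<^bsub>E\<^esub> \<zeta> | k. True}"
    proof -
      have "u \<in> center E \<longleftrightarrow> (\<exists>k. u = k \<odot>\<^bsub>?C\<^esub> \<zeta>)" for u
      proof
        assume "u \<in> center E"
        then have u: "u \<in> D0" "reduce (\<Theta> u) = 0" unfolding cker epi_kernel_def Es \<kappa>_def by simp_all
        then obtain k where "\<Theta> u = smul k (cart t)" using ker by (auto simp: D0_def)
        moreover have "\<zeta> \<in> carrier ?C" using \<zeta> D0C by auto
        ultimately have "\<Theta> u = \<Theta> (k \<odot>\<^bsub>?C\<^esub> \<zeta>)" using \<zeta> e(4) by simp
        then have "u = k \<odot>\<^bsub>?C\<^esub> \<zeta>" by (rule inj_onD[OF injD _ u(1) C.submoduleD(4)[OF D0sub \<zeta>(1)]])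
        then show "\<exists>k. u = k \<odot>\<^bsub>?C\<^esub> \<zeta>" by blast
      next
        assume "\<exists>k. u = k \<odot>\<^bsub>?C\<^esub> \<zeta>"
        then obtain k where k: "u = k \<odot>\<^bsub>?C\<^esub> \<zeta>" by blast
        have u: "u \<in> D0" unfolding k by (rule C.submoduleD(4)[OF D0sub \<zeta>(1)])
        have "\<zeta> \<in> carrier ?C" using \<zeta> D0C by auto
        then have "\<Theta> u = smul k (cart t)" using \<zeta> e(4) k by simp
        moreover have "\<Theta> u \<in> D.Car" using u by (simp add: D0_def)
        ultimately have "reduce (\<Theta> u) = 0" using ker by blast
        then show "u \<in> center E" using u unfolding cker epi_kernel_def Es \<kappa>_def by simp
      qed
      then show ?thesis unfolding Es by blast
    qed
    moreover have "\<zeta> \<noteq> zero E"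
    proof
      assume "\<zeta> = zero E"
      then have "cart t = 0" using \<zeta>(2) z(1) Es(4) by simp
      then show False using t0 by (metis fst_cart fst_zero)
    qed
    ultimately show ?thesis unfolding one_dimensional_def using \<zeta>(1) Es(1) by blast
  qed
  show thesis
  proof (rule that[of \<theta>])
    show "superalgebra_epi (superalgebra_quotient E (center E)) Q.alg \<theta>" by (rule \<theta>(1))
    show "inj_on \<theta> (carrier (superalgebra_quotient E (center E)))" by (rule \<theta>(3)[OF cker])
    show "bilinear_superalgebra (superalgebra_quotient E (center E))" by (rule K.quotient_bilinear)
    show "one_dimensional E (center E)" by (rule one)
    show "chevalley_e gpar sc h \<alpha> i \<in> carrier E" for i by (rule ce)
    show "center E +>\<^bsub>E\<^esub> chevalley_e gpar sc h \<alpha> i \<in> carrier (superalgebra_quotient E (center E))" for i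
      unfolding K.quotient_simps(1) using ce by blast
    show "\<theta> (center E +>\<^bsub>E\<^esub> chevalley_e gpar sc h \<alpha> i) = Q.rv (axis i 1) 1" for i
      unfolding \<theta>(2)[OF ce] by (rule ke)
  qed
qed

end

section \<open>Semisimplification described by kernels and images of the derivation\<close>

section \<open>Independence of the Jordan decomposition\<close>

text \<open>\<open>\<theta>\<close> identifies \<open>L\<close> with a subspace \<open>C\<close> of a vector space type, where \<open>d\<close> becomes \<open>D\<close>.\<close>

locale jordan_transfer = vector_space s + bilinear_superalgebra L
  for s :: "'k::field \<Rightarrow> 'w::ab_group_add \<Rightarrow> 'w" and L :: "('k, 'a, 'm) superalgebra_scheme" (structure) +
  fixes d :: "'a \<Rightarrow> 'a" and \<theta> :: "'a \<Rightarrow> 'w" and C :: "'w set" and br :: "'w \<Rightarrow> 'w \<Rightarrow> 'w" and D :: "'w \<Rightarrow> 'w"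
  assumes C_subspace: "subspace C" and \<theta>_image: "\<theta> ` carrier L = C" and \<theta>_inj: "inj_on \<theta> (carrier L)"
    and \<theta>_add: "\<lbrakk>x \<in> carrier L; y \<in> carrier L\<rbrakk> \<Longrightarrow> \<theta> (x \<oplus> y) = \<theta> x + \<theta> y"
    and \<theta>_smult: "x \<in> carrier L \<Longrightarrow> \<theta> (k \<odot>\<^bsub>L\<^esub> x) = s k (\<theta> x)"
    and \<theta>_mult: "\<lbrakk>x \<in> carrier L; y \<in> carrier L\<rbrakk> \<Longrightarrow> \<theta> (x \<otimes> y) = br (\<theta> x) (\<theta> y)"
    and d_closed: "x \<in> carrier L \<Longrightarrow> d x \<in> carrier L"
    and \<theta>_d: "x \<in> carrier L \<Longrightarrow> \<theta> (d x) = D (\<theta> x)"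
    and D_add: "D (u + v) = D u + D v" and D_scale: "D (s k u) = s k (D u)"
    and D_derivation: "\<lbrakk>u \<in> C; v \<in> C\<rbrakk> \<Longrightarrow> D (br u v) = br (D u) v + br u (D v)"
    and D_cube: "u \<in> C \<Longrightarrow> D (D (D u)) = 0"
    and br_zero: "br 0 u = 0" "br u 0 = 0"
begin

lemma \<theta>_C: "x \<in> carrier L \<Longrightarrow> \<theta> x \<in> C" using \<theta>_image by blast

lemma \<theta>_zero: "\<theta> \<zero> = 0"
  using \<theta>_smult[of \<zero> 0] smult_l_null[of \<zero>] by simp

lemma \<theta>_minus: "x \<in> carrier L \<Longrightarrow> \<theta> (\<ominus> x) = - \<theta> x"
  by (simp add: minus_eq_smult \<theta>_smult)

lemma D_zero: "D 0 = 0" using D_scale[of 0 0] by simp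

lemma D_minus: "D (- u) = - D u" using D_scale[of "-1" u] by simp

lemma D_sum: "D (sum f S) = (\<Sum>i\<in>S. D (f i))"
  by (induction S rule: infinite_finite_induct) (simp_all add: D_zero D_add)

lemma D_C: "u \<in> C \<Longrightarrow> D u \<in> C"
proof -
  assume "u \<in> C"
  then obtain x where "x \<in> carrier L" "u = \<theta> x" unfolding \<theta>_image[symmetric] by blast
  then show ?thesis using \<theta>_d \<theta>_C d_closed by metis
qed

lemma D_pow_C: "u \<in> C \<Longrightarrow> (D ^^ n) u \<in> C"
  by (induction n) (simp_all add: D_C)

lemma br_C: "u \<in> C \<Longrightarrow> v \<in> C \<Longrightarrow> br u v \<in> C"
proof -
  assume "u \<in> C" "v \<in> C"
  then obtain x y where "x \<in> carrier L" "u = \<theta> x" "y \<in> carrier L" "v = \<theta> y"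
    unfolding \<theta>_image[symmetric] by blast
  then show ?thesis using \<theta>_mult \<theta>_C mult_closed by metis
qed

lemma d_pow_closed: "x \<in> carrier L \<Longrightarrow> (d ^^ n) x \<in> carrier L"
  by (induction n) (simp_all add: d_closed)

lemma \<theta>_d_pow: "x \<in> carrier L \<Longrightarrow> \<theta> ((d ^^ n) x) = (D ^^ n) (\<theta> x)"
  by (induction n) (simp_all add: d_pow_closed \<theta>_d)

lemma \<theta>_finsum:
  assumes "finite S" "f \<in> S \<rightarrow> carrier L"
  shows "\<theta> (\<Oplus>i\<in>S. f i) = (\<Sum>i\<in>S. \<theta> (f i))"
  using assms
proof (induction S rule: finite_induct)
  case empty then show ?case by (simp add: \<theta>_zero)
next
  case (insert i S)
  then have f: "f \<in> S \<rightarrow> carrier L" "f i \<in> carrier L" by auto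
  then have "\<theta> (\<Oplus>i\<in>insert i S. f i) = \<theta> (f i \<oplus> (\<Oplus>i\<in>S. f i))"
    using insert(1,2) by (simp add: M.finsum_insert)
  also have "\<dots> = \<theta> (f i) + \<theta> (\<Oplus>i\<in>S. f i)" using f by (intro \<theta>_add) simp_all
  finally show ?case using insert f by simp
qed

lemma finite_jordan_index: "finite (jordan_index n1 n2 n3)"
  by (simp add: jordan_index_def)

definition coords :: "nat \<Rightarrow> nat \<Rightarrow> nat \<Rightarrow> (nat \<Rightarrow> 'w) \<Rightarrow> 'w \<Rightarrow> (nat \<times> nat \<Rightarrow> 'k) \<Rightarrow> bool" where
  "coords n1 n2 n3 V w c \<longleftrightarrow> (\<forall>p. p \<notin> jordan_index n1 n2 n3 \<longrightarrow> c p = 0) \<and>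
     w = (\<Sum>p\<in>jordan_index n1 n2 n3. s (c p) ((D ^^ snd p) (V (fst p))))"

definition jordan_basis :: "nat \<Rightarrow> nat \<Rightarrow> nat \<Rightarrow> (nat \<Rightarrow> 'w) \<Rightarrow> bool" where
  "jordan_basis n1 n2 n3 V \<longleftrightarrow>
     (\<forall>i\<in>{1..n1 + n2 + n3}. V i \<in> C \<and> (D ^^ block_size n1 n2 i) (V i) = 0) \<and>
     (\<forall>w\<in>C. \<exists>!c. coords n1 n2 n3 V w c)"

lemma is_coordinates_iff:
  assumes "\<And>i. i \<in> {1..n1 + n2 + n3} \<Longrightarrow> x i \<in> carrier L" "v \<in> carrier L"
  shows "is_coordinates L d n1 n2 n3 x v c \<longleftrightarrow> coords n1 n2 n3 (\<theta> \<circ> x) (\<theta> v) c"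
proof -
  let ?J = "jordan_index n1 n2 n3"
  have x: "x (fst p) \<in> carrier L" if "p \<in> ?J" for p using that assms(1) by (auto simp: jordan_index_def)
  let ?f = "\<lambda>p. c p \<odot>\<^bsub>L\<^esub> (d ^^ snd p) (x (fst p))"
  have f: "?f \<in> ?J \<rightarrow> carrier L" using x d_pow_closed smult_in by simp
  then have sum: "(\<Oplus>p\<in>?J. ?f p) \<in> carrier L" by (rule M.finsum_closed)
  have "\<theta> (\<Oplus>p\<in>?J. ?f p) = (\<Sum>p\<in>?J. \<theta> (?f p))" by (rule \<theta>_finsum[OF finite_jordan_index f])
  also have "\<dots> = (\<Sum>p\<in>?J. s (c p) ((D ^^ snd p) ((\<theta> \<circ> x) (fst p))))"
    by (rule sum.cong) (simp_all add: x d_pow_closed \<theta>_smult \<theta>_d_pow)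
  finally have e: "\<theta> (\<Oplus>p\<in>?J. ?f p) = (\<Sum>p\<in>?J. s (c p) ((D ^^ snd p) ((\<theta> \<circ> x) (fst p))))" .
  have "v = (\<Oplus>p\<in>?J. ?f p) \<longleftrightarrow> \<theta> v = \<theta> (\<Oplus>p\<in>?J. ?f p)"
    by (rule inj_on_eq_iff[OF \<theta>_inj assms(2) sum, symmetric])
  then show ?thesis unfolding is_coordinates_def coords_def e by simp
qed

lemma jordan_decomposition_iff:
  assumes "\<And>i. i \<in> {1..n1 + n2 + n3} \<Longrightarrow> x i \<in> carrier L"
  shows "jordan_decomposition L d n1 n2 n3 x \<longleftrightarrow> jordan_basis n1 n2 n3 (\<theta> \<circ> x)"
proof -
  have 1: "x i \<in> carrier L \<and> (d ^^ b) (x i) = \<zero> \<longleftrightarrow> (\<theta> \<circ> x) i \<in> C \<and> (D ^^ b) ((\<theta> \<circ> x) i) = 0"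
    if i: "i \<in> {1..n1 + n2 + n3}" for i b
  proof -
    have xi: "x i \<in> carrier L" by (rule assms[OF i])
    have "(d ^^ b) (x i) = \<zero> \<longleftrightarrow> \<theta> ((d ^^ b) (x i)) = \<theta> \<zero>"
      by (rule inj_on_eq_iff[OF \<theta>_inj d_pow_closed[OF xi] M.zero_closed, symmetric])
    then show ?thesis using xi \<theta>_C by (simp add: \<theta>_zero \<theta>_d_pow)
  qed
  have 2: "(\<forall>v\<in>carrier L. \<exists>!c. is_coordinates L d n1 n2 n3 x v c) \<longleftrightarrow> (\<forall>w\<in>C. \<exists>!c. coords n1 n2 n3 (\<theta> \<circ> x) w c)"
    unfolding \<theta>_image[symmetric] ball_simps(9)
    by (rule ball_cong[OF refl]) (simp only: is_coordinates_iff[OF assms])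
  show ?thesis unfolding jordan_decomposition_def jordan_basis_def 2
    by (intro conj_cong refl ball_cong 1)
qed

lemma jordan_decomposition_exists:
  assumes "jordan_basis n1 n2 n3 V"
  shows "\<exists>x. jordan_decomposition L d n1 n2 n3 x"
proof -
  let ?N = "{1..n1 + n2 + n3}"
  define x where "x = (\<lambda>i. the_inv_into (carrier L) \<theta> (V i))"
  have XC: "V i \<in> C" if "i \<in> ?N" for i using assms that by (simp add: jordan_basis_def)
  have x: "x i \<in> carrier L" "\<theta> (x i) = V i" if "i \<in> ?N" for i
    using the_inv_into_into[OF \<theta>_inj, of "V i"] f_the_inv_into_f[OF \<theta>_inj, of "V i"] XC[OF that]
    by (simp_all add: x_def \<theta>_image)
  have "coords n1 n2 n3 (\<theta> \<circ> x) w c \<longleftrightarrow> coords n1 n2 n3 V w c" for w c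
  proof -
    have "(\<Sum>p\<in>jordan_index n1 n2 n3. s (c p) ((D ^^ snd p) ((\<theta> \<circ> x) (fst p))))
      = (\<Sum>p\<in>jordan_index n1 n2 n3. s (c p) ((D ^^ snd p) (V (fst p))))"
      by (rule sum.cong) (auto simp: jordan_index_def x(2))
    then show ?thesis unfolding coords_def by simp
  qed
  then have "jordan_basis n1 n2 n3 (\<theta> \<circ> x)" using assms x by (simp add: jordan_basis_def)
  then show ?thesis using jordan_decomposition_iff[of n1 n2 n3 x] x(1) by blast
qed

end

text \<open>\<open>p\<close> realizes \<open>ker D / (ker D \<inter> im D)\<close> as the even part and \<open>q\<close> realizes
  \<open>ker D\<^sup>2 / (ker D + im D)\<close> as the odd part of \<open>T\<close>. These two quotients have bases given by the blocks of
  size 1 and of size 2.\<close>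

locale semisimple_model = jordan_transfer s L d \<theta> C br D + T: vector_space sT
  for s :: "'k::field \<Rightarrow> 'w::ab_group_add \<Rightarrow> 'w" and L :: "('k, 'a, 'm) superalgebra_scheme" (structure)
    and d \<theta> C br D and sT :: "'k \<Rightarrow> 't::ab_group_add \<Rightarrow> 't" +
  fixes CT :: "'t set" and bT :: "'t \<Rightarrow> 't \<Rightarrow> 't" and PT :: "bit \<Rightarrow> 't set" and p q :: "'w \<Rightarrow> 't"
  assumes PT_subspace: "T.subspace (PT i)"
    and CT_sum: "CT = {a + b | a b. a \<in> PT 0 \<and> b \<in> PT 1}" and PT_int: "PT 0 \<inter> PT 1 \<subseteq> {0}"
    and bT_add: "bT (a + b) e = bT a e + bT b e" "bT a (b + e) = bT a b + bT a e"
    and bT_scale: "bT (sT k a) b = sT k (bT a b)" "bT a (sT k b) = sT k (bT a b)"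
    and p_add: "p (u + v) = p u + p v" and p_scale: "p (s k u) = sT k (p u)"
    and q_add: "q (u + v) = q u + q v" and q_scale: "q (s k u) = sT k (q u)"
    and p_image: "p ` {u\<in>C. D u = 0} = PT 0" and q_image: "q ` {u\<in>C. D (D u) = 0} = PT 1"
    and p_kernel: "\<lbrakk>u \<in> C; D u = 0; p u = 0\<rbrakk> \<Longrightarrow> \<exists>v\<in>C. u = D v"
    and p_D: "\<lbrakk>u \<in> C; D (D u) = 0\<rbrakk> \<Longrightarrow> p (D u) = 0"
    and q_kernel: "\<lbrakk>u \<in> C; D (D u) = 0; q u = 0\<rbrakk> \<Longrightarrow> \<exists>v\<in>C. \<exists>w\<in>C. D v = 0 \<and> u = v + D w"
    and q_D: "u \<in> C \<Longrightarrow> q (D u) = 0" and q_ker_D: "\<lbrakk>u \<in> C; D u = 0\<rbrakk> \<Longrightarrow> q u = 0"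
    and br_pp: "\<lbrakk>u \<in> C; v \<in> C; D u = 0; D v = 0\<rbrakk> \<Longrightarrow> p (br u v) = bT (p u) (p v)"
    and br_pq: "\<lbrakk>u \<in> C; v \<in> C; D u = 0; D (D v) = 0\<rbrakk> \<Longrightarrow> q (br u v) = bT (p u) (q v)"
    and br_qp: "\<lbrakk>u \<in> C; v \<in> C; D (D u) = 0; D v = 0\<rbrakk> \<Longrightarrow> q (br u v) = bT (q u) (p v)"
    and br_qq: "\<lbrakk>u \<in> C; v \<in> C; D (D u) = 0; D (D v) = 0\<rbrakk> \<Longrightarrow> p (- br u (D v) + br (D u) v) = bT (q u) (q v)"
begin

lemma p_zero: "p 0 = 0" and q_zero: "q 0 = 0"
  using p_scale[of 0 0] q_scale[of 0 0] by simp_all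

lemma p_sum: "p (sum f S) = (\<Sum>i\<in>S. p (f i))" and q_sum: "q (sum f S) = (\<Sum>i\<in>S. q (f i))"
  by (induction S rule: infinite_finite_induct) (simp_all add: p_zero q_zero p_add q_add)

lemma bT_zero: "bT 0 a = 0" "bT a 0 = 0" using bT_scale[of 0 0] by (simp, metis T.scale_zero_left bT_scale(2))

lemma bT_sum: "bT (sum f S) a = (\<Sum>i\<in>S. bT (f i) a)" "bT a (sum f S) = (\<Sum>i\<in>S. bT a (f i))"
  by (induction S rule: infinite_finite_induct) (simp_all add: bT_zero bT_add)

text \<open>\<Psi> sends the basis vector of a block to the value of \<open>p\<close> (size 1) or of
  \<open>q\<close> (size 2) at the generator of the block. On the relevant kernels \<open>p\<close>
  and \<open>q\<close> depend only on the coordinates at \<open>(i, 0)\<close>, which are exactly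
  those recorded by \<open>semisimple_constant\<close>; hence the structure constants become the
  bracket \<open>bT\<close>.\<close>

theorem semisimplification_iso:
  assumes "jordan_decomposition L d n1 n2 n3 x"
  shows "superalgebra_isomorphic (semisimplification L d n1 n2 n3 x) (typed_superalgebra CT bT sT PT)"
proof -
  let ?J = "jordan_index n1 n2 n3"
  let ?N = "{1..n1 + n2 + n3}"
  let ?S = "semisimplification L d n1 n2 n3 x"
  define V where "V = \<theta> \<circ> x"
  have xL: "x i \<in> carrier L" if "i \<in> ?N" for i using assms that by (simp add: jordan_decomposition_def)
  then have jb: "jordan_basis n1 n2 n3 V"
    using jordan_decomposition_iff[of n1 n2 n3 x] assms by (simp add: V_def)
  have XC: "V i \<in> C" if "i \<in> ?N" for i using jb that by (simp add: jordan_basis_def)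
  have Xb: "(D ^^ block_size n1 n2 i) (V i) = 0" if "i \<in> ?N" for i using jb that by (simp add: jordan_basis_def)
  have X1: "D (V i) = 0" if "i \<in> {1..n1}" for i using Xb[of i] that by (simp add: block_size_def)
  have X2: "D (D (V i)) = 0" if "i \<in> {1..n1 + n2}" for i
    using Xb[of i] that D_zero by (cases "i \<le> n1") (simp_all add: block_size_def numeral_2_eq_2)
  define cf where "cf w = (THE c. coords n1 n2 n3 V w c)" for w
  have cf: "coords n1 n2 n3 V w (cf w)" if "w \<in> C" for w
    unfolding cf_def by (rule theI'[of "coords n1 n2 n3 V w"]) (use jb that in \<open>simp add: jordan_basis_def\<close>)
  have cf_unique: "cf w = c" if "w \<in> C" "coords n1 n2 n3 V w c" for w c
    using jb cf that by (auto simp: jordan_basis_def)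
  have cf_out: "cf w r = 0" if "w \<in> C" "r \<notin> ?J" for w r
    using cf[OF that(1)] that(2) unfolding coords_def by blast
  have cf_exp: "w = (\<Sum>r\<in>?J. s (cf w r) ((D ^^ snd r) (V (fst r))))" if "w \<in> C" for w
    using cf[OF that] by (simp add: coords_def)
  have cf_add: "cf (u + v) r = cf u r + cf v r" if "u \<in> C" "v \<in> C" for u v r
  proof -
    have "coords n1 n2 n3 V (u + v) (\<lambda>r. cf u r + cf v r)"
      unfolding coords_def
    proof (intro conjI allI impI)
      show "u + v = (\<Sum>r\<in>?J. s (cf u r + cf v r) ((D ^^ snd r) (V (fst r))))"
        unfolding scale_left_distrib sum.distrib using cf_exp[OF that(1)] cf_exp[OF that(2)] by simp
    qed (simp add: cf_out that)
    then show ?thesis using cf_unique[OF subspace_add[OF C_subspace that]] by simp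
  qed
  have cf_zero: "cf 0 r = 0" for r
    using cf_add[OF subspace_0[OF C_subspace] subspace_0[OF C_subspace], of r]
    by (metis add.right_neutral add_left_cancel)
  have J_in: "fst r \<in> ?N" "snd r < block_size n1 n2 (fst r)" if "r \<in> ?J" for r
    using that by (auto simp: jordan_index_def)
  \<comment> \<open>In a Jordan basis D shifts the coordinates by one place within each block and
    puts 0 at the generator.\<close>
  have cf_D: "cf (D w) (i, l) = (if (i, l) \<in> ?J \<and> 0 < l then cf w (i, l - 1) else 0)" if w: "w \<in> C" for w i l
  proof -
    let ?c = "\<lambda>(i, l). if (i, l) \<in> ?J \<and> 0 < l then cf w (i, l - 1) else 0"
    have blk: "(\<Sum>l<b. s (f l) ((D ^^ Suc l) y)) = (\<Sum>l<b. s (if 0 < l then f (l - 1) else 0) ((D ^^ l) y))"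
      if "(D ^^ b) y = 0" for b f y
    proof (cases b)
      case (Suc b')
      have "(\<Sum>l<b. s (f l) ((D ^^ Suc l) y)) = (\<Sum>l<b'. s (f l) ((D ^^ Suc l) y))"
        using that Suc by simp
      also have "\<dots> = (\<Sum>l<b. s (if 0 < l then f (l - 1) else 0) ((D ^^ l) y))"
        unfolding Suc sum.lessThan_Suc_shift by simp
      finally show ?thesis .
    qed simp
    have "D w = D (\<Sum>r\<in>?J. s (cf w r) ((D ^^ snd r) (V (fst r))))" using cf_exp[OF w] by simp
    also have "\<dots> = (\<Sum>r\<in>?J. s (cf w r) ((D ^^ Suc (snd r)) (V (fst r))))"
      by (simp add: D_sum D_scale)
    also have "\<dots> = (\<Sum>i\<in>?N. \<Sum>l<block_size n1 n2 i. s (cf w (i, l)) ((D ^^ Suc l) (V i)))"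
      unfolding jordan_index_def by (subst sum.Sigma) (auto intro: sum.cong)
    also have "\<dots> = (\<Sum>i\<in>?N. \<Sum>l<block_size n1 n2 i. s (if 0 < l then cf w (i, l - 1) else 0) ((D ^^ l) (V i)))"
      by (rule sum.cong[OF refl], rule blk, rule Xb)
    also have "\<dots> = (\<Sum>i\<in>?N. \<Sum>l<block_size n1 n2 i. s (?c (i, l)) ((D ^^ l) (V i)))"
      by (intro sum.cong refl) (simp add: jordan_index_def)
    also have "\<dots> = (\<Sum>r\<in>?J. s (?c r) ((D ^^ snd r) (V (fst r))))"
      unfolding jordan_index_def by (subst sum.Sigma) (auto intro: sum.cong)
    finally have "coords n1 n2 n3 V (D w) ?c" unfolding coords_def by auto
    from cf_unique[OF D_C[OF w] this] show ?thesis by simp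
  qed
  \<comment> \<open>If D w = 0, a coordinate that is not the last one of its block vanishes, since D
    w shows it one place further. The last vector of a block of size at least 2 has the form D u
    with D (D u) = 0 and is killed by \<open>p\<close>.\<close>
  have p_exp: "p w = (\<Sum>i\<in>{1..n1}. sT (cf w (i, 0)) (p (V i)))" if w: "w \<in> C" "D w = 0" for w
  proof -
    let ?K = "(\<lambda>i. (i, 0::nat)) ` {1..n1}"
    have K: "?K \<subseteq> ?J" by (auto simp: jordan_index_def block_size_def)
    have "p w = p (\<Sum>r\<in>?J. s (cf w r) ((D ^^ snd r) (V (fst r))))" using cf_exp[OF w(1)] by simp
    also have "\<dots> = (\<Sum>r\<in>?J. sT (cf w r) (p ((D ^^ snd r) (V (fst r)))))" by (simp add: p_sum p_scale)
    also have "\<dots> = (\<Sum>r\<in>?K. sT (cf w r) (p ((D ^^ snd r) (V (fst r)))))"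
    proof (rule sum.mono_neutral_right[OF finite_jordan_index K], rule ballI)
      fix r assume r: "r \<in> ?J - ?K"
      obtain i l where il: "r = (i, l)" by (cases r)
      have i: "i \<in> ?N" "l < block_size n1 n2 i" using J_in[of r] r il by auto
      have n1: "n1 < i"
      proof (rule ccontr)
        assume "\<not> n1 < i"
        then have "i \<in> {1..n1}" "l = 0" using i by (auto simp: block_size_def)
        then show False using r il by blast
      qed
      show "sT (cf w r) (p ((D ^^ snd r) (V (fst r)))) = 0"
      proof (cases "Suc l < block_size n1 n2 i")
        case True
        then have "(i, Suc l) \<in> ?J" using i by (simp add: jordan_index_def)
        then have "cf (D w) (i, Suc l) = cf w (i, l)" using cf_D[OF w(1)] by simp
        moreover have "cf (D w) (i, Suc l) = 0"
          by (simp add: w(2) cf_zero) 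
        ultimately show ?thesis by (simp add: il)
      next
        case False
        then have b: "block_size n1 n2 i = Suc l" using i by simp
        then obtain m where m: "l = Suc m" using n1 by (cases l) (auto simp: block_size_def split: if_splits)
        have v: "(D ^^ m) (V i) \<in> C" by (rule D_pow_C[OF XC[OF i(1)]])
        have "D (D ((D ^^ m) (V i))) = 0" using Xb[OF i(1)] b m by simp
        from p_D[OF v this] show ?thesis by (simp add: il m)
      qed
    qed
    also have "\<dots> = (\<Sum>i\<in>{1..n1}. sT (cf w (i, 0)) (p (V i)))"
      by (subst sum.reindex) (auto simp: inj_on_def)
    finally show ?thesis .
  qed
  \<comment> \<open>Vectors after the generator of a block are in the image of D and generators of
    blocks of size 1 in its kernel, so \<open>q\<close> kills them. The coordinate at the generator
    of a block of size 3 reappears in D (D w) = 0.\<close>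
  have q_exp: "q w = (\<Sum>i\<in>{n1 + 1..n1 + n2}. sT (cf w (i, 0)) (q (V i)))" if w: "w \<in> C" "D (D w) = 0" for w
  proof -
    let ?K = "(\<lambda>i. (i, 0::nat)) ` {n1 + 1..n1 + n2}"
    have K: "?K \<subseteq> ?J" by (auto simp: jordan_index_def block_size_def)
    have "q w = q (\<Sum>r\<in>?J. s (cf w r) ((D ^^ snd r) (V (fst r))))" using cf_exp[OF w(1)] by simp
    also have "\<dots> = (\<Sum>r\<in>?J. sT (cf w r) (q ((D ^^ snd r) (V (fst r)))))" by (simp add: q_sum q_scale)
    also have "\<dots> = (\<Sum>r\<in>?K. sT (cf w r) (q ((D ^^ snd r) (V (fst r)))))"
    proof (rule sum.mono_neutral_right[OF finite_jordan_index K], rule ballI)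
      fix r assume r: "r \<in> ?J - ?K"
      obtain i l where il: "r = (i, l)" by (cases r)
      have i: "i \<in> ?N" "l < block_size n1 n2 i" using J_in[of r] r il by auto
      show "sT (cf w r) (q ((D ^^ snd r) (V (fst r)))) = 0"
      proof (cases l)
        case (Suc m)
        have v: "(D ^^ m) (V i) \<in> C" by (rule D_pow_C[OF XC[OF i(1)]])
        from q_D[OF v] show ?thesis by (simp add: il Suc)
      next
        case 0
        show ?thesis
        proof (cases "i \<le> n1")
          case True
          then have "q (V i) = 0" using i X1[of i] XC[OF i(1)] by (intro q_ker_D) simp_all
          then show ?thesis by (simp add: il 0)
        next
          case False
          then have n: "n1 + n2 < i" using r il 0 i by force
          then have J: "(i, 1) \<in> ?J" "(i, 2) \<in> ?J" using i by (auto simp: jordan_index_def block_size_def)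
          have "cf (D (D w)) (i, 2) = cf w (i, 0)"
            using cf_D[OF D_C[OF w(1)], of i 2] cf_D[OF w(1), of i 1] J by simp
          moreover have "cf (D (D w)) (i, 2) = 0"
            by (simp add: w(2) cf_zero)
          ultimately show ?thesis by (simp add: il 0)
        qed
      qed
    qed
    also have "\<dots> = (\<Sum>i\<in>{n1 + 1..n1 + n2}. sT (cf w (i, 0)) (q (V i)))"
      by (subst sum.reindex) (auto simp: inj_on_def)
    finally show ?thesis .
  qed
  define Y where "Y i = (if i \<le> n1 then p (V i) else q (V i))" for i
  define \<Psi> where "\<Psi> y = (\<Sum>i\<in>{1..n1 + n2}. sT (y i) (Y i))" for y
  have split: "(\<Sum>i\<in>{1..n1 + n2}. f i) = (\<Sum>i\<in>{1..n1}. f i) + (\<Sum>i\<in>{n1 + 1..n1 + n2}. f i)" for f :: "nat \<Rightarrow> 't"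
    by (subst sum.ub_add_nat[of 1 n1 f n2, symmetric]) simp_all
  define W0 where "W0 y = (\<Sum>i\<in>{1..n1}. s (y i) (V i))" for y
  define W1 where "W1 y = (\<Sum>i\<in>{n1 + 1..n1 + n2}. s (y i) (V i))" for y
  have W0C: "W0 y \<in> C" and W1C: "W1 y \<in> C" for y
    unfolding W0_def W1_def by (intro subspace_sum C_subspace subspace_scale XC; simp)+
  have DW0: "D (W0 y) = 0" for y by (simp add: W0_def D_sum D_scale X1)
  have DW1: "D (D (W1 y)) = 0" for y by (simp add: W1_def D_sum D_scale X2)
  have pW0: "p (W0 y) = (\<Sum>i\<in>{1..n1}. sT (y i) (Y i))" for y by (simp add: W0_def p_sum p_scale Y_def)
  have qW1: "q (W1 y) = (\<Sum>i\<in>{n1 + 1..n1 + n2}. sT (y i) (Y i))" for y by (simp add: W1_def q_sum q_scale Y_def)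
  have \<Psi>_split: "\<Psi> y = p (W0 y) + q (W1 y)" for y unfolding \<Psi>_def pW0 qW1 by (rule split)
  have pP: "p u \<in> PT 0" if "u \<in> C" "D u = 0" for u using p_image that by blast
  have qP: "q u \<in> PT 1" if "u \<in> C" "D (D u) = 0" for u using q_image that by blast
  have cfW: "cf (\<Sum>i\<in>S. s (y i) (V i)) (i, l) = (if i \<in> S \<and> l = 0 then y i else 0)"
    if S: "S \<subseteq> ?N" for S y i l
  proof -
    let ?c = "\<lambda>(i, l::nat). if i \<in> S \<and> l = 0 then y i else 0"
    have fS: "finite S" using S by (rule finite_subset) simp
    let ?K = "(\<lambda>i. (i, 0::nat)) ` S"
    have K: "?K \<subseteq> ?J" using S by (auto simp: jordan_index_def block_size_def)
    have "(\<Sum>r\<in>?J. s (?c r) ((D ^^ snd r) (V (fst r)))) = (\<Sum>r\<in>?K. s (?c r) ((D ^^ snd r) (V (fst r))))"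
      by (rule sum.mono_neutral_right[OF finite_jordan_index K]) auto
    also have "\<dots> = (\<Sum>i\<in>S. s (y i) (V i))" by (subst sum.reindex) (auto simp: inj_on_def)
    finally have "coords n1 n2 n3 V (\<Sum>i\<in>S. s (y i) (V i)) ?c"
      using K unfolding coords_def by (auto split: if_splits)
    moreover have "(\<Sum>i\<in>S. s (y i) (V i)) \<in> C"
      by (intro subspace_sum C_subspace subspace_scale XC) (use S in blast)
    ultimately have "cf (\<Sum>i\<in>S. s (y i) (V i)) = ?c" by (intro cf_unique)
    then show ?thesis by simp
  qed
  have cfW0: "cf (W0 y) (i, 0) = y i" if "i \<in> {1..n1}" for y i
    unfolding W0_def using cfW[of "{1..n1}" y i 0] that by simp
  have cfW1: "cf (W1 y) (i, 0) = y i" if "i \<in> {n1 + 1..n1 + n2}" for y i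
    unfolding W1_def using cfW[of "{n1 + 1..n1 + n2}" y i 0] that by simp
  \<comment> \<open>The values of \<open>p\<close> and \<open>q\<close> lie in parts with trivial
    intersection and so vanish separately. By the kernel conditions the combination of generators
    lies in im D, or in ker D + im D for blocks of size 2, where the coordinates at these generators
    are zero.\<close>
  have \<Psi>_inj: "y i = 0" if \<Psi>: "\<Psi> y = 0" and i: "i \<in> {1..n1 + n2}" for y i
  proof -
    have "p (W0 y) = - q (W1 y)" using \<Psi> \<Psi>_split[of y] by (simp add: eq_neg_iff_add_eq_0)
    moreover have "- q (W1 y) \<in> PT 1" by (intro T.subspace_neg PT_subspace qP W1C DW1)
    moreover have "p (W0 y) \<in> PT 0" by (intro pP W0C DW0)
    ultimately have "p (W0 y) \<in> PT 0 \<inter> PT 1" by simp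
    then have p0: "p (W0 y) = 0" using PT_int by blast
    then have q0: "q (W1 y) = 0" using \<Psi> \<Psi>_split[of y] by simp
    show ?thesis
    proof (cases "i \<le> n1")
      case True
      obtain v where "v \<in> C" "W0 y = D v" using p_kernel[OF W0C DW0 p0] by blast
      then have "cf (W0 y) (i, 0) = 0" using cf_D[of v i 0] by simp
      then show ?thesis using cfW0[of i y] True i by simp
    next
      case False
      obtain v w where v: "v \<in> C" "w \<in> C" "D v = 0" "W1 y = v + D w" using q_kernel[OF W1C DW1 q0] by blast
      have J: "(i, 1) \<in> ?J" using False i by (auto simp: jordan_index_def block_size_def)
      have "cf (D v) (i, 1) = cf v (i, 0)" using cf_D[OF v(1), of i 1] J by simp
      moreover have "cf (D v) (i, 1) = 0"
        by (simp add: v(3) cf_zero)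
      ultimately have "cf v (i, 0) = 0" by simp
      then have "cf (W1 y) (i, 0) = 0"
        using cf_add[OF v(1) D_C[OF v(2)]] cf_D[OF v(2), of i 0] v(4) by simp
      then show ?thesis using cfW1[of i y] False i by simp
    qed
  qed
  have \<Psi>_add: "\<Psi> (\<lambda>i. y i + z i) = \<Psi> y + \<Psi> z" for y z
    by (simp add: \<Psi>_def T.scale_left_distrib sum.distrib)
  have \<Psi>_scale: "\<Psi> (\<lambda>i. k * y i) = sT k (\<Psi> y)" for k y
    by (simp add: \<Psi>_def T.scale_sum_right)
  have bp: "block_parity n1 i = 0 \<longleftrightarrow> i \<le> n1" "block_parity n1 i = 1 \<longleftrightarrow> n1 < i" for i by (auto simp: block_parity_def)
  have Ssimps: "carrier ?S = {y. \<forall>i. i \<notin> {1..n1 + n2} \<longrightarrow> y i = 0}" "add ?S = (\<lambda>y z i. y i + z i)"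
    "module.smult ?S = (\<lambda>c y i. c * y i)"
    "part ?S r = {y. \<forall>i. y i \<noteq> 0 \<longrightarrow> i \<in> {1..n1 + n2} \<and> block_parity n1 i = r}" for r
    by (simp_all add: semisimplification_def)
  have part0: "\<Psi> ` part ?S 0 = PT 0"
  proof
    show "\<Psi> ` part ?S 0 \<subseteq> PT 0"
    proof
      fix t assume "t \<in> \<Psi> ` part ?S 0"
      then obtain y where y: "t = \<Psi> y" "\<And>i. n1 < i \<Longrightarrow> y i = 0" using bp by (fastforce simp: Ssimps)
      have "W1 y = 0" unfolding W1_def by (rule sum.neutral) (simp add: y(2))
      then show "t \<in> PT 0" unfolding y(1) \<Psi>_split by (simp add: q_zero pP W0C DW0)
    qed
    show "PT 0 \<subseteq> \<Psi> ` part ?S 0"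
    proof
      fix t assume "t \<in> PT 0"
      then obtain u where u: "u \<in> C" "D u = 0" "t = p u" unfolding p_image[symmetric] by blast
      define y where "y i = (if i \<in> {1..n1} then cf u (i, 0) else 0)" for i
      have "\<Psi> y = (\<Sum>i\<in>{1..n1}. sT (y i) (Y i)) + (\<Sum>i\<in>{n1 + 1..n1 + n2}. sT (y i) (Y i))"
        unfolding \<Psi>_def by (rule split)
      also have "\<dots> = t" unfolding u(3) p_exp[OF u(1,2)] by (simp add: y_def Y_def)
      finally have "\<Psi> y = t" .
      moreover have "y \<in> part ?S 0" by (auto simp: Ssimps y_def bp)
      ultimately show "t \<in> \<Psi> ` part ?S 0" by blast
    qed
  qed
  have part1: "\<Psi> ` part ?S 1 = PT 1"
  proof
    show "\<Psi> ` part ?S 1 \<subseteq> PT 1"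
    proof
      fix t assume "t \<in> \<Psi> ` part ?S 1"
      then obtain y where y: "t = \<Psi> y" "\<And>i. i \<le> n1 \<Longrightarrow> y i = 0" using bp by (fastforce simp: Ssimps)
      have "W0 y = 0" unfolding W0_def by (rule sum.neutral) (simp add: y(2))
      then show "t \<in> PT 1" unfolding y(1) \<Psi>_split by (simp add: p_zero qP W1C DW1)
    qed
    show "PT 1 \<subseteq> \<Psi> ` part ?S 1"
    proof
      fix t assume "t \<in> PT 1"
      then obtain u where u: "u \<in> C" "D (D u) = 0" "t = q u" unfolding q_image[symmetric] by blast
      define y where "y i = (if i \<in> {n1 + 1..n1 + n2} then cf u (i, 0) else 0)" for i
      have "\<Psi> y = (\<Sum>i\<in>{1..n1}. sT (y i) (Y i)) + (\<Sum>i\<in>{n1 + 1..n1 + n2}. sT (y i) (Y i))"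
        unfolding \<Psi>_def by (rule split)
      also have "\<dots> = t" unfolding u(3) q_exp[OF u(1,2)] by (simp add: y_def Y_def)
      finally have "\<Psi> y = t" .
      moreover have "y \<in> part ?S 1" by (auto simp: Ssimps y_def bp)
      ultimately show "t \<in> \<Psi> ` part ?S 1" by blast
    qed
  qed
  have bij: "bij_betw \<Psi> (carrier ?S) CT"
    unfolding bij_betw_def
  proof
    show "inj_on \<Psi> (carrier ?S)"
    proof (rule inj_onI)
      fix y z assume yz: "y \<in> carrier ?S" "z \<in> carrier ?S" "\<Psi> y = \<Psi> z"
      have "\<Psi> (\<lambda>i. y i + (-1) * z i) = \<Psi> y + sT (-1) (\<Psi> z)" unfolding \<Psi>_add \<Psi>_scale ..
      then have "\<Psi> (\<lambda>i. y i + (-1) * z i) = 0" using yz(3) by simp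
      then have "y i + (-1) * z i = 0" if "i \<in> {1..n1 + n2}" for i using \<Psi>_inj that by blast
      moreover have "y i = z i" if "i \<notin> {1..n1 + n2}" for i using yz(1,2) that unfolding Ssimps by simp
      ultimately have "y i = z i" for i by (cases "i \<in> {1..n1 + n2}") auto
      then show "y = z" by (rule ext)
    qed
    show "\<Psi> ` carrier ?S = CT"
    proof
      show "\<Psi> ` carrier ?S \<subseteq> CT"
        using pP[OF W0C DW0] qP[OF W1C DW1] by (auto simp: CT_sum \<Psi>_split)
      show "CT \<subseteq> \<Psi> ` carrier ?S"
      proof
        fix t assume "t \<in> CT"
        then obtain a b where ab: "a \<in> PT 0" "b \<in> PT 1" "t = a + b" unfolding CT_sum by blast
        obtain y where y: "y \<in> part ?S 0" "a = \<Psi> y" using ab(1) part0 by blast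
        obtain z where z: "z \<in> part ?S 1" "b = \<Psi> z" using ab(2) part1 by blast
        have "t = \<Psi> (\<lambda>i. y i + z i)" unfolding ab(3) y(2) z(2) \<Psi>_add ..
        moreover have "(\<lambda>i. y i + z i) \<in> carrier ?S"
        proof -
          have "y i = 0" "z i = 0" if "i \<notin> {1..n1 + n2}" for i using y(1) z(1) that unfolding Ssimps by blast+
          then show ?thesis unfolding Ssimps by simp
        qed
        ultimately show "t \<in> \<Psi> ` carrier ?S" by blast
      qed
    qed
  qed
  have coef: "coefficient L d n1 n2 n3 x k v = cf (\<theta> v) (k, 0)" if "v \<in> carrier L" for k v
  proof -
    have "is_coordinates L d n1 n2 n3 x v = coords n1 n2 n3 V (\<theta> v)"
      unfolding V_def by (rule ext) (rule is_coordinates_iff[OF xL that])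
    then show ?thesis by (simp add: coefficient_def cf_def)
  qed
  have const: "(\<Sum>k\<in>{1..n1 + n2}. sT (semisimple_constant L d n1 n2 n3 x i j k) (Y k)) = bT (Y i) (Y j)"
    if i: "i \<in> {1..n1 + n2}" and j: "j \<in> {1..n1 + n2}" for i j
  proof -
    have xij: "x i \<in> carrier L" "x j \<in> carrier L" using i j xL by auto
    have Xij: "V i \<in> C" "V j \<in> C" using i j XC by auto
    have D2: "D (D (V i)) = 0" "D (D (V j)) = 0" using i j X2 by auto
    have Xth: "\<theta> (x i) = V i" "\<theta> (x j) = V j" by (simp_all add: V_def)
    let ?c = "semisimple_constant L d n1 n2 n3 x i j"
    have evens: "(\<Sum>k\<in>{1..n1 + n2}. sT (f k) (Y k)) = p w"
      if "w \<in> C" "D w = 0" "\<And>k. f k = (if k \<le> n1 then cf w (k, 0) else 0)" for f w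
      unfolding split p_exp[OF that(1,2)] by (simp add: that(3) Y_def)
    have odds: "(\<Sum>k\<in>{1..n1 + n2}. sT (f k) (Y k)) = q w"
      if "w \<in> C" "D (D w) = 0" "\<And>k. f k = (if k \<le> n1 then 0 else cf w (k, 0))" for f w
      unfolding split q_exp[OF that(1,2)] by (simp add: that(3) Y_def)
    have cm: "coefficient L d n1 n2 n3 x k (x i \<otimes> x j) = cf (br (V i) (V j)) (k, 0)" for k
      using coef[OF mult_closed[OF xij]] by (simp add: \<theta>_mult xij Xth)
    have brC: "br (V i) (V j) \<in> C" by (rule br_C[OF Xij])
    have Dbr: "D (br (V i) (V j)) = br (D (V i)) (V j) + br (V i) (D (V j))" by (rule D_derivation[OF Xij])
    consider "i \<le> n1" "j \<le> n1" | "i \<le> n1" "n1 < j" | "n1 < i" "j \<le> n1" | "n1 < i" "n1 < j" by linarith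
    then show ?thesis
    proof cases
      case 1
      then have D1: "D (V i) = 0" "D (V j) = 0" using X1 i j by auto
      have "(\<Sum>k\<in>{1..n1 + n2}. sT (?c k) (Y k)) = p (br (V i) (V j))"
        by (rule evens[OF brC]) (use 1 D1 in \<open>simp_all add: Dbr br_zero semisimple_constant_def block_parity_def cm\<close>)
      then show ?thesis using 1 br_pp[OF Xij D1] by (simp add: Y_def)
    next
      case 2
      then have D1: "D (V i) = 0" using X1 i by auto
      have "D (D (br (V i) (V j))) = 0"
        using D_derivation[OF Xij(1) D_C[OF Xij(2)]] by (simp add: Dbr D1 D2 br_zero)
      then have "(\<Sum>k\<in>{1..n1 + n2}. sT (?c k) (Y k)) = q (br (V i) (V j))"
        by (rule odds[OF brC]) (use 2 in \<open>simp add: semisimple_constant_def block_parity_def cm\<close>)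
      then show ?thesis using 2 br_pq[OF Xij D1 D2(2)] by (simp add: Y_def)
    next
      case 3
      then have D1: "D (V j) = 0" using X1 j by auto
      have "D (D (br (V i) (V j))) = 0"
        using D_derivation[OF D_C[OF Xij(1)] Xij(2)] by (simp add: Dbr D1 D2 br_zero)
      then have "(\<Sum>k\<in>{1..n1 + n2}. sT (?c k) (Y k)) = q (br (V i) (V j))"
        by (rule odds[OF brC]) (use 3 in \<open>simp add: semisimple_constant_def block_parity_def cm\<close>)
      then show ?thesis using 3 br_qp[OF Xij D2(1) D1] by (simp add: Y_def)
    next
      case 4
      \<comment> \<open>In D of this element the two brackets of D (V i) with D (V j) cancel and the
        other terms contain D (D (V i)) or D (D (V j)). So it lies in the kernel of D, where
        \<open>p\<close> can be evaluated.\<close>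
      let ?w = "- br (V i) (D (V j)) + br (D (V i)) (V j)"
      have wC: "?w \<in> C"
        by (intro subspace_add subspace_neg C_subspace br_C Xij D_C)
      have wD: "D ?w = 0"
        unfolding D_add D_minus D_derivation[OF Xij(1) D_C[OF Xij(2)]] D_derivation[OF D_C[OF Xij(1)] Xij(2)]
        by (simp add: D2 br_zero)
      have cl: "x i \<otimes> d (x j) \<in> carrier L" "d (x i) \<otimes> x j \<in> carrier L"
        using xij d_closed mult_closed by auto
      have "\<theta> ((\<ominus> (x i \<otimes> d (x j))) \<oplus> (d (x i) \<otimes> x j)) = ?w"
        using cl xij by (simp add: \<theta>_add \<theta>_minus \<theta>_mult d_closed \<theta>_d Xth)
      then have cw: "coefficient L d n1 n2 n3 x k ((\<ominus> (x i \<otimes> d (x j))) \<oplus> (d (x i) \<otimes> x j)) = cf ?w (k, 0)" for k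
        using coef cl by simp
      have "(\<Sum>k\<in>{1..n1 + n2}. sT (?c k) (Y k)) = p ?w"
        by (rule evens[OF wC wD]) (use 4 in \<open>simp add: semisimple_constant_def block_parity_def cw\<close>)
      then show ?thesis using 4 br_qq[OF Xij D2] by (simp add: Y_def)
    qed
  qed
  have hom: "\<Psi> (y \<otimes>\<^bsub>?S\<^esub> z) = bT (\<Psi> y) (\<Psi> z)" for y z
  proof -
    let ?M = "{1..n1 + n2}"
    let ?c = "semisimple_constant L d n1 n2 n3 x"
    have "\<Psi> (y \<otimes>\<^bsub>?S\<^esub> z) = (\<Sum>k\<in>?M. sT (\<Sum>i\<in>?M. \<Sum>j\<in>?M. y i * z j * ?c i j k) (Y k))"
      unfolding \<Psi>_def by (rule sum.cong) (simp_all add: semisimplification_def)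
    also have "\<dots> = (\<Sum>k\<in>?M. \<Sum>i\<in>?M. \<Sum>j\<in>?M. sT (y i * z j) (sT (?c i j k) (Y k)))"
      by (simp add: T.scale_sum_left)
    also have "\<dots> = (\<Sum>i\<in>?M. \<Sum>k\<in>?M. \<Sum>j\<in>?M. sT (y i * z j) (sT (?c i j k) (Y k)))"
      by (rule sum.swap)
    also have "\<dots> = (\<Sum>i\<in>?M. \<Sum>j\<in>?M. \<Sum>k\<in>?M. sT (y i * z j) (sT (?c i j k) (Y k)))"
      by (rule sum.cong[OF refl], rule sum.swap)
    also have "\<dots> = (\<Sum>i\<in>?M. \<Sum>j\<in>?M. sT (y i * z j) (bT (Y i) (Y j)))"
      by (intro sum.cong refl) (simp only: T.scale_sum_right[symmetric] const)
    also have "\<dots> = bT (\<Psi> y) (\<Psi> z)"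
      by (simp only: \<Psi>_def bT_sum(1), simp only: bT_sum(2) bT_scale T.scale_scale, simp add: mult.commute)
    finally show ?thesis .
  qed
  show ?thesis
    unfolding superalgebra_isomorphic_def
  proof (intro exI[of _ \<Psi>] conjI allI ballI)
    show "\<Psi> ` part ?S r = part (typed_superalgebra CT bT sT PT) r" for r
      using part0 part1 by (cases r) simp_all
  qed (use bij hom in \<open>simp_all add: Ssimps \<Psi>_add \<Psi>_scale\<close>)
qed

end

section \<open>Positive definiteness of the E6 form and finiteness of its roots\<close>

section \<open>The lattice of type \<open>E\<^sub>6\<close>\<close>

lemma exhaust_6:
  fixes x :: 6
  shows "x = 1 \<or> x = 2 \<or> x = 3 \<or> x = 4 \<or> x = 5 \<or> x = 6"
proof (induct x)
  case (of_int z)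
  then have "0 \<le> z" and "z < 6" by simp_all
  then have "z = 0 \<or> z = 1 \<or> z = 2 \<or> z = 3 \<or> z = 4 \<or> z = 5" by arith
  then show ?case by auto
qed

lemma exhaust_5:
  fixes x :: 5
  shows "x = 1 \<or> x = 2 \<or> x = 3 \<or> x = 4 \<or> x = 5"
proof (induct x)
  case (of_int z)
  then have "0 \<le> z" and "z < 5" by simp_all
  then have "z = 0 \<or> z = 1 \<or> z = 2 \<or> z = 3 \<or> z = 4" by arith
  then show ?case by auto
qed

lemma UNIV_6: "UNIV = {1, 2, 3, 4, 5, 6 :: 6}" using exhaust_6 by auto
lemma UNIV_5: "UNIV = {1, 2, 3, 4, 5 :: 5}" using exhaust_5 by auto

lemma forall_6: "(\<forall>i::6. P i) \<longleftrightarrow> P 1 \<and> P 2 \<and> P 3 \<and> P 4 \<and> P 5 \<and> P 6"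
proof -
  have "(\<forall>i::6. P i) \<longleftrightarrow> (\<forall>i\<in>UNIV. P i)" by simp
  then show ?thesis unfolding UNIV_6 by simp
qed
lemma forall_5: "(\<forall>i::5. P i) \<longleftrightarrow> P 1 \<and> P 2 \<and> P 3 \<and> P 4 \<and> P 5"
proof -
  have "(\<forall>i::5. P i) \<longleftrightarrow> (\<forall>i\<in>UNIV. P i)" by simp
  then show ?thesis unfolding UNIV_5 by simp
qed

lemma sum_6: "sum f (UNIV :: 6 set) = f 1 + f 2 + f 3 + f 4 + f 5 + f 6"
  unfolding UNIV_6 by (simp add: ac_simps)
lemma sum_5: "sum f (UNIV :: 5 set) = f 1 + f 2 + f 3 + f 4 + f 5"
  unfolding UNIV_5 by (simp add: ac_simps)

lemma vector_6:
  "(vector [a, b, c, d, e, f] :: 'a::zero^6) $ 1 = a" "(vector [a, b, c, d, e, f] :: 'a::zero^6) $ 2 = b"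
  "(vector [a, b, c, d, e, f] :: 'a::zero^6) $ 3 = c" "(vector [a, b, c, d, e, f] :: 'a::zero^6) $ 4 = d"
  "(vector [a, b, c, d, e, f] :: 'a::zero^6) $ 5 = e" "(vector [a, b, c, d, e, f] :: 'a::zero^6) $ 6 = f"
  unfolding vector_def by simp_all

lemma vector_5:
  "(vector [a, b, c, d, e] :: 'a::zero^5) $ 1 = a" "(vector [a, b, c, d, e] :: 'a::zero^5) $ 2 = b"
  "(vector [a, b, c, d, e] :: 'a::zero^5) $ 3 = c" "(vector [a, b, c, d, e] :: 'a::zero^5) $ 4 = d"
  "(vector [a, b, c, d, e] :: 'a::zero^5) $ 5 = e"
  unfolding vector_def by simp_all

text \<open>A bilinear form with \<open>bil x y + bil y x = ip x y\<close>, the inner product; the sign \<open>(-1) ^ bil x y\<close> is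
  then a cocycle for the root lattice.\<close>

definition orientation :: "6 \<Rightarrow> 6 \<Rightarrow> int" where
  "orientation i j = (if i = j then 1
     else if (i, j) \<in> {(1, 3), (2, 4), (3, 4), (4, 5), (5, 6)} then - 1 else 0)"

definition bil :: "int^6 \<Rightarrow> int^6 \<Rightarrow> int" where
  "bil x y = (\<Sum>i\<in>UNIV. \<Sum>j\<in>UNIV. x $ i * y $ j * orientation i j)"

lemma bil_expand:
  "bil x y = x$1 * y$1 + x$2 * y$2 + x$3 * y$3 + x$4 * y$4 + x$5 * y$5 + x$6 * y$6
     - x$1 * y$3 - x$2 * y$4 - x$3 * y$4 - x$4 * y$5 - x$5 * y$6"
  by (simp add: bil_def sum_6 orientation_def)

definition ip :: "int^6 \<Rightarrow> int^6 \<Rightarrow> int" where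
  "ip x y = bil x y + bil y x"

lemma bil_simps: "bil (x + y) z = bil x z + bil y z" "bil x (y + z) = bil x y + bil x z"
  "bil (- x) z = - bil x z" "bil x (- z) = - bil x z" "bil 0 z = 0" "bil z 0 = 0"
  "bil (x - y) z = bil x z - bil y z" "bil x (y - z) = bil x y - bil x z"
  by (simp_all add: bil_def distrib_left distrib_right left_diff_distrib right_diff_distrib
      sum.distrib sum_negf sum_subtractf)

lemma ip_simps: "ip (x + y) z = ip x z + ip y z" "ip x (y + z) = ip x y + ip x z"
  "ip (- x) z = - ip x z" "ip x (- z) = - ip x z" "ip 0 z = 0" "ip z 0 = 0"
  "ip (x - y) z = ip x z - ip y z" "ip x (y - z) = ip x y - ip x z"
  by (simp_all add: ip_def bil_simps)

lemma ip_sym: "ip x y = ip y x" by (simp add: ip_def)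

text \<open>Squares are completed along the three arms of the diagram, from their ends towards the
  branch node 4. What is left for node 4 is 12 - 3 - 4 - 4 = 1, which is positive.\<close>

lemma bil_squares: "12 * bil x x = 3 * (2 * x$1 - x$3)\<^sup>2 + 3 * (2 * x$2 - x$4)\<^sup>2 + 3 * (2 * x$6 - x$5)\<^sup>2
    + (3 * x$3 - 2 * x$4)\<^sup>2 + (3 * x$5 - 2 * x$4)\<^sup>2 + (x$4)\<^sup>2"
  by (simp add: bil_expand power2_eq_square algebra_simps)

lemma bil_nonneg: "0 \<le> bil x x"
  using bil_squares[of x] zero_le_power2[of "2 * x$1 - x$3"] zero_le_power2[of "2 * x$2 - x$4"]
    zero_le_power2[of "2 * x$6 - x$5"] zero_le_power2[of "3 * x$3 - 2 * x$4"]
    zero_le_power2[of "3 * x$5 - 2 * x$4"] zero_le_power2[of "x$4"] by linarith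

lemma bil_zero: "bil x x = 0 \<Longrightarrow> x = 0"
proof -
  assume "bil x x = 0"
  then have s: "3 * (2 * x$1 - x$3)\<^sup>2 + 3 * (2 * x$2 - x$4)\<^sup>2 + 3 * (2 * x$6 - x$5)\<^sup>2
    + (3 * x$3 - 2 * x$4)\<^sup>2 + (3 * x$5 - 2 * x$4)\<^sup>2 + (x$4)\<^sup>2 = 0" using bil_squares[of x] by simp
  note nn = zero_le_power2[of "2 * x$1 - x$3"] zero_le_power2[of "2 * x$2 - x$4"] zero_le_power2[of "2 * x$6 - x$5"]
    zero_le_power2[of "3 * x$3 - 2 * x$4"] zero_le_power2[of "3 * x$5 - 2 * x$4"] zero_le_power2[of "x$4"]
  have "(2 * x$1 - x$3)\<^sup>2 = 0" "(2 * x$2 - x$4)\<^sup>2 = 0" "(2 * x$6 - x$5)\<^sup>2 = 0"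
    "(3 * x$3 - 2 * x$4)\<^sup>2 = 0" "(3 * x$5 - 2 * x$4)\<^sup>2 = 0" "(x$4)\<^sup>2 = 0"
    using s nn by linarith+
  then have "x$4 = 0" "x$3 = 0" "x$5 = 0" "x$1 = 0" "x$2 = 0" "x$6 = 0" by simp_all
  then show "x = 0" by (simp add: vec_eq_iff forall_6)
qed

lemma abs_le_of_square: "(z::int)\<^sup>2 \<le> 12 \<Longrightarrow> \<bar>z\<bar> \<le> 3"
proof (rule ccontr)
  assume "z\<^sup>2 \<le> 12" "\<not> \<bar>z\<bar> \<le> 3"
  then have "4 * 4 \<le> \<bar>z\<bar> * \<bar>z\<bar>" by (intro mult_mono) auto
  then show False using \<open>z\<^sup>2 \<le> 12\<close> by (simp add: power2_eq_square)
qed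

text \<open>Norm 1 bounds each square in \<open>bil_squares\<close> by 12, hence its base by 3 in
  absolute value. Going outwards from node 4, every coordinate is then at most 3 in absolute
  value.\<close>

lemma finite_bil: "finite {x. bil x x = 1}"
proof -
  have b: "x $ i \<in> {-3..3}" if "bil x x = 1" for x i
  proof -
    note nn = zero_le_power2[of "2 * x$1 - x$3"] zero_le_power2[of "2 * x$2 - x$4"] zero_le_power2[of "2 * x$6 - x$5"]
      zero_le_power2[of "3 * x$3 - 2 * x$4"] zero_le_power2[of "3 * x$5 - 2 * x$4"] zero_le_power2[of "x$4"]
    have "(2 * x$1 - x$3)\<^sup>2 \<le> 12" "(2 * x$2 - x$4)\<^sup>2 \<le> 12" "(2 * x$6 - x$5)\<^sup>2 \<le> 12"
      "(3 * x$3 - 2 * x$4)\<^sup>2 \<le> 12" "(3 * x$5 - 2 * x$4)\<^sup>2 \<le> 12" "(x$4)\<^sup>2 \<le> 12"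
      using bil_squares[of x] nn that by linarith+
    from this[THEN abs_le_of_square] have "\<forall>i. x $ i \<in> {-3..3}"
      unfolding forall_6 by auto
    then show ?thesis by blast
  qed
  have "{x. bil x x = 1} \<subseteq> vec_lambda ` (UNIV \<rightarrow>\<^sub>E {-3..3})"
  proof
    fix x assume "x \<in> {x. bil x x = 1}"
    then have "vec_nth x \<in> UNIV \<rightarrow>\<^sub>E {-3..3}" using b by auto
    then show "x \<in> vec_lambda ` (UNIV \<rightarrow>\<^sub>E {-3..3})" by (metis imageI vec_nth_inverse)
  qed
  then show ?thesis by (rule finite_subset) (intro finite_imageI finite_PiE; simp)
qed

section \<open>Sign cocycles and the Jacobi identity as a finite table\<close>

section \<open>Root data obtained from the lattice\<close>

definition msign :: "int \<Rightarrow> 'k::field" where "msign n = (if even n then 1 else - 1)"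

lemma msign_simps: "msign (m + n) = msign m * msign n" "msign (- n) = msign n" "msign 0 = 1" "msign 1 = - 1"
  "msign (m - n) = msign m * msign n" "msign n * msign n = 1" "msign n * (msign n * x) = x" "msign n \<noteq> 0"
  by (auto simp: msign_def)

definition eps :: "int^6 \<Rightarrow> int^6 \<Rightarrow> 'k::field" where "eps x y = msign (bil x y)"

lemma eps_simps: "eps (x + y) z = eps x z * eps y z" "eps x (y + z) = eps x y * eps x z"
  "eps (- x) z = eps x z" "eps x (- z) = eps x z" "eps 0 z = 1" "eps z 0 = 1" "eps x y \<noteq> 0"
  "eps x y * eps x y = 1" "eps x y * (eps x y * k) = k"
  by (simp_all add: eps_def bil_simps msign_simps)

lemma eps_swap: "eps y x = msign (ip x y) * eps x y"
  by (simp add: eps_def ip_def msign_def)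

text \<open>\<open>double_coeff\<close> without its sign: j is the inner product of the two inner
  roots corrected for parity, with - 1 meaning that their sum is a root and - 2 that it is zero; m
  stands for the pairing that occurs in the second case.\<close>

definition dbl :: "int \<Rightarrow> int \<Rightarrow> int" where
  "dbl j m = (if j = - 1 then 1 else if j = - 2 then - m else 0)"

definition isign :: "int \<Rightarrow> int" where "isign n = (if even n then 1 else - 1)"

text \<open>The Jacobi identity for root vectors of parities \<open>a\<close>, \<open>b\<close>, \<open>g\<close>, divided by their common sign,
  in terms of the inner products \<open>i\<close>, \<open>j\<close>, \<open>k\<close> of the three roots.\<close>

definition jacobi_check :: "int \<Rightarrow> int \<Rightarrow> int \<Rightarrow> int \<Rightarrow> int \<Rightarrow> bool" where
  "jacobi_check a b g i j = (let k = - 2 + a * b + b * g + a * g - a * b * g - i - j in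
     k \<le> 2 \<longrightarrow> - 2 \<le> i - a * b \<longrightarrow> - 2 \<le> j - b * g \<longrightarrow> - 2 \<le> k - a * g \<longrightarrow>
     (j - b * g = - 2 \<longrightarrow> b = g \<and> k = - i + a * b) \<longrightarrow>
     (i - a * b = - 2 \<longrightarrow> a = b \<and> j = - k + a * g) \<longrightarrow>
     (k - a * g = - 2 \<longrightarrow> a = g \<and> j = - i + a * b) \<longrightarrow>
     (dbl (j - b * g) (i + a * b) + isign ((a + b) * g + j + k) * dbl (i - a * b) (k + a * g)
      - isign (a * b + i) * dbl (k - a * g) (i + a * b)) mod 3 = 0)"

text \<open>The third inner product is eliminated by the condition that the sum of the three roots
  has norm 1, which leaves 8 triples of parities and 25 pairs of inner products. The premises in
  \<open>jacobi_check\<close> restrict these to the bounds and to the relations that hold when two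
  of the roots are opposite.\<close>

lemma jacobi_table:
  "\<forall>a\<in>{0, 1}. \<forall>b\<in>{0, 1}. \<forall>g\<in>{0, 1}. \<forall>i\<in>{-2, -1, 0, 1, 2}. \<forall>j\<in>{-2, -1, 0, 1, 2}. jacobi_check a b g i j"
  by code_simp

text \<open>The lattice of the contragredient algebra is mapped to the lattice of type \<open>E\<^sub>6\<close> by a map \<open>\<iota>\<close> that is
  additive up to the defect \<open>\<omega>\<close> for two odd arguments. For \<open>\<ee>\<^sub>6\<close> all parities are \<open>0\<close> and \<open>\<iota>\<close> is
  the identity. For \<open>\<gg>(2,6)\<close>, \<open>\<omega>\<close> is the simple root \<open>\<alpha>\<^sub>2\<close> and \<open>\<iota>\<close> maps the even and odd roots to the
  roots that have inner product \<open>0\<close> and \<open>-1\<close> with \<open>\<alpha>\<^sub>2\<close>.\<close>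

locale lattice_roots =
  fixes \<iota> :: "int^'n::finite \<Rightarrow> int^6" and par :: "int^'n \<Rightarrow> bit" and \<omega> :: "int^6" and A :: "int^'n^'n"
    and K :: "'k::field itself"
  assumes char_3: "CHAR('k) = 3"
    and par_sum: "par (x + y) = par x + par y"
    and \<iota>_add: "\<iota> (x + y) = \<iota> x + \<iota> y + (if par x = 1 \<and> par y = 1 then \<omega> else 0)"
    and \<iota>_inj: "inj \<iota>"
    and ip_\<omega>: "ip (\<iota> x) \<omega> = (if par x = 1 then - 1 else 0)"
    and bil_\<omega>: "par x = 1 \<Longrightarrow> bil \<omega> \<omega> = 1"
    and pairing_ip: "3 dvd (\<Sum>i\<in>UNIV. \<Sum>j\<in>UNIV. x $ i * y $ j * A $ i $ j) -
      (ip (\<iota> x) (\<iota> y) + (if par x = 1 \<and> par y = 1 then 1 else 0))"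
begin

definition R :: "(int^'n) set" where "R = {x. bil (\<iota> x) (\<iota> x) = 1}"

text \<open>On odd pairs the correction is dictated by the semisimplification: both terms of - [x,
  [e_2, y]] + [[e_2, x], y] contribute the sign eps(\<omega>, x) eps(x, y) eps(\<omega>, y), and 1 +
  1 = - 1 in characteristic 3.\<close>

definition c :: "int^'n \<Rightarrow> int^'n \<Rightarrow> 'k" where
  "c x y = eps (\<iota> x) (\<iota> y) * (if par x = 1 \<and> par y = 1 then - (eps \<omega> (\<iota> x) * eps \<omega> (\<iota> y)) else 1)"

text \<open>A form of the product \<open>c y z * c x (y + z)\<close> (\<open>c_mult_c\<close>) in
  which permutations of the arguments change only signs given by inner products. This makes it a
  common factor of the three terms of the Jacobi identity.\<close>

definition Q :: "int^'n \<Rightarrow> int^'n \<Rightarrow> int^'n \<Rightarrow> 'k" where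
  "Q x y z = eps (\<iota> x) (\<iota> y) * eps (\<iota> y) (\<iota> z) * eps (\<iota> x) (\<iota> z) *
     (if par x = 1 \<and> par y = 1 \<or> par y = 1 \<and> par z = 1 \<or> par x = 1 \<and> par z = 1
      then eps \<omega> (\<iota> x) * eps \<omega> (\<iota> y) * eps \<omega> (\<iota> z) * (if par x = 1 \<and> par y = 1 \<and> par z = 1 then 1 else - 1)
      else 1)"

definition both :: "int^'n \<Rightarrow> int^'n \<Rightarrow> int" where "both x y = (if par x = 1 \<and> par y = 1 then 1 else 0)"

lemma three_zero: "(3::'k) = 0"
  using of_nat_CHAR[where 'a = 'k] char_3 by simp

lemma par_0: "par 0 = 0" using par_sum[of 0 0] by simp

lemma \<iota>_0: "\<iota> 0 = 0" using \<iota>_add[of 0 0] by (simp add: par_0)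

lemma \<iota>_zero_iff: "\<iota> x = 0 \<longleftrightarrow> x = 0" using \<iota>_inj \<iota>_0 by (metis injD)

lemma par_uminus: "par (- x) = par x"
  using par_sum[of x "- x"] by (cases "par x"; cases "par (- x)") (simp_all add: par_0)

lemma \<iota>_minus: "\<iota> (- x) = - \<iota> x - (if par x = 1 then \<omega> else 0)"
  using \<iota>_add[of x "- x"] by (simp add: \<iota>_0 par_uminus algebra_simps eq_neg_iff_add_eq_0 split: if_splits)

lemma eps_\<omega>: "eps (\<iota> x) \<omega> = (if par x = 1 then - eps \<omega> (\<iota> x) else (eps \<omega> (\<iota> x) :: 'k))"
  using eps_swap[of \<omega> "\<iota> x"] ip_\<omega>[of x] by (auto simp: eps_swap[of "\<iota> x" \<omega>] ip_sym[of \<omega>] msign_def)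

lemma eps_\<omega>_\<omega>: "par x = 1 \<Longrightarrow> eps \<omega> \<omega> = (- 1 :: 'k)"
  using bil_\<omega> by (simp add: eps_def msign_def)

lemma c_mult_c: "c y z * c x (y + z) = Q x y z"
  by (cases "par x"; cases "par y"; cases "par z")
     (simp_all add: c_def Q_def \<iota>_add par_sum eps_simps eps_\<omega> eps_\<omega>_\<omega>[of y] mult_ac)

lemma Q_swap: "Q y x z = msign (ip (\<iota> x) (\<iota> y)) * Q x y z"
  by (simp add: Q_def eps_swap[of "\<iota> y" "\<iota> x"] ip_sym[of "\<iota> y"] mult_ac conj_commute disj_commute) 

lemma Q_rotate: "Q z x y = msign (ip (\<iota> y) (\<iota> z) + ip (\<iota> x) (\<iota> z)) * Q x y z"
  using Q_swap[of x z y] Q_swap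
  by (simp add: Q_def eps_swap[of "\<iota> z" "\<iota> x"] eps_swap[of "\<iota> z" "\<iota> y"] msign_simps ip_sym[of "\<iota> z"] mult_ac)

lemma c_nonzero': "c x y \<noteq> 0"
  by (simp add: c_def eps_simps)

lemma c_swap': "c y x = msign (ip (\<iota> x) (\<iota> y)) * c x y"
  by (simp add: c_def eps_swap[of "\<iota> y" "\<iota> x"] ip_sym[of "\<iota> y"] mult_ac)

text \<open>For two odd arguments the defect \<omega> contributes its norm 1 and two inner products
  - 1, in total - 1. So \<open>ip (\<iota> x) (\<iota> y) - both x y\<close> takes the role of the
  inner product: two roots add up to a root at - 1 and to zero at - 2.\<close>

lemma bil_\<iota>_add: "bil (\<iota> (x + y)) (\<iota> (x + y)) =
   bil (\<iota> x) (\<iota> x) + bil (\<iota> y) (\<iota> y) + ip (\<iota> x) (\<iota> y) - both x y"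
proof -
  have "ip (\<iota> x) \<omega> = bil (\<iota> x) \<omega> + bil \<omega> (\<iota> x)" "ip (\<iota> y) \<omega> = bil (\<iota> y) \<omega> + bil \<omega> (\<iota> y)"
    "ip (\<iota> x) (\<iota> y) = bil (\<iota> x) (\<iota> y) + bil (\<iota> y) (\<iota> x)" by (simp_all add: ip_def)
  then show ?thesis using ip_\<omega>[of x] ip_\<omega>[of y] bil_\<omega>[of x]
    by (auto simp: \<iota>_add both_def bil_simps split: if_splits)
qed

lemma ip_\<iota>_add: "ip (\<iota> (x + y)) (\<iota> z) = ip (\<iota> x) (\<iota> z) + ip (\<iota> y) (\<iota> z) -
    (if par x = 1 \<and> par y = 1 \<and> par z = 1 then 1 else 0)"
  using ip_\<omega>[of z] by (simp add: \<iota>_add ip_simps ip_sym[of \<omega>])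

lemma sum_root_iff: "x \<in> R \<Longrightarrow> y \<in> R \<Longrightarrow> x + y \<in> R \<longleftrightarrow> ip (\<iota> x) (\<iota> y) - both x y = - 1"
  by (auto simp: R_def bil_\<iota>_add)

lemma sum_zero_iff: "x \<in> R \<Longrightarrow> y \<in> R \<Longrightarrow> x + y = 0 \<longleftrightarrow> ip (\<iota> x) (\<iota> y) - both x y = - 2"
proof -
  assume xy: "x \<in> R" "y \<in> R"
  have "x + y = 0 \<longleftrightarrow> bil (\<iota> (x + y)) (\<iota> (x + y)) = 0"
    using bil_zero[of "\<iota> (x + y)"] \<iota>_zero_iff[of "x + y"] by (metis \<iota>_0 bil_simps(5))
  then show ?thesis using xy by (simp add: bil_\<iota>_add R_def) linarith
qed

lemma ip_bounds:
  assumes "x \<in> R" "y \<in> R"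
  shows "ip (\<iota> x) (\<iota> y) \<le> 2" "- 2 \<le> ip (\<iota> x) (\<iota> y) - both x y"
proof -
  have "0 \<le> bil (\<iota> x - \<iota> y) (\<iota> x - \<iota> y)" by (rule bil_nonneg)
  then show "ip (\<iota> x) (\<iota> y) \<le> 2" using assms by (simp add: R_def bil_simps ip_def)
  show "- 2 \<le> ip (\<iota> x) (\<iota> y) - both x y" using bil_nonneg[of "\<iota> (x + y)"] assms by (simp add: R_def bil_\<iota>_add)
qed

lemma koszul_both: "koszul_sign (par x) (par y) = (msign (both x y) :: 'k)"
  by (simp add: koszul_sign_def both_def msign_def)

lemma root_uminus: "x \<in> R \<Longrightarrow> - x \<in> R"
proof -
  assume x: "x \<in> R"
  have "ip (\<iota> x) (\<iota> x) = 2" using x by (simp add: R_def ip_def)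
  then show ?thesis using x ip_\<omega>[of x] bil_\<omega>[of x] by (auto simp: R_def \<iota>_minus bil_simps ip_def)
qed

sublocale datum: root_datum R par c A
proof
  have "R = \<iota> -` {x. bil x x = 1}" by (auto simp: R_def)
  then show "finite R" using finite_vimageI[OF finite_bil \<iota>_inj] by simp
  show "0 \<notin> R" by (simp add: R_def \<iota>_0 bil_simps)
  show "- x \<in> R" if "x \<in> R" for x using that by (rule root_uminus)
  show "par (x + y) = par x + par y" for x y by (rule par_sum)
  show "c x (- x) \<noteq> 0" for x by (rule c_nonzero')
  show "c x y = - koszul_sign (par x) (par y) * c y x" if "x \<in> R" "y \<in> R" "x + y \<in> R" for x y
  proof -
    have "ip (\<iota> x) (\<iota> y) = both x y - 1" using sum_root_iff that by fastforce
    then show ?thesis unfolding c_swap'[of y x] koszul_both by (simp add: msign_simps)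
  qed
  show "c x (- x) = koszul_sign (par x) (par x) * c (- x) x" if "x \<in> R" for x
  proof -
    have "ip (\<iota> x) (\<iota> (- x)) = both x (- x) - 2" using sum_zero_iff[OF that root_uminus[OF that]] by simp
    moreover have "both x (- x) = both x x" by (simp add: both_def par_uminus)
    ultimately show ?thesis unfolding c_swap'[of x "- x"] koszul_both
      by (simp add: msign_simps msign_def ip_sym[of "\<iota> (- x)"])
  qed
  show "x + x \<notin> R" if "x \<in> R" "par x = 1" for x
    using that sum_root_iff[OF that(1) that(1)] by (simp add: R_def ip_def both_def)
qed

lemma double_coeff_dbl:
  assumes "y \<in> R" "z \<in> R"
  shows "datum.double_coeff x y z =
    Q x y z * of_int (dbl (ip (\<iota> y) (\<iota> z) - both y z) (ip (\<iota> x) (\<iota> y) + both x y))"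
proof -
  have p: "of_int (datum.pairing y x) = (of_int (ip (\<iota> x) (\<iota> y) + both x y) :: 'k)"
  proof -
    have "both x y = (if par y = 1 \<and> par x = 1 then 1 else 0)" by (simp add: both_def conj_commute)
    then have "int CHAR('k) dvd datum.pairing y x - (ip (\<iota> x) (\<iota> y) + both x y)"
      using pairing_ip[of y x] ip_sym[of "\<iota> x" "\<iota> y"] by (simp add: datum.pairing_def char_3)
    then have "(of_int (datum.pairing y x - (ip (\<iota> x) (\<iota> y) + both x y)) :: 'k) = 0"
      by (simp only: of_int_eq_0_iff_char_dvd)
    then show ?thesis by simp
  qed
  \<comment> \<open>The case y + z = 0 of the product formula, in which the second factor is
    \<open>c x 0 = 1\<close>.\<close>
  have z: "c y z = Q x y z" if "y + z = 0"
  proof -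
    have "c x 0 = 1" by (simp add: c_def \<iota>_0 eps_simps par_0)
    then show ?thesis using c_mult_c[of y z x] that by simp
  qed
  show ?thesis
    unfolding datum.double_coeff_def p sum_root_iff[OF assms] sum_zero_iff[OF assms] c_mult_c dbl_def
    using z sum_zero_iff[OF assms] by (auto simp: algebra_simps)
qed

text \<open>The Jacobi identity with \<open>Q\<close> cancelled, where i, j, k are the inner
  products of the pairs (x, y), (y, z), (x, z). The last three hypotheses state what a pair of
  opposite roots forces. To enter the table, parities are encoded as the integers 0 and 1.\<close>

lemma jacobi_int:
  fixes i j k :: int and px py pz :: bit
  assumes "i \<le> 2" "j \<le> 2" "k \<le> 2"
  defines "bxy \<equiv> (if px = 1 \<and> py = 1 then 1 else 0)" and "byz \<equiv> (if py = 1 \<and> pz = 1 then 1 else 0)"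
    and "bxz \<equiv> (if px = 1 \<and> pz = 1 then 1 else 0)"
  assumes b: "- 2 \<le> i - bxy" "- 2 \<le> j - byz" "- 2 \<le> k - bxz"
    and sum: "i + j + k = - 2 + bxy + byz + bxz - (if px = 1 \<and> py = 1 \<and> pz = 1 then 1 else 0)"
    and jz: "j - byz = - 2 \<Longrightarrow> py = pz \<and> k = - i + bxy"
    and iz: "i - bxy = - 2 \<Longrightarrow> px = py \<and> j = - k + bxz"
    and kz: "k - bxz = - 2 \<Longrightarrow> px = pz \<and> j = - i + bxy"
  shows "(of_int (dbl (j - byz) (i + bxy)) :: 'k) =
    - koszul_sign (px + py) pz * msign (j + k) * of_int (dbl (i - bxy) (k + bxz))
    + koszul_sign px py * msign i * of_int (dbl (k - bxz) (i + bxy))"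
proof -
  define n :: "bit \<Rightarrow> int" where "n p = (if p = 1 then 1 else 0)" for p
  have nb: "bxy = n px * n py" "byz = n py * n pz" "bxz = n px * n pz"
    "(if px = 1 \<and> py = 1 \<and> pz = 1 then 1 else 0) = n px * n py * n pz"
    by (auto simp: bxy_def byz_def bxz_def n_def)
  have n01: "n p \<in> {0, 1}" for p by (simp add: n_def)
  have ninj: "n p = n q \<longleftrightarrow> p = q" for p q by (cases p; cases q) (simp_all add: n_def)
  have iv: "i \<in> {-2, -1, 0, 1, 2}" "j \<in> {-2, -1, 0, 1, 2}"
    using assms(1-3) b unfolding bxy_def byz_def by (auto split: if_splits)
  have k: "k = - 2 + n px * n py + n py * n pz + n px * n pz - n px * n py * n pz - i - j"
    using sum unfolding nb by simp
  have "jacobi_check (n px) (n py) (n pz) i j"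
    using jacobi_table n01 iv by blast
  then have m: "(dbl (j - byz) (i + bxy) + isign ((n px + n py) * n pz + j + k) * dbl (i - bxy) (k + bxz)
      - isign (n px * n py + i) * dbl (k - bxz) (i + bxy)) mod 3 = 0"
    unfolding jacobi_check_def Let_def
    unfolding k[symmetric]
    unfolding nb(1-3)[symmetric] ninj
    using assms(3) b jz iz kz by blast
  have "(of_int (dbl (j - byz) (i + bxy) + isign ((n px + n py) * n pz + j + k) * dbl (i - bxy) (k + bxz)
      - isign (n px * n py + i) * dbl (k - bxz) (i + bxy)) :: 'k) = 0"
    unfolding of_int_eq_0_iff_char_dvd char_3 using m by (simp add: dvd_eq_mod_eq_0)
  moreover have "of_int (isign ((n px + n py) * n pz + j + k)) = (koszul_sign (px + py) pz * msign (j + k) :: 'k)"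
    by (cases px; cases py; cases pz) (simp_all add: isign_def msign_def n_def koszul_sign_def)
  moreover have "of_int (isign (n px * n py + i)) = (koszul_sign px py * msign i :: 'k)"
    by (cases px; cases py) (simp_all add: isign_def msign_def n_def koszul_sign_def)
  ultimately show ?thesis by (simp add: algebra_simps)
qed

lemma ip_uminus: "ip (\<iota> (- x)) (\<iota> z) = - ip (\<iota> x) (\<iota> z) + both x z"
  using ip_\<omega>[of z] by (simp add: \<iota>_minus ip_simps ip_sym[of \<omega>] both_def)

lemma both_sym: "both x y = both y x" by (simp add: both_def conj_commute)

sublocale jacobi_root_datum R par c A
proof
  fix x y z assume R: "x \<in> R" "y \<in> R" "z \<in> R" and s: "x + y + z \<in> R"
  let ?i = "ip (\<iota> x) (\<iota> y)" and ?j = "ip (\<iota> y) (\<iota> z)" and ?k = "ip (\<iota> x) (\<iota> z)"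
  \<comment> \<open>Expanding the norm of x + y + z, which is 1, gives a linear relation between the
    three inner products; its parity terms come from the defect \<omega>.\<close>
  have sum: "?i + ?j + ?k = - 2 + both x y + both y z + both x z - (if par x = 1 \<and> par y = 1 \<and> par z = 1 then 1 else 0)"
    using s R unfolding R_def mem_Collect_eq bil_\<iota>_add ip_\<iota>_add
    by (cases "par x"; cases "par y"; cases "par z") (simp_all add: both_def par_sum)
  have j: "par y = par z \<and> ?k = - ?i + both x y" if "?j - both y z = - 2"
  proof -
    have "z = - y" using sum_zero_iff[OF R(2,3)] that by (simp add: eq_neg_iff_add_eq_0 add.commute)
    then show ?thesis using ip_uminus[of y x] by (simp add: par_uminus ip_sym both_sym)
  qed
  have i: "par x = par y \<and> ?j = - ?k + both x z" if "?i - both x y = - 2"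
  proof -
    have "y = - x" using sum_zero_iff[OF R(1,2)] that by (simp add: eq_neg_iff_add_eq_0 add.commute)
    then show ?thesis using ip_uminus[of x z] by (simp add: par_uminus)
  qed
  have k: "par x = par z \<and> ?j = - ?i + both x y" if "?k - both x z = - 2"
  proof -
    have "z = - x" using sum_zero_iff[OF R(1,3)] that by (simp add: eq_neg_iff_add_eq_0 add.commute)
    then show ?thesis using ip_uminus[of x y] by (simp add: par_uminus ip_sym both_sym)
  qed
  have main: "(of_int (dbl (?j - both y z) (?i + both x y)) :: 'k) =
    - koszul_sign (par x + par y) (par z) * msign (?j + ?k) * of_int (dbl (?i - both x y) (?k + both x z))
    + koszul_sign (par x) (par y) * msign ?i * of_int (dbl (?k - both x z) (?i + both x y))"
    by (rule jacobi_int[OF ip_bounds(1)[OF R(1,2)] ip_bounds(1)[OF R(2,3)] ip_bounds(1)[OF R(1,3)],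
      of "par x" "par y" "par z", folded both_def,
      OF ip_bounds(2)[OF R(1,2)] ip_bounds(2)[OF R(2,3)] ip_bounds(2)[OF R(1,3)] sum j i k])
  show "datum.double_coeff x y z = - koszul_sign (par x + par y) (par z) * datum.double_coeff z x y
        + koszul_sign (par x) (par y) * datum.double_coeff y x z"
    unfolding double_coeff_dbl[OF R(2,3)] double_coeff_dbl[OF R(1,2)] double_coeff_dbl[OF R(1,3)]
      Q_rotate[of z x y] Q_swap[of y x z] ip_sym[of "\<iota> z" "\<iota> x"] ip_sym[of "\<iota> y" "\<iota> x"] both_sym[of z x] both_sym[of y x] main
    by (simp add: algebra_simps)
next
  fix x y z assume R: "x \<in> R" "y \<in> R" "z \<in> R" and s: "x + y + z = 0"
  have "y + z = - x" "x + z = - y" "x + y = - z" using s by (simp_all add: eq_neg_iff_add_eq_0 algebra_simps)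
  then have r: "y + z \<in> R" "x + z \<in> R" "x + y \<in> R" using root_uminus R by simp_all
  have e: "ip (\<iota> y) (\<iota> z) = both y z - 1" "ip (\<iota> x) (\<iota> z) = both x z - 1" "ip (\<iota> x) (\<iota> y) = both x y - 1"
    using sum_root_iff R r by fastforce+
  have p: "par x + par y + par z = 0" using s par_sum par_0 by metis
  show "c y z * c x (y + z) = koszul_sign (par z) (par z) * (c x y * c z (x + y)) \<and>
      koszul_sign (par z) (par z) * (c x y * c z (x + y)) = - koszul_sign (par x) (par y) * (c x z * c y (x + z))"
    unfolding c_mult_c Q_rotate[of z x y] Q_swap[of y x z] e
    using p by (cases "par x"; cases "par y"; cases "par z") (simp_all add: both_def koszul_sign_def msign_def)
qed

end

text \<open>\<open>not_dvd_3\<close> keeps the reductions of roots and coroots mod 3 nonzero,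
  \<open>descent\<close> provides a simple root that brings a given root closer to 0, and
  \<open>kernel_A\<close> is the linear algebra behind the one-dimensional center.\<close>

locale lattice_roots_gen = lattice_roots \<iota> par \<omega> A K
  for \<iota> :: "int^'n::finite \<Rightarrow> int^6" and par :: "int^'n \<Rightarrow> bit" and \<omega> :: "int^6" and A :: "int^'n^'n"
    and K :: "'k::field itself" +
  assumes simple_in_R: "axis i 1 \<in> R"
    and simple_diff_notin_R: "i \<noteq> j \<Longrightarrow> axis i 1 - axis j 1 \<notin> R"
    and not_dvd_3: "x \<in> R \<Longrightarrow> \<exists>i. \<not> 3 dvd x $ i"
    and descent: "x \<in> R \<Longrightarrow> \<exists>i. 0 < x $ i \<and> 1 \<le> ip (\<iota> x) (\<iota> (axis i 1)) \<or>
      x $ i < 0 \<and> ip (\<iota> x) (\<iota> (axis i 1)) - both x (axis i 1) \<le> - 1"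
    and kernel_A: "\<exists>v. (\<exists>i. v i \<noteq> 0) \<and> (\<forall>w. (\<forall>j. (\<Sum>i\<in>UNIV. w i * of_int (A $ i $ j)) = 0)
       \<longleftrightarrow> (\<exists>k::'k. w = (\<lambda>i. k * v i)))"
begin

lemma sum_abs_less:
  fixes x y :: "int^'n"
  assumes "\<bar>y $ i\<bar> < \<bar>x $ i\<bar>" "\<And>j. j \<noteq> i \<Longrightarrow> y $ j = x $ j"
  shows "(\<Sum>j\<in>UNIV. \<bar>y $ j\<bar>) < (\<Sum>j\<in>UNIV. \<bar>x $ j\<bar>)"
proof (rule sum_strict_mono_ex1)
  show "\<forall>j\<in>UNIV. \<bar>y $ j\<bar> \<le> \<bar>x $ j\<bar>"
  proof
    fix j show "\<bar>y $ j\<bar> \<le> \<bar>x $ j\<bar>" using assms by (cases "j = i") auto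
  qed
qed (use assms(1) in auto)

text \<open>By \<open>descent\<close> the corrected inner product of x with alpha_i or - alpha_i is
  negative, hence - 1 or - 2. In the first case the sum is a root whose coordinate i is smaller in
  absolute value; in the second it is zero and x is a simple root up to sign.\<close>

lemma generation_R:
  assumes x: "x \<in> R"
  shows "\<exists>i. x = axis i 1 \<or> x = - axis i 1 \<or>
      x - axis i 1 \<in> R \<and> (\<Sum>j\<in>UNIV. \<bar>(x - axis i 1) $ j\<bar>) < (\<Sum>j\<in>UNIV. \<bar>x $ j\<bar>) \<or>
      x + axis i 1 \<in> R \<and> (\<Sum>j\<in>UNIV. \<bar>(x + axis i 1) $ j\<bar>) < (\<Sum>j\<in>UNIV. \<bar>x $ j\<bar>)"
proof -
  obtain i where i: "0 < x $ i \<and> 1 \<le> ip (\<iota> x) (\<iota> (axis i 1)) \<or>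
      x $ i < 0 \<and> ip (\<iota> x) (\<iota> (axis i 1)) - both x (axis i 1) \<le> - 1"
    using descent[OF x] by blast
  let ?f = "ip (\<iota> x) (\<iota> (axis i 1))" and ?b = "both x (axis i 1)"
  have a: "axis i 1 \<in> R" "- axis i 1 \<in> R" using simple_in_R root_uminus by auto
  have m: "ip (\<iota> x) (\<iota> (- axis i 1)) - both x (- axis i 1) = - ?f"
  proof -
    have "both x (- axis i 1) = ?b" by (simp add: both_def par_uminus)
    then show ?thesis using ip_uminus[of "axis i 1" x] by (simp add: ip_sym both_sym)
  qed
  from i show ?thesis
  proof (elim disjE conjE)
    assume p: "0 < x $ i" "1 \<le> ?f"
    have "?f \<le> 2" by (rule ip_bounds(1)[OF x a(1)])
    then consider "?f = 1" | "?f = 2" using p by linarith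
    then show ?thesis
    proof cases
      case 1
      then have "x - axis i 1 \<in> R" using sum_root_iff[OF x a(2)] m by simp
      moreover have "(\<Sum>j\<in>UNIV. \<bar>(x - axis i 1) $ j\<bar>) < (\<Sum>j\<in>UNIV. \<bar>x $ j\<bar>)"
        by (rule sum_abs_less[of _ i]) (use p in \<open>auto simp: axis_def\<close>)
      ultimately show ?thesis by blast
    next
      case 2
      then have "x + - axis i 1 = 0" using sum_zero_iff[OF x a(2)] m by simp
      then have "x = axis i 1" by simp
      then show ?thesis by blast
    qed
  next
    assume p: "x $ i < 0" "?f - ?b \<le> - 1"
    have "- 2 \<le> ?f - ?b" by (rule ip_bounds(2)[OF x a(1)])
    then consider "?f - ?b = - 1" | "?f - ?b = - 2" using p by linarith
    then show ?thesis
    proof cases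
      case 1
      then have "x + axis i 1 \<in> R" using sum_root_iff[OF x a(1)] by simp
      moreover have "(\<Sum>j\<in>UNIV. \<bar>(x + axis i 1) $ j\<bar>) < (\<Sum>j\<in>UNIV. \<bar>x $ j\<bar>)"
        by (rule sum_abs_less[of _ i]) (use p in \<open>auto simp: axis_def\<close>)
      ultimately show ?thesis by blast
    next
      case 2
      then have "x + axis i 1 = 0" using sum_zero_iff[OF x a(1)] by simp
      then have "x = - axis i 1" by (simp add: eq_neg_iff_add_eq_0)
      then show ?thesis by blast
    qed
  qed
qed

text \<open>Independence of the h_i and of the \<alpha> j turns a coordinate of x that is nonzero
  mod 3 into the nonvanishing of its coroot and of its root.\<close>

lemma derived_model_of_realization:
  fixes sc :: "'k \<Rightarrow> 'h::ab_group_add \<Rightarrow> 'h"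
  assumes "cartan_realization A sc h \<alpha>"
  shows "derived_model R par c A sc h \<alpha>"
proof -
  have vs: "vector_space sc"
    and ih: "\<And>k. (\<Sum>i\<in>UNIV. sc (k i) (h i)) = 0 \<Longrightarrow> \<forall>i. k i = 0"
    and lin: "\<And>j. Vector_Spaces.linear sc (*) (\<alpha> j)"
    and ia: "\<And>k. (\<forall>x. (\<Sum>j\<in>UNIV. k j * \<alpha> j x) = 0) \<Longrightarrow> \<forall>j. k j = 0"
    and ah: "\<And>i j. \<alpha> j (h i) = of_int (A $ i $ j)"
    using assms by (auto simp: cartan_realization_def cartan_reduction_def)
  interpret vector_space sc by (rule vs)
  interpret M: root_model R par c A sc h \<alpha> UNIV
    by (intro root_model.intro root_model_axioms.intro jacobi_root_datum_axioms vs)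
       (simp_all add: lin ah)
  have nz: "\<exists>i. (of_int (x $ i) :: 'k) \<noteq> 0" if "x \<in> R" for x
    using not_dvd_3[OF that] by (simp add: of_int_eq_0_iff_char_dvd char_3)
  show ?thesis
  proof (intro derived_model.intro contragredient_model.intro M.root_model_axioms
      contragredient_model_axioms.intro derived_model_axioms.intro)
    show "M.coroot x \<noteq> 0" if "x \<in> R" for x
      using nz[OF that] ih[of "\<lambda>i. of_int (x $ i)"] unfolding M.coroot_def by blast
    show "\<exists>t. M.root x t \<noteq> 0" if "x \<in> R" for x
      using nz[OF that] ia[of "\<lambda>i. of_int (x $ i)"] unfolding M.root_def by blast
    show "k i = 0" if "(\<Sum>i\<in>UNIV. sc (k i) (h i)) = 0" for k i using ih[OF that] by blast
    show "\<exists>v. (\<exists>i. v i \<noteq> 0) \<and> (\<forall>w. (\<forall>j. (\<Sum>i\<in>UNIV. w i * of_int (A $ i $ j)) = 0)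
       \<longleftrightarrow> (\<exists>k::'k. w = (\<lambda>i. k * v i)))" by (rule kernel_A)
    show "\<exists>i. x = axis i 1 \<or> x = - axis i 1 \<or>
      x - axis i 1 \<in> R \<and> (\<Sum>j\<in>UNIV. \<bar>(x - axis i 1) $ j\<bar>) < (\<Sum>j\<in>UNIV. \<bar>x $ j\<bar>) \<or>
      x + axis i 1 \<in> R \<and> (\<Sum>j\<in>UNIV. \<bar>(x + axis i 1) $ j\<bar>) < (\<Sum>j\<in>UNIV. \<bar>x $ j\<bar>)" if "x \<in> R" for x
      by (rule generation_R[OF that])
  qed (simp_all add: char_3 simple_in_R simple_diff_notin_R c_nonzero')
qed

end

section \<open>Verification of the lattice axioms for the two Cartan matrices\<close>

section \<open>The root data of \<open>\<ee>\<^sub>6\<close> and \<open>\<gg>(2,6)\<close>\<close>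

text \<open>The nodes 1, 2, 3, 4, 5 of g(2,6) are placed on the nodes 1, 3, 4, 5, 6 of E6. The
  coordinate at node 2 is then forced by the inner product 2 x_2 - x_4 with alpha_2, which has to be
  0 on even and - 1 on odd vectors: it is half of x_4, rounded down.\<close>

definition iota26 :: "int^5 \<Rightarrow> int^6" where
  "iota26 y = vector [y$1, y$3 div 2, y$2, y$3, y$4, y$5]"

definition par26 :: "int^5 \<Rightarrow> bit" where
  "par26 y = (if odd (y$3) then 1 else 0)"

lemma iota26_simps: "iota26 y $ 1 = y$1" "iota26 y $ 2 = y$3 div 2" "iota26 y $ 3 = y$2"
  "iota26 y $ 4 = y$3" "iota26 y $ 5 = y$4" "iota26 y $ 6 = y$5"
  unfolding iota26_def by (rule vector_6)+

lemma e6_cartan_simps: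
  "e6_cartan $ 1 = vector [2, 0, -1, 0, 0, 0]" "e6_cartan $ 2 = vector [0, 2, 0, -1, 0, 0]"
  "e6_cartan $ 3 = vector [-1, 0, 2, -1, 0, 0]" "e6_cartan $ 4 = vector [0, -1, -1, 2, -1, 0]"
  "e6_cartan $ 5 = vector [0, 0, 0, -1, 2, -1]" "e6_cartan $ 6 = vector [0, 0, 0, 0, -1, 2]"
  unfolding e6_cartan_def by (rule vector_6)+

lemma g26_cartan_simps:
  "g26_cartan $ 1 = vector [2, -1, 0, 0, 0]" "g26_cartan $ 2 = vector [-1, 2, -1, 0, 0]"
  "g26_cartan $ 3 = vector [0, -1, 0, -1, 0]" "g26_cartan $ 4 = vector [0, 0, -1, 2, -1]"
  "g26_cartan $ 5 = vector [0, 0, 0, -1, 2]"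
  unfolding g26_cartan_def by (rule vector_5)+

lemma ip_expand: "ip x y = 2 * (x$1 * y$1 + x$2 * y$2 + x$3 * y$3 + x$4 * y$4 + x$5 * y$5 + x$6 * y$6)
     - (x$1 * y$3 + x$3 * y$1) - (x$2 * y$4 + x$4 * y$2) - (x$3 * y$4 + x$4 * y$3)
     - (x$4 * y$5 + x$5 * y$4) - (x$5 * y$6 + x$6 * y$5)"
  by (simp add: ip_def bil_expand algebra_simps)

lemma axis_6_simps: "(axis i (1::int) :: int^6) $ j = (if j = i then 1 else 0)" by (simp add: axis_def)
lemma axis_5_simps: "(axis i (1::int) :: int^5) $ j = (if j = i then 1 else 0)" by (simp add: axis_def)

lemma ip_axis: "ip x (axis 1 1) = 2 * x$1 - x$3" "ip x (axis 2 1) = 2 * x$2 - x$4"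
  "ip x (axis 3 1) = 2 * x$3 - x$1 - x$4" "ip x (axis 4 1) = 2 * x$4 - x$2 - x$3 - x$5"
  "ip x (axis 5 1) = 2 * x$5 - x$4 - x$6" "ip x (axis 6 1) = 2 * x$6 - x$5"
  by (simp_all add: ip_expand axis_6_simps)

text \<open>The expansion of ip x x in simple roots. For a root its value is 2, so that some term is
  positive, and this term yields the simple root used for descent.\<close>

lemma ip_axis_sum: "x$1 * ip x (axis 1 1) + x$2 * ip x (axis 2 1) + x$3 * ip x (axis 3 1)
    + x$4 * ip x (axis 4 1) + x$5 * ip x (axis 5 1) + x$6 * ip x (axis 6 1) = 2 * bil x x"
  by (simp add: ip_axis bil_expand algebra_simps)

lemma iota26_axis: "iota26 (axis 1 1) = axis 1 1" "iota26 (axis 2 1) = axis 3 1" "iota26 (axis 3 1) = axis 4 1"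
  "iota26 (axis 4 1) = axis 5 1" "iota26 (axis 5 1) = axis 6 1"
  unfolding vec_eq_iff forall_6 by (simp_all add: iota26_simps axis_6_simps axis_5_simps)

lemma bil_axis: "bil (axis i 1) (axis i 1) = 1"
  using exhaust_6[of i] by (elim disjE) (simp_all add: bil_expand axis_6_simps)

text \<open>Norms of vectors in three times the lattice are multiples of 9, whereas roots have norm
  1; this is how roots survive the reduction mod 3.\<close>

lemma nine_dvd_bil:
  assumes "\<And>i. 3 dvd x $ i" shows "9 dvd bil x x"
proof -
  define y where "y = (\<chi> i. x $ i div 3)"
  have x: "x = y + y + y" using assms by (auto simp: vec_eq_iff y_def)
  have "bil x x = 9 * bil y y" unfolding x
    using bil_simps(1)[of "y + y" y "y + y + y"] bil_simps(1)[of y y "y + y + y"]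
      bil_simps(2)[of y "y + y" y] bil_simps(2)[of y y y] by linarith
  then show ?thesis by simp
qed

locale characteristic_three =
  fixes K :: "'k::field itself"
  assumes char_three: "CHAR('k) = 3"
begin

sublocale E: lattice_roots "\<lambda>x. x" "\<lambda>_. 0" 0 e6_cartan K
proof
  show "3 dvd (\<Sum>i\<in>UNIV. \<Sum>j\<in>UNIV. x $ i * y $ j * e6_cartan $ i $ j) -
      (ip x y + (if (0::bit) = 1 \<and> (0::bit) = 1 then 1 else 0))" for x y
  proof -
    have "(\<Sum>i\<in>UNIV. \<Sum>j\<in>UNIV. x $ i * y $ j * e6_cartan $ i $ j) = ip x y"
      by (simp add: sum_6 e6_cartan_simps vector_6 ip_expand algebra_simps)
    then show ?thesis by simp
  qed
qed (simp_all add: char_three ip_simps bil_simps)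

lemma inj_iota26: "inj iota26"
proof (rule injI)
  fix x y assume e: "iota26 x = iota26 y"
  have "iota26 x $ 1 = iota26 y $ 1" "iota26 x $ 3 = iota26 y $ 3" "iota26 x $ 4 = iota26 y $ 4"
    "iota26 x $ 5 = iota26 y $ 5" "iota26 x $ 6 = iota26 y $ 6" using e by simp_all
  then show "x = y" by (simp add: vec_eq_iff forall_5 iota26_simps)
qed

sublocale G: lattice_roots iota26 par26 "axis 2 1" g26_cartan K
proof
  show "iota26 (x + y) = iota26 x + iota26 y + (if par26 x = 1 \<and> par26 y = 1 then axis 2 1 else 0)" for x y
  proof -
    have "(a + b) div 2 = a div 2 + b div 2 + (if odd a \<and> odd b then 1 else 0)" for a b :: int
      by (cases "even a"; cases "even b") (auto elim!: evenE oddE)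
    then show ?thesis
      unfolding vec_eq_iff forall_6 by (simp add: iota26_simps axis_6_simps par26_def)
  qed
  show "ip (iota26 x) (axis 2 1) = (if par26 x = 1 then - 1 else 0)" for x
    by (auto simp: ip_axis iota26_simps par26_def elim!: evenE oddE)
  show "bil (axis 2 1) (axis 2 1) = 1" by (rule bil_axis)
  show "3 dvd (\<Sum>i\<in>UNIV. \<Sum>j\<in>UNIV. x $ i * y $ j * g26_cartan $ i $ j) -
      (ip (iota26 x) (iota26 y) + (if par26 x = 1 \<and> par26 y = 1 then 1 else 0))" for x y
  proof -
    \<comment> \<open>Quotients and remainders of the coordinate at node 3 eliminate
      \<open>div\<close>. The two forms then differ by 3 times an explicit integer: the simple root
      at node 3, for instance, has diagonal entry 0 in the Cartan matrix but 2 + 1 in the corrected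
      inner product.\<close>
    define u v a b where uv: "u = x$3 div 2" "v = y$3 div 2" "a = x$3 mod 2" "b = y$3 mod 2"
    have x3: "x$3 = 2 * u + a" "y$3 = 2 * v + b" by (simp_all add: uv)
    have ab: "(if par26 x = 1 \<and> par26 y = 1 then 1 else 0) = a * b"
      by (auto simp: par26_def uv odd_iff_mod_2_eq_one)
    have u2: "iota26 x $ 2 = u" "iota26 y $ 2 = v" by (simp_all add: iota26_simps uv)
    have "(\<Sum>i\<in>UNIV. \<Sum>j\<in>UNIV. x $ i * y $ j * g26_cartan $ i $ j) -
      (ip (iota26 x) (iota26 y) + a * b) = 3 * (- 2 * u * v - u * b - v * a - a * b)"
      unfolding ip_expand u2
      by (simp add: sum_5 g26_cartan_simps vector_5 iota26_simps(1,3-6) x3 algebra_simps)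
    then show ?thesis unfolding ab by (simp only: dvd_triv_left)
  qed
qed (simp_all add: char_three par26_def inj_iota26)

lemma three_K: "(3::'k) = 0"
  by (rule E.three_zero)

lemma two_K: "(2::'k) = - 1"
  using three_K by (simp add: eq_neg_iff_add_eq_0)

sublocale E: lattice_roots_gen "\<lambda>x. x" "\<lambda>_. 0" 0 e6_cartan K
proof
  show "axis i 1 \<in> E.R" for i by (simp add: E.R_def bil_axis)
  show "axis i 1 - axis j 1 \<notin> E.R" if "i \<noteq> j" for i j
    using that exhaust_6[of i] exhaust_6[of j]
    by (elim disjE) (simp_all add: E.R_def bil_expand axis_6_simps)
  show "\<exists>i. \<not> 3 dvd x $ i" if "x \<in> E.R" for x
  proof (rule ccontr)
    assume "\<nexists>i. \<not> 3 dvd x $ i"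
    then have "9 dvd bil x x" using nine_dvd_bil by blast
    then show False using that by (simp add: E.R_def)
  qed
  show "\<exists>i. 0 < x $ i \<and> 1 \<le> ip x (axis i 1) \<or> x $ i < 0 \<and> ip x (axis i 1) - E.both x (axis i 1) \<le> - 1"
    if "x \<in> E.R" for x
  proof -
    have "\<exists>i. 0 < x $ i * ip x (axis i 1)"
    proof (rule ccontr)
      assume "\<nexists>i. 0 < x $ i * ip x (axis i 1)"
      then have "x $ i * ip x (axis i 1) \<le> 0" for i by (meson not_le)
      from this[of 1] this[of 2] this[of 3] this[of 4] this[of 5] this[of 6]
      show False using ip_axis_sum[of x] that by (simp add: E.R_def)
    qed
    then obtain i where "0 < x $ i * ip x (axis i 1)" by blast
    then have "0 < x $ i \<and> 0 < ip x (axis i 1) \<or> x $ i < 0 \<and> ip x (axis i 1) < 0"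
      by (simp add: zero_less_mult_iff)
    then show ?thesis by (intro exI[of _ i]) (auto simp: E.both_def)
  qed
  show "\<exists>v. (\<exists>i. v i \<noteq> 0) \<and> (\<forall>w. (\<forall>j. (\<Sum>i\<in>UNIV. w i * of_int (e6_cartan $ i $ j)) = 0)
       \<longleftrightarrow> (\<exists>k::'k. w = (\<lambda>i. k * v i)))"
  \<comment> \<open>Modulo 3, where 2 = - 1, the left kernel consists of the multiples of this
    vector. It belongs to the central element h_1 - h_3 + h_5 - h_6.\<close>
  proof (intro exI[of _ "vec_nth (vector [1, 0, -1, 0, 1, -1] :: 'k^6)"] conjI allI)
    show "\<exists>i. (vector [1, 0, -1, 0, 1, -1] :: 'k^6) $ i \<noteq> 0"
      by (intro exI[of _ 1]) (simp add: vector_6)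
    fix w :: "6 \<Rightarrow> 'k"
    show "(\<forall>j. (\<Sum>i\<in>UNIV. w i * of_int (e6_cartan $ i $ j)) = 0)
       \<longleftrightarrow> (\<exists>k. w = (\<lambda>i. k * (vector [1, 0, -1, 0, 1, -1] :: 'k^6) $ i))" (is "?l \<longleftrightarrow> ?r")
    proof
      assume ?l
      then have e: "w 3 = 2 * w 1" "w 4 = 2 * w 2" "2 * w 3 = w 1 + w 4" "2 * w 4 = w 2 + w 3 + w 5"
         "2 * w 5 = w 4 + w 6" "2 * w 6 = w 5"
        by (simp_all add: forall_6 sum_6 e6_cartan_simps vector_6 algebra_simps eq_neg_iff_add_eq_0)
      have 3: "w 3 = - w 1" using e(1) by (simp add: two_K)
      have 4: "w 4 = 0" using e(3) by (simp add: two_K 3)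
      have 2: "w 2 = 0" using e(2) by (simp add: two_K 4)
      have 5: "w 5 = w 1" using e(4) by (simp add: 2 3 4)
      have 6: "w 6 = - w 1" using e(5) by (simp add: two_K 4 5)
      have "\<forall>i. w i = w 1 * (vector [1, 0, -1, 0, 1, -1] :: 'k^6) $ i"
        unfolding forall_6 vector_6 by (simp add: 2 3 4 5 6)
      then show ?r by (intro exI[of _ "w 1"] ext) blast
    next
      assume ?r
      then obtain k where k: "\<And>i. w i = k * (vector [1, 0, -1, 0, 1, -1] :: 'k^6) $ i" by auto
      show ?l unfolding forall_6
        by (simp add: sum_6 e6_cartan_simps k vector_6 two_K)
    qed
  qed
qed

sublocale G: lattice_roots_gen iota26 par26 "axis 2 1" g26_cartan K
proof
  show "axis i 1 \<in> G.R" for i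
    using exhaust_5[of i] by (elim disjE) (simp_all add: G.R_def iota26_axis bil_axis)
  show "axis i 1 - axis j 1 \<notin> G.R" if "i \<noteq> j" for i j
    using that exhaust_5[of i] exhaust_5[of j]
    by (elim disjE) (simp_all add: G.R_def bil_expand iota26_simps axis_5_simps)
  show "\<exists>i. \<not> 3 dvd x $ i" if x: "x \<in> G.R" for x
  proof (rule ccontr)
    assume "\<nexists>i. \<not> 3 dvd x $ i"
    then have d: "3 dvd x $ i" for i by blast
    show False
    proof (cases "even (x$3)")
      case True
      then have "3 dvd x$3 div 2" using d[of 3] by presburger
      then have "\<forall>i. 3 dvd iota26 x $ i" unfolding forall_6 iota26_simps using d by blast
      then have "9 dvd bil (iota26 x) (iota26 x)" using nine_dvd_bil by blast
      then show False using x by (simp add: G.R_def)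
    next
      case False
      \<comment> \<open>An odd multiple 6 m + 3 of 3 has half 3 m + 1 rounded down, so subtracting
        alpha_2 makes all coordinates divisible by 3. The norm of the difference is 1 + 1 + 1 = 3,
        which is no multiple of 9.\<close>
      then have 1: "3 dvd x$3 div 2 - 1" using d[of 3] by presburger
      let ?z = "iota26 x - axis 2 1"
      have "\<forall>i. 3 dvd ?z $ i"
        unfolding forall_6 using d 1 by (simp add: iota26_simps axis_6_simps)
      then have "9 dvd bil ?z ?z" using nine_dvd_bil by blast
      moreover have "bil ?z ?z = 3"
      proof -
        have "bil ?z ?z = bil (iota26 x) (iota26 x) + bil (axis 2 1) (axis 2 1) - ip (iota26 x) (axis 2 1)"
          by (simp add: bil_simps ip_def)
        then show ?thesis using x False G.ip_\<omega>[of x] by (simp add: G.R_def bil_axis par26_def)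
      qed
      ultimately show False by simp
    qed
  qed
  show "\<exists>i. 0 < x $ i \<and> 1 \<le> ip (iota26 x) (iota26 (axis i 1)) \<or>
      x $ i < 0 \<and> ip (iota26 x) (iota26 (axis i 1)) - G.both x (axis i 1) \<le> - 1"
    if x: "x \<in> G.R" for x
  proof -
    let ?f = "\<lambda>i. ip (iota26 x) (iota26 (axis i 1))"
    have b0: "G.both x (axis i 1) = 0" if "i \<noteq> 3" for i
      using that by (simp add: G.both_def par26_def axis_5_simps)
    \<comment> \<open>The expansion in E6 has one term, at alpha_2, that belongs to no simple root
      of g(2,6). It is 0 for even x and minus \<open>x$3 div 2\<close> for odd x.\<close>
    have sum: "x$1 * ?f 1 + x$3 div 2 * ip (iota26 x) (axis 2 1) + x$2 * ?f 2 + x$3 * ?f 3 + x$4 * ?f 4 + x$5 * ?f 5 = 2"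
      using ip_axis_sum[of "iota26 x"] x by (simp add: iota26_simps iota26_axis G.R_def)
    show ?thesis
    proof (cases "\<exists>i. i \<noteq> 3 \<and> 0 < x $ i * ?f i")
      case True
      then obtain i where i: "i \<noteq> 3" "0 < x $ i * ?f i" by blast
      then have "0 < x $ i \<and> 0 < ?f i \<or> x $ i < 0 \<and> ?f i < 0" by (simp add: zero_less_mult_iff)
      then show ?thesis using b0[OF i(1)] by (intro exI[of _ i]) auto
    next
      case False
      then have "x $ i * ?f i \<le> 0" if "i \<noteq> 3" for i using that by (meson not_le)
      from this[of 1] this[of 2] this[of 4] this[of 5]
      have "x$1 * ?f 1 \<le> 0" "x$2 * ?f 2 \<le> 0" "x$4 * ?f 4 \<le> 0" "x$5 * ?f 5 \<le> 0" by simp_all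
      then have main: "2 \<le> x$3 div 2 * ip (iota26 x) (axis 2 1) + x$3 * ?f 3" using sum by linarith
      show ?thesis
      proof (cases "even (x$3)")
        case True
        then have "0 < x$3 * ?f 3" using main G.ip_\<omega>[of x] by (simp add: par26_def)
        then have "0 < x$3 \<and> 0 < ?f 3 \<or> x$3 < 0 \<and> ?f 3 < 0" by (simp add: zero_less_mult_iff)
        moreover have "G.both x (axis 3 1) = 0" using True by (simp add: G.both_def par26_def)
        ultimately show ?thesis by (intro exI[of _ 3]) auto
      next
        case False
        \<comment> \<open>If x$3 is positive, this makes the inner product with node 3 positive. If
          x$3 is negative, the corrected inner product is smaller by 1 than the uncorrected one, so
          it suffices that the latter is not positive.\<close>
        then have m: "2 + x$3 div 2 \<le> x$3 * ?f 3" using main G.ip_\<omega>[of x] by (simp add: par26_def)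
        have b: "G.both x (axis 3 1) = 1" using False by (simp add: G.both_def par26_def axis_5_simps)
        have x3: "x$3 = 2 * (x$3 div 2) + 1" using False by presburger
        show ?thesis
        proof (cases "0 < x$3")
          case True
          then have "0 \<le> x$3 div 2" by simp
          then have "0 < x$3 * ?f 3" using m by linarith
          then have "0 < ?f 3" using True by (simp add: zero_less_mult_iff)
          then show ?thesis using True by (intro exI[of _ 3]) simp
        next
          case neg: False
          then have n: "x$3 < 0" using False by (cases "x$3 = 0") auto
          have "?f 3 \<le> 0"
          proof (rule ccontr)
            assume "\<not> ?f 3 \<le> 0"
            then have "x$3 * ?f 3 \<le> x$3 * 1" using n by (intro mult_left_mono_neg) auto
            then show False using m x3 n by linarith
          qed
          then show ?thesis using n b by (intro exI[of _ 3]) simp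
        qed
      qed
    qed
  qed
  show "\<exists>v. (\<exists>i. v i \<noteq> 0) \<and> (\<forall>w. (\<forall>j. (\<Sum>i\<in>UNIV. w i * of_int (g26_cartan $ i $ j)) = 0)
       \<longleftrightarrow> (\<exists>k::'k. w = (\<lambda>i. k * v i)))"
  \<comment> \<open>The same relation as for e6 under the placement of the nodes on 1, 3, 4, 5, 6;
    the odd node has coefficient 0.\<close>
  proof (intro exI[of _ "vec_nth (vector [1, -1, 0, 1, -1] :: 'k^5)"] conjI allI)
    show "\<exists>i. (vector [1, -1, 0, 1, -1] :: 'k^5) $ i \<noteq> 0"
      by (intro exI[of _ 1]) (simp add: vector_5)
    fix w :: "5 \<Rightarrow> 'k"
    show "(\<forall>j. (\<Sum>i\<in>UNIV. w i * of_int (g26_cartan $ i $ j)) = 0)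
       \<longleftrightarrow> (\<exists>k. w = (\<lambda>i. k * (vector [1, -1, 0, 1, -1] :: 'k^5) $ i))" (is "?l \<longleftrightarrow> ?r")
    proof
      assume ?l
      then have e: "w 2 = 2 * w 1" "2 * w 2 = w 1 + w 3" "- w 2 = w 4" "2 * w 4 = w 3 + w 5"
        by (simp_all add: forall_5 sum_5 g26_cartan_simps vector_5 algebra_simps eq_neg_iff_add_eq_0)
      have 2: "w 2 = - w 1" using e(1) by (simp add: two_K)
      have 3: "w 3 = 0" using e(2) by (simp add: two_K 2)
      have 4: "w 4 = w 1" using e(3) by (simp add: 2)
      have 5: "w 5 = - w 1" using e(4) by (simp add: two_K 3 4)
      have "\<forall>i. w i = w 1 * (vector [1, -1, 0, 1, -1] :: 'k^5) $ i"
        unfolding forall_5 vector_5 by (simp add: 2 3 4 5)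
      then show ?r by (intro exI[of _ "w 1"] ext) blast
    next
      assume ?r
      then obtain k where k: "\<And>i. w i = k * (vector [1, -1, 0, 1, -1] :: 'k^5) $ i" by auto
      show ?l unfolding forall_5
        by (simp add: sum_5 g26_cartan_simps k vector_5 two_K)
    qed
  qed
qed

end

lemma (in root_model) Car_eq_sum: "Car = {a + b | a b. a \<in> Par 0 \<and> b \<in> Par 1}"
proof
  show "Car \<subseteq> {a + b | a b. a \<in> Par 0 \<and> b \<in> Par 1}"
  proof
    fix x assume x: "x \<in> Car"
    define y0 where "y0 = (fst x, \<lambda>\<gamma>. if par \<gamma> = 0 then snd x \<gamma> else 0)"
    define y1 where "y1 = (0::'h, \<lambda>\<gamma>. if par \<gamma> = 0 then 0 else snd x \<gamma>)"
    have "y0 \<in> Par 0" "y1 \<in> Par 1" using x subspace_0[OF H_subspace]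
      by (auto simp: y0_def y1_def Par_def Car_def split: if_splits)
    moreover have "x = y0 + y1" by (rule pair_eqI) (auto simp: y0_def y1_def)
    ultimately show "x \<in> {a + b | a b. a \<in> Par 0 \<and> b \<in> Par 1}" by blast
  qed
  show "{a + b | a b. a \<in> Par 0 \<and> b \<in> Par 1} \<subseteq> Car"
  proof
    fix x assume "x \<in> {a + b | a b. a \<in> Par 0 \<and> b \<in> Par 1}"
    then obtain a b where "x = a + b" "a \<in> Car" "b \<in> Car" unfolding Par_def by blast
    then show "x \<in> Car" using V.subspace_add[OF Car_subspace] by simp
  qed
qed

lemma (in root_model) Par_disjoint: "Par 0 \<inter> Par 1 \<subseteq> {0}"
proof
  fix x assume "x \<in> Par 0 \<inter> Par 1"
  then have "fst x = 0" "snd x \<gamma> \<noteq> 0 \<Longrightarrow> par \<gamma> = 0 \<and> par \<gamma> = 1" for \<gamma> by (auto simp: Par_def)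
  then have "fst x = 0" "snd x \<gamma> = 0" for \<gamma> by force+
  then have "x = 0" by (intro pair_eqI) auto
  then show "x \<in> {0}" by simp
qed

text \<open>The summands of u inherit restrictions on its Cartan part and on its support. Thus a
  condition like D u = 0, once it is expressed through weights, can be exploited on single root
  vectors.\<close>

lemma (in root_model) support_induct [consumes 3, case_names cart rv add]:
  assumes "u \<in> Car" "fst u \<in> T" "\<And>\<gamma>. snd u \<gamma> \<noteq> 0 \<Longrightarrow> \<gamma> \<in> S"
    and ct: "\<And>t. t \<in> T \<Longrightarrow> Q (cart t)"
    and rv: "\<And>\<gamma> k. \<gamma> \<in> R \<Longrightarrow> \<gamma> \<in> S \<Longrightarrow> Q (rv \<gamma> k)" and ad: "\<And>u v. Q u \<Longrightarrow> Q v \<Longrightarrow> Q (u + v)"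
  shows "Q u"
proof -
  have "Q (cart (fst u) + (\<Sum>\<gamma>\<in>F. rv \<gamma> (snd u \<gamma>)))" if "F \<subseteq> R" for F
    using finite_subset[OF that finite_roots] that
  proof (induction F rule: finite_induct)
    case empty then show ?case using ct[OF assms(2)] by simp
  next
    case (insert \<gamma> F)
    then have IH: "Q (cart (fst u) + (\<Sum>\<gamma>\<in>F. rv \<gamma> (snd u \<gamma>)))" by simp
    show ?case
    proof (cases "snd u \<gamma> = 0")
      case True
      then show ?thesis using IH insert(1,2) by (simp add: rv_simps)
    next
      case False
      have "Q ((cart (fst u) + (\<Sum>\<gamma>\<in>F. rv \<gamma> (snd u \<gamma>))) + rv \<gamma> (snd u \<gamma>))"
        by (rule ad[OF IH rv]) (use insert(4) assms(3)[OF False] in auto)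
      then show ?thesis using insert(1,2) by (simp add: algebra_simps)
    qed
  qed
  from this[OF subset_refl] show ?thesis using decompose[OF assms(1)] by simp
qed

section \<open>Weights with respect to alpha_2 and the projections to g(2,6)\<close>

context characteristic_three
begin

subsection \<open>The quotient of \<open>\<ee>\<^sub>6\<close> and the bracket with \<open>e\<^sub>2\<close>\<close>

abbreviation r6 :: "6 \<Rightarrow> 'k^6" where "r6 \<equiv> cartan_row e6_cartan"
abbreviation r5 :: "5 \<Rightarrow> 'k^5" where "r5 \<equiv> cartan_row g26_cartan"
abbreviation H6 :: "('k^6) set" where "H6 \<equiv> vec.span (range r6)"
abbreviation H5 :: "('k^5) set" where "H5 \<equiv> vec.span (range r5)"
abbreviation a2 :: "int^6" where "a2 \<equiv> axis 2 1"
abbreviation wt :: "int^6 \<Rightarrow> int" where "wt \<gamma> \<equiv> ip \<gamma> a2"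

sublocale EM: root_model E.R "\<lambda>_. 0" E.c e6_cartan "(*s)" r6 "\<lambda>j (t :: 'k^6). t $ j" H6
  by (rule E.row_root_model)

sublocale GM: root_model G.R par26 G.c g26_cartan "(*s)" r5 "\<lambda>j (t :: 'k^5). t $ j" H5
  by (rule G.row_root_model)

lemma r6_simps: "r6 i $ j = of_int (e6_cartan $ i $ j)"
  and r5_simps: "r5 k $ l = of_int (g26_cartan $ k $ l)"
  by (simp_all add: cartan_row_def)

lemma both_E [simp]: "E.both x y = 0" by (simp add: E.both_def)

lemma wt_ne: "wt x \<noteq> 0 \<Longrightarrow> x \<noteq> 0"
  by (auto simp: ip_simps)

lemma a2_R: "a2 \<in> E.R" by (rule E.simple_in_R)

lemma wt_minus: "wt (- x) = - wt x" and wt_add: "wt (x + y) = wt x + wt y" and wt_diff: "wt (x - y) = wt x - wt y"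
  and wt_a2: "wt a2 = 2"
  by (simp_all add: ip_simps) (simp add: ip_def bil_axis)

lemma add_a2_R: "\<gamma> \<in> E.R \<Longrightarrow> \<gamma> + a2 \<in> E.R \<longleftrightarrow> wt \<gamma> = - 1"
  using E.sum_root_iff[OF _ a2_R, of \<gamma>] by simp

lemma a2_add_R: "\<gamma> \<in> E.R \<Longrightarrow> a2 + \<gamma> \<in> E.R \<longleftrightarrow> wt \<gamma> = - 1"
  using add_a2_R[of \<gamma>] by (simp add: add.commute)

lemma diff_a2_R: "\<gamma> \<in> E.R \<Longrightarrow> \<gamma> - a2 \<in> E.R \<longleftrightarrow> wt \<gamma> = 1"
  using E.sum_root_iff[OF _ E.root_uminus[OF a2_R], of \<gamma>] by (simp add: ip_simps)

lemma wt_eq_minus_two: "\<gamma> \<in> E.R \<Longrightarrow> wt \<gamma> = - 2 \<longleftrightarrow> \<gamma> = - a2"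
  using E.sum_zero_iff[OF _ a2_R, of \<gamma>] by (auto simp: eq_neg_iff_add_eq_0)

lemma wt_eq_two: "\<gamma> \<in> E.R \<Longrightarrow> wt \<gamma> = 2 \<longleftrightarrow> \<gamma> = a2"
  using E.sum_zero_iff[OF _ E.root_uminus[OF a2_R], of \<gamma>] by (auto simp: ip_simps)

lemma wt_bounds: "\<gamma> \<in> E.R \<Longrightarrow> - 2 \<le> wt \<gamma> \<and> wt \<gamma> \<le> 2"
  using E.ip_bounds[OF _ a2_R, of \<gamma>] by simp

lemma zero_notin_ER: "0 \<notin> E.R" by (rule E.datum.zero_not_root)

lemma root_E: "EM.root x t = of_int (x$1) * t$1 + of_int (x$2) * t$2 + of_int (x$3) * t$3
    + of_int (x$4) * t$4 + of_int (x$5) * t$5 + of_int (x$6) * t$6"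
  by (simp add: EM.root_def sum_6)

lemma root_a2: "EM.root a2 t = t $ 2"
  by (simp add: root_E axis_6_simps)

lemma coroot_E: "EM.coroot x = of_int (x$1) *s r6 1 + of_int (x$2) *s r6 2 + of_int (x$3) *s r6 3
    + of_int (x$4) *s r6 4 + of_int (x$5) *s r6 5 + of_int (x$6) *s r6 6"
  by (simp add: EM.coroot_def sum_6)

lemma coroot_a2: "EM.coroot a2 = r6 2"
  by (simp add: coroot_E axis_6_simps)

lemma r6_2_2: "r6 2 $ 2 = - 1"
  by (simp add: r6_simps e6_cartan_simps vector_6 two_K)

lemma c_a2: "E.c a2 (- a2) = - 1"
  by (simp add: E.c_def eps_def bil_simps bil_axis msign_def)

lemma c_square: "E.c x y * E.c x y = 1"
  by (simp add: E.c_def eps_simps)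

definition D :: "('k^6) \<times> (int^6 \<Rightarrow> 'k) \<Rightarrow> ('k^6) \<times> (int^6 \<Rightarrow> 'k)" where
  "D u = EM.br (EM.rv a2 1) u"

lemma D_fst: "fst (D u) = (- snd u (- a2)) *s r6 2"
proof -
  have "fst (D u) = (\<Sum>\<gamma>\<in>E.R. (snd (EM.rv a2 1) \<gamma> * snd u (- \<gamma>) * E.c \<gamma> (- \<gamma>)) *s EM.coroot \<gamma>)"
    by (simp add: D_def EM.br_def)
  also have "\<dots> = (\<Sum>\<gamma>\<in>E.R. if \<gamma> = a2 then (snd u (- \<gamma>) * E.c \<gamma> (- \<gamma>)) *s EM.coroot \<gamma> else 0)"
    by (rule sum.cong) (auto simp: EM.snd_rv)
  finally show ?thesis using a2_R E.datum.finite_roots by (simp add: c_a2 coroot_a2)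
qed

lemma D_snd: "snd (D u) \<delta> = (if \<delta> \<in> E.R then (if \<delta> = a2 then - (fst u $ 2) else 0) +
    (if \<delta> - a2 \<in> E.R then E.c a2 (\<delta> - a2) * snd u (\<delta> - a2) else 0) else 0)"
proof (cases "\<delta> \<in> E.R")
  case True
  have "(\<Sum>\<gamma>\<in>E.R. if \<delta> - \<gamma> \<in> E.R then E.c \<gamma> (\<delta> - \<gamma>) * snd (EM.rv a2 1) \<gamma> * snd u (\<delta> - \<gamma>) else 0)
    = (\<Sum>\<gamma>\<in>E.R. if \<gamma> = a2 then (if \<delta> - \<gamma> \<in> E.R then E.c \<gamma> (\<delta> - \<gamma>) * snd u (\<delta> - \<gamma>) else 0) else 0)"
    by (rule sum.cong[OF refl], case_tac "x = a2") (simp_all add: EM.snd_rv)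
  also have "\<dots> = (if \<delta> - a2 \<in> E.R then E.c a2 (\<delta> - a2) * snd u (\<delta> - a2) else 0)"
    using a2_R E.datum.finite_roots by simp
  finally have "(\<Sum>\<gamma>\<in>E.R. if \<delta> - \<gamma> \<in> E.R then E.c \<gamma> (\<delta> - \<gamma>) * snd (EM.rv a2 1) \<gamma> * snd u (\<delta> - \<gamma>) else 0)
    = (if \<delta> - a2 \<in> E.R then E.c a2 (\<delta> - a2) * snd u (\<delta> - a2) else 0)" .
  then show ?thesis using True by (simp add: D_def EM.br_def EM.snd_rv root_a2)
next
  case False
  then show ?thesis by (simp add: D_def EM.br_def)
qed

lemma D_Car: "D u \<in> EM.Car" unfolding D_def by (rule EM.br_in_Car)

lemma D_linear: "D (u + v) = D u + D v" "D (EM.smul k u) = EM.smul k (D u)"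
  by (simp_all add: D_def EM.br_add_right EM.br_smul_right)

lemma D_cart: "D (EM.cart t) = EM.rv a2 (- (t $ 2))"
  by (simp add: D_def EM.br_rv_cart[OF a2_R] root_a2)

lemma a2_plus_zero: "a2 + x = 0 \<longleftrightarrow> x = - a2"
  by (metis add.commute eq_neg_iff_add_eq_0)

lemma D_rv:
  assumes "\<gamma> \<in> E.R"
  shows "D (EM.rv \<gamma> k) = (if wt \<gamma> = - 1 then EM.rv (a2 + \<gamma>) (E.c a2 \<gamma> * k)
    else if \<gamma> = - a2 then EM.cart ((- k) *s r6 2) else 0)"
proof -
  have e: "D (EM.rv \<gamma> k) = (if a2 + \<gamma> \<in> E.R then EM.rv (a2 + \<gamma>) (E.c a2 \<gamma> * 1 * k)
      else if a2 + \<gamma> = 0 then EM.cart ((E.c a2 \<gamma> * 1 * k) *s EM.coroot a2) else 0)"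
    unfolding D_def by (rule EM.br_rv_rv[OF a2_R assms])
  show ?thesis
  proof (cases "wt \<gamma> = - 1")
    case True
    then show ?thesis using e a2_add_R[OF assms] by simp
  next
    case False
    then show ?thesis using e a2_add_R[OF assms]
      by (cases "\<gamma> = - a2") (simp_all only: a2_plus_zero if_False if_True coroot_a2 c_a2 mult_1_right mult_minus_left mult_1_left)
  qed
qed

lemma D_derivation: "D (EM.br u v) = EM.br (D u) v + EM.br u (D v)" if "u \<in> EM.Car" "v \<in> EM.Car"
proof -
  have P: "w \<in> EM.Par 0" if "w \<in> EM.Car" for w using that by (simp add: EM.Par_def)
  have "EM.rv a2 1 \<in> EM.Car" by (rule EM.rv_in_Car[OF a2_R])
  then have "EM.jac 0 0 (EM.rv a2 1) u v" by (intro EM.br_jacobi[of _ _ _ _ _ 0] P that)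
  then show ?thesis by (simp add: EM.jac_def D_def)
qed

text \<open>D is injective on weights - 2 and - 1: it sends f_2 to a nonzero multiple of h_2, and a
  root vector of weight - 1 to a nonzero multiple of one of weight 1. On the Cartan part its kernel
  is that of alpha_2.\<close>

lemma ker_D:
  assumes "u \<in> EM.Car" "D u = 0"
  shows "fst u $ 2 = 0" "snd u \<gamma> \<noteq> 0 \<Longrightarrow> 0 \<le> wt \<gamma>"
proof -
  have "fst (D u) $ 2 = 0" using assms(2) by simp
  then have a: "snd u (- a2) = 0" by (simp add: D_fst r6_2_2)
  have z: "snd (D u) \<delta> = 0" for \<delta> using assms(2) by simp
  show "fst u $ 2 = 0" using z[of a2] a2_R zero_notin_ER by (simp add: D_snd)
  show "0 \<le> wt \<gamma>" if n: "snd u \<gamma> \<noteq> 0"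
  proof (rule ccontr)
    assume w: "\<not> 0 \<le> wt \<gamma>"
    have g: "\<gamma> \<in> E.R" using n assms(1) by (auto simp: EM.Car_def)
    have "wt \<gamma> \<noteq> - 2" using wt_eq_minus_two[OF g] a n by auto
    then have "wt \<gamma> = - 1" using w wt_bounds[OF g] by linarith
    then have p: "\<gamma> + a2 \<in> E.R" using add_a2_R[OF g] by simp
    have "\<gamma> \<noteq> 0" using g zero_notin_ER by auto
    then have "snd (D u) (\<gamma> + a2) = E.c a2 \<gamma> * snd u \<gamma>" using p g by (simp add: D_snd)
    then show False using z n E.c_nonzero' by simp
  qed
qed

lemma ker_DD: "D (D u) = 0 \<Longrightarrow> snd u (- a2) = 0"
proof -
  assume "D (D u) = 0"
  then have "snd (D (D u)) a2 = 0" by simp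
  then have "fst (D u) $ 2 = 0" unfolding D_snd[of _ a2] using a2_R zero_notin_ER by simp
  then show ?thesis by (simp add: D_fst r6_2_2)
qed

lemma ker_DD_wt:
  assumes "u \<in> EM.Car" "D (D u) = 0" "snd u \<gamma> \<noteq> 0" shows "- 1 \<le> wt \<gamma>"
proof -
  have g: "\<gamma> \<in> E.R" using assms by (auto simp: EM.Car_def)
  have "wt \<gamma> \<noteq> - 2" using wt_eq_minus_two[OF g] ker_DD[OF assms(2)] assms(3) by auto
  then show ?thesis using wt_bounds[OF g] by linarith
qed

lemma D_zero: "D 0 = 0" by (simp add: D_def)

lemma a2_ne: "- 1 \<le> wt x \<Longrightarrow> x \<noteq> - a2"
  using wt_minus[of a2] wt_a2 by auto

lemma D_rv_high: "\<gamma> \<in> E.R \<Longrightarrow> 0 \<le> wt \<gamma> \<Longrightarrow> D (EM.rv \<gamma> k) = 0"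
  using a2_ne[of \<gamma>] by (simp add: D_rv)

lemma D_rv_a2: "D (EM.rv a2 k) = 0"
  by (rule D_rv_high[OF a2_R]) (simp add: wt_a2)

lemma D_cube_zero: "u \<in> EM.Car \<Longrightarrow> D (D (D u)) = 0"
proof (induction u rule: EM.Car_induct)
  case (cart t)
  show ?case by (simp only: D_cart D_rv_a2 D_zero)
next
  case (rv \<gamma> k)
  consider "wt \<gamma> = - 1" | "wt \<gamma> \<noteq> - 1" "\<gamma> = - a2" | "wt \<gamma> \<noteq> - 1" "\<gamma> \<noteq> - a2" by blast
  then show ?case
  proof cases
    case 1
    then have p: "a2 + \<gamma> \<in> E.R" using a2_add_R[OF rv] by simp
    have w: "wt (a2 + \<gamma>) = 1" using 1 by (simp add: wt_add wt_a2)
    have "D (EM.rv (a2 + \<gamma>) l) = 0" for l by (rule D_rv_high[OF p]) (simp add: w)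
    then show ?thesis using 1 rv by (simp add: D_rv D_zero)
  next
    case 2
    then have "D (EM.rv \<gamma> k) = EM.cart ((- k) *s r6 2)" using D_rv[OF rv, of k] by simp
    then show ?thesis by (simp only: D_cart D_rv_a2)
  next
    case 3
    then show ?thesis using rv by (simp add: D_rv D_zero)
  qed
qed (simp add: D_linear)

subsection \<open>Comparison with \<open>\<gg>(2,6)\<close>\<close>

definition node :: "5 \<Rightarrow> 6" where
  "node j = (if j = 1 then 1 else if j = 2 then 3 else if j = 3 then 4 else if j = 4 then 5 else 6)"

definition rest :: "'k^6 \<Rightarrow> 'k^5" where "rest t = (\<chi> j. t $ node j)"

text \<open>Forgets the coordinate at node 2. On vectors of weight 0 or - 1 this inverts
  \<open>iota26\<close>, because there the weight determines the forgotten coordinate.\<close>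

definition kap :: "int^6 \<Rightarrow> int^5" where "kap x = vector [x$1, x$3, x$4, x$5, x$6]"

text \<open>Meant for the kernel of D: it keeps the coefficients of weight 0 and the Cartan part,
  whose entry at node 2 vanishes on that kernel.\<close>

definition P :: "('k^6) \<times> (int^6 \<Rightarrow> 'k) \<Rightarrow> ('k^5) \<times> (int^5 \<Rightarrow> 'k)" where
  "P u = (rest (fst u), \<lambda>y. if y \<in> G.R \<and> par26 y = 0 then snd u (iota26 y) else 0)"

text \<open>Meant for the kernel of D^2: it keeps the coefficients of weight - 1. The Cartan part is
  dropped because it is contained in ker D + im D, being spanned by the kernel of alpha_2 and by
  h_2, a multiple of D f_2.\<close>

definition Qo :: "('k^6) \<times> (int^6 \<Rightarrow> 'k) \<Rightarrow> ('k^5) \<times> (int^5 \<Rightarrow> 'k)" where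
  "Qo u = (0, \<lambda>y. if y \<in> G.R \<and> par26 y = 1 then snd u (iota26 y) else 0)"

lemma node_simps: "node 1 = 1" "node 2 = 3" "node 3 = 4" "node 4 = 5" "node 5 = 6"
  by (simp_all add: node_def)

lemma rest_simps: "rest t $ 1 = t $ 1" "rest t $ 2 = t $ 3" "rest t $ 3 = t $ 4" "rest t $ 4 = t $ 5" "rest t $ 5 = t $ 6"
  by (simp_all add: rest_def node_simps)

lemma rest_linear: "rest (s + t) = rest s + rest t" "rest (k *s t) = k *s rest t" "rest 0 = 0" "rest (s - t) = rest s - rest t"
  by (simp_all add: rest_def vec_eq_iff)

lemma kap_simps: "kap x $ 1 = x$1" "kap x $ 2 = x$3" "kap x $ 3 = x$4" "kap x $ 4 = x$5" "kap x $ 5 = x$6"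
  unfolding kap_def by (rule vector_5)+

lemma kap_iota: "kap (iota26 y) = y"
  unfolding vec_eq_iff forall_5 by (simp add: kap_simps iota26_simps)

lemma iota_kap: "wt x = 0 \<or> wt x = - 1 \<Longrightarrow> iota26 (kap x) = x"
proof -
  assume w: "wt x = 0 \<or> wt x = - 1"
  then have "x$4 div 2 = x$2" by (auto simp: ip_axis)
  then show ?thesis unfolding vec_eq_iff forall_6 by (simp add: kap_simps iota26_simps)
qed

lemma par_kap: "wt x = 0 \<Longrightarrow> par26 (kap x) = 0" "wt x = - 1 \<Longrightarrow> par26 (kap x) = 1"
proof -
  show "par26 (kap x) = 0" if "wt x = 0"
  proof -
    have "x$4 = 2 * x$2" using that by (simp add: ip_axis)
    then show ?thesis by (simp add: par26_def kap_simps)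
  qed
  show "par26 (kap x) = 1" if "wt x = - 1"
  proof -
    have "x$4 = 2 * x$2 + 1" using that by (simp add: ip_axis)
    then show ?thesis by (simp add: par26_def kap_simps)
  qed
qed

lemma wt_iota: "wt (iota26 y) = (if par26 y = 1 then - 1 else 0)"
  by (rule G.ip_\<omega>)

lemma iota_R: "iota26 y \<in> E.R \<longleftrightarrow> y \<in> G.R"
  by (simp add: E.R_def G.R_def)

lemma kap_R: "x \<in> E.R \<Longrightarrow> wt x = 0 \<or> wt x = - 1 \<Longrightarrow> kap x \<in> G.R"
  using iota_R[of "kap x"] iota_kap[of x] by simp

lemma P_linear: "P (u + v) = P u + P v" "P (EM.smul k u) = GM.smul k (P u)"
  by (rule GM.pair_eqI; simp add: P_def rest_linear EM.smul_def GM.smul_def)+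

lemma Qo_linear: "Qo (u + v) = Qo u + Qo v" "Qo (EM.smul k u) = GM.smul k (Qo u)"
  by (rule GM.pair_eqI; simp add: Qo_def EM.smul_def GM.smul_def)+

lemma P_minus: "P (- u) = - P u"
proof -
  have "P (EM.smul (-1) u) = GM.smul (-1) (P u)" by (rule P_linear)
  then show ?thesis by simp
qed

lemma P_diff: "P (u - v) = P u - P v"
  using P_linear(1)[of u "- v"] by (simp add: P_minus)

lemma P_cart: "P (EM.cart t) = GM.cart (rest t)"
  by (rule GM.pair_eqI) (simp_all add: P_def)

lemma Qo_cart: "Qo (EM.cart t) = 0"
  by (rule GM.pair_eqI) (simp_all add: Qo_def)

lemma P_zero: "P 0 = 0" by (rule GM.pair_eqI) (simp_all add: P_def rest_linear)

lemma Qo_zero: "Qo 0 = 0" by (rule GM.pair_eqI) (simp_all add: Qo_def)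

lemma P_rv: "x \<in> E.R \<Longrightarrow> P (EM.rv x k) = (if wt x = 0 then GM.rv (kap x) k else 0)"
proof (rule GM.pair_eqI)
  fix y assume x: "x \<in> E.R"
  have "iota26 y = x \<and> par26 y = 0 \<longleftrightarrow> wt x = 0 \<and> y = kap x"
    using wt_iota[of y] iota_kap[of x] par_kap(1)[of x] kap_iota[of y] by auto
  then show "snd (P (EM.rv x k)) y = snd (if wt x = 0 then GM.rv (kap x) k else 0) y"
    using kap_R[OF x] by (auto simp: P_def EM.snd_rv GM.snd_rv)
qed (simp add: P_def rest_linear)

lemma Qo_rv: "x \<in> E.R \<Longrightarrow> Qo (EM.rv x k) = (if wt x = - 1 then GM.rv (kap x) k else 0)"
proof (rule GM.pair_eqI)
  fix y assume x: "x \<in> E.R"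
  have "iota26 y = x \<and> par26 y = 1 \<longleftrightarrow> wt x = - 1 \<and> y = kap x"
    using wt_iota[of y] iota_kap[of x] par_kap(2)[of x] kap_iota[of y] by auto
  then show "snd (Qo (EM.rv x k)) y = snd (if wt x = - 1 then GM.rv (kap x) k else 0) y"
    using kap_R[OF x] by (auto simp: Qo_def EM.snd_rv GM.snd_rv)
qed (simp add: Qo_def)

lemma root_G: "GM.root y t = of_int (y$1) * t$1 + of_int (y$2) * t$2 + of_int (y$3) * t$3
    + of_int (y$4) * t$4 + of_int (y$5) * t$5"
  by (simp add: GM.root_def sum_5)

lemma coroot_G: "GM.coroot y = of_int (y$1) *s r5 1 + of_int (y$2) *s r5 2 + of_int (y$3) *s r5 3
    + of_int (y$4) *s r5 4 + of_int (y$5) *s r5 5"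
  by (simp add: GM.coroot_def sum_5)

lemma root_rest: "t $ 2 = 0 \<Longrightarrow> GM.root (kap x) (rest t) = EM.root x t"
  by (simp add: root_G root_E kap_simps rest_simps)

text \<open>The odd node corresponds to h_4 - h_2, on which alpha_2 vanishes mod 3. Its value under
  alpha_4 is 2 + 1 = 0, the diagonal entry 0 of the Cartan matrix of g(2,6).\<close>

lemma rest_rows: "rest (r6 1) = r5 1" "rest (r6 3) = r5 2" "rest (r6 4 - r6 2) = r5 3" "rest (r6 5) = r5 4" "rest (r6 6) = r5 5"
  unfolding vec_eq_iff forall_5
  by (simp_all add: rest_simps r6_simps r5_simps e6_cartan_simps g26_cartan_simps vector_6 vector_5 three_K two_K)

text \<open>Weight 0 means x_4 = 2 x_2, so that x_2 = - x_4 mod 3, and h_4 and h_2 occur only in the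
  combination h_4 - h_2.\<close>

lemma rest_coroot_even: "wt x = 0 \<Longrightarrow> rest (EM.coroot x) = GM.coroot (kap x)"
proof -
  assume "wt x = 0"
  then have x4: "x$4 = 2 * x$2" by (simp add: ip_axis)
  have "(of_int (x$2) :: 'k) + 2 * of_int (x$2) = 3 * of_int (x$2)" by (simp add: algebra_simps)
  then have "(of_int (x$4) :: 'k) = - of_int (x$2)" by (simp add: x4 three_K eq_neg_iff_add_eq_0 add.commute)
  then have "EM.coroot x = of_int (x$1) *s r6 1 + of_int (x$3) *s r6 3 + of_int (x$4) *s (r6 4 - r6 2)
    + of_int (x$5) *s r6 5 + of_int (x$6) *s r6 6"
    by (simp add: coroot_E vec_eq_iff algebra_simps)
  then show ?thesis by (simp only: rest_linear(1,2) rest_rows coroot_G kap_simps)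
qed

text \<open>The coroot of a vector of weight - 1 has value - 1 under alpha_2, and so has h_2 mod 3.
  Their difference lies in the kernel of alpha_2 and again contains h_4 and h_2 only through h_4 -
  h_2.\<close>

lemma rest_coroot_odd: "wt x = - 1 \<Longrightarrow> rest (EM.coroot x - r6 2) = GM.coroot (kap x)"
proof -
  assume "wt x = - 1"
  then have x4: "x$4 = 2 * x$2 + 1" by (simp add: ip_axis)
  have "(of_int (x$2) :: 'k) - 1 + of_int (x$4) = 3 * of_int (x$2)" by (simp add: x4 algebra_simps)
  then have e: "(of_int (x$2) :: 'k) - 1 = - of_int (x$4)" by (simp add: three_K eq_neg_iff_add_eq_0)
  have "EM.coroot x - r6 2 = of_int (x$1) *s r6 1 + (of_int (x$2) - 1) *s r6 2 + of_int (x$3) *s r6 3 + of_int (x$4) *s r6 4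
    + of_int (x$5) *s r6 5 + of_int (x$6) *s r6 6"
    by (simp add: coroot_E vec_eq_iff algebra_simps)
  also have "\<dots> = of_int (x$1) *s r6 1 + of_int (x$3) *s r6 3 + of_int (x$4) *s (r6 4 - r6 2)
    + of_int (x$5) *s r6 5 + of_int (x$6) *s r6 6"
    unfolding e by (simp add: vec_eq_iff algebra_simps)
  finally show ?thesis by (simp only: rest_linear(1,2) rest_rows coroot_G kap_simps)
qed

lemma span_r6: "t \<in> H6 \<longleftrightarrow> (\<exists>k :: 6 \<Rightarrow> 'k. t = k 1 *s r6 1 + k 2 *s r6 2 + k 3 *s r6 3 + k 4 *s r6 4 + k 5 *s r6 5 + k 6 *s r6 6)"
proof
  assume "t \<in> H6"
  then show "\<exists>k :: 6 \<Rightarrow> 'k. t = k 1 *s r6 1 + k 2 *s r6 2 + k 3 *s r6 3 + k 4 *s r6 4 + k 5 *s r6 5 + k 6 *s r6 6"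
  proof (induction t rule: vec.span_induct_alt)
    case base
    show ?case by (intro exI[of _ "\<lambda>_. 0"]) simp
  next
    case (step l x y)
    then obtain m :: "6 \<Rightarrow> 'k" and i where m: "y = m 1 *s r6 1 + m 2 *s r6 2 + m 3 *s r6 3 + m 4 *s r6 4 + m 5 *s r6 5 + m 6 *s r6 6" "x = r6 i" by blast
    show ?case
      by (rule exI[of _ "\<lambda>j. m j + (if j = i then l else 0)"], unfold m)
         (use exhaust_6[of i] in \<open>elim disjE; simp add: vec.scale_left_distrib\<close>)
  qed
next
  assume "\<exists>k :: 6 \<Rightarrow> 'k. t = k 1 *s r6 1 + k 2 *s r6 2 + k 3 *s r6 3 + k 4 *s r6 4 + k 5 *s r6 5 + k 6 *s r6 6"
  then show "t \<in> H6" by (elim exE) (simp add: vec.span_add vec.span_scale vec.span_base)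
qed

lemma span_r5: "t \<in> H5 \<longleftrightarrow> (\<exists>k :: 5 \<Rightarrow> 'k. t = k 1 *s r5 1 + k 2 *s r5 2 + k 3 *s r5 3 + k 4 *s r5 4 + k 5 *s r5 5)"
proof
  assume "t \<in> H5"
  then show "\<exists>k :: 5 \<Rightarrow> 'k. t = k 1 *s r5 1 + k 2 *s r5 2 + k 3 *s r5 3 + k 4 *s r5 4 + k 5 *s r5 5"
  proof (induction t rule: vec.span_induct_alt)
    case base
    show ?case by (intro exI[of _ "\<lambda>_. 0"]) simp
  next
    case (step l x y)
    then obtain m :: "5 \<Rightarrow> 'k" and i where m: "y = m 1 *s r5 1 + m 2 *s r5 2 + m 3 *s r5 3 + m 4 *s r5 4 + m 5 *s r5 5" "x = r5 i" by blast
    show ?case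
      by (rule exI[of _ "\<lambda>j. m j + (if j = i then l else 0)"], unfold m)
         (use exhaust_5[of i] in \<open>elim disjE; simp add: vec.scale_left_distrib\<close>)
  qed
next
  assume "\<exists>k :: 5 \<Rightarrow> 'k. t = k 1 *s r5 1 + k 2 *s r5 2 + k 3 *s r5 3 + k 4 *s r5 4 + k 5 *s r5 5"
  then show "t \<in> H5" by (elim exE) (simp add: vec.span_add vec.span_scale vec.span_base)
qed

lemma rest_H5: "t \<in> H6 \<Longrightarrow> t $ 2 = 0 \<Longrightarrow> rest t \<in> H5"
proof -
  assume "t \<in> H6" "t $ 2 = 0"
  then obtain k :: "6 \<Rightarrow> 'k" where k: "t = k 1 *s r6 1 + k 2 *s r6 2 + k 3 *s r6 3 + k 4 *s r6 4 + k 5 *s r6 5 + k 6 *s r6 6"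
    unfolding span_r6 by blast
  then have "- k 2 = k 4"
    using \<open>t $ 2 = 0\<close> by (simp add: r6_simps e6_cartan_simps vector_6 two_K)
  then have "k 2 = - k 4" by (metis minus_minus)
  then have "t = k 1 *s r6 1 + k 3 *s r6 3 + k 4 *s (r6 4 - r6 2) + k 5 *s r6 5 + k 6 *s r6 6"
    using k by (simp add: vec_eq_iff algebra_simps)
  then have "rest t = k 1 *s r5 1 + k 3 *s r5 2 + k 4 *s r5 3 + k 5 *s r5 4 + k 6 *s r5 5"
    by (simp only: rest_linear(1,2) rest_rows)
  then show ?thesis by (simp add: vec.span_add vec.span_scale vec.span_base)
qed

lemma rest_onto: "s \<in> H5 \<Longrightarrow> \<exists>t\<in>H6. t $ 2 = 0 \<and> rest t = s"
proof -
  assume "s \<in> H5"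
  then obtain k :: "5 \<Rightarrow> 'k" where k: "s = k 1 *s r5 1 + k 2 *s r5 2 + k 3 *s r5 3 + k 4 *s r5 4 + k 5 *s r5 5" unfolding span_r5 by blast
  let ?t = "k 1 *s r6 1 + k 2 *s r6 3 + k 3 *s (r6 4 - r6 2) + k 4 *s r6 5 + k 5 *s r6 6"
  have "?t \<in> H6" by (simp add: vec.span_add vec.span_scale vec.span_base vec.span_diff)
  moreover have "?t $ 2 = 0" by (simp add: r6_simps e6_cartan_simps vector_6 two_K)
  moreover have "rest ?t = s" unfolding k by (simp only: rest_linear(1,2) rest_rows)
  ultimately show ?thesis by blast
qed

lemma kap_add: "kap (x + y) = kap x + kap y"
  unfolding vec_eq_iff forall_5 by (simp add: kap_simps)

lemma kap_a2: "kap a2 = 0"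
  unfolding vec_eq_iff forall_5 by (simp add: kap_simps axis_6_simps)

lemma kap_sum_R:
  assumes "wt (x + y) = 0 \<or> wt (x + y) = - 1"
  shows "kap x + kap y \<in> G.R \<longleftrightarrow> x + y \<in> E.R" "kap x + kap y = 0 \<and> wt (x + y) = 0 \<longleftrightarrow> x + y = 0"
proof -
  have i: "iota26 (kap x + kap y) = x + y" using iota_kap[OF assms] by (simp add: kap_add)
  then show "kap x + kap y \<in> G.R \<longleftrightarrow> x + y \<in> E.R" using iota_R by metis
  show "kap x + kap y = 0 \<and> wt (x + y) = 0 \<longleftrightarrow> x + y = 0"
  proof
    show "x + y = 0" if "kap x + kap y = 0 \<and> wt (x + y) = 0" using that i G.\<iota>_zero_iff[of 0] by simp
    assume 0: "x + y = 0"
    then have "kap x + kap y = 0" using i G.\<iota>_zero_iff[of "kap x + kap y"] by simp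
    moreover have "wt (x + y) = 0" unfolding 0 by (simp add: ip_simps)
    ultimately show "kap x + kap y = 0 \<and> wt (x + y) = 0" ..
  qed
qed

lemma ker_D_induct [consumes 2, case_names cart rv add]:
  assumes "u \<in> EM.Car" "D u = 0"
    and ct: "\<And>t. t \<in> H6 \<Longrightarrow> t $ 2 = 0 \<Longrightarrow> Q (EM.cart t)"
    and rv: "\<And>x k. x \<in> E.R \<Longrightarrow> 0 \<le> wt x \<Longrightarrow> Q (EM.rv x k)" and ad: "\<And>u v. Q u \<Longrightarrow> Q v \<Longrightarrow> Q (u + v)"
  shows "Q u"
  by (rule EM.support_induct[OF assms(1), of "{t\<in>H6. t $ 2 = 0}" "{x. 0 \<le> wt x}"])
     (use assms(1) ker_D[OF assms(1,2)] ct rv ad in \<open>auto simp: EM.Car_def\<close>)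

lemma ker_DD_induct [consumes 2, case_names cart rv add]:
  assumes "u \<in> EM.Car" "D (D u) = 0"
    and ct: "\<And>t. t \<in> H6 \<Longrightarrow> Q (EM.cart t)"
    and rv: "\<And>x k. x \<in> E.R \<Longrightarrow> - 1 \<le> wt x \<Longrightarrow> Q (EM.rv x k)" and ad: "\<And>u v. Q u \<Longrightarrow> Q v \<Longrightarrow> Q (u + v)"
  shows "Q u"
  by (rule EM.support_induct[OF assms(1), of H6 "{x. - 1 \<le> wt x}"])
     (use assms(1) ker_DD_wt[OF assms(1,2)] ct rv ad in \<open>auto simp: EM.Car_def\<close>)

lemma c_kap_even: "wt x = 0 \<Longrightarrow> wt y = 0 \<or> wt y = - 1 \<Longrightarrow> G.c (kap x) (kap y) = E.c x y"
  using iota_kap[of x] iota_kap[of y] par_kap(1)[of x] by (auto simp: G.c_def E.c_def)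

text \<open>All weights in the kernel of D are nonnegative. A bracket of root vectors of weight 0
  therefore comes from two factors of weight 0, where \<open>iota26\<close> is additive and the
  structure constants agree; \<open>P\<close> discards root vectors of positive weight.\<close>

lemma br_PP:
  assumes "u \<in> EM.Car" "v \<in> EM.Car" "D u = 0" "D v = 0"
  shows "P (EM.br u v) = GM.br (P u) (P v)"
  using assms(1,3)
proof (induction u rule: ker_D_induct)
  case (cart t)
  note t = cart
  from assms(2,4) show ?case
  proof (induction v rule: ker_D_induct)
    case (cart s)
    then show ?case by (simp add: EM.br_cart_cart GM.br_cart_cart P_cart P_zero)
  next
    case (rv x k)
    then show ?case using root_rest[OF t(2)] kap_R[of x]
      by (simp add: EM.br_cart_rv GM.br_cart_rv P_cart P_rv)
  qed (simp_all add: EM.br_add_right GM.br_add_right P_linear)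
next
  case (rv x k)
  note x = rv
  from assms(2,4) show ?case
  proof (induction v rule: ker_D_induct)
    case (cart t)
    then show ?case using root_rest[OF cart(2)] kap_R[of x] x
      by (simp add: EM.br_rv_cart GM.br_rv_cart P_cart P_rv)
  next
    case (rv y l)
    note y = rv
    show ?case
    proof (cases "wt x = 0 \<and> wt y = 0")
      case True
      then have w: "wt (x + y) = 0" by (simp add: wt_add)
      have 0: "x + y = 0 \<longleftrightarrow> kap x + kap y = 0" using kap_sum_R(2)[of x y] w by simp
      show ?thesis using True x y w kap_sum_R(1)[of x y] kap_R[of x] kap_R[of y] c_kap_even[of x y]
        by (simp add: EM.br_rv_rv GM.br_rv_rv P_rv 0 P_cart P_zero kap_add rest_linear rest_coroot_even)
    next
      case False
      then have w: "0 < wt (x + y)" using x y by (auto simp: wt_add)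
      then have "x + y \<noteq> 0" by (intro wt_ne) simp
      then have "P (EM.br (EM.rv x k) (EM.rv y l)) = 0" using x y w by (simp add: EM.br_rv_rv P_rv P_zero)
      moreover have "P (EM.rv x k) = 0 \<or> P (EM.rv y l) = 0" using False x y by (auto simp: P_rv)
      ultimately show ?thesis by auto
    qed
  qed (simp_all add: EM.br_add_right GM.br_add_right P_linear)
qed (simp_all add: EM.br_add_left GM.br_add_left P_linear)

text \<open>From weights at least 0 and at least - 1 the sum - 1 arises only as 0 + (- 1), and a
  pair with an even member carries no correction factor in \<open>G.c\<close>.\<close>

lemma br_PQ:
  assumes "u \<in> EM.Car" "v \<in> EM.Car" "D u = 0" "D (D v) = 0"
  shows "Qo (EM.br u v) = GM.br (P u) (Qo v)"
  using assms(1,3)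
proof (induction u rule: ker_D_induct)
  case (cart t)
  note t = cart
  from assms(2,4) show ?case
  proof (induction v rule: ker_DD_induct)
    case (cart s)
    then show ?case by (simp add: EM.br_cart_cart Qo_cart Qo_zero)
  next
    case (rv x k)
    then show ?case using root_rest[OF t(2)] kap_R[of x]
      by (simp add: EM.br_cart_rv GM.br_cart_rv P_cart Qo_rv)
  qed (simp_all add: EM.br_add_right GM.br_add_right Qo_linear)
next
  case (rv x k)
  note x = rv
  from assms(2,4) show ?case
  proof (induction v rule: ker_DD_induct)
    case (cart t)
    then show ?case using x by (simp add: EM.br_rv_cart Qo_cart Qo_rv)
  next
    case (rv y l)
    note y = rv
    show ?case
    proof (cases "wt x = 0 \<and> wt y = - 1")
      case True
      then have w: "wt (x + y) = - 1" by (simp add: wt_add)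
      then have 0: "x + y \<noteq> 0" by (intro wt_ne) simp
      have k0: "kap x + kap y \<noteq> 0"
      proof
        assume "kap x + kap y = 0"
        then have "x + y = iota26 0" using iota_kap[of "x + y"] w by (simp add: kap_add)
        then show False using 0 G.\<iota>_0 by simp
      qed
      show ?thesis using True x y w 0 k0 kap_sum_R(1)[of x y] kap_R[of x] kap_R[of y] c_kap_even[of x y]
        by (simp add: EM.br_rv_rv GM.br_rv_rv P_rv Qo_rv Qo_zero kap_add)
    next
      case False
      then have w: "wt (x + y) \<noteq> - 1" using x y by (auto simp: wt_add)
      then have "Qo (EM.br (EM.rv x k) (EM.rv y l)) = 0" using x y by (simp add: EM.br_rv_rv Qo_rv Qo_zero Qo_cart)
      moreover have "P (EM.rv x k) = 0 \<or> Qo (EM.rv y l) = 0" using False x y by (auto simp: P_rv Qo_rv)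
      ultimately show ?thesis by auto
    qed
  qed (simp_all add: EM.br_add_right GM.br_add_right Qo_linear)
qed (simp_all add: EM.br_add_left GM.br_add_left Qo_linear P_linear)

lemma P_in_Par: "u \<in> EM.Car \<Longrightarrow> D u = 0 \<Longrightarrow> P u \<in> GM.Par 0"
  using rest_H5[of "fst u"] ker_D(1)[of u] by (auto simp: GM.Par_def GM.Car_def P_def EM.Car_def)

lemma Qo_in_Par: "Qo u \<in> GM.Par 1"
  by (auto simp: GM.Par_def GM.Car_def Qo_def vec.span_zero split: if_splits)

lemma br_QP:
  assumes "u \<in> EM.Car" "v \<in> EM.Car" "D (D u) = 0" "D v = 0"
  shows "Qo (EM.br u v) = GM.br (Qo u) (P v)"
proof -
  have "EM.br u v = - EM.smul (koszul_sign 0 0) (EM.br v u)"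
    by (rule EM.br_anticommute) (use assms in \<open>simp_all add: EM.Par_def\<close>)
  then have "EM.br u v = EM.smul (-1) (EM.br v u)" by simp
  then have "Qo (EM.br u v) = GM.smul (-1) (GM.br (P v) (Qo u))"
    using br_PQ[OF assms(2,1,4,3)] by (simp only: Qo_linear)
  moreover have "GM.br (Qo u) (P v) = - GM.smul (koszul_sign 1 0) (GM.br (P v) (Qo u))"
    by (rule GM.br_anticommute[OF Qo_in_Par P_in_Par[OF assms(2,4)]])
  ultimately show ?thesis by simp
qed

definition odd_bracket :: "('k^6) \<times> (int^6 \<Rightarrow> 'k) \<Rightarrow> ('k^6) \<times> (int^6 \<Rightarrow> 'k) \<Rightarrow> ('k^6) \<times> (int^6 \<Rightarrow> 'k)" where
  "odd_bracket u v = - EM.br u (D v) + EM.br (D u) v"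

lemma odd_bracket_add: "odd_bracket (u + v) w = odd_bracket u w + odd_bracket v w"
  "odd_bracket w (u + v) = odd_bracket w u + odd_bracket w v"
  by (simp_all add: odd_bracket_def D_linear EM.br_add_left EM.br_add_right algebra_simps)

lemma P_br_high: "x \<in> E.R \<Longrightarrow> y \<in> E.R \<Longrightarrow> 0 < wt (x + y) \<Longrightarrow> P (EM.br (EM.rv x k) (EM.rv y l)) = 0"
  using wt_ne[of "x + y"] by (simp add: EM.br_rv_rv P_rv P_zero)

text \<open>D raises weights by 2, so the odd bracket of two root vectors has weight 0 only if both
  have weight - 1. The two terms then have the same sign q and add up to 2 q at the root x + alpha_2
  + y; as 2 = - 1, this is the constant - q of g(2,6).\<close>

lemma br_QQ:
  assumes "u \<in> EM.Car" "v \<in> EM.Car" "D (D u) = 0" "D (D v) = 0"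
  shows "P (odd_bracket u v) = GM.br (Qo u) (Qo v)"
  using assms(1,3)
proof (induction u rule: ker_DD_induct)
  case (cart t)
  note t = cart
  note na = a2_ne
  from assms(2,4) show ?case
  proof (induction v rule: ker_DD_induct)
    case (cart s)
    then show ?case using a2_R wt_a2
      by (simp add: odd_bracket_def D_cart EM.br_cart_rv EM.br_rv_cart P_linear P_minus P_diff P_rv Qo_cart)
  next
    case (rv x k)
    have "P (EM.br (EM.cart t) (D (EM.rv x k))) = 0"
    proof (cases "wt x = - 1")
      case True
      then have "a2 + x \<in> E.R" "wt (a2 + x) = 1" using a2_add_R[OF rv(1)] by (simp_all add: wt_add wt_a2)
      then show ?thesis using rv True by (simp add: D_rv EM.br_cart_rv P_rv)
    next
      case False
      then show ?thesis using rv na[of x] by (simp add: D_rv P_zero)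
    qed
    moreover have "P (EM.br (D (EM.cart t)) (EM.rv x k)) = 0"
      unfolding D_cart by (rule P_br_high[OF a2_R rv(1)]) (use rv in \<open>simp add: wt_add wt_a2\<close>)
    ultimately show ?case by (simp add: odd_bracket_def P_linear P_minus P_diff Qo_cart)
  qed (simp_all add: odd_bracket_add P_linear GM.br_add_right Qo_linear)
next
  case (rv x k)
  note x = rv
  note na = a2_ne
  from assms(2,4) show ?case
  proof (induction v rule: ker_DD_induct)
    case (cart t)
    have "P (EM.br (D (EM.rv x k)) (EM.cart t)) = 0"
    proof (cases "wt x = - 1")
      case True
      then have "a2 + x \<in> E.R" "wt (a2 + x) = 1" using a2_add_R[OF x(1)] by (simp_all add: wt_add wt_a2)
      then show ?thesis using x True by (simp add: D_rv EM.br_rv_cart P_rv)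
    next
      case False
      then show ?thesis using x na[of x] by (simp add: D_rv P_zero)
    qed
    moreover have "P (EM.br (EM.rv x k) (D (EM.cart t))) = 0"
      unfolding D_cart by (rule P_br_high[OF x(1) a2_R]) (use x in \<open>simp add: wt_add wt_a2\<close>)
    ultimately show ?case by (simp add: odd_bracket_def P_linear P_minus P_diff Qo_cart)
  next
    case (rv y l)
    note y = rv
    show ?case
    proof (cases "wt x = - 1 \<and> wt y = - 1")
      case False
      have 1: "P (EM.br (EM.rv x k) (D (EM.rv y l))) = 0"
      proof (cases "wt y = - 1")
        case True
        then have "a2 + y \<in> E.R" "0 < wt (x + (a2 + y))"
          using a2_add_R[OF y(1)] False x by (simp_all add: wt_add wt_a2)
        then show ?thesis using y True P_br_high[OF x(1)] by (simp add: D_rv)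
      next
        case False
        then show ?thesis using y na[of y] by (simp add: D_rv P_zero)
      qed
      have 2: "P (EM.br (D (EM.rv x k)) (EM.rv y l)) = 0"
      proof (cases "wt x = - 1")
        case True
        then have "a2 + x \<in> E.R" "0 < wt ((a2 + x) + y)"
          using a2_add_R[OF x(1)] False y by (simp_all add: wt_add wt_a2)
        then show ?thesis using x True P_br_high[OF _ y(1)] by (simp add: D_rv)
      next
        case False
        then show ?thesis using x na[of x] by (simp add: D_rv P_zero)
      qed
      have "Qo (EM.rv x k) = 0 \<or> Qo (EM.rv y l) = 0" using False x y by (auto simp: Qo_rv)
      then show ?thesis using 1 2 by (auto simp: odd_bracket_def P_linear P_minus P_diff)
    next
      case True
      define s where "s = x + (a2 + y)"
      define q where "q = (eps a2 x * eps x y * eps a2 y :: 'k)"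
      have s: "(a2 + x) + y = s" "x + (a2 + y) = s" by (simp_all add: s_def algebra_simps)
      have w: "wt s = 0" using True by (simp add: s_def wt_add wt_a2)
      have ks: "kap s = kap x + kap y" by (simp add: s_def kap_add kap_a2)
      have ik: "iota26 (kap s) = s" by (rule iota_kap) (simp add: w)
      have sR: "kap x + kap y \<in> G.R \<longleftrightarrow> s \<in> E.R" using iota_R[of "kap s"] ik ks by simp
      have s0: "kap x + kap y = 0 \<longleftrightarrow> s = 0" using ik ks G.\<iota>_zero_iff[of "kap s"] by metis
      have R: "a2 + x \<in> E.R" "a2 + y \<in> E.R" using a2_add_R x y True by simp_all
      have exa: "eps x a2 = (- eps a2 x :: 'k)"
        using eps_swap[of a2 x, where 'a = 'k] True by (simp add: ip_sym[of a2 x] msign_def)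
      have c1: "E.c x (a2 + y) * E.c a2 y = - q"
        by (simp add: E.c_def q_def eps_simps exa mult_ac)
      have c2: "E.c (a2 + x) y * E.c a2 x = q"
        by (simp add: E.c_def q_def eps_simps mult_ac)
      have c3: "G.c (kap x) (kap y) = - q"
        using True iota_kap[of x] iota_kap[of y] par_kap(2)[of x] par_kap(2)[of y]
        by (simp add: G.c_def q_def mult_ac)
      have kR: "kap x \<in> G.R" "kap y \<in> G.R" using kap_R x y True by simp_all
      have dx: "D (EM.rv x k) = EM.rv (a2 + x) (E.c a2 x * k)" and dy: "D (EM.rv y l) = EM.rv (a2 + y) (E.c a2 y * l)"
        using D_rv[OF x(1)] D_rv[OF y(1)] True by simp_all
      have m1: "E.c x (a2 + y) * k * (E.c a2 y * l) = - q * k * l"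
        unfolding c1[symmetric] by (simp add: mult_ac)
      have m2: "E.c (a2 + x) y * (E.c a2 x * k) * l = q * k * l"
        unfolding c2[symmetric] by (simp add: mult_ac)
      have b1: "EM.br (EM.rv x k) (D (EM.rv y l)) = (if s \<in> E.R then EM.rv s (- q * k * l)
         else if s = 0 then EM.cart ((- q * k * l) *s EM.coroot x) else 0)"
        unfolding dy EM.br_rv_rv[OF x(1) R(2)] s m1 ..
      have b2: "EM.br (D (EM.rv x k)) (EM.rv y l) = (if s \<in> E.R then EM.rv s (q * k * l)
         else if s = 0 then EM.cart ((q * k * l) *s EM.coroot (a2 + x)) else 0)"
        unfolding dx EM.br_rv_rv[OF R(1) y(1)] s m2 ..
      have b3: "GM.br (Qo (EM.rv x k)) (Qo (EM.rv y l)) = (if s \<in> E.R then GM.rv (kap s) (- q * k * l)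
         else if s = 0 then GM.cart ((- q * k * l) *s GM.coroot (kap x)) else 0)"
        using x y True by (simp add: Qo_rv GM.br_rv_rv[OF kR] sR s0 c3 ks)
      consider "s \<in> E.R" | "s \<notin> E.R" "s = 0" | "s \<notin> E.R" "s \<noteq> 0" by blast
      then show ?thesis
      proof cases
        case 1
        have "- GM.rv (kap s) (- q * k * l) + GM.rv (kap s) (q * k * l) = GM.rv (kap s) (2 * (q * k * l))"
          by (simp add: GM.rv_simps(1,4)[symmetric] mult_ac)
        then show ?thesis using 1 w by (simp add: odd_bracket_def b1 b2 b3 P_linear P_minus P_diff P_rv two_K mult_ac)
      next
        case 2
        have ca: "EM.coroot (a2 + x) = r6 2 + EM.coroot x" by (simp add: coroot_a2)
        \<comment> \<open>The two Cartan terms add up to q times 2 coroot x + h_2, which in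
          characteristic 3 is - q times coroot x - h_2; \<open>rest_coroot_odd\<close> identifies
          this with a coroot of g(2,6).\<close>
        have "- ((- q * k * l) *s rest (EM.coroot x)) + (q * k * l) *s rest (EM.coroot (a2 + x))
          = (q * k * l) *s (2 *s rest (EM.coroot x) + rest (r6 2))"
          unfolding ca by (simp add: vec_eq_iff rest_linear algebra_simps)
        also have "\<dots> = (- q * k * l) *s rest (EM.coroot x - r6 2)"
          by (simp add: vec_eq_iff rest_linear two_K algebra_simps)
        also have "\<dots> = (- q * k * l) *s GM.coroot (kap x)" using rest_coroot_odd[of x] True by simp
        finally have "- GM.cart ((- q * k * l) *s rest (EM.coroot x)) + GM.cart ((q * k * l) *s rest (EM.coroot (a2 + x)))
          = GM.cart ((- q * k * l) *s GM.coroot (kap x))"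
          by (simp only: GM.cart_simps(1,4)[symmetric])
        moreover have "P (odd_bracket (EM.rv x k) (EM.rv y l)) =
          - GM.cart ((- q * k * l) *s rest (EM.coroot x)) + GM.cart ((q * k * l) *s rest (EM.coroot (a2 + x)))"
          unfolding odd_bracket_def b1 b2 if_not_P[OF 2(1)] if_P[OF 2(2)] P_linear(1) P_minus P_cart rest_linear(2) ..
        ultimately show ?thesis unfolding b3 if_not_P[OF 2(1)] if_P[OF 2(2)] by (rule trans[rotated])
      next
        case 3
        then show ?thesis by (simp add: odd_bracket_def b1 b2 b3 P_zero)
      qed
    qed
  qed (simp_all add: odd_bracket_add P_linear GM.br_add_right Qo_linear)
qed (simp_all add: odd_bracket_add P_linear GM.br_add_left Qo_linear)

end

section \<open>Existence of Jordan decompositions\<close>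

context jordan_transfer
begin

lemma D_pow_add: "(D ^^ k) (u + v) = (D ^^ k) u + (D ^^ k) v" and D_pow_scale: "(D ^^ k) (s a u) = s a ((D ^^ k) u)"
  and D_pow_zero: "(D ^^ k) 0 = 0"
  by (induction k) (simp_all add: D_add D_scale D_zero)

lemma D_pow_sum: "(D ^^ k) (sum f S) = (\<Sum>i\<in>S. (D ^^ k) (f i))"
  by (induction S rule: infinite_finite_induct) (simp_all add: D_pow_zero D_pow_add)

lemma D_pow_diff: "(D ^^ k) (u - v) = (D ^^ k) u - (D ^^ k) v"
  using D_pow_add[of k u "- v"] D_pow_scale[of k "-1" v] by simp

text \<open>Chains ending in a basis \<open>f\<close> of the kernel of \<open>D\<close> that is adapted to the filtration by the
  images of the powers of \<open>D\<close> form a Jordan basis. The position of a vector in its chain is counted from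
  the end: \<open>D\<^sup>k\<close> maps the vectors of height \<open>k\<close> to members of \<open>f\<close> and kills those of smaller height.\<close>

lemma jordan_basisI:
  fixes n1 n2 n3
  defines "N \<equiv> {1..n1 + n2 + n3}" and "bs \<equiv> block_size n1 n2"
  assumes inj: "inj_on f N" and ind: "\<not> module.dependent s (f ` N)"
    and V: "\<And>i. i \<in> N \<Longrightarrow> V i \<in> C" "\<And>i. i \<in> N \<Longrightarrow> (D ^^ (bs i - 1)) (V i) = f i"
      "\<And>i. i \<in> N \<Longrightarrow> (D ^^ bs i) (V i) = 0"
    and filt: "\<And>k x. \<lbrakk>k < 3; x \<in> C; (D ^^ Suc k) x = 0\<rbrakk> \<Longrightarrow> (D ^^ k) x \<in> span (f ` {i\<in>N. k < bs i})"
  shows "jordan_basis n1 n2 n3 V"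
proof -
  define J where "J = jordan_index n1 n2 n3"
  have J: "p \<in> J \<longleftrightarrow> fst p \<in> N \<and> snd p < bs (fst p)" for p
    by (cases p) (simp add: J_def jordan_index_def N_def bs_def)
  have finJ: "finite J" unfolding J_def by (rule finite_jordan_index)
  have finN: "finite N" by (simp add: N_def)
  have bs: "0 < bs i" "bs i \<le> 3" for i by (simp_all add: bs_def block_size_def)
  define ht where "ht p = bs (fst p) - 1 - snd p" for p :: "nat \<times> nat"
  define S where "S c = (\<Sum>p\<in>J. s (c p) ((D ^^ snd p) (V (fst p))))" for c :: "nat \<times> nat \<Rightarrow> 'k"
  have SC: "S c \<in> C" for c unfolding S_def
    by (rule subspace_sum[OF C_subspace]) (simp add: J subspace_scale[OF C_subspace] D_pow_C V)
  have S_add: "S (\<lambda>p. c p + c' p) = S c + S c'" for c c'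
    by (simp add: S_def scale_left_distrib sum.distrib)
  have S_diff: "S (\<lambda>p. c p - c' p) = S c - S c'" for c c'
    by (simp add: S_def scale_left_diff_distrib sum_subtractf)
  have vanish: "(D ^^ m) (V i) = 0" if "i \<in> N" "bs i \<le> m" for i m
  proof -
    have "(D ^^ m) (V i) = (D ^^ (m - bs i)) ((D ^^ bs i) (V i))"
      using that(2) by (simp add: funpow_add[symmetric, THEN fun_cong, unfolded comp_apply])
    then show ?thesis using V(3)[OF that(1)] D_pow_zero by simp
  qed
  \<comment> \<open>On a combination without terms of height above k, D^k sees exactly the terms of
    height k and sends their vectors to members of f. Uniqueness of coordinates follows by going
    down through the heights, existence by induction on the power of D that kills a vector.\<close>
  have key: "(D ^^ k) (S c) = (\<Sum>i\<in>{i\<in>N. k < bs i}. s (c (i, bs i - 1 - k)) (f i))"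
    if c: "\<And>p. p \<in> J \<Longrightarrow> k < ht p \<Longrightarrow> c p = 0" for k c
  proof -
    let ?g = "\<lambda>i. (i, bs i - 1 - k)"
    let ?t = "\<lambda>p. s (c p) ((D ^^ (k + snd p)) (V (fst p)))"
    have "(D ^^ k) (S c) = (\<Sum>p\<in>J. ?t p)"
      by (simp add: S_def D_pow_sum D_pow_scale funpow_add)
    also have "\<dots> = (\<Sum>p\<in>?g ` {i\<in>N. k < bs i}. ?t p)"
    proof (rule sum.mono_neutral_right[OF finJ])
      show "?g ` {i\<in>N. k < bs i} \<subseteq> J" using bs(1) by (auto simp: J)
      show "\<forall>p\<in>J - ?g ` {i\<in>N. k < bs i}. ?t p = 0"
      proof
        fix p assume p: "p \<in> J - ?g ` {i\<in>N. k < bs i}"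
        have "ht p \<noteq> k"
        proof
          assume h: "ht p = k"
          then have "p = ?g (fst p)" "k < bs (fst p)" using p bs(1)[of "fst p"]
            by (auto simp: J ht_def prod_eq_iff)
          then show False using p J by blast
        qed
        then consider "k < ht p" | "ht p < k" by linarith
        then show "?t p = 0"
        proof cases
          case 1
          then show ?thesis using c p by simp
        next
          case 2
          then have "bs (fst p) \<le> k + snd p" by (simp add: ht_def)
          then show ?thesis using vanish p J by simp
        qed
      qed
    qed
    also have "\<dots> = (\<Sum>i\<in>{i\<in>N. k < bs i}. ?t (?g i))"
      by (rule sum.reindex_cong[OF _ refl refl]) (simp add: inj_on_def)
    also have "\<dots> = (\<Sum>i\<in>{i\<in>N. k < bs i}. s (c (i, bs i - 1 - k)) (f i))"
      by (rule sum.cong[OF refl]) (auto simp: V(2)[symmetric])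
    finally show ?thesis .
  qed
  have step: "c p = 0" if c: "\<And>p. p \<in> J \<Longrightarrow> k < ht p \<Longrightarrow> c p = 0" and S0: "S c = 0" and p: "p \<in> J" "ht p = k" for c k p
  proof -
    define u where "u v = c (the_inv_into N f v, bs (the_inv_into N f v) - 1 - k)" for v
    have "(\<Sum>v\<in>f ` {i\<in>N. k < bs i}. s (u v) v) = (\<Sum>i\<in>{i\<in>N. k < bs i}. s (u (f i)) (f i))"
      by (rule sum.reindex_cong[OF _ refl refl]) (rule inj_on_subset[OF inj], blast)
    also have "\<dots> = (\<Sum>i\<in>{i\<in>N. k < bs i}. s (c (i, bs i - 1 - k)) (f i))"
      by (rule sum.cong[OF refl]) (simp add: u_def the_inv_into_f_f[OF inj])
    also have "\<dots> = (D ^^ k) (S c)" by (rule key[OF c, symmetric])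
    finally have z: "(\<Sum>v\<in>f ` {i\<in>N. k < bs i}. s (u v) v) = 0" using S0 D_pow_zero by simp
    have pN: "fst p \<in> N" "k < bs (fst p)" using p bs(1)[of "fst p"] by (auto simp: J ht_def)
    have "u (f (fst p)) = 0"
      by (rule independentD[OF ind _ _ z]) (use finN pN in auto)
    moreover have "bs (fst p) - 1 - k = snd p" using p by (auto simp: J ht_def)
    ultimately show ?thesis using the_inv_into_f_f[OF inj pN(1)] by (simp add: u_def)
  qed
  have unique: "c p = 0" if "S c = 0" "p \<in> J" for c p
  proof -
    have "\<forall>p\<in>J. 3 - k \<le> ht p \<longrightarrow> c p = 0" for k
    proof (induction k)
      case 0
      have "ht p < 3" for p unfolding ht_def using bs[of "fst p"] by linarith
      then have "\<not> 3 \<le> ht p" for p by (metis leD)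
      then show ?case by simp
    next
      case (Suc k)
      show ?case
      proof (intro ballI impI)
        fix p assume p: "p \<in> J" "3 - Suc k \<le> ht p"
        show "c p = 0"
        proof (cases "3 - k \<le> ht p")
          case True then show ?thesis using Suc p by blast
        next
          case False
          then have "ht p = 3 - Suc k" using p by linarith
          moreover have "c p' = 0" if "p' \<in> J" "3 - Suc k < ht p'" for p' using Suc that by simp
          ultimately show ?thesis using step[of "3 - Suc k" c p] \<open>S c = 0\<close> p(1) by blast
        qed
      qed
    qed
    from this[of 3] show ?thesis using that(2) by simp
  qed
  have exist: "\<exists>c. x = S c" if "x \<in> C" "(D ^^ k) x = 0" "k \<le> 3" for k x
    using that
  proof (induction k arbitrary: x)
    case 0
    have "S (\<lambda>_. 0) = 0" by (simp add: S_def)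
    then show ?case using 0 by (intro exI[of _ "\<lambda>_. 0"]) simp
  next
    case (Suc k)
    let ?N = "{i\<in>N. k < bs i}"
    have "(D ^^ k) x \<in> span (f ` ?N)" using filt[of k x] Suc.prems by simp
    then obtain u where "(D ^^ k) x = (\<Sum>v\<in>f ` ?N. s (u v) v)" using span_finite[of "f ` ?N"] finN by auto
    also have "\<dots> = (\<Sum>i\<in>?N. s (u (f i)) (f i))"
      by (rule sum.reindex_cong[OF _ refl refl]) (rule inj_on_subset[OF inj], blast)
    finally have y: "(D ^^ k) x = (\<Sum>i\<in>?N. s (u (f i)) (f i))" .
    define c0 where "c0 p = (if ht p = k then u (f (fst p)) else 0)" for p
    have "(D ^^ k) (S c0) = (\<Sum>i\<in>?N. s (c0 (i, bs i - 1 - k)) (f i))" by (rule key) (simp add: c0_def)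
    also have "\<dots> = (D ^^ k) x" unfolding y by (rule sum.cong[OF refl]) (auto simp: c0_def ht_def)
    finally have "(D ^^ k) (x - S c0) = 0" by (simp add: D_pow_diff)
    then obtain c1 where c1: "x - S c0 = S c1"
      using Suc.IH[of "x - S c0"] Suc.prems SC subspace_diff[OF C_subspace] by auto
    have "x = S (\<lambda>p. c1 p + c0 p)" unfolding S_add c1[symmetric] by simp
    then show ?case by blast
  qed
  have "\<exists>!c. coords n1 n2 n3 V w c" if w: "w \<in> C" for w
  proof -
    have "(D ^^ 3) w = 0" using D_cube[OF w] by (simp add: numeral_3_eq_3)
    then obtain c where c: "w = S c" using exist[of w 3] w by auto
    define c' where "c' p = (if p \<in> J then c p else 0)" for p
    have "coords n1 n2 n3 V w c'" unfolding coords_def c J_def[symmetric]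
      by (auto simp: c'_def S_def intro!: sum.cong)
    moreover have "a = b" if "coords n1 n2 n3 V w a" "coords n1 n2 n3 V w b" for a b
    proof
      fix p
      have "S (\<lambda>p. a p - b p) = 0" unfolding S_diff using that unfolding coords_def S_def J_def by simp
      moreover have "a p = 0" "b p = 0" if "p \<notin> J" using that \<open>coords n1 n2 n3 V w a\<close> \<open>coords n1 n2 n3 V w b\<close>
        unfolding coords_def J_def by blast+
      ultimately show "a p = b p" using unique[of "\<lambda>p. a p - b p" p] by (cases "p \<in> J") simp_all
    qed
    ultimately show ?thesis by blast
  qed
  then show ?thesis unfolding jordan_basis_def N_def[symmetric] bs_def[symmetric] using V by blast
qed

text \<open>\<open>E k\<close> is the intersection of ker D with the image of D^k on
  \<open>C\<close>, and these spaces decrease with k. A basis of \<open>E 2\<close> is extended to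
  \<open>E 1\<close> and to \<open>E 0\<close>; the vectors new at each stage are the ends of chains
  of lengths 3, 2 and 1. They are listed by increasing length, as the numbering of blocks
  demands.\<close>

lemma jordan_basis_exists:
  assumes "finite F" "C \<subseteq> span F"
  shows "\<exists>n1 n2 n3 V. jordan_basis n1 n2 n3 V"
proof -
  define E where "E k = (D ^^ k) ` {x\<in>C. (D ^^ Suc k) x = 0}" for k
  have mono: "E (Suc k) \<subseteq> E k" for k
  proof
    fix y assume "y \<in> E (Suc k)"
    then obtain x where x: "x \<in> C" "(D ^^ Suc (Suc k)) x = 0" "y = (D ^^ Suc k) x" unfolding E_def by blast
    then have "D x \<in> C" "(D ^^ Suc k) (D x) = 0" "y = (D ^^ k) (D x)"
      using D_C by (simp_all add: funpow_swap1)
    then show "y \<in> E k" unfolding E_def by blast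
  qed
  have EC: "E k \<subseteq> C" for k using D_pow_C by (auto simp: E_def)
  obtain B3 where B3: "B3 \<subseteq> E 2" "\<not> module.dependent s B3" "E 2 \<subseteq> span B3" by (rule maximal_independent_subset)
  have "B3 \<subseteq> E 1" using B3(1) mono[of 1] by (simp add: numeral_2_eq_2) 
  then obtain B2 where B2: "B3 \<subseteq> B2" "B2 \<subseteq> E 1" "\<not> module.dependent s B2" "E 1 \<subseteq> span B2"
    using maximal_independent_subset_extend[OF _ B3(2)] by metis
  have "B2 \<subseteq> E 0" using B2(2) mono[of 0] by simp
  then obtain B1 where B1: "B2 \<subseteq> B1" "B1 \<subseteq> E 0" "\<not> module.dependent s B1" "E 0 \<subseteq> span B1"
    using maximal_independent_subset_extend[OF _ B2(3)] by metis
  have "B1 \<subseteq> span F" using B1(2) EC assms(2) by blast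
  then have fin: "finite B1" using independent_span_bound[OF assms(1) B1(3)] by blast
  obtain xs where xs: "set xs = B1 - B2" "distinct xs" using finite_distinct_list[of "B1 - B2"] fin by blast
  obtain ys where ys: "set ys = B2 - B3" "distinct ys"
    using finite_distinct_list[of "B2 - B3"] finite_subset[OF B1(1) fin] by blast
  obtain zs where zs: "set zs = B3" "distinct zs"
    using finite_distinct_list[of B3] finite_subset[OF B1(1) fin] finite_subset[OF B2(1)] by blast
  define n1 n2 n3 where n: "n1 = length xs" "n2 = length ys" "n3 = length zs"
  define N where "N = {1..n1 + n2 + n3}"
  define bs where "bs = block_size n1 n2"
  define f where "f i = (xs @ ys @ zs) ! (i - 1)" for i
  have dist: "distinct (xs @ ys @ zs)" using xs ys zs B2(1) B1(1) by auto
  have inj: "inj_on f N"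
  proof (rule inj_onI)
    fix i j assume ij: "i \<in> N" "j \<in> N" "f i = f j"
    then have "i - 1 < length (xs @ ys @ zs)" "j - 1 < length (xs @ ys @ zs)" "1 \<le> i" "1 \<le> j" by (auto simp: N_def n)
    then show "i = j" using nth_eq_iff_index_eq[OF dist, of "i - 1" "j - 1"] ij(3) unfolding f_def by linarith
  qed
  have f1: "f i \<in> B1 - B2 \<and> bs i = 1" if "i \<in> {1..n1}" for i
  proof -
    have l: "i - 1 < length xs" using that by (auto simp: n)
    then have "f i = xs ! (i - 1)" by (simp only: f_def nth_append if_True)
    then show ?thesis using nth_mem[OF l] that by (simp add: xs(1) bs_def block_size_def)
  qed
  have f2: "f i \<in> B2 - B3 \<and> bs i = 2" if "i \<in> {n1<..n1 + n2}" for i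
  proof -
    have l: "i - 1 - length xs < length ys" "\<not> i - 1 < length xs" using that by (auto simp: n)
    then have "f i = ys ! (i - 1 - length xs)" by (simp only: f_def nth_append if_True if_False)
    then show ?thesis using nth_mem[OF l(1)] that by (simp add: ys(1) bs_def block_size_def)
  qed
  have f3: "f i \<in> B3 \<and> bs i = 3" if "i \<in> {n1 + n2<..n1 + n2 + n3}" for i
  proof -
    have l: "i - 1 - length xs - length ys < length zs" "\<not> i - 1 - length xs < length ys" "\<not> i - 1 < length xs"
      using that by (auto simp: n)
    then have "f i = zs ! (i - 1 - length xs - length ys)" by (simp only: f_def nth_append if_True if_False)
    then show ?thesis using nth_mem[OF l(1)] that by (simp add: zs(1) bs_def block_size_def)
  qed
  have three: "i \<in> {1..n1} \<or> i \<in> {n1<..n1 + n2} \<or> i \<in> {n1 + n2<..n1 + n2 + n3}" if "i \<in> N" for i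
    using that by (auto simp: N_def)
  have im: "f ` N = B1"
  proof -
    have "f ` N = set (xs @ ys @ zs)" 
    proof -
      have "N = Suc ` {..<length (xs @ ys @ zs)}"
        unfolding N_def n by (simp add: image_Suc_lessThan add.assoc)
      then show ?thesis unfolding set_conv_nth f_def by (auto simp: image_image)
    qed
    then show ?thesis using xs ys zs B1(1) B2(1) by auto
  qed
  have fE: "f i \<in> E (bs i - 1)" if "i \<in> N" for i
    using three[OF that] f1[of i] f2[of i] f3[of i] B1(2) B2(2) B3(1) by auto
  have "\<forall>i\<in>N. \<exists>x. x \<in> C \<and> (D ^^ (bs i - 1)) x = f i \<and> (D ^^ bs i) x = 0"
  proof
    fix i assume "i \<in> N"
    then obtain x where "x \<in> C" "f i = (D ^^ (bs i - 1)) x" "(D ^^ Suc (bs i - 1)) x = 0"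
      using fE[of i] unfolding E_def by blast
    moreover have "Suc (bs i - 1) = bs i" by (simp add: bs_def block_size_def)
    ultimately show "\<exists>x. x \<in> C \<and> (D ^^ (bs i - 1)) x = f i \<and> (D ^^ bs i) x = 0" by metis
  qed
  then obtain V where V: "\<forall>i\<in>N. V i \<in> C \<and> (D ^^ (bs i - 1)) (V i) = f i \<and> (D ^^ bs i) (V i) = 0"
    unfolding bchoice_iff by blast
  have filt: "(D ^^ k) x \<in> span (f ` {i\<in>N. k < bs i})" if k: "k < 3" and x: "x \<in> C" "(D ^^ Suc k) x = 0" for k x
  proof -
    have y: "(D ^^ k) x \<in> E k" using x unfolding E_def by blast
    consider "k = 0" | "k = 1" | "k = 2" using k by linarith
    then show ?thesis
    proof cases
      case 1
      have "{i\<in>N. k < bs i} = N" using 1 by (auto simp: bs_def block_size_def)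
      then show ?thesis using y 1 B1(4) im by auto
    next
      case 2
      have "B2 \<subseteq> f ` {i\<in>N. k < bs i}"
      proof
        fix v assume v: "v \<in> B2"
        then obtain i where i: "i \<in> N" "v = f i" using im B1(1) by blast
        then have "k < bs i" using three[OF i(1)] f1[of i] f2[of i] f3[of i] v 2 by auto
        then show "v \<in> f ` {i\<in>N. k < bs i}" using i by blast
      qed
      then show ?thesis using y 2 B2(4) span_mono by blast
    next
      case 3
      have "B3 \<subseteq> f ` {i\<in>N. k < bs i}"
      proof
        fix v assume v: "v \<in> B3"
        then obtain i where i: "i \<in> N" "v = f i" using im B1(1) B2(1) by blast
        then have "k < bs i" using three[OF i(1)] f1[of i] f2[of i] f3[of i] v 3 B2(1) by auto
        then show "v \<in> f ` {i\<in>N. k < bs i}" using i by blast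
      qed
      then show ?thesis using y 3 B3(3) span_mono by blast
    qed
  qed
  have ind: "\<not> module.dependent s (f ` N)" using B1(3) im by simp
  have "jordan_basis n1 n2 n3 V"
    by (rule jordan_basisI[of f]) (use inj ind V filt in \<open>simp_all add: N_def bs_def\<close>)
  then show ?thesis by blast
qed

lemma finitely_spanned:
  assumes "finite F" "C \<subseteq> span F"
  shows "\<exists>B. finite B \<and> B \<subseteq> carrier L \<and> lin_span L B = carrier L"
proof -
  obtain F' where F': "F' \<subseteq> C" "\<not> module.dependent s F'" "C \<subseteq> span F'" by (rule maximal_independent_subset)
  have "finite F'" using independent_span_bound[OF assms(1) F'(2)] F'(1) assms(2) by blast
  define B where "B = the_inv_into (carrier L) \<theta> ` F'"
  have \<theta>B: "the_inv_into (carrier L) \<theta> v \<in> carrier L" "\<theta> (the_inv_into (carrier L) \<theta> v) = v" if "v \<in> F'" for v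
    using the_inv_into_into[OF \<theta>_inj, of v] f_the_inv_into_f[OF \<theta>_inj, of v] that F'(1) \<theta>_image by auto
  then have B: "B \<subseteq> carrier L" by (auto simp: B_def)
  note sp = lin_span_submodule[OF bilinear_superalgebra_axioms B]
  note N = submoduleD[OF sp(1)]
  have "subspace (\<theta> ` lin_span L B)"
  proof (rule subspaceI)
    show "0 \<in> \<theta> ` lin_span L B" using N(2) \<theta>_zero by (metis imageI)
    fix u v assume u: "u \<in> \<theta> ` lin_span L B"
    then obtain x where x: "x \<in> lin_span L B" "u = \<theta> x" by blast
    show "s k u \<in> \<theta> ` lin_span L B" for k
    proof -
      have "s k u = \<theta> (k \<odot>\<^bsub>L\<^esub> x)" using x N(1) by (simp add: \<theta>_smult subsetD)
      then show ?thesis using N(4)[OF x(1)] by blast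
    qed
    assume "v \<in> \<theta> ` lin_span L B"
    then obtain y where y: "y \<in> lin_span L B" "v = \<theta> y" by blast
    have "u + v = \<theta> (x \<oplus> y)" using x y N(1) by (simp add: \<theta>_add subsetD)
    then show "u + v \<in> \<theta> ` lin_span L B" using N(3)[OF x(1) y(1)] by blast
  qed
  moreover have "F' \<subseteq> \<theta> ` lin_span L B"
  proof
    fix v assume v: "v \<in> F'"
    then have "the_inv_into (carrier L) \<theta> v \<in> lin_span L B" using sp(2) by (auto simp: B_def)
    then show "v \<in> \<theta> ` lin_span L B" using \<theta>B(2)[OF v] by (metis imageI)
  qed
  ultimately have sub: "C \<subseteq> \<theta> ` lin_span L B" using span_minimal F'(3) by blast
  have "carrier L \<subseteq> lin_span L B"
  proof
    fix x assume x: "x \<in> carrier L"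
    then obtain y where "y \<in> lin_span L B" "\<theta> x = \<theta> y" using sub \<theta>_C by blast
    then show "x \<in> lin_span L B" using inj_onD[OF \<theta>_inj] x N(1) by (metis subsetD)
  qed
  then have "lin_span L B = carrier L" using N(1) by blast
  then show ?thesis using B \<open>finite F'\<close> unfolding B_def by blast
qed

end

context characteristic_three
begin

lemma EM_Par: "EM.Par 0 = EM.Car" "EM.Par 1 = {0}"
proof -
  have "u = 0" if "u \<in> EM.Par 1" for u using that
    by (intro EM.pair_eqI) (auto simp: EM.Par_def)
  moreover have "0 \<in> EM.Par 1" using EM.V.subspace_0[OF EM.Par_subspace] by simp
  ultimately show "EM.Par 1 = {0}" by blast
qed (auto simp: EM.Par_def)

lemma P_onto: "v \<in> GM.Par 0 \<Longrightarrow> \<exists>u\<in>EM.Car. D u = 0 \<and> P u = v"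
proof (induction v rule: GM.Par_induct)
  case zero
  show ?case using EM.V.subspace_0[OF EM.Car_subspace] D_zero P_zero by blast
next
  case (cart t)
  then obtain x where x: "x \<in> H6" "x $ 2 = 0" "rest x = t" using rest_onto by blast
  have "EM.cart x \<in> EM.Car" "D (EM.cart x) = 0" "P (EM.cart x) = GM.cart t"
    using EM.cart_in_Car[OF x(1)] x by (simp_all add: D_cart P_cart EM.rv_simps)
  then show ?case by blast
next
  case (rv y k)
  have x: "iota26 y \<in> E.R" "wt (iota26 y) = 0" using rv iota_R by (simp_all add: wt_iota)
  have "EM.rv (iota26 y) k \<in> EM.Car" "D (EM.rv (iota26 y) k) = 0" "P (EM.rv (iota26 y) k) = GM.rv y k"
    using EM.rv_in_Car[OF x(1)] D_rv_high[OF x(1)] P_rv[OF x(1)] x(2) by (simp_all add: kap_iota)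
  then show ?case by blast
next
  case (add u v)
  then obtain a b where ab: "a \<in> EM.Car" "D a = 0" "P a = u" "b \<in> EM.Car" "D b = 0" "P b = v" by blast
  have "a + b \<in> EM.Car" "D (a + b) = 0" "P (a + b) = u + v"
    using EM.V.subspace_add[OF EM.Car_subspace ab(1,4)] ab by (simp_all add: D_linear P_linear)
  then show ?case by blast
qed

lemma Qo_onto: "v \<in> GM.Par 1 \<Longrightarrow> \<exists>u\<in>EM.Car. D (D u) = 0 \<and> Qo u = v"
proof (induction v rule: GM.Par_induct)
  case zero
  show ?case using EM.V.subspace_0[OF EM.Car_subspace] D_zero Qo_zero by (intro bexI[of _ 0]) simp_all
next
  case (cart t)
  then show ?case by simp
next
  case (rv y k)
  let ?x = "iota26 y"
  have x: "?x \<in> E.R" "wt ?x = - 1" using rv iota_R by (simp_all add: wt_iota)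
  have a: "a2 + ?x \<in> E.R" "wt (a2 + ?x) = 1" using a2_add_R[OF x(1)] x(2) by (simp_all add: wt_add wt_a2)
  have "D (D (EM.rv ?x k)) = 0"
    unfolding D_rv[OF x(1)] if_P[OF x(2)] by (rule D_rv_high[OF a(1)]) (simp add: a(2))
  moreover have "EM.rv ?x k \<in> EM.Car" "Qo (EM.rv ?x k) = GM.rv y k"
    using EM.rv_in_Car[OF x(1)] Qo_rv[OF x(1)] x(2) by (simp_all add: kap_iota)
  ultimately show ?case by blast
next
  case (add u v)
  then obtain a b where ab: "a \<in> EM.Car" "D (D a) = 0" "Qo a = u" "b \<in> EM.Car" "D (D b) = 0" "Qo b = v" by blast
  have "a + b \<in> EM.Car" "D (D (a + b)) = 0" "Qo (a + b) = u + v"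
    using EM.V.subspace_add[OF EM.Car_subspace ab(1,4)] ab by (simp_all add: D_linear Qo_linear)
  then show ?case by blast
qed

lemma P_zero_snd:
  assumes "u \<in> EM.Car" "P u = 0" "wt x = 0" shows "snd u x = 0"
proof (rule ccontr)
  assume n: "snd u x \<noteq> 0"
  then have x: "x \<in> E.R" using assms(1) by (auto simp: EM.Car_def)
  have "snd (P u) (kap x) = 0" using assms(2) by simp
  then show False using n kap_R[OF x] par_kap(1)[of x] iota_kap[of x] assms(3) by (simp add: P_def)
qed

lemma Qo_zero_snd:
  assumes "u \<in> EM.Car" "Qo u = 0" "wt x = - 1" shows "snd u x = 0"
proof (rule ccontr)
  assume n: "snd u x \<noteq> 0"
  then have x: "x \<in> E.R" using assms(1) by (auto simp: EM.Car_def)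
  have "snd (Qo u) (kap x) = 0" using assms(2) by simp
  then show False using n kap_R[OF x] par_kap(2)[of x] iota_kap[of x] assms(3) by (simp add: Qo_def)
qed

lemma P_kernel:
  assumes u: "u \<in> EM.Car" "D u = 0" "P u = 0"
  shows "\<exists>v\<in>EM.Car. u = D v"
proof -
  have f: "fst u = 0"
  proof -
    have "rest (fst u) = 0" using arg_cong[OF u(3), of fst] by (simp add: P_def)
    then have r: "rest (fst u) $ j = 0" for j by simp
    show ?thesis unfolding vec_eq_iff forall_6 using r[of 1] r[of 2] r[of 3] r[of 4] r[of 5] ker_D(1)[OF u(1,2)]
      by (simp add: rest_simps)
  qed
  \<comment> \<open>A preimage under D. The value of h_2 under alpha_2 is - 1, so [e_2, h_2] = e_2;
    a coefficient of weight 1 is divided by its structure constant, which is its own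
    inverse.\<close>
  define v where "v = (snd u a2 *s r6 2, \<lambda>x. if x \<in> E.R \<and> wt x = - 1 then snd u (x + a2) * E.c a2 x else 0)"
  have "r6 2 \<in> H6" by (rule vec.span_base) simp
  then have "v \<in> EM.Car" by (auto simp: v_def EM.Car_def intro: vec.span_scale)
  moreover have "u = D v"
  proof (rule EM.pair_eqI)
    have "wt (- a2) \<noteq> - 1" using wt_minus[of a2] wt_a2 by simp
    then show "fst u = fst (D v)" by (simp add: f D_fst v_def)
    fix x
    show "snd u x = snd (D v) x"
    proof (cases "x \<in> E.R")
      case False
      moreover have "snd u x = 0" using False u(1) by (auto simp: EM.Car_def)
      ultimately show ?thesis by (simp add: D_snd)
    next
      case x: True
      consider "x = a2" | "x \<noteq> a2" "wt x = 1" | "x \<noteq> a2" "wt x \<noteq> 1" by blast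
      then show ?thesis
      proof cases
        case 1
        then show ?thesis using a2_R zero_notin_ER by (simp add: D_snd v_def r6_2_2)
      next
        case 2
        then have d: "x - a2 \<in> E.R" "wt (x - a2) = - 1" using diff_a2_R[OF x] by (simp_all add: wt_diff wt_a2)
        have "snd (D v) x = E.c a2 (x - a2) * snd v (x - a2)" unfolding D_snd using x 2 d(1) by simp
        also have "snd v (x - a2) = snd u x * E.c a2 (x - a2)"
          unfolding v_def snd_conv using d by (simp only: if_True simp_thms diff_add_cancel)
        also have "E.c a2 (x - a2) * (snd u x * E.c a2 (x - a2)) = (E.c a2 (x - a2) * E.c a2 (x - a2)) * snd u x"
          by (simp only: mult_ac)
        finally show ?thesis by (simp only: c_square mult_1_left)
      next
        case 3
        have "snd u x = 0"
        proof (rule ccontr)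
          assume n: "snd u x \<noteq> 0"
          then have "wt x \<noteq> 0" using P_zero_snd[OF u(1,3)] by blast
          then show False using ker_D(2)[OF u(1,2) n] wt_bounds[OF x] wt_eq_two[OF x] 3 by linarith
        qed
        moreover have "x - a2 \<notin> E.R" using diff_a2_R[OF x] 3 by simp
        ultimately show ?thesis unfolding D_snd using 3 by simp
      qed
    qed
  qed
  ultimately show ?thesis by blast
qed

lemma P_image: "u \<in> EM.Car \<Longrightarrow> D (D u) = 0 \<Longrightarrow> P (D u) = 0"
proof (induction u rule: ker_DD_induct)
  case (cart t)
  show ?case unfolding D_cart P_rv[OF a2_R] by (simp add: wt_a2)
next
  case (rv x k)
  show ?case
  proof (cases "wt x = - 1")
    case True
    then have a: "a2 + x \<in> E.R" "wt (a2 + x) = 1" using a2_add_R[OF rv(1)] by (simp_all add: wt_add wt_a2)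
    show ?thesis unfolding D_rv[OF rv(1)] if_P[OF True] P_rv[OF a(1)] by (simp add: a(2))
  next
    case False
    then have "0 \<le> wt x" using rv(2) by linarith
    then show ?thesis using D_rv_high[OF rv(1)] P_zero by simp
  qed
qed (simp add: D_linear P_linear)

lemma Qo_kernel:
  assumes u: "u \<in> EM.Car" "D (D u) = 0" "Qo u = 0"
  shows "\<exists>v\<in>EM.Car. \<exists>w\<in>EM.Car. D v = 0 \<and> u = v + D w"
proof -
  let ?k = "fst u $ 2"
  \<comment> \<open>The multiple of f_2 for which D w has the same value under alpha_2 as the Cartan
    part of u. Subtracting D w moves the Cartan part into the kernel of alpha_2 without touching the
    root coefficients.\<close>
  define w where "w = EM.rv (- a2) ?k"
  have m: "- a2 \<in> E.R" by (rule E.root_uminus[OF a2_R])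
  have "wt (- a2) \<noteq> - 1" using wt_minus[of a2] wt_a2 by simp
  then have Dw: "D w = EM.cart ((- ?k) *s r6 2)" unfolding w_def using D_rv[OF m, of ?k] by simp
  define v where "v = u - D w"
  have fv: "fst v $ 2 = 0" unfolding v_def Dw by (simp add: r6_2_2)
  have sv: "snd v = snd u" unfolding v_def Dw by (rule ext) simp
  have "v \<in> EM.Car" unfolding v_def using EM.V.subspace_diff[OF EM.Car_subspace u(1) D_Car] .
  moreover have "w \<in> EM.Car" unfolding w_def by (rule EM.rv_in_Car[OF m])
  moreover have "D v = 0"
  proof (rule EM.pair_eqI)
    show "fst (D v) = fst 0" unfolding D_fst sv ker_DD[OF u(2)] by simp
    fix x
    have "snd u (x - a2) = 0" if "x \<in> E.R" "x - a2 \<in> E.R"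
    proof -
      have "wt (x - a2) = - 1" using add_a2_R[OF that(2)] that(1) by simp
      then show ?thesis by (rule Qo_zero_snd[OF u(1,3)])
    qed
    then show "snd (D v) x = snd 0 x" unfolding D_snd sv fv by simp
  qed
  moreover have "u = v + D w" by (simp add: v_def)
  ultimately show ?thesis by blast
qed

lemma Qo_D: "u \<in> EM.Car \<Longrightarrow> Qo (D u) = 0"
proof (induction u rule: EM.Car_induct)
  case (cart t)
  show ?case unfolding D_cart Qo_rv[OF a2_R] by (simp add: wt_a2)
next
  case (rv x k)
  show ?case
  proof (cases "wt x = - 1")
    case True
    then have a: "a2 + x \<in> E.R" "wt (a2 + x) = 1" using a2_add_R[OF rv] by (simp_all add: wt_add wt_a2)
    show ?thesis unfolding D_rv[OF rv] if_P[OF True] Qo_rv[OF a(1)] by (simp add: a(2))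
  next
    case False
    then show ?thesis unfolding D_rv[OF rv] by (simp add: Qo_cart Qo_zero)
  qed
qed (simp add: D_linear Qo_linear)

lemma Qo_ker_D: "u \<in> EM.Car \<Longrightarrow> D u = 0 \<Longrightarrow> Qo u = 0"
  by (induction u rule: ker_D_induct) (simp_all add: Qo_cart Qo_rv Qo_linear)

lemma Car_finitely_spanned: "\<exists>F. finite F \<and> EM.Car \<subseteq> EM.V.span F"
proof (intro exI conjI subsetI)
  let ?F = "range (\<lambda>i. EM.cart (r6 i)) \<union> (\<lambda>x. EM.rv x 1) ` E.R"
  show "finite ?F" using E.datum.finite_roots by simp
  fix u assume "u \<in> EM.Car"
  then show "u \<in> EM.V.span ?F"
  proof (induction u rule: EM.Car_induct)
    case (cart t)
    then show ?case
    proof (induction t rule: vec.span_induct_alt)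
      case base
      show ?case using EM.V.span_zero by (simp add: EM.cart_simps)
    next
      case (step l x y)
      then obtain i where "x = r6 i" by blast
      then have "EM.cart x \<in> EM.V.span ?F" using EM.V.span_base[of "EM.cart x" ?F] by blast
      then show ?case using EM.V.span_add[OF EM.V.span_scale[of "EM.cart x" ?F l] step(2)]
        by (simp only: EM.cart_simps)
    qed
  next
    case (rv x k)
    have "EM.rv x 1 \<in> EM.V.span ?F" using rv by (intro EM.V.span_base) blast
    then show ?case using EM.V.span_scale[of "EM.rv x 1" ?F k] by (simp add: EM.rv_simps)
  next
    case (add u v)
    then show ?case by (rule EM.V.span_add)
  qed
qed

end

section \<open>From the models back to the two quotients\<close>

context characteristic_three
begin

text \<open>Stated for any superalgebra identified with the model so that \<open>e\<close> becomes
  e_2: the actual quotient consists of nested cosets, and all computations take place in the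
  model.\<close>

lemma semisimple_model_e6:
  fixes L :: "('k, 'a) superalgebra"
  assumes L: "bilinear_superalgebra L" and \<theta>: "superalgebra_epi L EM.alg \<theta>" "inj_on \<theta> (carrier L)"
    and e: "e \<in> carrier L" "\<theta> e = EM.rv a2 1"
  shows "semisimple_model EM.smul L (\<lambda>y. e \<otimes>\<^bsub>L\<^esub> y) \<theta> EM.Car EM.br D GM.smul GM.Car GM.br GM.Par P Qo"
proof -
  interpret L: bilinear_superalgebra L by (rule L)
  note t = superalgebra_epiD[OF \<theta>(1), unfolded EM.alg_simps]
  have J: "jordan_transfer EM.smul L (\<lambda>y. e \<otimes>\<^bsub>L\<^esub> y) \<theta> EM.Car EM.br D"
  proof (intro jordan_transfer.intro EM.smul_vector_space L jordan_transfer_axioms.intro)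
    show "EM.V.subspace EM.Car" by (rule EM.Car_subspace)
    show "\<theta> ` carrier L = EM.Car" by (rule t(1))
    show "inj_on \<theta> (carrier L)" by (rule \<theta>(2))
    show "\<theta> (x \<oplus>\<^bsub>L\<^esub> y) = \<theta> x + \<theta> y" if "x \<in> carrier L" "y \<in> carrier L" for x y using t(3)[OF that] .
    show "\<theta> (k \<odot>\<^bsub>L\<^esub> x) = EM.smul k (\<theta> x)" if "x \<in> carrier L" for k x using t(4)[OF that] .
    show "\<theta> (x \<otimes>\<^bsub>L\<^esub> y) = EM.br (\<theta> x) (\<theta> y)" if "x \<in> carrier L" "y \<in> carrier L" for x y using t(5)[OF that] .
    show "e \<otimes>\<^bsub>L\<^esub> y \<in> carrier L" if "y \<in> carrier L" for y by (rule L.mult_closed[OF e(1) that])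
    show "\<theta> (e \<otimes>\<^bsub>L\<^esub> y) = D (\<theta> y)" if "y \<in> carrier L" for y unfolding D_def e(2)[symmetric] by (rule t(5)[OF e(1) that])
  qed (simp_all add: D_linear D_derivation D_cube_zero)
  show ?thesis
  proof (intro semisimple_model.intro J GM.smul_vector_space semisimple_model_axioms.intro)
    show "GM.V.subspace (GM.Par i)" for i by (rule GM.Par_subspace)
    show "GM.Car = {a + b |a b. a \<in> GM.Par 0 \<and> b \<in> GM.Par 1}" by (rule GM.Car_eq_sum)
    show "GM.Par 0 \<inter> GM.Par 1 \<subseteq> {0}" by (rule GM.Par_disjoint)
    show "P ` {u \<in> EM.Car. D u = 0} = GM.Par 0" using P_in_Par P_onto by blast
    show "Qo ` {u \<in> EM.Car. D (D u) = 0} = GM.Par 1" using Qo_in_Par Qo_onto by blast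
    show "\<exists>v\<in>EM.Car. u = D v" if "u \<in> EM.Car" "D u = 0" "P u = 0" for u by (rule P_kernel[OF that])
    show "P (D u) = 0" if "u \<in> EM.Car" "D (D u) = 0" for u by (rule P_image[OF that])
    show "\<exists>v\<in>EM.Car. \<exists>w\<in>EM.Car. D v = 0 \<and> u = v + D w" if "u \<in> EM.Car" "D (D u) = 0" "Qo u = 0" for u
      by (rule Qo_kernel[OF that])
    show "Qo (D u) = 0" if "u \<in> EM.Car" for u by (rule Qo_D[OF that])
    show "Qo u = 0" if "u \<in> EM.Car" "D u = 0" for u by (rule Qo_ker_D[OF that])
    show "P (EM.br u v) = GM.br (P u) (P v)" if "u \<in> EM.Car" "v \<in> EM.Car" "D u = 0" "D v = 0" for u v by (rule br_PP[OF that])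
    show "Qo (EM.br u v) = GM.br (P u) (Qo v)" if "u \<in> EM.Car" "v \<in> EM.Car" "D u = 0" "D (D v) = 0" for u v by (rule br_PQ[OF that])
    show "Qo (EM.br u v) = GM.br (Qo u) (P v)" if "u \<in> EM.Car" "v \<in> EM.Car" "D (D u) = 0" "D v = 0" for u v by (rule br_QP[OF that])
    show "P (- EM.br u (D v) + EM.br (D u) v) = GM.br (Qo u) (Qo v)"
      if "u \<in> EM.Car" "v \<in> EM.Car" "D (D u) = 0" "D (D v) = 0" for u v
      using br_QQ[OF that] unfolding odd_bracket_def .
  qed (simp_all only: GM.br_add_left GM.br_add_right GM.br_smul_left GM.br_smul_right P_linear Qo_linear)
qed

lemma rep_alpha3_e6:
  fixes L :: "('k, 'a) superalgebra"
  assumes L: "bilinear_superalgebra L" and \<theta>: "superalgebra_epi L EM.alg \<theta>" "inj_on \<theta> (carrier L)"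
    and e: "e \<in> carrier L" "\<theta> e = EM.rv a2 1"
  shows "rep_alpha3_lie_algebra L (\<lambda>y. e \<otimes>\<^bsub>L\<^esub> y)"
proof -
  interpret semisimple_model EM.smul L "\<lambda>y. e \<otimes>\<^bsub>L\<^esub> y" \<theta> EM.Car EM.br D GM.smul GM.Car GM.br GM.Par P Qo
    by (rule semisimple_model_e6[OF assms])
  obtain F where F: "finite F" "EM.Car \<subseteq> EM.V.span F" using Car_finitely_spanned by blast
  have inj: "x = y" if "x \<in> carrier L" "y \<in> carrier L" "\<theta> x = \<theta> y" for x y by (rule inj_onD[OF \<theta>(2) that(3,1,2)])
  have z: "\<zero>\<^bsub>L\<^esub> \<in> carrier L" by simp
  show ?thesis unfolding rep_alpha3_lie_algebra_def
  proof (intro conjI ballI allI)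
    show "lie_superalgebra L" by (rule lie_superalgebra_pullback[OF EM.alg_lie[OF char_three] L \<theta>])
    have pt: "\<theta> ` part L 1 = {0}" using superalgebra_epiD(6)[OF \<theta>(1), of 1] EM_Par by simp
    show "part L 1 = {\<zero>\<^bsub>L\<^esub>}"
    proof
      show "part L 1 \<subseteq> {\<zero>\<^bsub>L\<^esub>}"
      proof
        fix x assume x: "x \<in> part L 1"
        have "\<theta> x \<in> \<theta> ` part L 1" by (rule imageI[OF x])
        then have "\<theta> x = \<theta> \<zero>\<^bsub>L\<^esub>" unfolding pt \<theta>_zero by (rule singletonD)
        then have "x = \<zero>\<^bsub>L\<^esub>" by (rule inj[OF subsetD[OF part_subset x] z])
        then show "x \<in> {\<zero>\<^bsub>L\<^esub>}" by simp
      qed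
      show "{\<zero>\<^bsub>L\<^esub>} \<subseteq> part L 1" using submoduleD(2)[OF part_submodule[of 1]] by simp
    qed
    show "\<exists>B. finite B \<and> B \<subseteq> carrier L \<and> lin_span L B = carrier L" by (rule finitely_spanned[OF F])
    show "(\<lambda>y. e \<otimes>\<^bsub>L\<^esub> y) \<in> carrier L \<rightarrow> carrier L" by (rule Pi_I) (rule d_closed)
    fix x assume x: "x \<in> carrier L"
    show "e \<otimes>\<^bsub>L\<^esub> (c \<odot>\<^bsub>L\<^esub> x) = c \<odot>\<^bsub>L\<^esub> (e \<otimes>\<^bsub>L\<^esub> x)" for c by (rule mult_smult_right[OF e(1) x])
    show "((\<lambda>y. e \<otimes>\<^bsub>L\<^esub> y) ^^ 3) x = \<zero>\<^bsub>L\<^esub>"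
      by (rule inj[OF d_pow_closed[OF x] z], unfold \<theta>_d_pow[OF x] \<theta>_zero)
         (simp add: numeral_3_eq_3 D_cube \<theta>_C[OF x])
    fix y assume y: "y \<in> carrier L"
    show "e \<otimes>\<^bsub>L\<^esub> (x \<oplus>\<^bsub>L\<^esub> y) = (e \<otimes>\<^bsub>L\<^esub> x) \<oplus>\<^bsub>L\<^esub> (e \<otimes>\<^bsub>L\<^esub> y)" by (rule mult_add_right[OF e(1) x y])
    have c: "e \<otimes>\<^bsub>L\<^esub> x \<in> carrier L" "e \<otimes>\<^bsub>L\<^esub> y \<in> carrier L" "x \<otimes>\<^bsub>L\<^esub> y \<in> carrier L"
      by (rule d_closed[OF x], rule d_closed[OF y], rule mult_closed[OF x y])
    show "e \<otimes>\<^bsub>L\<^esub> (x \<otimes>\<^bsub>L\<^esub> y) = ((e \<otimes>\<^bsub>L\<^esub> x) \<otimes>\<^bsub>L\<^esub> y) \<oplus>\<^bsub>L\<^esub> (x \<otimes>\<^bsub>L\<^esub> (e \<otimes>\<^bsub>L\<^esub> y))"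
    proof (rule inj)
      show "e \<otimes>\<^bsub>L\<^esub> (x \<otimes>\<^bsub>L\<^esub> y) \<in> carrier L" using d_closed[OF c(3)] .
      have c': "(e \<otimes>\<^bsub>L\<^esub> x) \<otimes>\<^bsub>L\<^esub> y \<in> carrier L" "x \<otimes>\<^bsub>L\<^esub> (e \<otimes>\<^bsub>L\<^esub> y) \<in> carrier L"
        by (rule mult_closed[OF c(1) y], rule mult_closed[OF x c(2)])
      then show "((e \<otimes>\<^bsub>L\<^esub> x) \<otimes>\<^bsub>L\<^esub> y) \<oplus>\<^bsub>L\<^esub> (x \<otimes>\<^bsub>L\<^esub> (e \<otimes>\<^bsub>L\<^esub> y)) \<in> carrier L" by simp
      show "\<theta> (e \<otimes>\<^bsub>L\<^esub> (x \<otimes>\<^bsub>L\<^esub> y)) = \<theta> (((e \<otimes>\<^bsub>L\<^esub> x) \<otimes>\<^bsub>L\<^esub> y) \<oplus>\<^bsub>L\<^esub> (x \<otimes>\<^bsub>L\<^esub> (e \<otimes>\<^bsub>L\<^esub> y)))"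
        unfolding \<theta>_d[OF c(3)] \<theta>_mult[OF x y] \<theta>_add[OF c'] \<theta>_mult[OF c(1) y] \<theta>_mult[OF x c(2)] \<theta>_d[OF x] \<theta>_d[OF y]
        by (rule D_derivation[OF \<theta>_C[OF x] \<theta>_C[OF y]])
    qed
  qed
qed

lemma e6_quotient:
  fixes sc :: "'k \<Rightarrow> 'h::ab_group_add \<Rightarrow> 'h"
  assumes "cartan_realization e6_cartan sc h \<alpha>"
  defines "E \<equiv> derived_algebra (contragredient (\<lambda>i. 0) sc h \<alpha>)"
  obtains \<theta> where "superalgebra_epi (superalgebra_quotient E (center E)) EM.alg \<theta>"
    "inj_on \<theta> (carrier (superalgebra_quotient E (center E)))"
    "bilinear_superalgebra (superalgebra_quotient E (center E))"
    "one_dimensional E (center E)" "chevalley_e (\<lambda>i. 0) sc h \<alpha> 2 \<in> carrier E"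
    "center E +>\<^bsub>E\<^esub> chevalley_e (\<lambda>i. 0) sc h \<alpha> 2 \<in> carrier (superalgebra_quotient E (center E))"
    "\<theta> (center E +>\<^bsub>E\<^esub> chevalley_e (\<lambda>i. 0) sc h \<alpha> 2) = EM.rv a2 1"
proof (rule derived_model.derived_mod_center[OF E.derived_model_of_realization[OF assms(1)], folded E_def], goal_cases)
  case (1 \<theta>)
  show thesis by (rule that[OF 1(2-8)])
qed

lemma g26_quotient:
  fixes sc :: "'k \<Rightarrow> 'h::ab_group_add \<Rightarrow> 'h"
  assumes "cartan_realization g26_cartan sc h \<alpha>"
  defines "G \<equiv> derived_algebra (contragredient (\<lambda>i. par26 (axis i 1)) sc h \<alpha>)"
  obtains \<theta> where "superalgebra_epi (superalgebra_quotient G (center G)) GM.alg \<theta>"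
    "inj_on \<theta> (carrier (superalgebra_quotient G (center G)))"
    "bilinear_superalgebra (superalgebra_quotient G (center G))" "one_dimensional G (center G)"
proof (rule derived_model.derived_mod_center[OF G.derived_model_of_realization[OF assms(1)], folded G_def], goal_cases)
  case (1 \<theta>)
  show thesis by (rule that[OF 1(2-5)])
qed

end

lemma superalgebra_isomorphic_trans:
  assumes "superalgebra_isomorphic A B" "superalgebra_isomorphic B C"
  shows "superalgebra_isomorphic A C"
proof -
  obtain \<phi> where \<phi>: "bij_betw \<phi> (carrier A) (carrier B)" "superalgebra_epi A B \<phi>"
    using assms(1) unfolding superalgebra_isomorphic_def superalgebra_epi_def bij_betw_def by blast
  obtain \<psi> where \<psi>: "bij_betw \<psi> (carrier B) (carrier C)" "superalgebra_epi B C \<psi>"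
    using assms(2) unfolding superalgebra_isomorphic_def superalgebra_epi_def bij_betw_def by blast
  show ?thesis
    using superalgebra_isomorphicI[OF superalgebra_epi_comp[OF \<phi>(2) \<psi>(2)]] bij_betw_trans[OF \<phi>(1) \<psi>(1)]
    by (simp add: bij_betw_def)
qed

theorem corollary4p4p3:
  fixes sc :: "'k::alg_closed_field \<Rightarrow> 'u::ab_group_add \<Rightarrow> 'u"
    and h :: "6 \<Rightarrow> 'u"
    and \<alpha> :: "6 \<Rightarrow> 'u \<Rightarrow> 'k"
    and sc' :: "'k \<Rightarrow> 'v::ab_group_add \<Rightarrow> 'v"
    and h' :: "5 \<Rightarrow> 'v"
    and \<alpha>' :: "5 \<Rightarrow> 'v \<Rightarrow> 'k"
  assumes "CHAR('k) = 3"
    and "cartan_realization e6_cartan sc h \<alpha>"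
    and "cartan_realization g26_cartan sc' h' \<alpha>'"
  shows "let E = derived_algebra (contragredient e6_parity sc h \<alpha>);
             G = derived_algebra (contragredient g26_parity sc' h' \<alpha>');
             L = superalgebra_quotient E (center E);
             d = (\<lambda>y. (center E +>\<^bsub>E\<^esub> chevalley_e e6_parity sc h \<alpha> 2) \<otimes>\<^bsub>L\<^esub> y)
         in one_dimensional E (center E) \<and>
            one_dimensional G (center G) \<and>
            chevalley_e e6_parity sc h \<alpha> 2 \<in> carrier E \<and>
            rep_alpha3_lie_algebra L d \<and>
            (\<exists>n1 n2 n3 x. jordan_decomposition L d n1 n2 n3 x) \<and>
            (\<forall>n1 n2 n3 x. jordan_decomposition L d n1 n2 n3 x \<longrightarrow>
               superalgebra_isomorphic (semisimplification L d n1 n2 n3 x)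
                                       (superalgebra_quotient G (center G)))"
proof -
  interpret characteristic_three "TYPE('k)" by unfold_locales (rule assms(1))
  have pe: "e6_parity = (\<lambda>i. 0)" by (rule ext) (simp add: e6_parity_def)
  \<comment> \<open>The parity on the lattice restricts to the prescribed one on simple roots, and
    only these values enter the contragredient algebra.\<close>
  have pg: "g26_parity = (\<lambda>i. par26 (axis i 1))"
  proof
    show "g26_parity i = par26 (axis i 1)" for i using exhaust_5[of i]
      by (elim disjE) (simp_all add: g26_parity_def par26_def axis_def)
  qed
  define E where "E = derived_algebra (contragredient (\<lambda>i. 0) sc h \<alpha>)"
  define G where "G = derived_algebra (contragredient (\<lambda>i. par26 (axis i 1)) sc' h' \<alpha>')"
  let ?L = "superalgebra_quotient E (center E)"
  let ?M = "superalgebra_quotient G (center G)"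
  let ?e = "center E +>\<^bsub>E\<^esub> chevalley_e (\<lambda>i. 0) sc h \<alpha> 2"
  obtain \<theta> where \<theta>: "superalgebra_epi ?L EM.alg \<theta>" "inj_on \<theta> (carrier ?L)" "bilinear_superalgebra ?L"
    "one_dimensional E (center E)" "chevalley_e (\<lambda>i. 0) sc h \<alpha> 2 \<in> carrier E"
    "?e \<in> carrier ?L" "\<theta> ?e = EM.rv a2 1"
    by (rule e6_quotient[OF assms(2), folded E_def])
  obtain \<eta> where \<eta>: "superalgebra_epi ?M GM.alg \<eta>" "inj_on \<eta> (carrier ?M)" "bilinear_superalgebra ?M"
    "one_dimensional G (center G)"
    by (rule g26_quotient[OF assms(3), folded G_def])
  interpret S: semisimple_model EM.smul ?L "\<lambda>y. ?e \<otimes>\<^bsub>?L\<^esub> y" \<theta> EM.Car EM.br D GM.smul GM.Car GM.br GM.Par P Qo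
    by (rule semisimple_model_e6[OF \<theta>(3,1,2,6,7)])
  obtain F where F: "finite F" "EM.Car \<subseteq> EM.V.span F" using Car_finitely_spanned by blast
  have exist: "\<exists>n1 n2 n3 x. jordan_decomposition ?L (\<lambda>y. ?e \<otimes>\<^bsub>?L\<^esub> y) n1 n2 n3 x"
    using S.jordan_basis_exists[OF F] S.jordan_decomposition_exists by blast
  \<comment> \<open>The identifications of both quotients lead into the models; the one for g(2,6)
    is inverted so that it can follow the isomorphism from the semisimplification.\<close>
  have "superalgebra_epi GM.alg ?M (the_inv_into (carrier ?M) \<eta>)" by (rule epi_inverse[OF \<eta>(1-3)])
  moreover have "inj_on (the_inv_into (carrier ?M) \<eta>) (carrier GM.alg)"
    using inj_on_the_inv_into[OF \<eta>(2)] superalgebra_epiD(1)[OF \<eta>(1)] by simp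
  ultimately have "superalgebra_isomorphic GM.alg ?M" by (rule superalgebra_isomorphicI)
  then have iso: "superalgebra_isomorphic (semisimplification ?L (\<lambda>y. ?e \<otimes>\<^bsub>?L\<^esub> y) n1 n2 n3 x) ?M"
    if "jordan_decomposition ?L (\<lambda>y. ?e \<otimes>\<^bsub>?L\<^esub> y) n1 n2 n3 x" for n1 n2 n3 x
    using superalgebra_isomorphic_trans[OF S.semisimplification_iso[OF that, folded GM.alg_def]] by blast
  show ?thesis unfolding Let_def pe pg E_def[symmetric] G_def[symmetric]
    by (intro conjI \<theta>(4,5) \<eta>(4) rep_alpha3_e6[OF \<theta>(3,1,2,6,7)] exist allI impI iso)
qed

end
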